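(* Let $n\geq 2$. Let $A:\mathbb{C}^n\to\mathbb{C}^n$ be a linear operator and let $b\in\mathbb{C}^n$. Let $f\in\mathcal{A}(\mathbb{B}_n)\cap\mathrm{Lip}(\alpha)$ for some $1/2<\alpha\leq 1$. Suppose that $\varphi(z)=f(z)(Az+b)$ is a selfmap of $\mathbb{B}_n$ such that $C_\varphi$ is bounded on $H^2$, and that $\varphi$ is not of the form $\varphi(z)=\lambda z$ with $|\lambda|=1$. Then both $C_\varphi$ and $C_\varphi^*$ are strongly asymptotically Toeplitz with asymptotic symbol zero; that is, $\Phi^m(C_\varphi)\to 0$ and $\Phi^m(C_\varphi^* )\to 0$ in the strong operator topology as $m\to\infty$.
   Context: $\mathbb{B}_n$ is the open unit ball and $\mathbb{S}_n$ the unit sphere of $\mathbb{C}^n$; $\sigma$ is the normalized surface measure on $\mathbb{S}_n$ ($\sigma(\mathbb{S}_n)=1$). The Hardy space $H^2$ consists of all analytic $h$ on $\mathbb{B}_n$ with $\|h\|^2=\sup_{0<r<1}\int_{\mathbb{S}_n}|h(r\zeta)|^2\,d\sigma(\zeta)<\infty$; via radial boundary limits (which exist a.e.) it is identified with a closed subspace of $L^2(\mathbb{S}_n,d\sigma)$, and $P$ is the orthogonal projection of $L^2(\mathbb{S}_n,d\sigma)$ onto $H^2$. For $f\in L^\infty(\mathbb{S}_n,d\sigma)$ the Toeplitz operator is $T_f h=P(fh)$, $h\in H^2$. For an analytic map $\varphi:\mathbb{B}_n\to\mathbb{B}_n$ (an analytic selfmap of $\mathbb{B}_n$), the composition operator is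 $C_\varphi h=h\circ\varphi$; adjoints are taken on $H^2$. For a bounded operator $B$ on $H^2$, $\Phi(B)=\sum_{j=1}^n T_{\overline{z}_j}BT_{z_j}$, and $\Phi^m$ is the $m$-fold composition of $\Phi$ with itself. $B$ is strongly asymptotically Toeplitz (SAT) if $\{\Phi^m(B)\}$ converges in the strong operator topology; the limit is then a Toeplitz operator $T_g$, and $g$ is called the asymptotic symbol of $B$. $\mathcal{A}(\mathbb{B}_n)$ is the space of functions analytic on $\mathbb{B}_n$ and continuous on $\overline{\mathbb{B}}_n$. For $0<\alpha\leq1$, $\mathrm{Lip}(\alpha)$ is the space of functions $f:\mathbb{B}_n\to\mathbb{C}$ with $\sup\{|f(a)-f(b)|/|a-b|^\alpha: a,b\in\mathbb{B}_n, a\neq b\}<\infty$. *)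

theory Defs
  imports "HOL-Probability.Probability"
begin

text \<open>The normalised surface measure: the radial projection to the sphere of the
  uniform distribution on the ball (polar coordinates). The underlying space of the measure is
  the sphere itself; the origin, where \<^term>\<open>sgn\<close> is not a unit vector, is a null set.\<close>

definition surface_measure :: "(complex ^ 'n) measure" where
  "surface_measure =
     restrict_space (distr (uniform_measure lborel (ball 0 1)) borel sgn) (sphere 0 1)"

text \<open>Used for open sets only: real differentiability with a complex-linear derivative.\<close>

definition holomorphic_Cn :: "(complex ^ 'n \<Rightarrow> complex) \<Rightarrow> (complex ^ 'n) set \<Rightarrow> bool" where
  "holomorphic_Cn h S \<longleftrightarrow>
     (\<forall>z\<in>S. \<exists>D. (h has_derivative D) (at z) \<and> Vector_Spaces.linear (*s) (*) D)"

definition hardy_norm :: "(complex ^ 'n \<Rightarrow> complex) \<Rightarrow> real" where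
  "hardy_norm h =
     sqrt (SUP r\<in>{0<..<1}. \<integral>\<zeta>. (cmod (h (r *\<^sub>R \<zeta>)))\<^sup>2 \<partial>surface_measure)"

text \<open>A function on the open ball is represented by its extension by zero, so that equality in
  the Hardy space is equality of HOL functions.\<close>

definition hardy_space :: "(complex ^ 'n \<Rightarrow> complex) set" where
  "hardy_space =
     {h. holomorphic_Cn h (ball 0 1) \<and> (\<forall>z. z \<notin> ball 0 1 \<longrightarrow> h z = 0) \<and>
         bdd_above ((\<lambda>r. \<integral>\<zeta>. (cmod (h (r *\<^sub>R \<zeta>)))\<^sup>2 \<partial>surface_measure) ` {0<..<1})}"

definition radial_limit :: "(complex ^ 'n \<Rightarrow> complex) \<Rightarrow> complex ^ 'n \<Rightarrow> complex" where
  "radial_limit h \<zeta> = Lim (at_left 1) (\<lambda>r. h (r *\<^sub>R \<zeta>))"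

definition hardy_inner ::
    "(complex ^ 'n \<Rightarrow> complex) \<Rightarrow> (complex ^ 'n \<Rightarrow> complex) \<Rightarrow> complex" where
  "hardy_inner h k = (\<integral>\<zeta>. radial_limit h \<zeta> * cnj (radial_limit k \<zeta>) \<partial>surface_measure)"

text \<open>The orthogonal projection of a square-integrable function \<open>g\<close> on the sphere: the member of
  the Hardy space whose boundary function differs from \<open>g\<close> by something orthogonal to all
  boundary functions. The result is again a function on the ball.\<close>

definition hardy_proj :: "(complex ^ 'n \<Rightarrow> complex) \<Rightarrow> (complex ^ 'n \<Rightarrow> complex)" where
  "hardy_proj g =
     (THE h. h \<in> hardy_space \<and>
        (\<forall>k\<in>hardy_space.
           (\<integral>\<zeta>. (g \<zeta> - radial_limit h \<zeta>) * cnj (radial_limit k \<zeta>) \<partial>surface_measure) = 0))"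

definition Linfty_sphere :: "(complex ^ 'n \<Rightarrow> complex) set" where
  "Linfty_sphere =
     {f \<in> borel_measurable surface_measure. \<exists>C. AE \<zeta> in surface_measure. cmod (f \<zeta>) \<le> C}"

type_synonym 'n hardy_op = "(complex ^ 'n \<Rightarrow> complex) \<Rightarrow> (complex ^ 'n \<Rightarrow> complex)"

definition toeplitz :: "(complex ^ 'n \<Rightarrow> complex) \<Rightarrow> 'n::finite hardy_op" where
  "toeplitz f h = hardy_proj (\<lambda>\<zeta>. f \<zeta> * radial_limit h \<zeta>)"

definition composition_op :: "(complex ^ 'n \<Rightarrow> complex ^ 'n) \<Rightarrow> 'n::finite hardy_op" where
  "composition_op \<phi> h = (\<lambda>z. if z \<in> ball 0 1 then h (\<phi> z) else 0)"

definition hardy_bounded :: "'n::finite hardy_op \<Rightarrow> bool" where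
  "hardy_bounded B \<longleftrightarrow>
     (\<forall>h\<in>hardy_space. B h \<in> hardy_space) \<and>
     (\<forall>h\<in>hardy_space. \<forall>k\<in>hardy_space. B (\<lambda>z. h z + k z) = (\<lambda>z. B h z + B k z)) \<and>
     (\<forall>c. \<forall>h\<in>hardy_space. B (\<lambda>z. c * h z) = (\<lambda>z. c * B h z)) \<and>
     (\<exists>C. \<forall>h\<in>hardy_space. hardy_norm (B h) \<le> C * hardy_norm h)"

definition hardy_adjoint :: "'n::finite hardy_op \<Rightarrow> 'n hardy_op" where
  "hardy_adjoint B h =
     (THE k. k \<in> hardy_space \<and> (\<forall>g\<in>hardy_space. hardy_inner (B g) h = hardy_inner g k))"

definition toeplitz_map :: "'n::finite hardy_op \<Rightarrow> 'n hardy_op" where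
  "toeplitz_map B h =
     (\<lambda>z. \<Sum>j\<in>UNIV. toeplitz (\<lambda>\<zeta>. cnj (\<zeta> $ j)) (B (toeplitz (\<lambda>\<zeta>. \<zeta> $ j) h)) z)"

definition sot_tendsto :: "(nat \<Rightarrow> 'n::finite hardy_op) \<Rightarrow> 'n hardy_op \<Rightarrow> bool" where
  "sot_tendsto X L \<longleftrightarrow>
     (\<forall>h\<in>hardy_space. (\<lambda>m. hardy_norm (\<lambda>z. X m h z - L h z)) \<longlonglongrightarrow> 0)"

definition strongly_asymptotically_toeplitz :: "'n::finite hardy_op \<Rightarrow> bool" where
  "strongly_asymptotically_toeplitz B \<longleftrightarrow>
     hardy_bounded B \<and>
     (\<exists>L. hardy_bounded L \<and> sot_tendsto (\<lambda>m. (toeplitz_map ^^ m) B) L)"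

definition has_asymptotic_symbol ::
    "'n::finite hardy_op \<Rightarrow> (complex ^ 'n \<Rightarrow> complex) \<Rightarrow> bool" where
  "has_asymptotic_symbol B g \<longleftrightarrow>
     g \<in> Linfty_sphere \<and> sot_tendsto (\<lambda>m. (toeplitz_map ^^ m) B) (toeplitz g)"

definition ball_algebra :: "(complex ^ 'n \<Rightarrow> complex) set" where
  "ball_algebra = {f. holomorphic_Cn f (ball 0 1) \<and> continuous_on (cball 0 1) f}"

definition Lip :: "real \<Rightarrow> (complex ^ 'n \<Rightarrow> complex) set" where
  "Lip \<alpha> =
     {f. bdd_above {cmod (f a - f b) / norm (a - b) powr \<alpha> |a b.
           a \<in> ball 0 1 \<and> b \<in> ball 0 1 \<and> a \<noteq> b}}"

end

theory Submission
  imports Defs "HOL-Complex_Analysis.Complex_Analysis"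
begin

text \<open>On boundary values \<open>C\<^sub>\<phi> (z\<^sub>j h) = \<phi>\<^sub>j C\<^sub>\<phi> h\<close>, so \<open>\<langle>\<Phi>\<^sup>m(C\<^sub>\<phi>) h, k\<rangle>\<close> is the integral of \<open>w\<^sup>m (C\<^sub>\<phi> h) \<bar>k\<close>
  with the weight \<open>w(\<zeta>) = \<langle>\<phi>(\<zeta>), \<zeta>\<rangle>\<close>, and similarly for the adjoint. Since \<open>|w| \<le> 1\<close>, both sequences
  tend strongly to zero as soon as \<open>|w| < 1\<close> almost everywhere.

  If \<open>|w| = 1\<close> on a set of positive measure, then \<open>\<phi>(\<zeta>) = w(\<zeta>) \<zeta>\<close> there, so \<open>A z + b\<close> is parallel to
  \<open>z\<close> on that set, hence everywhere by uniqueness on complex lines through the origin. Therefore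
  \<open>\<phi>(z) = F(z) z\<close> with \<open>|F| \<le> 1\<close> and \<open>F\<close> in \<open>Lip(\<alpha>)\<close>. At boundary points with \<open>|F| = 1\<close> the complex
  tangential derivatives of \<open>F\<close> have radial limit zero, by Caratheodory's inequality on tangential
  discs of radius \<open>sqrt (1 - r)\<close>; here \<open>\<alpha> > 1/2\<close> is used. Uniqueness makes these derivatives
  vanish identically, which for \<open>n \<ge> 2\<close> forces \<open>F\<close> to be a unimodular constant.\<close>

section \<open>Rotation-invariant measure on the sphere\<close>

text \<open>The operators act on holomorphic functions while the weight argument needs boundary
  values, so much of the work is to identify the two: radial limits must exist almost everywhere,
  and the boundary \<open>L\<^sup>2\<close> norm must equal the growth norm. Both follow from a
  maximal inequality for radial values. It is proved on circles \<open>\<mu> *s x\<close>: rotation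
  invariance writes an integral over the sphere as an average of integrals over such circles, where
  power series and the Poisson kernel of the disc suffice. The uniqueness part has the opposite
  difficulty, because information is available only on a boundary set of positive measure. On a
  slice that meets this set in positive measure, a boundary uniqueness theorem in one variable
  applies. These slices fill a set of positive volume in the ball, and vanishing spreads from there
  along real lines. Real lines are used because the tangential expressions carry conjugated
  coordinates; on a real line they still extend holomorphically to complex values of the
  parameter.\<close>

lemma nn_integral_lborel_shift:
  fixes f :: "'a::euclidean_space \<Rightarrow> ennreal"
  assumes [measurable]: "f \<in> borel_measurable borel"
  shows "(\<integral>\<^sup>+x. f (x + a) \<partial>lborel) = (\<integral>\<^sup>+x. f x \<partial>lborel)"
proof -
  have "(\<integral>\<^sup>+x. f x \<partial>lborel) = (\<integral>\<^sup>+x. f x \<partial>distr lborel borel ((+) a))"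
    by (simp add: lborel_distr_plus)
  also have "\<dots> = (\<integral>\<^sup>+x. f (a + x) \<partial>lborel)"
    by (rule nn_integral_distr) auto
  finally show ?thesis by (simp add: add.commute)
qed

lemma emeasure_unit_ball_pos_finite:
  "emeasure lborel (ball (0::'a::euclidean_space) 1) \<noteq> 0"
  "emeasure lborel (ball (0::'a::euclidean_space) 1) \<noteq> \<infinity>"
proof -
  have "0 < unit_ball_vol (real DIM('a))"
    by (rule unit_ball_vol_pos) simp
  then show "emeasure lborel (ball (0::'a) 1) \<noteq> 0" "emeasure lborel (ball (0::'a) 1) \<noteq> \<infinity>"
    using emeasure_bounded_finite[OF bounded_ball, of "0::'a" 1]
    by (auto simp: emeasure_ball ennreal_eq_0_iff simp del: unit_ball_vol_pos)
qed

text \<open>Both measures are translation invariant; comparing them by Fubini on the product of the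
  unit ball with an arbitrary set shows that they are proportional.\<close>

lemma lborel_distr_isometry:
  fixes T :: "'a::euclidean_space \<Rightarrow> 'a"
  assumes T: "linear T" and norm_T: "\<And>x. norm (T x) = norm x"
  shows "distr lborel borel T = lborel"
proof -
  define M where "M = distr lborel borel T"
  have [measurable]: "T \<in> borel_measurable borel"
    using T by (intro borel_measurable_continuous_onI linear_continuous_on)
      (simp add: linear_conv_bounded_linear)
  have "inj T"
    using T norm_T by (metis linear_injective_0 norm_eq_zero)
  then have "surj T"
    using T by (simp add: linear_injective_imp_surjective)
  have setsM [measurable_cong, simp]: "sets M = sets borel" and spaceM [simp]: "space M = UNIV"
    by (auto simp: M_def)
  have M_shift: "(\<integral>\<^sup>+x. f (x + a) \<partial>M) = (\<integral>\<^sup>+x. f x \<partial>M)"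
    if [measurable]: "f \<in> borel_measurable borel" for f :: "'a \<Rightarrow> ennreal" and a
  proof -
    obtain a' where a': "a = T a'" using \<open>surj T\<close> by (auto simp: surj_def)
    have "(\<integral>\<^sup>+x. f (x + a) \<partial>M) = (\<integral>\<^sup>+x. f (T (x + a')) \<partial>lborel)"
      by (simp add: M_def nn_integral_distr a' linear_add[OF T])
    also have "\<dots> = (\<integral>\<^sup>+x. f (T x) \<partial>lborel)"
      by (rule nn_integral_lborel_shift) auto
    finally show ?thesis by (simp add: M_def nn_integral_distr)
  qed
  \<comment> \<open>A norm-preserving map fixes centred balls; this determines the proportionality
    constant as 1.\<close>
  have Mball: "emeasure M (ball 0 r) = emeasure lborel (ball (0::'a) r)" for r
  proof -
    have "T -` ball 0 r = ball 0 r" by (auto simp: norm_T)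
    then show ?thesis by (simp add: M_def emeasure_distr)
  qed
  interpret M: sigma_finite_measure M
  proof
    show "\<exists>A. countable A \<and> A \<subseteq> sets M \<and> \<Union> A = space M \<and> (\<forall>a\<in>A. emeasure M a \<noteq> \<infinity>)"
    proof (intro exI[of _ "range (\<lambda>n::nat. ball (0::'a) (real n))"] conjI ballI)
      show "\<Union> (range (\<lambda>n::nat. ball (0::'a) (real n))) = space M"
        by (auto intro: reals_Archimedean2)
      fix a assume "a \<in> range (\<lambda>n::nat. ball (0::'a) (real n))"
      then show "emeasure M a \<noteq> \<infinity>"
        using emeasure_bounded_finite[OF bounded_ball, of "0::'a"] Mball
        by (force simp: less_top[symmetric])
    qed auto
  qed
  interpret pair_sigma_finite lborel M ..
  \<comment> \<open>Common mass of the unit ball under \<open>M\<close> and \<open>lborel\<close>;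
    being positive and finite, it cancels at the end.\<close>
  define c where "c = emeasure lborel (ball (0::'a) 1)"
  have c: "c \<noteq> 0" "c \<noteq> \<infinity>"
    unfolding c_def by (rule emeasure_unit_ball_pos_finite)+
  have "emeasure M B = emeasure lborel B" if [measurable]: "B \<in> sets borel" for B
  proof -
    let ?A = "ball (0::'a) 1"
    have [measurable]: "(indicator ?A :: 'a \<Rightarrow> ennreal) \<in> borel_measurable borel"
      "(indicator B :: 'a \<Rightarrow> ennreal) \<in> borel_measurable borel"
      by (auto intro!: borel_measurable_indicator)
    have "c * emeasure M B = (\<integral>\<^sup>+x. indicator ?A x * (\<integral>\<^sup>+y. indicator B y \<partial>M) \<partial>lborel)"
      by (subst nn_integral_multc) (auto simp: c_def intro!: borel_measurable_indicator)
    also have "\<dots> = (\<integral>\<^sup>+x. indicator ?A x * (\<integral>\<^sup>+y. indicator B (y + x) \<partial>M) \<partial>lborel)"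
      by (subst M_shift) auto
    also have "\<dots> = (\<integral>\<^sup>+x. \<integral>\<^sup>+y. indicator ?A x * indicator B (y + x) \<partial>M \<partial>lborel)"
      by (intro nn_integral_cong nn_integral_cmult[symmetric]) measurable
    also have "\<dots> = (\<integral>\<^sup>+y. \<integral>\<^sup>+x. indicator ?A x * indicator B (y + x) \<partial>lborel \<partial>M)"
      by (rule Fubini'[symmetric]) measurable
    \<comment> \<open>Translating by \<open>y\<close> moves the shift from \<open>B\<close> to the
      ball. After a second exchange of integrals, and by symmetry of the ball, the invariance of
      \<open>M\<close> applies to the ball alone.\<close>
    also have "\<dots> = (\<integral>\<^sup>+y. \<integral>\<^sup>+x. indicator ?A (x - y) * indicator B x \<partial>lborel \<partial>M)"
    proof (rule nn_integral_cong)
      fix y :: 'a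
      show "(\<integral>\<^sup>+x. indicator ?A x * indicator B (y + x) \<partial>lborel) =
          (\<integral>\<^sup>+x. indicator ?A (x - y) * indicator B x \<partial>lborel)"
        using nn_integral_lborel_shift[of "\<lambda>x. indicator ?A (x - y) * indicator B x" y]
        by (simp add: add.commute)
    qed
    also have "\<dots> = (\<integral>\<^sup>+x. \<integral>\<^sup>+y. indicator ?A (x - y) * indicator B x \<partial>M \<partial>lborel)"
      by (rule Fubini') measurable
    also have "\<dots> = (\<integral>\<^sup>+x. indicator B x * (\<integral>\<^sup>+y. indicator ?A (y + (- x)) \<partial>M) \<partial>lborel)"
      by (subst nn_integral_cmult[symmetric])
         (auto intro!: nn_integral_cong simp: indicator_def norm_minus_commute)
    also have "\<dots> = (\<integral>\<^sup>+x. indicator B x * (\<integral>\<^sup>+y. indicator ?A y \<partial>M) \<partial>lborel)"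
      by (subst M_shift) auto
    also have "\<dots> = c * emeasure lborel B"
      by (subst nn_integral_multc) (auto simp: c_def Mball mult.commute intro!: borel_measurable_indicator)
    finally show ?thesis
      using c by (simp add: ennreal_mult_cancel_left)
  qed
  then show ?thesis
    unfolding M_def[symmetric] by (intro measure_eqI) auto
qed

section \<open>Uniform probability measures on ball and sphere\<close>

definition unif_ball :: "'a::euclidean_space measure" where
  "unif_ball = uniform_measure lborel (ball 0 1)"

text \<open>\<open>surface_measure\<close> is the restriction of this measure to the sphere. Keeping
  the whole space as carrier allows plain Borel measurability, and over \<open>complex\<close> the
  same definition yields the circle.\<close>

definition unif_sphere :: "'a::euclidean_space measure" where
  "unif_sphere = distr unif_ball borel sgn"

lemma sgn_borel_measurable [measurable]:
  "(sgn :: 'a::euclidean_space \<Rightarrow> 'a) \<in> borel_measurable borel"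
  unfolding sgn_div_norm[abs_def] by measurable

lemma sets_unif_ball [measurable_cong, simp]: "sets unif_ball = sets borel"
  and space_unif_ball [simp]: "space unif_ball = UNIV"
  by (auto simp: unif_ball_def)

lemma sets_unif_sphere [measurable_cong, simp]: "sets unif_sphere = sets borel"
  and space_unif_sphere [simp]: "space unif_sphere = UNIV"
  by (auto simp: unif_sphere_def)

lemma prob_space_unif_ball: "prob_space unif_ball"
  unfolding unif_ball_def using emeasure_unit_ball_pos_finite
  by (intro prob_space_uniform_measure) auto

lemma prob_space_unif_sphere: "prob_space unif_sphere"
  unfolding unif_sphere_def
  by (intro prob_space.prob_space_distr prob_space_unif_ball) measurable

lemma AE_unif_ball: "AE x in (unif_ball :: 'a::euclidean_space measure). x \<noteq> 0 \<and> norm x < 1"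
proof -
  have "AE x in (lborel :: 'a measure). x \<noteq> 0"
    by (rule AE_lborel_singleton)
  then show ?thesis
    unfolding unif_ball_def by (intro AE_uniform_measureI) auto
qed

lemma AE_unif_sphere: "AE x in (unif_sphere :: 'a::euclidean_space measure). norm x = 1"
  unfolding unif_sphere_def
  by (subst AE_distr_iff) (use AE_unif_ball in \<open>auto simp: norm_sgn\<close>)

lemma nn_integral_unif_sphere:
  assumes [measurable]: "f \<in> borel_measurable borel"
  shows "(\<integral>\<^sup>+x. f x \<partial>unif_sphere) = (\<integral>\<^sup>+x. f (sgn x) \<partial>unif_ball)"
  unfolding unif_sphere_def by (rule nn_integral_distr) measurable

lemma distr_unif_ball_isometry:
  fixes T :: "'a::euclidean_space \<Rightarrow> 'a"
  assumes T: "linear T" and norm_T: "\<And>x. norm (T x) = norm x"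
  shows "distr unif_ball borel T = unif_ball"
proof (rule measure_eqI)
  have [measurable]: "T \<in> borel_measurable borel"
    using T by (intro borel_measurable_continuous_onI linear_continuous_on)
      (simp add: linear_conv_bounded_linear)
  fix A assume "A \<in> sets (distr unif_ball borel T)"
  then have [measurable]: "A \<in> sets borel" by simp
  have "ball 0 1 \<inter> T -` A = T -` (ball 0 1 \<inter> A)" by (auto simp: norm_T)
  then have "emeasure lborel (ball 0 1 \<inter> T -` A) = emeasure (distr lborel borel T) (ball 0 1 \<inter> A)"
    by (subst emeasure_distr) auto
  then show "emeasure (distr unif_ball borel T) A = emeasure unif_ball A"
    using lborel_distr_isometry[OF assms]
    by (subst emeasure_distr)
       (auto simp: unif_ball_def emeasure_uniform_measure measurable_sets_borel[of T borel])
qed auto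

lemma distr_unif_sphere_isometry:
  fixes T :: "'a::euclidean_space \<Rightarrow> 'a"
  assumes T: "linear T" and norm_T: "\<And>x. norm (T x) = norm x"
  shows "distr unif_sphere borel T = unif_sphere"
proof -
  have [measurable]: "T \<in> borel_measurable borel"
    using T by (intro borel_measurable_continuous_onI linear_continuous_on)
      (simp add: linear_conv_bounded_linear)
  have "distr unif_sphere borel T = distr unif_ball borel (T \<circ> sgn)"
    unfolding unif_sphere_def by (subst distr_distr) auto
  also have "T \<circ> sgn = sgn \<circ> T"
    by (auto simp: sgn_div_norm norm_T linear_scale[OF T])
  also have "distr unif_ball borel (sgn \<circ> T) = distr (distr unif_ball borel T) borel sgn"
    by (subst distr_distr) auto
  finally show ?thesis
    by (simp add: distr_unif_ball_isometry[OF assms] unif_sphere_def)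
qed

lemma nn_integral_isometry:
  fixes T :: "'a::euclidean_space \<Rightarrow> 'a" and f :: "'a \<Rightarrow> ennreal"
  assumes T: "linear T" and norm_T: "\<And>x. norm (T x) = norm x"
    and [measurable]: "f \<in> borel_measurable borel"
  shows "(\<integral>\<^sup>+x. f (T x) \<partial>unif_sphere) = (\<integral>\<^sup>+x. f x \<partial>unif_sphere)"
    and "(\<integral>\<^sup>+x. f (T x) \<partial>unif_ball) = (\<integral>\<^sup>+x. f x \<partial>unif_ball)"
proof -
  have [measurable]: "T \<in> borel_measurable borel"
    using T by (intro borel_measurable_continuous_onI linear_continuous_on)
      (simp add: linear_conv_bounded_linear)
  show "(\<integral>\<^sup>+x. f (T x) \<partial>unif_sphere) = (\<integral>\<^sup>+x. f x \<partial>unif_sphere)"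
    by (subst (2) distr_unif_sphere_isometry[OF T norm_T, symmetric]) (simp add: nn_integral_distr)
  show "(\<integral>\<^sup>+x. f (T x) \<partial>unif_ball) = (\<integral>\<^sup>+x. f x \<partial>unif_ball)"
    by (subst (2) distr_unif_ball_isometry[OF T norm_T, symmetric]) (simp add: nn_integral_distr)
qed

lemma integral_unif_sphere_isometry:
  fixes T :: "'a::euclidean_space \<Rightarrow> 'a" and f :: "'a \<Rightarrow> 'b::{banach, second_countable_topology}"
  assumes T: "linear T" and norm_T: "\<And>x. norm (T x) = norm x"
    and [measurable]: "f \<in> borel_measurable borel"
  shows "(\<integral>x. f (T x) \<partial>unif_sphere) = (\<integral>x. f x \<partial>unif_sphere)"
proof -
  have [measurable]: "T \<in> borel_measurable borel"
    using T by (intro borel_measurable_continuous_onI linear_continuous_on)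
      (simp add: linear_conv_bounded_linear)
  show ?thesis
    by (subst (2) distr_unif_sphere_isometry[OF T norm_T, symmetric]) (simp add: integral_distr)
qed

section \<open>Unimodular rotations and integration over slices\<close>

lemma norm_vector_scalar_mult: "norm (c *s x) = cmod c * norm (x :: complex ^ 'n::finite)"
  by (simp add: norm_vec_def L2_set_def norm_mult power_mult_distrib real_sqrt_mult
      flip: sum_distrib_left)

lemma linear_vector_scalar_mult: "linear ((*s) (c::complex) :: complex ^ 'n::finite \<Rightarrow> _)"
  by (rule linearI) (auto simp: vec_eq_iff algebra_simps scaleR_conv_of_real)

lemma continuous_on_vector_scalar_mult [continuous_intros]:
  fixes g :: "'a::topological_space \<Rightarrow> complex ^ 'n::finite"
  assumes "continuous_on S f" "continuous_on S g"
  shows "continuous_on S (\<lambda>x. f x *s g x)"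
  unfolding vector_scalar_mult_def using assms by (intro continuous_intros) auto

lemma borel_measurable_vector_scalar_mult [measurable (raw)]:
  fixes g :: "'a \<Rightarrow> complex ^ 'n::finite"
  assumes "f \<in> borel_measurable M" "g \<in> borel_measurable M"
  shows "(\<lambda>x. f x *s g x) \<in> borel_measurable M"
  by (rule borel_measurable_continuous_Pair[OF assms])
     (intro continuous_intros continuous_on_fst continuous_on_snd; simp add: continuous_on_id)

abbreviation circle_measure :: "complex measure" where
  "circle_measure \<equiv> unif_sphere"

lemma nn_integral_circle_rotate:
  assumes "cmod c = 1" "f \<in> borel_measurable borel"
  shows "(\<integral>\<^sup>+\<mu>. f (c * \<mu>) \<partial>circle_measure) = (\<integral>\<^sup>+\<mu>. f \<mu> \<partial>circle_measure)"
  using assms by (intro nn_integral_isometry(1)[where T = "(*) c"])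
    (auto simp: norm_mult intro!: linearI simp: algebra_simps)

lemma integral_circle_rotate:
  fixes f :: "complex \<Rightarrow> 'b::{banach, second_countable_topology}"
  assumes "cmod c = 1" "f \<in> borel_measurable borel"
  shows "(\<integral>\<mu>. f (c * \<mu>) \<partial>circle_measure) = (\<integral>\<mu>. f \<mu> \<partial>circle_measure)"
  using assms by (intro integral_unif_sphere_isometry[where T = "(*) c"])
    (auto simp: norm_mult intro!: linearI simp: algebra_simps)

lemma nn_integral_circle_cnj:
  assumes "f \<in> borel_measurable borel"
  shows "(\<integral>\<^sup>+\<mu>. f (cnj \<mu>) \<partial>circle_measure) = (\<integral>\<^sup>+\<mu>. f \<mu> \<partial>circle_measure)"
  using assms by (intro nn_integral_isometry(1)) (auto intro!: linearI)

lemma nn_integral_sphere_rotate: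
  fixes f :: "complex ^ 'n::finite \<Rightarrow> ennreal"
  assumes "cmod c = 1" "f \<in> borel_measurable borel"
  shows "(\<integral>\<^sup>+x. f (c *s x) \<partial>unif_sphere) = (\<integral>\<^sup>+x. f x \<partial>unif_sphere)"
    and "(\<integral>\<^sup>+x. f (c *s x) \<partial>unif_ball) = (\<integral>\<^sup>+x. f x \<partial>unif_ball)"
  using assms by (auto intro!: nn_integral_isometry linear_vector_scalar_mult
      simp: norm_vector_scalar_mult)

text \<open>After an exchange of integrals, the inner integral over \<open>x\<close> is rotation
  invariant for each unimodular \<open>\<mu>\<close>, and the circle has total mass 1. This is the
  bridge from one complex variable to the sphere and the ball.\<close>

lemma nn_integral_slices:
  fixes f :: "complex ^ 'n::finite \<Rightarrow> ennreal"
  assumes [measurable]: "f \<in> borel_measurable borel"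
  shows "(\<integral>\<^sup>+x. \<integral>\<^sup>+\<mu>. f (\<mu> *s x) \<partial>circle_measure \<partial>unif_sphere) = (\<integral>\<^sup>+x. f x \<partial>unif_sphere)"
    and "(\<integral>\<^sup>+x. \<integral>\<^sup>+\<mu>. f (\<mu> *s x) \<partial>circle_measure \<partial>unif_ball) = (\<integral>\<^sup>+x. f x \<partial>unif_ball)"
proof -
  interpret C: prob_space circle_measure by (rule prob_space_unif_sphere)
  interpret S: prob_space "unif_sphere :: (complex ^ 'n) measure" by (rule prob_space_unif_sphere)
  interpret B: prob_space "unif_ball :: (complex ^ 'n) measure" by (rule prob_space_unif_ball)
  interpret P1: pair_sigma_finite "unif_sphere :: (complex ^ 'n) measure" circle_measure ..
  interpret P2: pair_sigma_finite "unif_ball :: (complex ^ 'n) measure" circle_measure ..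
  have AE: "AE \<mu> in circle_measure. cmod \<mu> = 1" by (rule AE_unif_sphere)
  have "(\<integral>\<^sup>+x. \<integral>\<^sup>+\<mu>. f (\<mu> *s x) \<partial>circle_measure \<partial>unif_sphere) =
      (\<integral>\<^sup>+\<mu>. \<integral>\<^sup>+x. f (\<mu> *s x) \<partial>unif_sphere \<partial>circle_measure)"
    by (rule P1.Fubini'[symmetric]) measurable
  also have "\<dots> = (\<integral>\<^sup>+\<mu>. (\<integral>\<^sup>+x. f x \<partial>unif_sphere) \<partial>circle_measure)"
    using AE by (intro nn_integral_cong_AE) (auto simp: nn_integral_sphere_rotate)
  finally show "(\<integral>\<^sup>+x. \<integral>\<^sup>+\<mu>. f (\<mu> *s x) \<partial>circle_measure \<partial>unif_sphere) = (\<integral>\<^sup>+x. f x \<partial>unif_sphere)"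
    using C.emeasure_space_1 by simp
  have "(\<integral>\<^sup>+x. \<integral>\<^sup>+\<mu>. f (\<mu> *s x) \<partial>circle_measure \<partial>unif_ball) =
      (\<integral>\<^sup>+\<mu>. \<integral>\<^sup>+x. f (\<mu> *s x) \<partial>unif_ball \<partial>circle_measure)"
    by (rule P2.Fubini'[symmetric]) measurable
  also have "\<dots> = (\<integral>\<^sup>+\<mu>. (\<integral>\<^sup>+x. f x \<partial>unif_ball) \<partial>circle_measure)"
    using AE by (intro nn_integral_cong_AE) (auto simp: nn_integral_sphere_rotate)
  finally show "(\<integral>\<^sup>+x. \<integral>\<^sup>+\<mu>. f (\<mu> *s x) \<partial>circle_measure \<partial>unif_ball) = (\<integral>\<^sup>+x. f x \<partial>unif_ball)"
    using C.emeasure_space_1 by simp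
qed

lemma surface_measure_eq:
  "surface_measure = restrict_space (unif_sphere :: (complex ^ 'n::finite) measure) (sphere 0 1)"
  by (simp add: surface_measure_def unif_sphere_def unif_ball_def)

lemma space_surface_measure [simp]: "space surface_measure = sphere 0 1"
  by (simp add: surface_measure_eq space_restrict_space)

lemma borel_measurable_surface_measure [measurable (raw)]:
  "f \<in> borel_measurable borel \<Longrightarrow> f \<in> borel_measurable surface_measure"
  unfolding surface_measure_eq by (rule measurable_restrict_space1) simp

lemma AE_surface_measure_iff:
  "(AE x in surface_measure. P x) \<longleftrightarrow> (AE x in unif_sphere. norm x = 1 \<longrightarrow> P x)"
  unfolding surface_measure_eq by (subst AE_restrict_space_iff) auto

lemma nn_integral_surface_measure:
  assumes [measurable]: "f \<in> borel_measurable borel"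
  shows "(\<integral>\<^sup>+x. f x \<partial>surface_measure) = (\<integral>\<^sup>+x. f x \<partial>unif_sphere)"
  unfolding surface_measure_eq
  by (subst nn_integral_restrict_space)
     (auto intro!: nn_integral_cong_AE eventually_mono[OF AE_unif_sphere])

lemma prob_space_surface_measure: "prob_space (surface_measure :: (complex ^ 'n::finite) measure)"
proof
  interpret prob_space "unif_sphere :: (complex ^ 'n) measure" by (rule prob_space_unif_sphere)
  have "emeasure surface_measure (space (surface_measure :: (complex ^ 'n) measure)) =
      (\<integral>\<^sup>+x. 1 \<partial>(surface_measure :: (complex ^ 'n) measure))"
    by (simp only: nn_integral_const mult_1)
  also have "\<dots> = (\<integral>\<^sup>+x. 1 \<partial>(unif_sphere :: (complex ^ 'n) measure))"
    by (rule nn_integral_surface_measure) simp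
  also have "\<dots> = 1" using emeasure_space_1 by simp
  finally show "emeasure surface_measure (space (surface_measure :: (complex ^ 'n) measure)) = 1" .
qed

section \<open>Power series and the Poisson kernel on the circle\<close>

interpretation circle: prob_space circle_measure
  by (rule prob_space_unif_sphere)

lemma circle_prob_UNIV [simp]: "measure circle_measure UNIV = 1"
  using circle.prob_space by simp

lemma AE_circle: "AE \<mu> in circle_measure. cmod \<mu> = 1"
  by (rule AE_unif_sphere)

lemma borel_measurable_cnj [measurable]: "cnj \<in> borel_measurable borel"
  by (intro borel_measurable_continuous_onI continuous_intros)

lemma circle_integrable_bounded:
  fixes f :: "complex \<Rightarrow> 'b::{banach, second_countable_topology}"
  assumes [measurable]: "f \<in> borel_measurable borel"
    and "\<And>\<mu>. cmod \<mu> = 1 \<Longrightarrow> norm (f \<mu>) \<le> B"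
  shows "integrable circle_measure f"
  by (rule circle.integrable_const_bound[where B = B])
     (use assms in \<open>auto intro!: eventually_mono[OF AE_circle]\<close>)

lemma circle_integral_power:
  assumes "m > 0"
  shows "(\<integral>\<mu>. \<mu> ^ m \<partial>circle_measure) = 0"
proof -
  \<comment> \<open>An \<open>m\<close>-th root of -1: rotating by \<open>c\<close> changes the sign
    of the integrand but not the integral.\<close>
  define c where "c = cis (pi / real m)"
  have "c ^ m = cis (real m * (pi / real m))" unfolding c_def by (rule Complex.DeMoivre)
  then have c: "c ^ m = -1" "cmod c = 1"
    using assms by (auto simp: c_def)
  have "(\<integral>\<mu>. \<mu> ^ m \<partial>circle_measure) = (\<integral>\<mu>. (c * \<mu>) ^ m \<partial>circle_measure)"
    using c by (intro integral_circle_rotate[symmetric]) auto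
  also have "\<dots> = - (\<integral>\<mu>. \<mu> ^ m \<partial>circle_measure)"
    using c by (simp add: power_mult_distrib)
  finally show ?thesis by simp
qed

lemma circle_integral_monomials:
  "(\<integral>\<mu>. \<mu> ^ k * cnj \<mu> ^ m \<partial>circle_measure) = (if k = m then 1 else 0)"
proof -
  have unit: "\<mu> ^ j * cnj \<mu> ^ j = 1" if "cmod \<mu> = 1" for \<mu> :: complex and j
    using that by (metis complex_norm_square mult.commute of_real_1 one_power2 power_mult_distrib power_one)
  have diff: "(\<integral>\<mu>. \<mu> ^ k * cnj \<mu> ^ m \<partial>circle_measure) = (\<integral>\<mu>. \<mu> ^ (k - m) \<partial>circle_measure)"
    if "m \<le> k" for k m
  proof (intro integral_cong_AE)
    show "AE \<mu> in circle_measure. \<mu> ^ k * cnj \<mu> ^ m = \<mu> ^ (k - m)"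
    proof (rule eventually_mono[OF AE_circle])
      fix \<mu> :: complex assume "cmod \<mu> = 1"
      have "\<mu> ^ k = \<mu> ^ (k - m) * \<mu> ^ m" using that by (simp flip: power_add)
      then show "\<mu> ^ k * cnj \<mu> ^ m = \<mu> ^ (k - m)"
        using unit[OF \<open>cmod \<mu> = 1\<close>, of m] by (simp add: mult.assoc)
    qed
  qed auto
  show ?thesis
  proof (cases "m \<le> k")
    case True
    then show ?thesis
      using circle_integral_power[of "k - m"] by (auto simp: diff circle.prob_space)
  next
    case False
    have "(\<integral>\<mu>. \<mu> ^ k * cnj \<mu> ^ m \<partial>circle_measure) = (\<integral>\<mu>. cnj (\<mu> ^ m * cnj \<mu> ^ k) \<partial>circle_measure)"
      by (simp add: mult.commute)
    also have "\<dots> = cnj (\<integral>\<mu>. \<mu> ^ m * cnj \<mu> ^ k \<partial>circle_measure)"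
      by (rule Bochner_Integration.integral_cnj)
    finally show ?thesis
      using False circle_integral_power[of "m - k"] by (auto simp: diff)
  qed
qed

lemma circle_coeff:
  assumes a: "summable (\<lambda>n. cmod (a n))"
    and f: "\<And>\<mu>. cmod \<mu> = 1 \<Longrightarrow> f \<mu> = (\<Sum>n. a n * \<mu> ^ n)"
    and [measurable]: "f \<in> borel_measurable borel"
  shows "(\<integral>\<mu>. f \<mu> * cnj \<mu> ^ m \<partial>circle_measure) = a m"
proof -
  let ?t = "\<lambda>n \<mu>. a n * (\<mu> ^ n * cnj \<mu> ^ m)"
  have norm_t: "cmod (?t n \<mu>) = cmod (a n)" if "cmod \<mu> = 1" for n \<mu>
    using that by (simp add: norm_mult norm_power)
  have int_norm: "(\<integral>\<mu>. cmod (?t n \<mu>) \<partial>circle_measure) = cmod (a n)" for n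
  proof -
    have "(\<integral>\<mu>. cmod (?t n \<mu>) \<partial>circle_measure) = (\<integral>\<mu>. cmod (a n) \<partial>circle_measure)"
      by (rule integral_cong_AE) (measurable, auto intro!: eventually_mono[OF AE_circle] norm_t)
    then show ?thesis by (simp add: circle.prob_space)
  qed
  have "(\<lambda>n. \<integral>\<mu>. ?t n \<mu> \<partial>circle_measure) sums (\<integral>\<mu>. (\<Sum>n. ?t n \<mu>) \<partial>circle_measure)"
  proof (rule sums_integral)
    show "integrable circle_measure (?t n)" for n
      by (rule circle_integrable_bounded[where B = "cmod (a n)"]) (auto simp: norm_t)
    show "AE \<mu> in circle_measure. summable (\<lambda>n. norm (?t n \<mu>))"
      by (rule eventually_mono[OF AE_circle]) (simp add: norm_t a)
    show "summable (\<lambda>n. \<integral>\<mu>. norm (?t n \<mu>) \<partial>circle_measure)"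
      by (simp only: int_norm a)
  qed
  moreover have "(\<integral>\<mu>. ?t n \<mu> \<partial>circle_measure) = (if n = m then a m else 0)" for n
    by (simp add: circle_integral_monomials)
  moreover have "(\<integral>\<mu>. (\<Sum>n. ?t n \<mu>) \<partial>circle_measure) = (\<integral>\<mu>. f \<mu> * cnj \<mu> ^ m \<partial>circle_measure)"
  proof (rule integral_cong_AE)
    show "AE \<mu> in circle_measure. (\<Sum>n. ?t n \<mu>) = f \<mu> * cnj \<mu> ^ m"
    proof (rule eventually_mono[OF AE_circle])
      fix \<mu> :: complex assume \<mu>: "cmod \<mu> = 1"
      have "summable (\<lambda>n. a n * \<mu> ^ n)"
        by (rule summable_norm_cancel) (simp add: norm_mult norm_power \<mu> a)
      then show "(\<Sum>n. ?t n \<mu>) = f \<mu> * cnj \<mu> ^ m"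
        unfolding f[OF \<mu>] by (subst suminf_mult2) (auto simp: mult.assoc)
    qed
  qed measurable
  ultimately have "(\<lambda>n. if n = m then a m else 0) sums (\<integral>\<mu>. f \<mu> * cnj \<mu> ^ m \<partial>circle_measure)"
    by simp
  then show ?thesis
    using sums_single[of m "\<lambda>_. a m"] by (metis (mono_tags, lifting) sums_cong sums_unique2)
qed

text \<open>Only the series of \<open>g\<close> is expanded. The factor \<open>f\<close> enters
  through its coefficients by \<open>circle_coeff\<close>, and its bound by the sum of their moduli
  justifies termwise integration.\<close>

lemma circle_parseval:
  assumes a: "summable (\<lambda>n. cmod (a n))" and b: "summable (\<lambda>n. cmod (b n))"
    and f: "\<And>\<mu>. cmod \<mu> = 1 \<Longrightarrow> f \<mu> = (\<Sum>n. a n * \<mu> ^ n)"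
    and g: "\<And>\<mu>. cmod \<mu> = 1 \<Longrightarrow> g \<mu> = (\<Sum>n. b n * \<mu> ^ n)"
    and [measurable]: "f \<in> borel_measurable borel" "g \<in> borel_measurable borel"
  shows "(\<lambda>n. a n * cnj (b n)) sums (\<integral>\<mu>. f \<mu> * cnj (g \<mu>) \<partial>circle_measure)"
proof -
  let ?t = "\<lambda>n \<mu>. cnj (b n) * (f \<mu> * cnj \<mu> ^ n)"
  define K where "K = (\<Sum>n. cmod (a n))"
  have fK: "cmod (f \<mu>) \<le> K" if \<mu>: "cmod \<mu> = 1" for \<mu>
    unfolding f[OF \<mu>] K_def
    using summable_norm[of "\<lambda>n. a n * \<mu> ^ n"] a by (simp add: norm_mult norm_power \<mu>)
  have norm_t: "cmod (?t n \<mu>) \<le> cmod (b n) * K" if "cmod \<mu> = 1" for n \<mu>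
    using fK[OF that] that by (simp add: norm_mult norm_power mult_left_mono)
  have int_t: "integrable circle_measure (?t n)" for n
    by (rule circle_integrable_bounded[where B = "cmod (b n) * K"]) (auto simp: norm_t)
  have "(\<lambda>n. \<integral>\<mu>. ?t n \<mu> \<partial>circle_measure) sums (\<integral>\<mu>. (\<Sum>n. ?t n \<mu>) \<partial>circle_measure)"
  proof (rule sums_integral[OF int_t])
    show "AE \<mu> in circle_measure. summable (\<lambda>n. norm (?t n \<mu>))"
    proof (rule eventually_mono[OF AE_circle])
      fix \<mu> :: complex assume "cmod \<mu> = 1"
      then show "summable (\<lambda>n. norm (?t n \<mu>))"
        using b by (simp add: norm_mult norm_power summable_mult2)
    qed
    show "summable (\<lambda>n. \<integral>\<mu>. norm (?t n \<mu>) \<partial>circle_measure)"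
    proof (rule summable_comparison_test')
      show "summable (\<lambda>n. cmod (b n) * K)" using b by (rule summable_mult2)
      fix n
      have "(\<integral>\<mu>. norm (?t n \<mu>) \<partial>circle_measure) \<le> (\<integral>\<mu>. cmod (b n) * K \<partial>circle_measure)"
        using int_t by (intro integral_mono_AE integrable_norm)
          (auto intro!: eventually_mono[OF AE_circle] norm_t simp del: norm_mult)
      then show "norm (\<integral>\<mu>. norm (?t n \<mu>) \<partial>circle_measure) \<le> cmod (b n) * K"
        by (simp add: circle.prob_space del: norm_mult)
    qed
  qed
  moreover have "(\<integral>\<mu>. ?t n \<mu> \<partial>circle_measure) = a n * cnj (b n)" for n
    by (subst integral_mult_right_zero) (simp add: circle_coeff[OF a f])
  moreover have "(\<integral>\<mu>. (\<Sum>n. ?t n \<mu>) \<partial>circle_measure) = (\<integral>\<mu>. f \<mu> * cnj (g \<mu>) \<partial>circle_measure)"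
  proof (rule integral_cong_AE)
    show "AE \<mu> in circle_measure. (\<Sum>n. ?t n \<mu>) = f \<mu> * cnj (g \<mu>)"
    proof (rule eventually_mono[OF AE_circle])
      fix \<mu> :: complex assume \<mu>: "cmod \<mu> = 1"
      have s: "summable (\<lambda>n. b n * \<mu> ^ n)"
        by (rule summable_norm_cancel) (simp add: norm_mult norm_power \<mu> b)
      have "(\<lambda>n. cnj (b n * \<mu> ^ n)) sums cnj (g \<mu>)"
        unfolding g[OF \<mu>] sums_cnj using s by (rule summable_sums)
      from sums_mult[OF this, of "f \<mu>"]
      show "(\<Sum>n. ?t n \<mu>) = f \<mu> * cnj (g \<mu>)"
        by (simp add: sums_iff mult_ac)
    qed
  qed measurable
  ultimately show ?thesis by (simp only:)
qed

section \<open>Square means and pairings of holomorphic functions on discs\<close>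

lemma holomorphic_taylor_abs:
  assumes "f holomorphic_on ball 0 R" "0 \<le> r" "r < R"
  shows "summable (\<lambda>n. cmod ((deriv ^^ n) f 0 / fact n * of_real r ^ n))"
    and "cmod z \<le> r \<Longrightarrow> f z = (\<Sum>n. (deriv ^^ n) f 0 / fact n * z ^ n)"
proof -
  define t where "t = (r + R) / 2"
  have t: "r < t" "t < R" "0 < t" using assms by (auto simp: t_def)
  have "summable (\<lambda>n. (deriv ^^ n) f 0 / fact n * (of_real t - 0) ^ n)"
    using holomorphic_power_series[OF assms(1), of "of_real t"] t by (auto simp: sums_iff)
  then show "summable (\<lambda>n. cmod ((deriv ^^ n) f 0 / fact n * of_real r ^ n))"
    using t assms by (intro powser_insidea[where x = "of_real t"]) auto
  show "f z = (\<Sum>n. (deriv ^^ n) f 0 / fact n * z ^ n)" if "cmod z \<le> r"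
    using holomorphic_power_series[OF assms(1), of z] that assms by (auto simp: sums_iff)
qed

lemma circle_parseval_holomorphic:
  assumes f: "f holomorphic_on ball 0 R" and g: "g holomorphic_on ball 0 R"
    and rs: "0 \<le> r" "r < R" "0 \<le> s" "s < R"
    and [measurable]: "f \<in> borel_measurable borel" "g \<in> borel_measurable borel"
  shows "(\<lambda>n. ((deriv ^^ n) f 0 / fact n) * cnj ((deriv ^^ n) g 0 / fact n) * of_real (r * s) ^ n)
     sums (\<integral>\<mu>. f (r * \<mu>) * cnj (g (s * \<mu>)) \<partial>circle_measure)"
proof -
  have "(\<lambda>n. ((deriv ^^ n) f 0 / fact n * of_real r ^ n) * cnj ((deriv ^^ n) g 0 / fact n * of_real s ^ n))
     sums (\<integral>\<mu>. f (r * \<mu>) * cnj (g (s * \<mu>)) \<partial>circle_measure)"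
  proof (rule circle_parseval)
    fix \<mu> :: complex assume "cmod \<mu> = 1"
    then show "f (r * \<mu>) = (\<Sum>n. (deriv ^^ n) f 0 / fact n * of_real r ^ n * \<mu> ^ n)"
      and "g (s * \<mu>) = (\<Sum>n. (deriv ^^ n) g 0 / fact n * of_real s ^ n * \<mu> ^ n)"
      using holomorphic_taylor_abs(2)[OF f rs(1,2), of "r * \<mu>"]
        holomorphic_taylor_abs(2)[OF g rs(3,4), of "s * \<mu>"] rs
      by (simp_all add: norm_mult power_mult_distrib mult.assoc)
  qed (use holomorphic_taylor_abs(1)[OF f rs(1,2)] holomorphic_taylor_abs(1)[OF g rs(3,4)] in auto)
  then show ?thesis
    by (simp add: power_mult_distrib mult_ac)
qed

lemma circle_mean_value:
  fixes r :: real
  assumes f: "f holomorphic_on ball 0 R" and r: "0 \<le> r" "r < R"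
    and [measurable]: "f \<in> borel_measurable borel"
  shows "(\<integral>\<mu>. f (r * \<mu>) \<partial>circle_measure) = f 0"
proof -
  have "(\<lambda>n. ((deriv ^^ n) f 0 / fact n) * cnj ((deriv ^^ n) (\<lambda>_. 1 :: complex) 0 / fact n) * of_real (r * 0 :: real) ^ n)
     sums (\<integral>\<mu>. f (r * \<mu>) * cnj 1 \<partial>circle_measure)"
    using r by (intro circle_parseval_holomorphic[where s = 0, OF f]) auto
  moreover have "(\<lambda>n. ((deriv ^^ n) f 0 / fact n) * cnj ((deriv ^^ n) (\<lambda>_. 1 :: complex) 0 / fact n) * of_real (r * 0 :: real) ^ n)
     = (\<lambda>n. if n = 0 then f 0 else 0)"
    by (auto simp: power_0_left)
  ultimately show ?thesis
    using sums_single[of 0 "\<lambda>_. f 0"] by (auto simp: sums_iff)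
qed

text \<open>In the Parseval series the radii enter only through \<open>(r * s) ^ n\<close>, so both
  may be replaced by their geometric mean.\<close>

lemma circle_inner_radii:
  fixes r s :: real
  assumes f: "f holomorphic_on ball 0 R" and rs: "0 \<le> r" "r < R" "0 \<le> s" "s < R"
    and m: "f \<in> borel_measurable borel"
  shows "(\<integral>\<mu>. f (r * \<mu>) * cnj (f (s * \<mu>)) \<partial>circle_measure) =
    of_real (\<integral>\<mu>. (cmod (f (sqrt (r * s) * \<mu>)))\<^sup>2 \<partial>circle_measure)"
proof -
  have q: "0 \<le> sqrt (r * s)" "sqrt (r * s) < R"
  proof -
    have "sqrt (r * s) \<le> sqrt (max r s * max r s)"
      using rs by (intro real_sqrt_le_mono mult_mono) auto
    then show "sqrt (r * s) < R" using rs by (auto simp: max_def split: if_splits)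
  qed (use rs in auto)
  have "(\<integral>\<mu>. f (r * \<mu>) * cnj (f (s * \<mu>)) \<partial>circle_measure) =
      (\<integral>\<mu>. f (sqrt (r * s) * \<mu>) * cnj (f (sqrt (r * s) * \<mu>)) \<partial>circle_measure)"
    using circle_parseval_holomorphic[OF f f rs m m] circle_parseval_holomorphic[OF f f q q m m] rs
    by (simp add: sums_iff)
  also have "\<dots> = (\<integral>\<mu>. of_real ((cmod (f (sqrt (r * s) * \<mu>)))\<^sup>2) \<partial>circle_measure)"
    by (simp only: complex_norm_square)
  finally show ?thesis by (simp only: integral_complex_of_real)
qed

lemma circle_square_mono:
  fixes r s :: real
  assumes f: "f holomorphic_on ball 0 R" and rs: "0 \<le> r" "r \<le> s" "s < R"
    and m: "f \<in> borel_measurable borel"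
  shows "(\<integral>\<mu>. (cmod (f (r * \<mu>)))\<^sup>2 \<partial>circle_measure) \<le> (\<integral>\<mu>. (cmod (f (s * \<mu>)))\<^sup>2 \<partial>circle_measure)"
proof -
  let ?a = "\<lambda>n. (cmod ((deriv ^^ n) f 0 / fact n))\<^sup>2"
  have *: "(\<lambda>n. ?a n * (r * r) ^ n) sums (\<integral>\<mu>. (cmod (f (r * \<mu>)))\<^sup>2 \<partial>circle_measure)"
    if r: "0 \<le> r" "r < R" for r :: real
  proof -
    have "(\<lambda>n. (((deriv ^^ n) f 0 / fact n) * cnj ((deriv ^^ n) f 0 / fact n)) * of_real (r * r) ^ n)
       sums (\<integral>\<mu>. f (r * \<mu>) * cnj (f (r * \<mu>)) \<partial>circle_measure)"
      by (rule circle_parseval_holomorphic[OF f f r r m m])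
    then have "(\<lambda>n. of_real (?a n * (r * r) ^ n) :: complex)
       sums of_real (\<integral>\<mu>. (cmod (f (r * \<mu>)))\<^sup>2 \<partial>circle_measure)"
      by (simp only: complex_norm_square[symmetric] flip: integral_complex_of_real of_real_mult of_real_power)
    then show ?thesis by (simp only: sums_of_real_iff)
  qed
  show ?thesis
    by (rule sums_le[OF _ *[of r] *[of s]])
       (use rs in \<open>auto intro!: mult_left_mono power_mono mult_mono\<close>)
qed

text \<open>The Cayley transform of \<open>G\<close>, normalised to vanish at 0, maps the disc into
  itself, and the Schwarz lemma bounds its derivative there.\<close>

lemma caratheodory_deriv_bound:
  assumes G: "G holomorphic_on ball 0 \<rho>" and "0 < \<rho>"
    and Re: "\<And>z. z \<in> ball 0 \<rho> \<Longrightarrow> 0 \<le> Re (G z)"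
  shows "cmod (deriv G 0) * \<rho> \<le> 2 * Re (G 0)"
proof -
  \<comment> \<open>Adding \<open>e\<close> makes the real part strictly positive, so that the
    transform is defined and takes values in the open disc.\<close>
  have eps: "cmod (deriv G 0) * \<rho> \<le> 2 * (Re (G 0) + e)" if e: "e > 0" for e :: real
  proof -
    define a where "a = G 0 + e"
    define W where "W = (\<lambda>z :: complex. (G (\<rho> * z) + e - a) / (G (\<rho> * z) + e + cnj a))"
    have Rea: "Re a > 0" using Re[of 0] \<open>0 < \<rho>\<close> e by (simp add: a_def)
    have ball: "of_real \<rho> * z \<in> ball 0 \<rho>" if "z \<in> ball 0 1" for z :: complex
      using that \<open>0 < \<rho>\<close> by (simp add: norm_mult)
    have Re': "0 < Re (G (\<rho> * z) + e)" if "z \<in> ball 0 1" for z :: complex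
      using Re[OF ball[OF that]] e by simp
    have nz: "G (\<rho> * z) + e + cnj a \<noteq> 0" if "z \<in> ball 0 1" for z :: complex
    proof
      assume "G (\<rho> * z) + e + cnj a = 0"
      then have "Re (G (\<rho> * z) + e + cnj a) = 0" by simp
      then show False using Re'[OF that] Rea by simp
    qed
    have hG: "(\<lambda>z. G (\<rho> * z)) holomorphic_on ball 0 1"
      using holomorphic_on_compose_gen[of "\<lambda>z. \<rho> * z" "ball 0 1" G "ball 0 \<rho>"] G ball
      by (auto simp: o_def image_subset_iff intro!: holomorphic_intros)
    have W: "W holomorphic_on ball 0 1"
      unfolding W_def using nz by (intro holomorphic_intros hG) auto
    have W0: "W 0 = 0" by (simp add: W_def a_def)
    have W1: "cmod (W z) < 1" if "cmod z < 1" for z :: complex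
    proof -
      define g where "g = G (\<rho> * z) + e"
      have g: "0 < Re g" using Re'[of z] that by (simp add: g_def)
      have "(cmod (g - a))\<^sup>2 = (cmod (g + cnj a))\<^sup>2 - 4 * (Re g * Re a)"
        by (simp add: cmod_power2) (simp add: power2_eq_square algebra_simps)
      then have "(cmod (g - a))\<^sup>2 < (cmod (g + cnj a))\<^sup>2" using g Rea by simp
      then have "cmod (g - a) < cmod (g + cnj a)" by (rule power2_less_imp_less) simp
      moreover have "g + cnj a \<noteq> 0" using nz[of z] that by (simp add: g_def)
      ultimately show ?thesis
        unfolding W_def g_def[symmetric] by (simp add: norm_divide)
    qed
    have "cmod (deriv W 0) \<le> 1"
      by (rule Schwarz_Lemma(2)[OF W W0 W1, of 0]) auto
    moreover have "deriv W 0 = deriv G 0 * \<rho> / (2 * Re a)"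
    proof (rule DERIV_imp_deriv)
      have "(G has_field_derivative deriv G 0) (at (of_real \<rho> * 0))"
        using G \<open>0 < \<rho>\<close> by (auto intro!: holomorphic_derivI[of _ "ball 0 \<rho>"])
      then have d: "((\<lambda>z. G (\<rho> * z)) has_field_derivative deriv G 0 * \<rho>) (at 0)"
        by (rule DERIV_chain2) (auto intro!: derivative_eq_intros)
      have "G 0 + e + cnj a = 2 * Re a"
        by (simp add: a_def complex_eq_iff)
      then show "(W has_field_derivative deriv G 0 * \<rho> / (2 * Re a)) (at 0)"
        unfolding W_def using Rea
        by (auto intro!: derivative_eq_intros d simp: a_def[symmetric])
    qed
    ultimately have "cmod (deriv G 0) * \<rho> / (2 * Re a) \<le> 1"
      using Rea \<open>0 < \<rho>\<close> by (simp add: norm_divide norm_mult)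
    then show ?thesis
      using Rea by (simp add: divide_le_eq a_def)
  qed
  show ?thesis
  proof (rule field_le_epsilon)
    fix e :: real assume "e > 0"
    then show "cmod (deriv G 0) * \<rho> \<le> 2 * Re (G 0) + e" using eps[of "e / 2"] by simp
  qed
qed

section \<open>The Poisson kernel of the disc\<close>

definition poisson :: "real \<Rightarrow> complex \<Rightarrow> real" where
  "poisson r \<mu> = (1 - r\<^sup>2) / (cmod (1 - r * \<mu>))\<^sup>2"

lemma poisson_measurable [measurable]: "poisson r \<in> borel_measurable borel"
  unfolding poisson_def[abs_def] by measurable

lemma poisson_nonneg: "0 \<le> r \<Longrightarrow> r < 1 \<Longrightarrow> 0 \<le> poisson r \<mu>"
  by (simp add: poisson_def power_le_one)

lemma poisson_cnj: "poisson r (cnj \<mu>) = poisson r \<mu>"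
proof -
  have "1 - r * cnj \<mu> = cnj (1 - r * \<mu>)" by simp
  then show ?thesis unfolding poisson_def by (simp only: complex_mod_cnj)
qed

lemma one_minus_nonzero: "cmod z < 1 \<Longrightarrow> 1 - z \<noteq> 0"
  by auto

text \<open>A conjugated geometric series plus an analytic term that vanishes at 0: against a
  holomorphic function the first reproduces the value and the second integrates to 0.\<close>

lemma poisson_eq:
  assumes "0 \<le> r" "r < 1" "cmod \<mu> = 1"
  shows "of_real (poisson r \<mu>) = cnj (1 / (1 - r * \<mu>)) + (r * \<mu>) / (1 - r * \<mu>)"
proof -
  have 1: "1 - r * \<mu> \<noteq> 0" using assms by (intro one_minus_nonzero) (simp add: norm_mult)
  have 2: "1 - r * cnj \<mu> \<noteq> 0" using assms by (intro one_minus_nonzero) (simp add: norm_mult)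
  have u: "\<mu> * cnj \<mu> = 1" using assms by (simp flip: complex_norm_square)
  have "of_real (poisson r \<mu>) = (1 - r\<^sup>2) / ((1 - r * \<mu>) * (1 - r * cnj \<mu>))"
    unfolding poisson_def of_real_divide complex_norm_square by simp
  also have "\<dots> = 1 / (1 - r * cnj \<mu>) + (r * \<mu>) / (1 - r * \<mu>)"
  proof -
    have "(1 - r * \<mu>) + (r * \<mu>) * (1 - r * cnj \<mu>) = 1 - of_real (r\<^sup>2)"
      using u by (simp add: algebra_simps power2_eq_square)
    then show ?thesis using 1 2 by (simp add: add_frac_eq mult.commute)
  qed
  finally show ?thesis by simp
qed

lemma poisson_reproducing:
  fixes f :: "complex \<Rightarrow> complex"
  assumes f: "f holomorphic_on ball 0 R" and R: "1 < R"
    and r: "0 \<le> r" "r < 1" and l: "cmod l = 1"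
    and [measurable]: "f \<in> borel_measurable borel"
  shows "(\<integral>\<mu>. poisson r \<mu> * f (l * \<mu>) \<partial>circle_measure) = f (r * l)"
    and "integrable circle_measure (\<lambda>\<mu>. poisson r \<mu> * f (l * \<mu>))"
proof -
  have "compact (f ` sphere 0 1)"
    using R by (intro compact_continuous_image holomorphic_on_imp_continuous_on
      holomorphic_on_subset[OF f]) (auto simp: subset_iff)
  then obtain K where K: "\<And>z. cmod z = 1 \<Longrightarrow> cmod (f z) \<le> K"
    by (force dest!: compact_imp_bounded simp: bounded_iff)
  \<comment> \<open>Since \<open>r * (2 / (1 + r)) < 1\<close>, this disc, still larger than the
    unit disc, contains no zero of \<open>1 - r * z\<close>.\<close>
  define R' where "R' = min R (2 / (1 + r))"
  have R': "1 < R'" "R' \<le> R" using R r by (auto simp: R'_def field_simps)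
  have rR': "cmod (r * z) < 1" if "z \<in> ball 0 R'" for z :: complex
  proof -
    have "cmod z < 2 / (1 + r)" using that by (auto simp: R'_def)
    then have "cmod (r * z) \<le> r * (2 / (1 + r))" 
      using r mult_left_mono[of "cmod z" "2 / (1 + r)" r] by (simp add: norm_mult)
    also have "\<dots> < 1" using r by (simp add: field_simps)
    finally show ?thesis .
  qed
  have fl: "(\<lambda>z. f (l * z)) holomorphic_on ball 0 R'"
    using holomorphic_on_compose_gen[of "\<lambda>z. l * z" "ball 0 R'" f "ball 0 R"] f l R'
    by (auto simp: o_def norm_mult image_subset_iff intro!: holomorphic_intros)
  have nz: "1 - r * z \<noteq> 0" if "z \<in> ball 0 R'" for z :: complex
    using rR'[OF that] by (rule one_minus_nonzero)
  have "(\<lambda>n. (((deriv ^^ n) f 0 / fact n) * l ^ n) * cnj (r ^ n)) sums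
      (\<integral>\<mu>. f (l * \<mu>) * cnj (1 / (1 - r * \<mu>)) \<partial>circle_measure)"
  proof (rule circle_parseval)
    show "summable (\<lambda>n. cmod (((deriv ^^ n) f 0 / fact n) * l ^ n))"
      using holomorphic_taylor_abs(1)[OF f _ R]
      by (simp only: norm_mult norm_power l power_one of_real_1 norm_one mult_1_right zero_le_one)
    show "summable (\<lambda>n. cmod (of_real (r ^ n)))"
      using r by (simp add: norm_power summable_geometric)
    fix \<mu> :: complex assume \<mu>: "cmod \<mu> = 1"
    show "f (l * \<mu>) = (\<Sum>n. (deriv ^^ n) f 0 / fact n * l ^ n * \<mu> ^ n)"
      using holomorphic_taylor_abs(2)[OF f _ R, of "l * \<mu>"] l \<mu>
      by (simp add: norm_mult power_mult_distrib mult.assoc)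
    show "1 / (1 - r * \<mu>) = (\<Sum>n. of_real (r ^ n) * \<mu> ^ n)"
      using suminf_geometric[of "r * \<mu>"] r \<mu> by (simp add: norm_mult power_mult_distrib)
  qed measurable
  moreover have "(\<lambda>n. (((deriv ^^ n) f 0 / fact n) * l ^ n) * cnj (r ^ n)) sums f (r * l)"
    using holomorphic_power_series[OF f, of "r * l"] l r R
    by (simp add: norm_mult power_mult_distrib mult_ac)
  ultimately have 1: "(\<integral>\<mu>. f (l * \<mu>) * cnj (1 / (1 - r * \<mu>)) \<partial>circle_measure) = f (r * l)"
    by (rule sums_unique2)
  have 2: "(\<integral>\<mu>. f (l * \<mu>) * ((r * \<mu>) / (1 - r * \<mu>)) \<partial>circle_measure) = 0"
  proof -
    have "(\<lambda>z. f (l * z) * ((r * z) / (1 - r * z))) holomorphic_on ball 0 R'"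
      using nz by (intro holomorphic_intros fl) auto
    from circle_mean_value[OF this, of 1] R' show ?thesis by simp
  qed
  have lb: "1 / cmod (1 - r * \<mu>) \<le> 1 / (1 - r)" if "cmod \<mu> = 1" for \<mu> :: complex
    using norm_triangle_ineq2[of 1 "r * \<mu>"] that r
    by (intro frac_le) (auto simp: norm_mult)
  have K0: "0 \<le> K" using K[of 1] by (auto intro: order_trans[OF norm_ge_zero])
  have i1: "integrable circle_measure (\<lambda>\<mu>. f (l * \<mu>) * cnj (1 / (1 - r * \<mu>)))"
    using mult_mono[OF K lb] K0 l
    by (intro circle_integrable_bounded[where B = "K * (1 / (1 - r))"])
       (simp_all add: norm_mult norm_divide)
  have i2: "integrable circle_measure (\<lambda>\<mu>. f (l * \<mu>) * ((r * \<mu>) / (1 - r * \<mu>)))"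
  proof (intro circle_integrable_bounded[where B = "K * (1 / (1 - r))"])
    fix \<mu> :: complex assume \<mu>: "cmod \<mu> = 1"
    have "cmod (f (l * \<mu>) * ((r * \<mu>) / (1 - r * \<mu>))) = cmod (f (l * \<mu>)) * (r * (1 / cmod (1 - r * \<mu>)))"
      using \<mu> r by (simp add: norm_mult norm_divide)
    also have "\<dots> \<le> K * (1 * (1 / (1 - r)))"
      using lb[OF \<mu>] K[of "l * \<mu>"] K0 l \<mu> r by (intro mult_mono) (auto simp: norm_mult)
    finally show "cmod (f (l * \<mu>) * ((r * \<mu>) / (1 - r * \<mu>))) \<le> K * (1 / (1 - r))" by simp
  qed measurable
  have AE: "AE \<mu> in circle_measure. poisson r \<mu> * f (l * \<mu>) =
     f (l * \<mu>) * cnj (1 / (1 - r * \<mu>)) + f (l * \<mu>) * ((r * \<mu>) / (1 - r * \<mu>))"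
    by (rule eventually_mono[OF AE_circle]) (simp only: poisson_eq[OF r], simp only: algebra_simps)
  show "integrable circle_measure (\<lambda>\<mu>. poisson r \<mu> * f (l * \<mu>))"
    using Bochner_Integration.integrable_add[OF i1 i2]
    by (rule integrable_cong_AE_imp) (measurable, use AE in \<open>auto elim: eventually_mono\<close>)
  have "(\<integral>\<mu>. poisson r \<mu> * f (l * \<mu>) \<partial>circle_measure) =
     (\<integral>\<mu>. f (l * \<mu>) * cnj (1 / (1 - r * \<mu>)) + f (l * \<mu>) * ((r * \<mu>) / (1 - r * \<mu>)) \<partial>circle_measure)"
    using AE by (intro integral_cong_AE) measurable
  also have "\<dots> = f (r * l)"
    using Bochner_Integration.integral_add[OF i1 i2] 1 2 by simp
  finally show "(\<integral>\<mu>. poisson r \<mu> * f (l * \<mu>) \<partial>circle_measure) = f (r * l)" .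
qed

lemma poisson_dominates:
  assumes "f holomorphic_on ball 0 R" "1 < R" "0 \<le> r" "r < 1" "cmod l = 1"
    and [measurable]: "f \<in> borel_measurable borel"
  shows "ennreal (cmod (f (r * l))) \<le>
    (\<integral>\<^sup>+\<mu>. ennreal (poisson r \<mu>) * ennreal (cmod (f (l * \<mu>))) \<partial>circle_measure)"
proof -
  have "ennreal (cmod (f (r * l))) \<le> (\<integral>\<^sup>+\<mu>. ennreal (cmod (poisson r \<mu> * f (l * \<mu>))) \<partial>circle_measure)"
    using integral_norm_bound_ennreal[OF poisson_reproducing(2)[OF assms]]
    by (simp add: poisson_reproducing(1)[OF assms])
  then show ?thesis
    using poisson_nonneg[of r] assms by (simp add: norm_mult ennreal_mult')
qed

lemma Re_cayley: "1 - z \<noteq> 0 \<Longrightarrow> Re ((1 + z) / (1 - z)) = (1 - (cmod z)\<^sup>2) / (cmod (1 - z))\<^sup>2"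
  by (simp add: Re_divide cmod_power2) (simp add: field_simps power2_eq_square)

text \<open>On the circle \<open>poisson s\<close> is the real part of the Cayley function
  \<open>(1 + s * z) / (1 - s * z)\<close>, which is holomorphic beyond the closed disc. The
  reproducing formula evaluates it at \<open>r * l\<close>, and its real part there is the kernel of
  the product radius.\<close>

lemma poisson_semigroup:
  assumes r: "0 \<le> r" "r < 1" and s: "0 \<le> s" "s < 1" and l: "cmod l = 1"
  shows "(\<integral>\<^sup>+\<mu>. ennreal (poisson r \<mu>) * ennreal (poisson s (l * \<mu>)) \<partial>circle_measure) =
    ennreal (poisson (r * s) l)"
proof -
  define f :: "complex \<Rightarrow> complex" where
    "f = (\<lambda>z :: complex. (1 + of_real s * z) / (1 - of_real s * z))"
  have [measurable]: "f \<in> borel_measurable borel" unfolding f_def by measurable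
  have nz: "1 - s * z \<noteq> 0" if "z \<in> ball 0 (2 / (1 + s))" for z :: complex
  proof (rule one_minus_nonzero)
    have "cmod (s * z) \<le> s * (2 / (1 + s))" 
      using s that mult_left_mono[of "cmod z" "2 / (1 + s)" s] by (simp add: norm_mult)
    also have "\<dots> < 1" using s by (simp add: field_simps)
    finally show "cmod (s * z) < 1" .
  qed
  have f: "f holomorphic_on ball 0 (2 / (1 + s))"
    unfolding f_def using nz by (intro holomorphic_intros) auto
  have R: "1 < 2 / (1 + s)" using s by (simp add: field_simps)
  have Ref: "Re (f z) = (1 - s\<^sup>2 * (cmod z)\<^sup>2) / (cmod (1 - s * z))\<^sup>2" if "cmod z \<le> 1" for z :: complex
  proof -
    have "Re (f z) = (1 - (cmod (s * z))\<^sup>2) / (cmod (1 - s * z))\<^sup>2"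
      unfolding f_def using that R by (intro Re_cayley nz) auto
    then show ?thesis by (simp add: norm_mult power_mult_distrib)
  qed
  note P = poisson_reproducing[OF f R r l]
  have AE: "AE \<mu> in circle_measure. poisson r \<mu> * poisson s (l * \<mu>) = Re (poisson r \<mu> * f (l * \<mu>))"
    by (rule eventually_mono[OF AE_circle]) (use l in \<open>simp add: Ref poisson_def norm_mult\<close>)
  have int: "integrable circle_measure (\<lambda>\<mu>. poisson r \<mu> * poisson s (l * \<mu>))"
    using integrable_Re[OF P(2)]
    by (rule integrable_cong_AE_imp) (measurable, use AE in \<open>auto elim: eventually_mono\<close>)
  have "(\<integral>\<mu>. poisson r \<mu> * poisson s (l * \<mu>) \<partial>circle_measure) =
      (\<integral>\<mu>. Re (poisson r \<mu> * f (l * \<mu>)) \<partial>circle_measure)"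
    using AE by (intro integral_cong_AE) measurable
  also have "\<dots> = Re (f (r * l))"
    using integral_Re[OF P(2)] P(1) by simp
  also have "\<dots> = poisson (r * s) l"
  proof -
    have "cmod (r * l) \<le> 1" using r l by (simp add: norm_mult)
    then show ?thesis
      using r l by (simp add: Ref poisson_def norm_mult power_mult_distrib mult_ac)
  qed
  finally have "(\<integral>\<^sup>+\<mu>. ennreal (poisson r \<mu> * poisson s (l * \<mu>)) \<partial>circle_measure) = ennreal (poisson (r * s) l)"
    using int r s poisson_nonneg by (subst nn_integral_eq_integral) auto
  then show ?thesis
    using poisson_nonneg r s by (simp add: ennreal_mult)
qed

lemma poisson_total:
  assumes "0 \<le> r" "r < 1"
  shows "(\<integral>\<^sup>+\<mu>. ennreal (poisson r \<mu>) \<partial>circle_measure) = 1"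
  using poisson_semigroup[OF assms, of 0 1] by (simp add: poisson_def)

text \<open>With \<open>q = r * s\<close> between \<open>r\<^sup>2\<close> and \<open>r\<close>, the
  numerator grows by at most a factor 2, and the modulus whose square is the denominator shrinks by
  at most a factor 2; hence 8.\<close>

lemma poisson_mult_le:
  assumes r: "0 \<le> r" and rs: "r \<le> s" "s < 1" and \<mu>: "cmod \<mu> = 1"
  shows "poisson (r * s) \<mu> \<le> 8 * poisson r \<mu>"
proof -
  define q where "q = r * s"
  have q: "r\<^sup>2 \<le> q" "q \<le> r" "q < 1"
    using r rs mult_left_mono[of r s r] mult_left_mono[of s 1 r] by (auto simp: q_def power2_eq_square)
  have 1: "1 - q \<le> cmod (1 - q * \<mu>)"
    using norm_triangle_ineq2[of 1 "q * \<mu>"] \<mu> q r rs by (simp add: norm_mult q_def)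
  have "cmod (1 - r * \<mu>) \<le> cmod (1 - q * \<mu>) + cmod ((q - r) * \<mu>)"
    using norm_triangle_ineq[of "1 - q * \<mu>" "(q - r) * \<mu>"] by (simp add: algebra_simps)
  also have "\<dots> = cmod (1 - q * \<mu>) + (r - q)"
    using \<mu> q by (simp add: norm_mult flip: of_real_diff)
  also have "\<dots> \<le> 2 * cmod (1 - q * \<mu>)" using 1 q r rs by linarith
  finally have 2: "cmod (1 - r * \<mu>) \<le> 2 * cmod (1 - q * \<mu>)" .
  have r1: "1 - r * \<mu> \<noteq> 0" using r rs \<mu> by (intro one_minus_nonzero) (simp add: norm_mult)
  have "(r\<^sup>2)\<^sup>2 \<le> q\<^sup>2" using q by (intro power_mono) auto
  then have "1 - q\<^sup>2 \<le> (1 - r\<^sup>2) * (1 + r\<^sup>2)" by (simp add: algebra_simps power2_eq_square)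
  also have "\<dots> \<le> (1 - r\<^sup>2) * 2" using r rs by (intro mult_left_mono) (auto simp: power_le_one)
  finally have 3: "1 - q\<^sup>2 \<le> 2 * (1 - r\<^sup>2)" by simp
  have 4: "(cmod (1 - r * \<mu>))\<^sup>2 \<le> 4 * (cmod (1 - q * \<mu>))\<^sup>2"
    using power_mono[OF 2, of 2] by (simp add: power_mult_distrib)
  have "(1 - q\<^sup>2) / (cmod (1 - q * \<mu>))\<^sup>2 = 4 * (1 - q\<^sup>2) / (4 * (cmod (1 - q * \<mu>))\<^sup>2)"
    by (rule mult_divide_mult_cancel_left[symmetric]) simp
  also have "\<dots> \<le> 4 * (2 * (1 - r\<^sup>2)) / (cmod (1 - r * \<mu>))\<^sup>2"
    using 3 4 r1 q r rs by (intro frac_le) (auto simp: power_le_one)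
  finally show ?thesis by (simp add: poisson_def q_def)
qed

section \<open>A maximal inequality for Poisson averages\<close>

text \<open>Poisson average over the circle through \<open>x\<close>, evaluated on nonnegative
  functions so that no integrability condition arises.\<close>

definition pavg :: "real \<Rightarrow> (complex ^ 'n::finite \<Rightarrow> ennreal) \<Rightarrow> complex ^ 'n \<Rightarrow> ennreal" where
  "pavg r g x = (\<integral>\<^sup>+\<mu>. ennreal (poisson r \<mu>) * g (\<mu> *s x) \<partial>circle_measure)"

lemma pavg_measurable [measurable (raw)]:
  assumes [measurable]: "g \<in> borel_measurable borel"
  shows "pavg r g \<in> borel_measurable borel"
  unfolding pavg_def[abs_def] by measurable

lemma pavg_sum:
  assumes "\<And>i. i \<in> I \<Longrightarrow> g i \<in> borel_measurable borel"
  shows "pavg r (\<lambda>x. \<Sum>i\<in>I. g i x) x = (\<Sum>i\<in>I. pavg r (g i) x)"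
  using assms unfolding pavg_def sum_distrib_left by (subst nn_integral_sum) auto

text \<open>Rotating the inner variable makes the argument of \<open>g\<close> independent of the
  outer one; after an exchange of integrals the remaining kernel integral is
  \<open>poisson_semigroup\<close>.\<close>

lemma pavg_semigroup:
  assumes r: "0 \<le> r" "r < 1" and s: "0 \<le> s" "s < 1"
    and [measurable]: "g \<in> borel_measurable borel"
  shows "pavg r (pavg s g) x = pavg (r * s) g x"
proof -
  have P: "pair_sigma_finite circle_measure circle_measure"
    by (intro pair_sigma_finite.intro circle.sigma_finite_measure_axioms)
  have "pavg r (pavg s g) x =
      (\<integral>\<^sup>+\<mu>. \<integral>\<^sup>+\<nu>. (ennreal (poisson r \<mu>) * ennreal (poisson s (cnj \<nu> * \<mu>))) * g (\<nu> *s x)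
        \<partial>circle_measure \<partial>circle_measure)"
    unfolding pavg_def
  proof (rule nn_integral_cong_AE, rule eventually_mono[OF AE_circle])
    fix \<mu> :: complex assume \<mu>: "cmod \<mu> = 1"
    have u: "cnj \<mu> * \<mu> = 1" using \<mu> by (simp add: mult.commute flip: complex_norm_square)
    have "(\<integral>\<^sup>+\<nu>. ennreal (poisson s \<nu>) * g (\<nu> *s (\<mu> *s x)) \<partial>circle_measure) =
        (\<integral>\<^sup>+\<nu>. ennreal (poisson s (cnj \<mu> * (\<mu> * \<nu>))) * g ((\<mu> * \<nu>) *s x) \<partial>circle_measure)"
    proof -
      have "cnj \<mu> * (\<mu> * \<nu>) = \<nu>" "\<nu> *s (\<mu> *s x) = (\<mu> * \<nu>) *s x" for \<nu>
        using u by (simp_all add: vector_smult_assoc mult.commute[of \<nu>] flip: mult.assoc)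
      then show ?thesis by (simp only:)
    qed
    also have "\<dots> = (\<integral>\<^sup>+\<nu>. ennreal (poisson s (cnj \<mu> * \<nu>)) * g (\<nu> *s x) \<partial>circle_measure)"
      using \<mu> by (intro nn_integral_circle_rotate) auto
    also have "\<dots> = (\<integral>\<^sup>+\<nu>. ennreal (poisson s (cnj \<nu> * \<mu>)) * g (\<nu> *s x) \<partial>circle_measure)"
    proof -
      have "poisson s (cnj \<mu> * \<nu>) = poisson s (cnj \<nu> * \<mu>)" for \<nu>
        using poisson_cnj[of s "cnj \<nu> * \<mu>"] by (simp add: mult.commute)
      then show ?thesis by (simp only:)
    qed
    finally show "ennreal (poisson r \<mu>) * (\<integral>\<^sup>+\<nu>. ennreal (poisson s \<nu>) * g (\<nu> *s (\<mu> *s x)) \<partial>circle_measure) =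
      (\<integral>\<^sup>+\<nu>. (ennreal (poisson r \<mu>) * ennreal (poisson s (cnj \<nu> * \<mu>))) * g (\<nu> *s x) \<partial>circle_measure)"
      by (simp add: mult.assoc nn_integral_cmult)
  qed
  also have "\<dots> = (\<integral>\<^sup>+\<nu>. \<integral>\<^sup>+\<mu>. (ennreal (poisson r \<mu>) * ennreal (poisson s (cnj \<nu> * \<mu>))) * g (\<nu> *s x)
        \<partial>circle_measure \<partial>circle_measure)"
    by (rule pair_sigma_finite.Fubini'[OF P]) measurable
  also have "\<dots> = pavg (r * s) g x"
    unfolding pavg_def
  proof (rule nn_integral_cong_AE, rule eventually_mono[OF AE_circle])
    fix \<nu> :: complex assume \<nu>: "cmod \<nu> = 1"
    show "(\<integral>\<^sup>+\<mu>. (ennreal (poisson r \<mu>) * ennreal (poisson s (cnj \<nu> * \<mu>))) * g (\<nu> *s x) \<partial>circle_measure) =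
        ennreal (poisson (r * s) \<nu>) * g (\<nu> *s x)"
      using poisson_semigroup[OF r s, of "cnj \<nu>"] \<nu>
      by (subst nn_integral_multc) (auto simp: poisson_cnj)
  qed
  finally show ?thesis .
qed

text \<open>Rotation by \<open>\<mu>\<close> preserves the measure, its inverse is rotation by
  \<open>cnj \<mu>\<close>, and the kernel does not distinguish the two. So the averaging operator
  is self-adjoint.\<close>

lemma pavg_symmetric:
  fixes g k :: "complex ^ 'n::finite \<Rightarrow> ennreal"
  assumes [measurable]: "g \<in> borel_measurable borel" "k \<in> borel_measurable borel"
  shows "(\<integral>\<^sup>+x. k x * pavg r g x \<partial>unif_sphere) = (\<integral>\<^sup>+x. pavg r k x * g x \<partial>unif_sphere)"
proof -
  interpret S: prob_space "unif_sphere :: (complex ^ 'n) measure" by (rule prob_space_unif_sphere)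
  interpret P: pair_sigma_finite "unif_sphere :: (complex ^ 'n) measure" circle_measure ..
  have *: "(\<integral>\<^sup>+x. k x * pavg r g x \<partial>unif_sphere) =
      (\<integral>\<^sup>+\<mu>. ennreal (poisson r \<mu>) * (\<integral>\<^sup>+x. k x * g (\<mu> *s x) \<partial>unif_sphere) \<partial>circle_measure)"
    if [measurable]: "g \<in> borel_measurable borel" "k \<in> borel_measurable borel"
    for g k :: "complex ^ 'n \<Rightarrow> ennreal"
  proof -
    have "(\<integral>\<^sup>+x. k x * pavg r g x \<partial>unif_sphere) =
       (\<integral>\<^sup>+x. \<integral>\<^sup>+\<mu>. ennreal (poisson r \<mu>) * (k x * g (\<mu> *s x)) \<partial>circle_measure \<partial>unif_sphere)"
    proof (rule nn_integral_cong)
      fix x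
      have "k x * pavg r g x = (\<integral>\<^sup>+\<mu>. k x * (ennreal (poisson r \<mu>) * g (\<mu> *s x)) \<partial>circle_measure)"
        unfolding pavg_def by (rule nn_integral_cmult[symmetric]) measurable
      then show "k x * pavg r g x = (\<integral>\<^sup>+\<mu>. ennreal (poisson r \<mu>) * (k x * g (\<mu> *s x)) \<partial>circle_measure)"
        by (simp only: mult.left_commute)
    qed
    also have "\<dots> = (\<integral>\<^sup>+\<mu>. \<integral>\<^sup>+x. ennreal (poisson r \<mu>) * (k x * g (\<mu> *s x)) \<partial>unif_sphere \<partial>circle_measure)"
      by (rule P.Fubini'[symmetric]) measurable
    also have "\<dots> = (\<integral>\<^sup>+\<mu>. ennreal (poisson r \<mu>) * (\<integral>\<^sup>+x. k x * g (\<mu> *s x) \<partial>unif_sphere) \<partial>circle_measure)"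
      by (intro nn_integral_cong nn_integral_cmult) measurable
    finally show ?thesis .
  qed
  have "(\<integral>\<^sup>+x. k x * pavg r g x \<partial>unif_sphere) =
      (\<integral>\<^sup>+\<mu>. ennreal (poisson r \<mu>) * (\<integral>\<^sup>+x. k x * g (\<mu> *s x) \<partial>unif_sphere) \<partial>circle_measure)"
    by (rule *) measurable
  also have "\<dots> = (\<integral>\<^sup>+\<mu>. ennreal (poisson r (cnj \<mu>)) * (\<integral>\<^sup>+x. g x * k (cnj \<mu> *s x) \<partial>unif_sphere) \<partial>circle_measure)"
  proof (rule nn_integral_cong_AE, rule eventually_mono[OF AE_circle])
    fix \<mu> :: complex assume \<mu>: "cmod \<mu> = 1"
    have u: "cnj \<mu> * \<mu> = 1" using \<mu> by (simp add: mult.commute flip: complex_norm_square)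
    have "(\<integral>\<^sup>+x. k x * g (\<mu> *s x) \<partial>unif_sphere) = (\<integral>\<^sup>+x. k (cnj \<mu> *s (\<mu> *s x)) * g (\<mu> *s x) \<partial>unif_sphere)"
      using u by (simp add: vector_smult_assoc)
    also have "\<dots> = (\<integral>\<^sup>+x. k (cnj \<mu> *s x) * g x \<partial>unif_sphere)"
      using \<mu> by (intro nn_integral_sphere_rotate(1)) auto
    finally show "ennreal (poisson r \<mu>) * (\<integral>\<^sup>+x. k x * g (\<mu> *s x) \<partial>unif_sphere) =
       ennreal (poisson r (cnj \<mu>)) * (\<integral>\<^sup>+x. g x * k (cnj \<mu> *s x) \<partial>unif_sphere)"
      by (simp only: poisson_cnj mult.commute[of "g _"])
  qed
  also have "\<dots> = (\<integral>\<^sup>+\<mu>. ennreal (poisson r \<mu>) * (\<integral>\<^sup>+x. g x * k (\<mu> *s x) \<partial>unif_sphere) \<partial>circle_measure)"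
    by (rule nn_integral_circle_cnj) measurable
  also have "\<dots> = (\<integral>\<^sup>+x. g x * pavg r k x \<partial>unif_sphere)"
    by (rule *[symmetric]) measurable
  finally show ?thesis by (simp only: mult.commute[of "g _"])
qed

lemma pavg_mult_le:
  assumes "0 \<le> r" "r \<le> s" "s < 1" and [measurable]: "g \<in> borel_measurable borel"
  shows "pavg (r * s) g x \<le> 8 * pavg r g x"
proof -
  have "pavg (r * s) g x \<le> (\<integral>\<^sup>+\<mu>. 8 * (ennreal (poisson r \<mu>) * g (\<mu> *s x)) \<partial>circle_measure)"
    unfolding pavg_def
  proof (rule nn_integral_mono_AE, rule eventually_mono[OF AE_circle])
    fix \<mu> :: complex assume "cmod \<mu> = 1"
    then have "ennreal (poisson (r * s) \<mu>) \<le> ennreal (8 * poisson r \<mu>)"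
      using assms by (intro ennreal_leI poisson_mult_le) auto
    also have "\<dots> = 8 * ennreal (poisson r \<mu>)" by (subst ennreal_mult') auto
    finally show "ennreal (poisson (r * s) \<mu>) * g (\<mu> *s x) \<le> 8 * (ennreal (poisson r \<mu>) * g (\<mu> *s x))"
      by (metis mult.assoc mult_right_mono zero_le)
  qed
  also have "\<dots> = 8 * pavg r g x" unfolding pavg_def by (rule nn_integral_cmult) measurable
  finally show ?thesis .
qed

text \<open>Cauchy-Schwarz with respect to the kernel, whose total mass is 1.\<close>

lemma pavg_square_le:
  assumes r: "0 \<le> r" "r < 1" and [measurable]: "g \<in> borel_measurable borel"
  shows "(pavg r g x)\<^sup>2 \<le> pavg r (\<lambda>y. (g y)\<^sup>2) x"
proof -
  let ?M = "density circle_measure (\<lambda>\<mu>. ennreal (poisson r \<mu>))"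
  have eq: "pavg r k x = (\<integral>\<^sup>+\<mu>. k (\<mu> *s x) \<partial>?M)" if [measurable]: "k \<in> borel_measurable borel" for k
    unfolding pavg_def by (subst nn_integral_density) auto
  have "(\<integral>\<^sup>+\<mu>. 1 \<partial>?M) = 1"
    using poisson_total[OF r] by (subst nn_integral_density) auto
  then show ?thesis
    using Cauchy_Schwarz_nn_integral[of "\<lambda>\<mu>. g (\<mu> *s x)" ?M "\<lambda>_. 1"] by (simp add: eq)
qed

lemma pavg_integral:
  fixes g :: "complex ^ 'n::finite \<Rightarrow> ennreal"
  assumes r: "0 \<le> r" "r < 1" and [measurable]: "g \<in> borel_measurable borel"
  shows "(\<integral>\<^sup>+x. pavg r g x \<partial>unif_sphere) = (\<integral>\<^sup>+x. g x \<partial>unif_sphere)"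
  using pavg_symmetric[of g "\<lambda>_. 1" r] poisson_total[OF r] by (simp add: pavg_def)

text \<open>Arithmetic of the improvement step in \<open>linearised_maximal\<close>:
  \<open>G\<close> and \<open>X\<close> stand for the squared norms of \<open>k\<close> and
  \<open>T k\<close>, \<open>Y\<close> for that of \<open>T (T k)\<close>, and \<open>Z\<close> for
  the pairing of \<open>T k\<close> with \<open>T (T k)\<close>. Chaining the bounds gives
  \<open>X ^ 4 \<le> 256 * G\<^sup>2 * K * X\<^sup>2\<close>.\<close>

lemma ennreal_power_sqrt_bound:
  fixes X G Z Y :: ennreal and K :: real
  assumes K: "0 \<le> K" and fin: "G < \<infinity>" "X < \<infinity>"
    and 1: "X\<^sup>2 \<le> G * (16 * Z)" and 2: "Z\<^sup>2 \<le> X * Y" and 3: "Y \<le> ennreal K * X"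
  shows "X \<le> ennreal (16 * sqrt K) * G"
proof -
  obtain g where g: "G = ennreal g" "0 \<le> g" using fin by (cases G) auto
  obtain x where x: "X = ennreal x" "0 \<le> x" using fin by (cases X) auto
  have "ennreal K * X < \<infinity>" using fin by (auto simp: ennreal_mult_less_top)
  then have "Y < \<infinity>" using 3 by (rule le_less_trans[rotated])
  then obtain y where y: "Y = ennreal y" "0 \<le> y" by (cases Y) auto
  have "Z\<^sup>2 < \<infinity>" using 2 fin \<open>Y < \<infinity>\<close> by (auto intro!: le_less_trans[OF 2] simp: ennreal_mult_less_top)
  then obtain z where z: "Z = ennreal z" "0 \<le> z" by (cases Z) (auto simp: power2_eq_square)
  have "G * (16 * Z) = ennreal (g * (16 * z))" using g z by (simp add: ennreal_mult)
  then have b1: "x\<^sup>2 \<le> g * (16 * z)"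
    using 1 g x z by (simp add: ennreal_power)
  have b2: "z\<^sup>2 \<le> x * y"
    using 2 x y z by (simp add: ennreal_power flip: ennreal_mult)
  have b3: "y \<le> K * x"
    using 3 x y K by (simp flip: ennreal_mult)
  have "(x\<^sup>2)\<^sup>2 \<le> (g * (16 * z))\<^sup>2" using b1 by (intro power_mono) auto
  also have "\<dots> = 256 * g\<^sup>2 * z\<^sup>2" by (simp add: power_mult_distrib)
  also have "\<dots> \<le> 256 * g\<^sup>2 * (x * (K * x))"
    using b2 mult_left_mono[OF b3 x(2)] by (intro mult_left_mono) auto
  finally have "x\<^sup>2 * x\<^sup>2 \<le> (256 * K * g\<^sup>2) * x\<^sup>2" by (simp add: power2_eq_square mult_ac)
  then have "x\<^sup>2 \<le> 256 * K * g\<^sup>2 \<or> x = 0"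
    using mult_right_le_imp_le[of "x\<^sup>2" "x\<^sup>2" "256 * K * g\<^sup>2"] zero_less_power2[of x] by blast
  moreover have "(16 * sqrt K * g)\<^sup>2 = 256 * K * g\<^sup>2"
    using K by (simp add: power_mult_distrib)
  ultimately have "x\<^sup>2 \<le> (16 * sqrt K * g)\<^sup>2"
    using K by (elim disjE) simp_all
  then have "x \<le> 16 * sqrt K * g"
    by (rule power2_le_imp_le) (simp add: K g)
  then have "ennreal x \<le> ennreal (16 * sqrt K * g)" by (rule ennreal_leI)
  then show ?thesis using K g x by (simp add: ennreal_mult)
qed

text \<open>The linearised maximal operator is bounded by applying Cauchy--Schwarz to its adjoint. The
  kernel comparison \<open>P\<^sub>r P\<^sub>s \<le> 8 P\<^sub>r + 8 P\<^sub>s\<close> turns the square of the adjoint back into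
  the operator itself, so any bound \<open>K\<close> improves to \<open>16 sqrt K\<close>.\<close>

lemma linearised_maximal:
  fixes \<rho> :: "complex ^ 'n::finite \<Rightarrow> real" and g :: "complex ^ 'n \<Rightarrow> ennreal"
  assumes I: "finite I" "I \<subseteq> {0..<1}" and \<rho>: "\<And>x. \<rho> x \<in> I"
    and m\<rho>: "\<And>r. r \<in> I \<Longrightarrow> {x. \<rho> x = r} \<in> sets borel"
    and g [measurable]: "g \<in> borel_measurable borel"
  shows "(\<integral>\<^sup>+x. (pavg (\<rho> x) g x)\<^sup>2 \<partial>unif_sphere) \<le> 256 * (\<integral>\<^sup>+x. (g x)\<^sup>2 \<partial>unif_sphere)"
proof -
  define T where "T k x = pavg (\<rho> x) k x" for k x
  define E where "E r = {x. \<rho> x = r}" for r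
  define X where "X k = (\<integral>\<^sup>+x. (k x)\<^sup>2 \<partial>(unif_sphere :: (complex ^ 'n) measure))" for k :: "_ \<Rightarrow> ennreal"
  have Isub: "0 \<le> r \<and> r < 1" if "r \<in> I" for r using that I by auto
  have [measurable]: "E r \<in> sets borel" if "r \<in> I" for r
    using m\<rho>[OF that] by (simp add: E_def)
  have T_eq: "T k x = (\<Sum>r\<in>I. indicator (E r) x * pavg r k x)" for k x
  proof -
    have "(\<Sum>r\<in>I. indicator (E r) x * pavg r k x) = (\<Sum>r\<in>I. if r = \<rho> x then pavg r k x else 0)"
      by (intro sum.cong) (auto simp: E_def indicator_def)
    then show ?thesis using \<rho>[of x] I by (simp add: T_def)
  qed
  have sum_E: "(\<Sum>r\<in>I. indicator (E r) x * c) = c" for x and c :: ennreal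
  proof -
    have "(\<Sum>r\<in>I. indicator (E r) x * c) = (\<Sum>r\<in>I. if r = \<rho> x then c else 0)"
      by (intro sum.cong) (auto simp: E_def indicator_def)
    then show ?thesis using \<rho>[of x] I by simp
  qed
  have mT [measurable]: "T k \<in> borel_measurable borel" if [measurable]: "k \<in> borel_measurable borel" for k
    unfolding T_eq[abs_def] using I by measurable
  \<comment> \<open>A crude bound that depends on \<open>I\<close>; it makes all quantities finite
    and shows that some constant is admissible.\<close>
  have base: "X (T k) \<le> of_nat (card I) * X k" if [measurable]: "k \<in> borel_measurable borel" for k
  proof -
    have "X (T k) \<le> (\<integral>\<^sup>+x. (\<Sum>r\<in>I. (pavg r k x)\<^sup>2) \<partial>unif_sphere)"
      unfolding X_def
    proof (rule nn_integral_mono)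
      fix x
      show "(T k x)\<^sup>2 \<le> (\<Sum>r\<in>I. (pavg r k x)\<^sup>2)"
        unfolding T_def by (rule member_le_sum[OF \<rho>]) (use I in auto)
    qed
    also have "\<dots> = (\<Sum>r\<in>I. \<integral>\<^sup>+x. (pavg r k x)\<^sup>2 \<partial>unif_sphere)"
      by (rule nn_integral_sum) measurable
    also have "\<dots> \<le> (\<Sum>r\<in>I. X k)"
    proof (rule sum_mono)
      fix r assume "r \<in> I"
      then have "(\<integral>\<^sup>+x. (pavg r k x)\<^sup>2 \<partial>unif_sphere) \<le> (\<integral>\<^sup>+x. pavg r (\<lambda>y. (k y)\<^sup>2) x \<partial>unif_sphere)"
        using Isub by (intro nn_integral_mono pavg_square_le) auto
      also have "\<dots> = X k"
        unfolding X_def using Isub \<open>r \<in> I\<close> by (intro pavg_integral) auto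
      finally show "(\<integral>\<^sup>+x. (pavg r k x)\<^sup>2 \<partial>unif_sphere) \<le> X k" .
    qed
    finally show ?thesis by simp
  qed
  have improve: "X (T k) \<le> ennreal (16 * sqrt K) * X k"
    if K: "0 \<le> K" "\<And>k. k \<in> borel_measurable borel \<Longrightarrow> X k < \<infinity> \<Longrightarrow> X (T k) \<le> ennreal K * X k"
      and [measurable]: "k \<in> borel_measurable borel" and fin: "X k < \<infinity>" for K k
  proof (rule ennreal_power_sqrt_bound[OF K(1) fin])
    define w where "w = T k"
    define v where "v r x = indicator (E r) x * w x" for r x
    \<comment> \<open>The adjoint of the linearised operator, applied to
      \<open>w = T k\<close>.\<close>
    define V where "V x = (\<Sum>r\<in>I. pavg r (v r) x)" for x
    have [measurable]: "w \<in> borel_measurable borel" by (simp add: w_def)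
    have [measurable]: "v r \<in> borel_measurable borel" if [measurable]: "r \<in> I" for r
      unfolding v_def[abs_def] by measurable
    have [measurable]: "V \<in> borel_measurable borel"
      unfolding V_def[abs_def] by measurable
    have v_sum: "(\<Sum>r\<in>I. v r x) = w x" for x
      unfolding v_def by (rule sum_E)
    have finX: "X (T k) < \<infinity>"
      using base[of k] fin by (auto intro: le_less_trans simp: ennreal_mult_less_top of_nat_less_top)
    then show "X (T k) < \<infinity>" .
    show "X (T (T k)) \<le> ennreal K * X (T k)"
      using finX by (intro K) auto
    show "(\<integral>\<^sup>+x. w x * T w x \<partial>unif_sphere)\<^sup>2 \<le> X (T k) * X (T (T k))"
      unfolding X_def w_def by (rule Cauchy_Schwarz_nn_integral) measurable
    have "X (T k) = (\<integral>\<^sup>+x. (\<Sum>r\<in>I. v r x * pavg r k x) \<partial>unif_sphere)"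
      unfolding X_def power2_eq_square
      by (subst (2) T_eq) (simp add: sum_distrib_left v_def w_def mult_ac)
    also have "\<dots> = (\<Sum>r\<in>I. \<integral>\<^sup>+x. v r x * pavg r k x \<partial>unif_sphere)"
      by (rule nn_integral_sum) measurable
    also have "\<dots> = (\<Sum>r\<in>I. \<integral>\<^sup>+x. pavg r (v r) x * k x \<partial>unif_sphere)"
      by (intro sum.cong refl pavg_symmetric) measurable
    also have "\<dots> = (\<integral>\<^sup>+x. (\<Sum>r\<in>I. pavg r (v r) x * k x) \<partial>unif_sphere)"
      by (rule nn_integral_sum[symmetric]) measurable
    also have "\<dots> = (\<integral>\<^sup>+x. k x * V x \<partial>unif_sphere)"
      by (simp add: V_def sum_distrib_left mult.commute)
    finally have XV: "(X (T k))\<^sup>2 \<le> X k * X V"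
      unfolding X_def by (simp only: Cauchy_Schwarz_nn_integral \<open>k \<in> borel_measurable borel\<close>
          \<open>V \<in> borel_measurable borel\<close> measurable_cong_sets[OF sets_unif_sphere refl])
    \<comment> \<open>Symmetry and the semigroup law turn the product into a pairing with kernel
      radius \<open>r * s\<close>, which is comparable with the smaller of the two radii.\<close>
    have pair: "(\<integral>\<^sup>+x. pavg r (v r) x * pavg s (v s) x \<partial>unif_sphere) \<le>
        8 * (\<integral>\<^sup>+x. v r x * pavg r (v s) x \<partial>unif_sphere) + 8 * (\<integral>\<^sup>+x. v s x * pavg s (v r) x \<partial>unif_sphere)"
      if rs: "r \<in> I" "s \<in> I" for r s
    proof -
      have [measurable]: "v r \<in> borel_measurable borel" "v s \<in> borel_measurable borel" using rs by auto
      have eq: "(\<integral>\<^sup>+x. pavg r (v r) x * pavg s (v s) x \<partial>unif_sphere) =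
          (\<integral>\<^sup>+x. v r x * pavg (r * s) (v s) x \<partial>unif_sphere)"
        using Isub[OF rs(1)] Isub[OF rs(2)]
        by (subst pavg_symmetric[symmetric]) (auto simp: pavg_semigroup)
      show ?thesis
      proof (cases "r \<le> s")
        case True
        have "(\<integral>\<^sup>+x. v r x * pavg (r * s) (v s) x \<partial>unif_sphere) \<le> (\<integral>\<^sup>+x. 8 * (v r x * pavg r (v s) x) \<partial>unif_sphere)"
          using Isub[OF rs(1)] Isub[OF rs(2)] True pavg_mult_le[of r s "v s"]
          by (intro nn_integral_mono) (simp add: mult.left_commute[of 8] mult_left_mono)
        also have "\<dots> = 8 * (\<integral>\<^sup>+x. v r x * pavg r (v s) x \<partial>unif_sphere)"
          by (rule nn_integral_cmult) measurable
        finally show ?thesis unfolding eq by (rule order_trans) (simp add: add_increasing2)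
      next
        case False
        have "(\<integral>\<^sup>+x. v r x * pavg (r * s) (v s) x \<partial>unif_sphere) \<le> (\<integral>\<^sup>+x. 8 * (v r x * pavg s (v s) x) \<partial>unif_sphere)"
          using Isub[OF rs(1)] Isub[OF rs(2)] False pavg_mult_le[of s r "v s"]
          by (intro nn_integral_mono) (simp add: mult.left_commute[of 8] mult_left_mono mult.commute[of r s])
        also have "\<dots> = 8 * (\<integral>\<^sup>+x. v r x * pavg s (v s) x \<partial>unif_sphere)"
          by (rule nn_integral_cmult) measurable
        also have "\<dots> = 8 * (\<integral>\<^sup>+x. v s x * pavg s (v r) x \<partial>unif_sphere)"
          by (subst pavg_symmetric) (auto simp: mult.commute)
        finally show ?thesis unfolding eq by (rule order_trans) (simp add: add_increasing)
      qed
    qed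
    have vT: "(\<Sum>r\<in>I. \<Sum>s\<in>I. \<integral>\<^sup>+x. v r x * pavg r (v s) x \<partial>unif_sphere) = (\<integral>\<^sup>+x. w x * T w x \<partial>unif_sphere)"
    proof -
      have "(\<Sum>r\<in>I. \<Sum>s\<in>I. \<integral>\<^sup>+x. v r x * pavg r (v s) x \<partial>unif_sphere) =
          (\<Sum>r\<in>I. \<integral>\<^sup>+x. (\<Sum>s\<in>I. v r x * pavg r (v s) x) \<partial>unif_sphere)"
        by (intro sum.cong refl nn_integral_sum[symmetric]) measurable
      also have "\<dots> = (\<Sum>r\<in>I. \<integral>\<^sup>+x. v r x * pavg r w x \<partial>unif_sphere)"
      proof -
        have "pavg r w x = (\<Sum>s\<in>I. pavg r (v s) x)" for r x
          using pavg_sum[of I v r x] by (simp add: v_sum)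
        then show ?thesis by (simp add: sum_distrib_left)
      qed
      also have "\<dots> = (\<integral>\<^sup>+x. (\<Sum>r\<in>I. v r x * pavg r w x) \<partial>unif_sphere)"
        by (rule nn_integral_sum[symmetric]) measurable
      also have "\<dots> = (\<integral>\<^sup>+x. w x * T w x \<partial>unif_sphere)"
        by (simp add: T_eq[of w] sum_distrib_left v_def mult_ac)
      finally show ?thesis .
    qed
    have "X V = (\<integral>\<^sup>+x. (\<Sum>r\<in>I. \<Sum>s\<in>I. pavg r (v r) x * pavg s (v s) x) \<partial>unif_sphere)"
      by (simp add: X_def V_def power2_eq_square sum_product)
    also have "\<dots> = (\<Sum>r\<in>I. \<integral>\<^sup>+x. (\<Sum>s\<in>I. pavg r (v r) x * pavg s (v s) x) \<partial>unif_sphere)"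
      by (rule nn_integral_sum) measurable
    also have "\<dots> = (\<Sum>r\<in>I. \<Sum>s\<in>I. \<integral>\<^sup>+x. pavg r (v r) x * pavg s (v s) x \<partial>unif_sphere)"
      by (intro sum.cong refl nn_integral_sum) measurable
    also have "\<dots> \<le> (\<Sum>r\<in>I. \<Sum>s\<in>I. 8 * (\<integral>\<^sup>+x. v r x * pavg r (v s) x \<partial>unif_sphere) +
        8 * (\<integral>\<^sup>+x. v s x * pavg s (v r) x \<partial>unif_sphere))"
      by (intro sum_mono pair)
    also have "\<dots> = 8 * (\<Sum>r\<in>I. \<Sum>s\<in>I. \<integral>\<^sup>+x. v r x * pavg r (v s) x \<partial>unif_sphere) +
        8 * (\<Sum>r\<in>I. \<Sum>s\<in>I. \<integral>\<^sup>+x. v s x * pavg s (v r) x \<partial>unif_sphere)"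
      by (simp add: sum.distrib sum_distrib_left)
    also have "(\<Sum>r\<in>I. \<Sum>s\<in>I. \<integral>\<^sup>+x. v s x * pavg s (v r) x \<partial>unif_sphere) =
        (\<Sum>r\<in>I. \<Sum>s\<in>I. \<integral>\<^sup>+x. v r x * pavg r (v s) x \<partial>unif_sphere)"
      by (rule sum.swap)
    finally have "X V \<le> 16 * (\<integral>\<^sup>+x. w x * T w x \<partial>unif_sphere)"
      unfolding vT by (simp flip: distrib_right)
    then show "(X (T k))\<^sup>2 \<le> X k * (16 * (\<integral>\<^sup>+x. w x * T w x \<partial>unif_sphere))"
      using XV by (meson mult_left_mono order_trans zero_le)
  qed
  \<comment> \<open>The admissible constants. Their infimum is again admissible and cannot be
    improved, so \<open>K \<le> 16 * sqrt K\<close>, which forces \<open>K \<le> 256\<close>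
    independently of \<open>I\<close>.\<close>
  define \<K> where "\<K> = {K. 0 \<le> K \<and> (\<forall>k\<in>borel_measurable borel. X k < \<infinity> \<longrightarrow> X (T k) \<le> ennreal K * X k)}"
  define K where "K = Inf \<K>"
  have "real (card I) \<in> \<K>"
    using base by (auto simp: \<K>_def ennreal_of_nat_eq_real_of_nat)
  then have ne: "\<K> \<noteq> {}" by auto
  have bdd: "bdd_below \<K>" by (rule bdd_belowI[of _ 0]) (auto simp: \<K>_def)
  have K0: "0 \<le> K" unfolding K_def using ne by (rule cInf_greatest) (auto simp: \<K>_def)
  have K: "X (T k) \<le> ennreal K * X k" if [measurable]: "k \<in> borel_measurable borel" and fin: "X k < \<infinity>" for k
  proof -
    have "X (T k) < \<infinity>"
      using base[of k] fin by (auto intro: le_less_trans simp: ennreal_mult_less_top of_nat_less_top)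
    then obtain a where a: "X (T k) = ennreal a" "0 \<le> a" by (cases "X (T k)") auto
    obtain c where c: "X k = ennreal c" "0 \<le> c" using fin by (cases "X k") auto
    have "a \<le> L * c" if "L \<in> \<K>" for L
    proof -
      have "X (T k) \<le> ennreal L * X k" "0 \<le> L"
        using that \<open>k \<in> borel_measurable borel\<close> fin unfolding \<K>_def by blast+
      then have "ennreal a \<le> ennreal L * ennreal c" "0 \<le> L" by (simp_all only: a(1) c(1))
      then show ?thesis using a c by (simp flip: ennreal_mult)
    qed
    then have "a \<le> K * c"
    proof (cases "c = 0")
      case False
      then have "c > 0" using c by simp
      have "a / c \<le> K" unfolding K_def
        using ne \<open>\<And>L. L \<in> \<K> \<Longrightarrow> a \<le> L * c\<close> \<open>c > 0\<close> by (intro cInf_greatest) (auto simp: divide_le_eq)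
      then show ?thesis using \<open>c > 0\<close> by (simp add: divide_le_eq)
    qed (use \<open>\<And>L. L \<in> \<K> \<Longrightarrow> a \<le> L * c\<close> ne in auto)
    then show ?thesis using a c K0 by (simp flip: ennreal_mult)
  qed
  have "16 * sqrt K \<in> \<K>"
    using improve[OF K0 K] K0 by (auto simp: \<K>_def)
  then have "K \<le> 16 * sqrt K" unfolding K_def using bdd by (rule cInf_lower)
  then have "sqrt K * sqrt K \<le> 16 * sqrt K" using K0 by simp
  then have "sqrt K \<le> 16 \<or> K = 0"
  proof (cases "K = 0")
    case False
    then have "0 < sqrt K" using K0 by simp
    with \<open>sqrt K * sqrt K \<le> 16 * sqrt K\<close> show ?thesis
      by (intro disjI1) (rule mult_right_le_imp_le)
  qed simp
  then have "K \<le> 256"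
  proof
    assume "sqrt K \<le> 16"
    then have "(sqrt K)\<^sup>2 \<le> 16\<^sup>2" using K0 by (intro power_mono) auto
    then show ?thesis using K0 by simp
  qed simp
  show ?thesis
  proof (cases "X g < \<infinity>")
    case True
    have "X (T g) \<le> ennreal K * X g" using True by (intro K) auto
    also have "\<dots> \<le> 256 * X g"
      using \<open>K \<le> 256\<close> by (intro mult_right_mono) (auto simp flip: ennreal_numeral intro: ennreal_leI)
    finally show ?thesis by (simp add: X_def T_def)
  next
    case False
    then have "X g = \<top>" by (simp add: less_top[symmetric])
    then show ?thesis by (simp add: X_def ennreal_mult_top)
  qed
qed

text \<open>A radius attaining the finite supremum is a function of \<open>x\<close> with values in
  \<open>I\<close>, which is the linearised situation. Taking the least such radius makes the choice
  measurable.\<close>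

lemma poisson_maximal:
  fixes g :: "complex ^ 'n::finite \<Rightarrow> ennreal"
  assumes I: "finite I" "I \<noteq> {}" "I \<subseteq> {0..<1}" and [measurable]: "g \<in> borel_measurable borel"
  shows "(\<integral>\<^sup>+x. (SUP r\<in>I. (pavg r g x)\<^sup>2) \<partial>unif_sphere) \<le> 256 * (\<integral>\<^sup>+x. (g x)\<^sup>2 \<partial>unif_sphere)"
proof -
  define J where "J x = {r\<in>I. \<forall>s\<in>I. pavg s g x \<le> pavg r g x}" for x
  define \<rho> where "\<rho> x = Min (J x)" for x
  have J: "finite (J x)" "J x \<noteq> {}" for x
  proof -
    show "finite (J x)" using I by (simp add: J_def)
    have "Max ((\<lambda>r. pavg r g x) ` I) \<in> (\<lambda>r. pavg r g x) ` I" using I by (intro Max_in) auto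
    then obtain r where "r \<in> I" "pavg r g x = Max ((\<lambda>r. pavg r g x) ` I)" by auto
    then have "r \<in> J x" using I by (auto simp: J_def)
    then show "J x \<noteq> {}" by auto
  qed
  have \<rho>: "\<rho> x \<in> J x" for x unfolding \<rho>_def using J by (rule Min_in)
  then have \<rho>I: "\<rho> x \<in> I" for x by (auto simp: J_def)
  have m: "{x. \<rho> x = r} \<in> sets borel" if "r \<in> I" for r
  proof -
    have SJ: "{x. s \<in> J x} \<in> sets borel" if "s \<in> I" for s
    proof -
      have "{x. s \<in> J x} = (\<Inter>t\<in>I. {x. pavg t g x \<le> pavg s g x})"
        using that by (auto simp: J_def)
      moreover have "{x. pavg t g x \<le> pavg s g x} \<in> sets borel" for t by measurable
      ultimately show ?thesis using I by (auto intro!: sets.finite_INT)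
    qed
    have eq: "\<rho> x = r \<longleftrightarrow> r \<in> J x \<and> (\<forall>s\<in>J x. r \<le> s)" for x
      unfolding \<rho>_def using J[of x] by (rule Min_eq_iff)
    have JI: "J x \<subseteq> I" for x by (auto simp: J_def)
    have "{x. r \<in> J x \<and> (\<forall>s\<in>J x. r \<le> s)} = {x. r \<in> J x} \<inter> - (\<Union>s\<in>{s\<in>I. s < r}. {x. s \<in> J x})"
    proof (intro set_eqI iffI)
      fix x assume "x \<in> {x. r \<in> J x \<and> (\<forall>s\<in>J x. r \<le> s)}"
      then show "x \<in> {x. r \<in> J x} \<inter> - (\<Union>s\<in>{s\<in>I. s < r}. {x. s \<in> J x})"
        by (auto dest: leD)
    next
      fix x assume "x \<in> {x. r \<in> J x} \<inter> - (\<Union>s\<in>{s\<in>I. s < r}. {x. s \<in> J x})"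
      then have "r \<in> J x" "\<And>s. s \<in> I \<Longrightarrow> s < r \<Longrightarrow> s \<notin> J x" by auto
      then have "\<forall>s\<in>J x. r \<le> s" using JI by (meson not_le subsetD)
      then show "x \<in> {x. r \<in> J x \<and> (\<forall>s\<in>J x. r \<le> s)}" using \<open>r \<in> J x\<close> by simp
    qed
    also have "\<dots> \<in> sets borel"
      using I SJ that by (intro sets.Int sets.finite_UN borel_comp) auto
    finally show ?thesis unfolding eq .
  qed
  have "(SUP r\<in>I. (pavg r g x)\<^sup>2) = (pavg (\<rho> x) g x)\<^sup>2" for x
    using \<rho>[of x] by (intro antisym SUP_least SUP_upper2[OF \<rho>I]) (auto simp: J_def intro!: power_mono)
  then show ?thesis
    using linearised_maximal[OF I(1,3) \<rho>I m, of g] by simp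
qed

section \<open>Functions holomorphic on complex lines\<close>

lemma holomorphic_Cn_line_deriv:
  assumes "holomorphic_Cn h S" "a + t *s v \<in> S"
  shows "\<exists>D. (h has_derivative D) (at (a + t *s v)) \<and> Vector_Spaces.linear (*s) (*) D \<and>
    ((\<lambda>t. h (a + t *s v)) has_field_derivative D v) (at t)"
proof -
  obtain D where D: "(h has_derivative D) (at (a + t *s v))" "Vector_Spaces.linear (*s) (*) D"
    using assms by (auto simp: holomorphic_Cn_def)
  interpret D: Vector_Spaces.linear "(*s)" "(*)" D by fact
  have "bounded_linear (\<lambda>t. t *s v)"
    by (intro linear_conv_bounded_linear[THEN iffD1] linearI)
      (auto simp: vec_eq_iff algebra_simps)
  then have "((\<lambda>t. a + t *s v) has_derivative (\<lambda>t. t *s v)) (at t)"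
    by (auto intro!: derivative_eq_intros bounded_linear_imp_has_derivative)
  from has_derivative_compose[OF this D(1)]
  have "((\<lambda>t. h (a + t *s v)) has_derivative (\<lambda>t. D v * t)) (at t)"
    by (simp add: D.scale mult.commute)
  then show ?thesis
    using D by (auto simp: has_field_derivative_def)
qed

lemma holomorphic_Cn_line:
  assumes "holomorphic_Cn h S"
  shows "(\<lambda>t. h (a + t *s v)) holomorphic_on {t. a + t *s v \<in> S}"
  unfolding holomorphic_on_def field_differentiable_def
  using holomorphic_Cn_line_deriv[OF assms] has_field_derivative_at_within by blast

lemma holomorphic_Cn_continuous_on: "holomorphic_Cn h S \<Longrightarrow> continuous_on S h"
  unfolding holomorphic_Cn_def
  by (meson continuous_at_imp_continuous_on has_derivative_continuous)

lemma holomorphic_Cn_slice: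
  assumes "holomorphic_Cn h (ball 0 1)" "norm v \<le> 1"
  shows "(\<lambda>t. h (t *s v)) holomorphic_on ball 0 1"
proof -
  have "ball 0 1 \<subseteq> {t. 0 + t *s v \<in> ball 0 1}"
  proof
    fix t :: complex assume "t \<in> ball 0 1"
    moreover have "cmod t * norm v \<le> cmod t * 1" using assms(2) by (rule mult_left_mono) simp
    ultimately show "t \<in> {t. 0 + t *s v \<in> ball 0 1}" by (simp add: norm_vector_scalar_mult)
  qed
  then show ?thesis
    using holomorphic_on_subset[OF holomorphic_Cn_line[OF assms(1), of 0 v]] by simp
qed

lemma linear_Cn_lincomb:
  assumes "Vector_Spaces.linear (*s) (*) D" "Vector_Spaces.linear (*s) (*) E"
  shows "Vector_Spaces.linear (*s) (*) (\<lambda>x :: complex ^ 'n. a * D x + b * E x)"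
proof -
  interpret D: Vector_Spaces.linear "(*s)" "(*)" D by fact
  interpret E: Vector_Spaces.linear "(*s)" "(*)" E by fact
  show ?thesis
    by unfold_locales (simp_all add: D.add E.add D.scale E.scale algebra_simps)
qed

text \<open>\<open>hardy_space\<close> without the growth condition. Because of the extension by
  zero the members are Borel measurable on the whole space.\<close>

definition hol0 :: "(complex ^ 'n::finite \<Rightarrow> complex) set" where
  "hol0 = {h. holomorphic_Cn h (ball 0 1) \<and> (\<forall>z. z \<notin> ball 0 1 \<longrightarrow> h z = 0)}"

lemma hol0_lincomb:
  assumes "h \<in> hol0" "k \<in> hol0"
  shows "(\<lambda>z. a * h z + b * k z) \<in> hol0"
proof -
  have "\<exists>D. ((\<lambda>z. a * h z + b * k z) has_derivative D) (at z) \<and> Vector_Spaces.linear (*s) (*) D"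
    if z: "z \<in> ball 0 1" for z
  proof -
    obtain D E where D: "(h has_derivative D) (at z)" "Vector_Spaces.linear (*s) (*) D"
      and E: "(k has_derivative E) (at z)" "Vector_Spaces.linear (*s) (*) E"
      using assms z unfolding hol0_def holomorphic_Cn_def by blast
    have "((\<lambda>z. a * h z + b * k z) has_derivative (\<lambda>x. a * D x + b * E x)) (at z)"
      by (intro derivative_intros D E)
    with linear_Cn_lincomb[OF D(2) E(2)] show ?thesis by blast
  qed
  then show ?thesis using assms by (auto simp: hol0_def holomorphic_Cn_def)
qed

lemma hol0_diff: "h \<in> hol0 \<Longrightarrow> k \<in> hol0 \<Longrightarrow> (\<lambda>z. h z - k z) \<in> hol0"
  using hol0_lincomb[of h k 1 "-1"] by simp

lemma hol0_mult:
  assumes h: "h \<in> hol0" and k: "holomorphic_Cn k (ball 0 1)"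
  shows "(\<lambda>z. k z * h z) \<in> hol0"
proof -
  have "\<exists>D. ((\<lambda>z. k z * h z) has_derivative D) (at z) \<and> Vector_Spaces.linear (*s) (*) D"
    if z: "z \<in> ball 0 1" for z
  proof -
    obtain D E where D: "(h has_derivative D) (at z)" "Vector_Spaces.linear (*s) (*) D"
      and E: "(k has_derivative E) (at z)" "Vector_Spaces.linear (*s) (*) E"
      using assms z unfolding hol0_def holomorphic_Cn_def by blast
    have "((\<lambda>z. k z * h z) has_derivative (\<lambda>x. k z * D x + E x * h z)) (at z)"
      by (intro derivative_intros D E)
    then have "((\<lambda>z. k z * h z) has_derivative (\<lambda>x. k z * D x + h z * E x)) (at z)"
      by (simp add: mult.commute)
    with linear_Cn_lincomb[OF D(2) E(2)] show ?thesis by blast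
  qed
  then show ?thesis using assms by (auto simp: hol0_def holomorphic_Cn_def)
qed

lemma scaleR_eq_vector_scalar_mult: "r *\<^sub>R x = of_real r *s (x :: complex ^ 'n)"
  unfolding vec_eq_iff vector_scaleR_component vector_smult_component
  by (simp only: scaleR_conv_of_real simp_thms)

text \<open>Before the extension by zero, a dilate with \<open>R < 1\<close> is holomorphic past the
  closed ball. These are the approximants through which boundary values are obtained.\<close>

definition dilate :: "real \<Rightarrow> (complex ^ 'n::finite \<Rightarrow> complex) \<Rightarrow> complex ^ 'n \<Rightarrow> complex" where
  "dilate R h = (\<lambda>z. if z \<in> ball 0 1 then h (R *\<^sub>R z) else 0)"

lemma hol0_dilate:
  assumes "h \<in> hol0" "0 \<le> R" "R \<le> 1"
  shows "dilate R h \<in> hol0"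
proof -
  have "\<exists>D. (dilate R h has_derivative D) (at z) \<and> Vector_Spaces.linear (*s) (*) D"
    if z: "z \<in> ball 0 1" for z
  proof -
    have Rz: "R *\<^sub>R z \<in> ball 0 1"
      using z assms mult_left_le_one_le[of "norm z" R] by simp
    obtain D where D: "(h has_derivative D) (at (R *\<^sub>R z))" "Vector_Spaces.linear (*s) (*) D"
      using assms Rz unfolding hol0_def holomorphic_Cn_def by blast
    have "((\<lambda>z. h (R *\<^sub>R z)) has_derivative (\<lambda>x. D (R *\<^sub>R x))) (at z)"
      by (rule has_derivative_compose[where f = "\<lambda>z. R *\<^sub>R z" and g = h and g' = D, OF _ D(1)])
         (auto intro!: derivative_eq_intros)
    then have "(dilate R h has_derivative (\<lambda>x. D (R *\<^sub>R x))) (at z)"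
      using z by (rule has_derivative_transform_within_open[OF _ open_ball]) (simp add: dilate_def)
    moreover have "Vector_Spaces.linear (*s) (*) (\<lambda>x. D (R *\<^sub>R x))"
    proof -
      interpret D: Vector_Spaces.linear "(*s)" "(*)" D by fact
      show ?thesis
        using linear_Cn_lincomb[OF D(2) D(2), of "of_real R" 0]
        by (simp add: D.scale scaleR_eq_vector_scalar_mult)
    qed
    ultimately show ?thesis by blast
  qed
  then show ?thesis by (auto simp: hol0_def holomorphic_Cn_def dilate_def)
qed

lemma hol0_continuous_on: "h \<in> hol0 \<Longrightarrow> continuous_on (ball 0 1) h"
  by (simp add: hol0_def holomorphic_Cn_continuous_on)

lemma hol0_measurable [measurable_dest]:
  assumes "h \<in> hol0"
  shows "h \<in> borel_measurable borel"
proof -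
  have "(\<lambda>z. if z \<in> ball 0 1 then h z else 0) \<in> borel_measurable borel"
    by (rule borel_measurable_continuous_on_if)
      (use hol0_continuous_on[OF assms] in \<open>auto intro!: continuous_intros\<close>)
  also have "(\<lambda>z. if z \<in> ball 0 1 then h z else 0) = h"
    using assms by (auto simp: hol0_def)
  finally show ?thesis .
qed

lemma hol0_slice:
  assumes "h \<in> hol0" "norm v \<le> 1"
  shows "(\<lambda>t. h (t *s v)) holomorphic_on ball 0 1"
    and "(\<lambda>t. h (t *s v)) \<in> borel_measurable borel"
proof -
  show "(\<lambda>t. h (t *s v)) holomorphic_on ball 0 1"
    using assms by (intro holomorphic_Cn_slice) (auto simp: hol0_def)
  have [measurable]: "h \<in> borel_measurable borel" using assms(1) by (rule hol0_measurable)
  show "(\<lambda>t. h (t *s v)) \<in> borel_measurable borel" by measurable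
qed

section \<open>Spherical square means and the radial maximal function\<close>

definition S2 :: "(complex ^ 'n::finite \<Rightarrow> complex) \<Rightarrow> real \<Rightarrow> ennreal" where
  "S2 h r = (\<integral>\<^sup>+x. ennreal ((cmod (h (r *\<^sub>R x)))\<^sup>2) \<partial>unif_sphere)"

lemma hol0_bounded_sphere:
  assumes "h \<in> hol0" "0 \<le> r" "r < 1"
  shows "\<exists>B\<ge>0. \<forall>x. norm x \<le> r \<longrightarrow> cmod (h x) \<le> B"
proof -
  have "continuous_on (cball 0 r) h"
    using assms by (intro continuous_on_subset[OF hol0_continuous_on]) auto
  then have "bounded (h ` cball 0 r)"
    by (intro compact_imp_bounded compact_continuous_image) auto
  then obtain B where "\<And>x. x \<in> cball 0 r \<Longrightarrow> cmod (h x) \<le> B"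
    unfolding bounded_iff by blast
  then show ?thesis
    by (intro exI[of _ "max B 0"]) (auto simp: max.coboundedI1)
qed

lemma S2_finite:
  assumes "h \<in> hol0" "0 \<le> r" "r < 1"
  shows "integrable surface_measure (\<lambda>x. (cmod (h (r *\<^sub>R x)))\<^sup>2)"
    and "ennreal (\<integral>x. (cmod (h (r *\<^sub>R x)))\<^sup>2 \<partial>surface_measure) = S2 h r"
proof -
  interpret prob_space "surface_measure :: (complex ^ 'a) measure"
    by (rule prob_space_surface_measure)
  have [measurable]: "h \<in> borel_measurable borel" using assms(1) by (rule hol0_measurable)
  obtain B where B: "0 \<le> B" "\<And>x. norm x \<le> r \<Longrightarrow> cmod (h x) \<le> B"
    using hol0_bounded_sphere[OF assms] by blast
  show int: "integrable surface_measure (\<lambda>x. (cmod (h (r *\<^sub>R x)))\<^sup>2)"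
    by (rule integrable_const_bound[where B = "B\<^sup>2"])
      (use B assms in \<open>auto intro!: AE_I2 power_mono\<close>)
  show "ennreal (\<integral>x. (cmod (h (r *\<^sub>R x)))\<^sup>2 \<partial>surface_measure) = S2 h r"
    using nn_integral_eq_integral[OF int] by (simp add: S2_def nn_integral_surface_measure)
qed

lemma circle_square_integrable:
  assumes f: "f holomorphic_on ball 0 1" and r: "0 \<le> r" "r < 1"
    and [measurable]: "f \<in> borel_measurable borel"
  shows "\<exists>B. \<forall>\<mu>. cmod \<mu> = 1 \<longrightarrow> cmod (f (of_real r * \<mu>)) \<le> B"
    and "integrable circle_measure (\<lambda>\<mu>. (cmod (f (of_real r * \<mu>)))\<^sup>2)"
proof -
  have "continuous_on (cball 0 r) f"
    using r by (intro holomorphic_on_imp_continuous_on holomorphic_on_subset[OF f]) auto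
  then have "bounded (f ` cball 0 r)"
    by (intro compact_imp_bounded compact_continuous_image) auto
  then obtain B where B: "\<And>x. x \<in> cball 0 r \<Longrightarrow> cmod (f x) \<le> B"
    unfolding bounded_iff by blast
  then have *: "cmod (f (of_real r * \<mu>)) \<le> B" if "cmod \<mu> = 1" for \<mu>
    using r that by (simp add: norm_mult)
  then show "\<exists>B. \<forall>\<mu>. cmod \<mu> = 1 \<longrightarrow> cmod (f (of_real r * \<mu>)) \<le> B" by blast
  show "integrable circle_measure (\<lambda>\<mu>. (cmod (f (of_real r * \<mu>)))\<^sup>2)"
    by (rule circle_integrable_bounded[where B = "B\<^sup>2"]) (use * in \<open>auto intro!: power_mono\<close>)
qed

lemma circle_square_mono_nn:
  assumes f: "f holomorphic_on ball 0 1" and rs: "0 \<le> r" "r \<le> s" "s < 1"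
    and m: "f \<in> borel_measurable borel"
  shows "(\<integral>\<^sup>+\<mu>. ennreal ((cmod (f (of_real r * \<mu>)))\<^sup>2) \<partial>circle_measure) \<le>
    (\<integral>\<^sup>+\<mu>. ennreal ((cmod (f (of_real s * \<mu>)))\<^sup>2) \<partial>circle_measure)"
  using circle_square_mono[OF f rs m] circle_square_integrable(2)[OF f _ _ m, of r]
    circle_square_integrable(2)[OF f _ _ m, of s] rs
  by (simp add: nn_integral_eq_integral ennreal_leI)

text \<open>Expanding the square, the cross term is a square mean at the geometric mean radius by
  \<open>circle_inner_radii\<close>. It is moved to the left because \<open>ennreal\<close> has no
  well-behaved subtraction.\<close>

lemma circle_square_diff_nn:
  assumes f: "f holomorphic_on ball 0 1" and rs: "0 \<le> r" "r < 1" "0 \<le> s" "s < 1"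
    and m [measurable]: "f \<in> borel_measurable borel"
  shows "(\<integral>\<^sup>+\<mu>. ennreal ((cmod (f (of_real r * \<mu>) - f (of_real s * \<mu>)))\<^sup>2) \<partial>circle_measure) +
    2 * (\<integral>\<^sup>+\<mu>. ennreal ((cmod (f (of_real (sqrt (r * s)) * \<mu>)))\<^sup>2) \<partial>circle_measure) =
    (\<integral>\<^sup>+\<mu>. ennreal ((cmod (f (of_real r * \<mu>)))\<^sup>2) \<partial>circle_measure) +
    (\<integral>\<^sup>+\<mu>. ennreal ((cmod (f (of_real s * \<mu>)))\<^sup>2) \<partial>circle_measure)"
proof -
  let ?q = "sqrt (r * s)"
  have q: "0 \<le> ?q" "?q < 1" using rs mult_strict_mono'[of r 1 s 1] by auto
  note i = circle_square_integrable(2)[OF f _ _ m]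
  obtain B C where B: "\<And>\<mu>. cmod \<mu> = 1 \<Longrightarrow> cmod (f (of_real r * \<mu>)) \<le> B"
    and C: "\<And>\<mu>. cmod \<mu> = 1 \<Longrightarrow> cmod (f (of_real s * \<mu>)) \<le> C"
    using circle_square_integrable(1)[OF f rs(1,2) m] circle_square_integrable(1)[OF f rs(3,4) m] by blast
  have cross: "integrable circle_measure (\<lambda>\<mu>. f (of_real r * \<mu>) * cnj (f (of_real s * \<mu>)))"
    by (rule circle_integrable_bounded[where B = "B * C"])
      (use B C in \<open>auto simp: norm_mult intro!: mult_mono intro: order_trans[OF norm_ge_zero B]\<close>)
  have expand: "(cmod (a - b))\<^sup>2 = (cmod a)\<^sup>2 + (cmod b)\<^sup>2 - 2 * Re (a * cnj b)" for a b
    by (simp add: cmod_power2) (simp add: power2_eq_square algebra_simps)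
  have d: "integrable circle_measure (\<lambda>\<mu>. (cmod (f (of_real r * \<mu>) - f (of_real s * \<mu>)))\<^sup>2)"
    unfolding expand using i[OF rs(1,2)] i[OF rs(3,4)] integrable_Re[OF cross]
    by (intro Bochner_Integration.integrable_diff Bochner_Integration.integrable_add
      integrable_mult_right) auto
  have lin: "(\<integral>\<mu>. a \<mu> + b \<mu> - 2 * c \<mu> \<partial>circle_measure) =
      (\<integral>\<mu>. a \<mu> \<partial>circle_measure) + (\<integral>\<mu>. b \<mu> \<partial>circle_measure) - 2 * (\<integral>\<mu>. c \<mu> \<partial>circle_measure)"
    if "integrable circle_measure a" "integrable circle_measure b" "integrable circle_measure c"
    for a b c :: "complex \<Rightarrow> real"
    using that by simp
  have "(\<integral>\<mu>. (cmod (f (of_real r * \<mu>) - f (of_real s * \<mu>)))\<^sup>2 \<partial>circle_measure) =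
     (\<integral>\<mu>. (cmod (f (of_real r * \<mu>)))\<^sup>2 \<partial>circle_measure) +
     (\<integral>\<mu>. (cmod (f (of_real s * \<mu>)))\<^sup>2 \<partial>circle_measure) -
     2 * Re (\<integral>\<mu>. f (of_real r * \<mu>) * cnj (f (of_real s * \<mu>)) \<partial>circle_measure)"
    unfolding expand lin[OF i[OF rs(1,2)] i[OF rs(3,4)] integrable_Re[OF cross]] integral_Re[OF cross] ..
  then have "(\<integral>\<mu>. (cmod (f (of_real r * \<mu>) - f (of_real s * \<mu>)))\<^sup>2 \<partial>circle_measure) +
     2 * (\<integral>\<mu>. (cmod (f (of_real ?q * \<mu>)))\<^sup>2 \<partial>circle_measure) =
     (\<integral>\<mu>. (cmod (f (of_real r * \<mu>)))\<^sup>2 \<partial>circle_measure) +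
     (\<integral>\<mu>. (cmod (f (of_real s * \<mu>)))\<^sup>2 \<partial>circle_measure)"
    by (simp add: circle_inner_radii[OF f rs m])
  then show ?thesis
    using nn_integral_eq_integral[OF d] nn_integral_eq_integral[OF i[OF rs(1,2)]]
      nn_integral_eq_integral[OF i[OF rs(3,4)]] nn_integral_eq_integral[OF i[OF q]]
    by (simp flip: ennreal_plus ennreal_mult' ennreal_numeral)
qed

lemma S2_slices:
  assumes "h \<in> borel_measurable borel"
  shows "S2 h r = (\<integral>\<^sup>+x. \<integral>\<^sup>+\<mu>. ennreal ((cmod (h ((of_real r * \<mu>) *s x)))\<^sup>2) \<partial>circle_measure \<partial>unif_sphere)"
  using assms unfolding S2_def
  by (subst nn_integral_slices(1)[symmetric])
     (auto simp: scaleR_eq_vector_scalar_mult vector_smult_assoc)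

lemma S2_mono:
  assumes h: "h \<in> hol0" and rs: "0 \<le> r" "r \<le> s" "s < 1"
  shows "S2 h r \<le> S2 h s"
  unfolding S2_slices[OF hol0_measurable[OF h]]
proof (rule nn_integral_mono_AE, rule eventually_mono[OF AE_unif_sphere])
  fix x :: "complex ^ 'a" assume "norm x = 1"
  then show "(\<integral>\<^sup>+\<mu>. ennreal ((cmod (h ((of_real r * \<mu>) *s x)))\<^sup>2) \<partial>circle_measure) \<le>
      (\<integral>\<^sup>+\<mu>. ennreal ((cmod (h ((of_real s * \<mu>) *s x)))\<^sup>2) \<partial>circle_measure)"
    using circle_square_mono_nn[OF hol0_slice(1)[OF h, of x] rs hol0_slice(2)[OF h, of x]] by simp
qed

lemma S2_dilate_diff:
  assumes h: "h \<in> hol0" and r: "0 \<le> r" "r < 1" and R: "0 \<le> R" "R \<le> 1"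
  shows "S2 (\<lambda>z. h z - dilate R h z) r + 2 * S2 h (r * sqrt R) = S2 h r + S2 h (R * r)"
proof -
  have [measurable]: "h \<in> borel_measurable borel" using h by (rule hol0_measurable)
  have Rr: "0 \<le> R * r" "R * r < 1"
    using r R mult_left_le_one_le[of r R] by auto
  have [measurable]: "(\<lambda>z. h z - dilate R h z) \<in> borel_measurable borel"
    using hol0_diff[OF h hol0_dilate[OF h R]] by (rule hol0_measurable)
  have q: "sqrt (r * (R * r)) = r * sqrt R" using r by (simp add: real_sqrt_mult)
  have "S2 (\<lambda>z. h z - dilate R h z) r + 2 * S2 h (r * sqrt R) =
    (\<integral>\<^sup>+x. (\<integral>\<^sup>+\<mu>. ennreal ((cmod (h ((of_real r * \<mu>) *s x) - h ((of_real (R * r) * \<mu>) *s x)))\<^sup>2) \<partial>circle_measure) +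
      2 * (\<integral>\<^sup>+\<mu>. ennreal ((cmod (h ((of_real (r * sqrt R) * \<mu>) *s x)))\<^sup>2) \<partial>circle_measure) \<partial>unif_sphere)"
  proof -
    have "S2 (\<lambda>z. h z - dilate R h z) r =
        (\<integral>\<^sup>+x. \<integral>\<^sup>+\<mu>. ennreal ((cmod (h ((of_real r * \<mu>) *s x) - h ((of_real (R * r) * \<mu>) *s x)))\<^sup>2) \<partial>circle_measure \<partial>unif_sphere)"
    proof (subst S2_slices, measurable, rule nn_integral_cong_AE, rule eventually_mono[OF AE_unif_sphere],
        rule nn_integral_cong_AE, rule eventually_mono[OF AE_circle])
      fix x :: "complex ^ 'a" and \<mu> :: complex assume "norm x = 1" "cmod \<mu> = 1"
      then have "dilate R h ((of_real r * \<mu>) *s x) = h ((of_real (R * r) * \<mu>) *s x)"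
        using r by (simp add: dilate_def norm_vector_scalar_mult norm_mult scaleR_eq_vector_scalar_mult
            vector_smult_assoc mult.assoc)
      then show "ennreal ((cmod (h ((of_real r * \<mu>) *s x) - dilate R h ((of_real r * \<mu>) *s x)))\<^sup>2) =
        ennreal ((cmod (h ((of_real r * \<mu>) *s x) - h ((of_real (R * r) * \<mu>) *s x)))\<^sup>2)" by simp
    qed
    then show ?thesis
      by (subst nn_integral_add) (auto simp: nn_integral_cmult S2_slices)
  qed
  also have "\<dots> = (\<integral>\<^sup>+x. (\<integral>\<^sup>+\<mu>. ennreal ((cmod (h ((of_real r * \<mu>) *s x)))\<^sup>2) \<partial>circle_measure) +
      (\<integral>\<^sup>+\<mu>. ennreal ((cmod (h ((of_real (R * r) * \<mu>) *s x)))\<^sup>2) \<partial>circle_measure) \<partial>unif_sphere)"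
  proof (rule nn_integral_cong_AE, rule eventually_mono[OF AE_unif_sphere])
    fix x :: "complex ^ 'a" assume "norm x = 1"
    then show "(\<integral>\<^sup>+\<mu>. ennreal ((cmod (h ((of_real r * \<mu>) *s x) - h ((of_real (R * r) * \<mu>) *s x)))\<^sup>2) \<partial>circle_measure) +
      2 * (\<integral>\<^sup>+\<mu>. ennreal ((cmod (h ((of_real (r * sqrt R) * \<mu>) *s x)))\<^sup>2) \<partial>circle_measure) =
      (\<integral>\<^sup>+\<mu>. ennreal ((cmod (h ((of_real r * \<mu>) *s x)))\<^sup>2) \<partial>circle_measure) +
      (\<integral>\<^sup>+\<mu>. ennreal ((cmod (h ((of_real (R * r) * \<mu>) *s x)))\<^sup>2) \<partial>circle_measure)"
      using circle_square_diff_nn[OF hol0_slice(1)[OF h, of x] r Rr hol0_slice(2)[OF h, of x]]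
      unfolding q by simp
  qed
  also have "\<dots> = S2 h r + S2 h (R * r)"
    by (subst nn_integral_add) (auto simp: S2_slices)
  finally show ?thesis .
qed

definition N2 :: "(complex ^ 'n::finite \<Rightarrow> complex) \<Rightarrow> ennreal" where
  "N2 h = (SUP r\<in>{0<..<1}. S2 h r)"

lemma S2_le_N2:
  assumes "h \<in> hol0" "0 \<le> r" "r < 1"
  shows "S2 h r \<le> N2 h"
proof -
  have "S2 h r \<le> S2 h ((r + 1) / 2)" using assms by (intro S2_mono) auto
  also have "\<dots> \<le> N2 h" unfolding N2_def using assms by (intro SUP_upper) auto
  finally show ?thesis .
qed

text \<open>In \<open>S2_dilate_diff\<close> one of the two means at radius
  \<open>s * sqrt R\<close> absorbs the mean at \<open>R * s\<close>, and the other is at least the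
  mean at \<open>R\<close> once \<open>s \<ge> sqrt R\<close>. So the dilation error is at most the
  gap between \<open>N2 h\<close> and the mean at \<open>R\<close>, which can be made arbitrarily
  small.\<close>

lemma N2_dilate_diff:
  assumes h: "h \<in> hol0" and fin: "N2 h < \<infinity>" and R: "0 < R" "R < 1"
  shows "N2 (\<lambda>z. h z - dilate R h z) + S2 h R \<le> N2 h"
proof -
  let ?k = "\<lambda>z. h z - dilate R h z"
  have k: "?k \<in> hol0" using R by (intro hol0_diff h hol0_dilate) auto
  have sR: "sqrt R < 1" "0 < sqrt R" using R by auto
  have "S2 ?k r + S2 h R \<le> N2 h" if r: "r \<in> {0<..<1}" for r
  proof -
    define s where "s = max r (sqrt R)"
    have s: "r \<le> s" "sqrt R \<le> s" "s < 1" "0 < s" using r R sR by (auto simp: s_def)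
    have "sqrt R * sqrt R \<le> s * sqrt R" using s sR by (intro mult_right_mono) auto
    then have q1: "R \<le> s * sqrt R" using R by simp
    have q2: "R * s \<le> s * sqrt R" "s * sqrt R < 1"
    proof -
      have "sqrt R * sqrt R \<le> 1 * sqrt R" using sR by (intro mult_right_mono) auto
      then show "R * s \<le> s * sqrt R" using s R by (simp add: mult.commute)
      have "s * sqrt R < 1 * 1" using s sR by (intro mult_strict_mono) auto
      then show "s * sqrt R < 1" by simp
    qed
    have "S2 ?k r + S2 h R \<le> S2 ?k s + S2 h (s * sqrt R)"
      using r s R q1 q2 by (intro add_mono S2_mono k h) auto
    also have "\<dots> \<le> N2 h"
    proof -
      have "(S2 ?k s + S2 h (s * sqrt R)) + S2 h (s * sqrt R) = S2 h s + S2 h (R * s)"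
        using S2_dilate_diff[OF h, of s R] s R by (simp add: mult_2 add.assoc)
      also have "\<dots> \<le> N2 h + S2 h (s * sqrt R)"
        using s R q2 h by (intro add_mono S2_le_N2 S2_mono) auto
      finally have le: "(S2 ?k s + S2 h (s * sqrt R)) + S2 h (s * sqrt R) \<le> N2 h + S2 h (s * sqrt R)" .
      have "S2 h (s * sqrt R) < \<infinity>"
        using S2_le_N2[OF h, of "s * sqrt R"] fin s q2 R by (auto intro: le_less_trans)
      then show ?thesis using le by (auto simp: ennreal_add_left_cancel_le add.commute)
    qed
    finally show ?thesis .
  qed
  then have "(SUP r\<in>{0<..<1}. S2 ?k r + S2 h R) \<le> N2 h" by (rule SUP_least)
  then show ?thesis unfolding N2_def[of ?k] by (subst (asm) ennreal_SUP_add_left) auto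
qed

text \<open>Rational radii keep the supremum countable and hence measurable; by continuity along
  radii it still dominates every radius, see \<open>radial_max_upper\<close>.\<close>

definition radial_max :: "(complex ^ 'n::finite \<Rightarrow> complex) \<Rightarrow> complex ^ 'n \<Rightarrow> ennreal" where
  "radial_max h x = (SUP r\<in>\<rat> \<inter> {0..<1}. ennreal ((cmod (h (r *\<^sub>R x)))\<^sup>2))"

text \<open>Values at smaller radii are dominated by Poisson averages over a circle of radius
  \<open>R < 1\<close>. The bound of \<open>poisson_maximal\<close> does not depend on the finite
  set of radii, so monotone convergence extends it to all rational ones.\<close>

lemma radial_maximal:
  assumes h: "h \<in> hol0"
  shows "(\<integral>\<^sup>+x. radial_max h x \<partial>unif_sphere) \<le> 256 * N2 h"
proof -
  have [measurable]: "h \<in> borel_measurable borel" using h by (rule hol0_measurable)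
  define e where "e = from_nat_into (\<rat> \<inter> {0..<1::real})"
  have cnt: "countable (\<rat> \<inter> {0..<1::real})" by (intro countable_Int1 countable_rat)
  have ne: "\<rat> \<inter> {0..<1::real} \<noteq> {}" using Rats_0 by force
  have range_e: "range e = \<rat> \<inter> {0..<1}"
    unfolding e_def using cnt ne by (simp add: range_from_nat_into)
  then have e: "0 \<le> e i" "e i < 1" for i by (metis IntD2 atLeastLessThan_iff rangeI)+
  define F where "F n x = (SUP i\<in>{..n}. ennreal ((cmod (h (e i *\<^sub>R x)))\<^sup>2))" for n :: nat and x
  have F_inc: "incseq F"
    unfolding F_def by (auto simp: incseq_def le_fun_def intro!: SUP_subset_mono)
  have rm: "radial_max h x = (SUP n. F n x)" for x
  proof -
    have "radial_max h x = (SUP i. ennreal ((cmod (h (e i *\<^sub>R x)))\<^sup>2))"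
      unfolding radial_max_def range_e[symmetric] image_image ..
    also have "\<dots> = (SUP n. F n x)"
      unfolding F_def by (intro antisym SUP_least) (auto intro: SUP_upper2 SUP_upper2[of n UNIV for n])
    finally show ?thesis .
  qed
  have F_bound: "(\<integral>\<^sup>+x. F n x \<partial>unif_sphere) \<le> 256 * N2 h" for n
  proof -
    define m where "m = Max (e ` {..n})"
    \<comment> \<open>Halfway between the largest radius involved and 1: the quotients
      \<open>e i / R\<close> stay below 1, and \<open>h\<close> is holomorphic past the circles of
      radius \<open>R\<close>.\<close>
    define R where "R = (m + 1) / 2"
    have m: "e i \<le> m" if "i \<le> n" for i using that unfolding m_def by (intro Max_ge) auto
    have "m \<in> e ` {..n}" unfolding m_def by (intro Max_in) auto
    then have "0 \<le> m" "m < 1" using e by auto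
    then have R: "m < R" "R < 1" "0 < R" by (auto simp: R_def)
    define g where "g y = ennreal (cmod (h (R *\<^sub>R y)))" for y
    have [measurable]: "g \<in> borel_measurable borel" unfolding g_def[abs_def] by measurable
    define I where "I = (\<lambda>i. e i / R) ` {..n}"
    have I: "finite I" "I \<noteq> {}" "I \<subseteq> {0..<1}"
      using e R m le_less_trans[OF m R(1)] by (auto simp: I_def divide_simps)
    have "(\<integral>\<^sup>+x. F n x \<partial>unif_sphere) \<le> (\<integral>\<^sup>+x. (SUP r\<in>I. (pavg r g x)\<^sup>2) \<partial>unif_sphere)"
    proof (rule nn_integral_mono_AE, rule eventually_mono[OF AE_unif_sphere])
      fix x :: "complex ^ 'a" assume x: "norm x = 1"
      show "F n x \<le> (SUP r\<in>I. (pavg r g x)\<^sup>2)"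
        unfolding F_def
      proof (rule SUP_least)
        fix i assume i: "i \<in> {..n}"
        define f where "f t = h (t *s (R *\<^sub>R x))" for t
        have hol: "f holomorphic_on ball 0 (1 / R)"
        proof -
          have "{t. 0 + t *s (R *\<^sub>R x) \<in> ball 0 1} = ball 0 (1 / R)"
            using R x by (auto simp: norm_vector_scalar_mult divide_simps mult.commute)
          then show ?thesis
            unfolding f_def using holomorphic_Cn_line[of h "ball 0 1" 0 "R *\<^sub>R x"] h
            by (simp add: hol0_def)
        qed
        have [measurable]: "f \<in> borel_measurable borel" unfolding f_def[abs_def] by measurable
        have eR: "0 \<le> e i / R" "e i / R < 1" "1 < 1 / R"
          using e[of i] m[of i] i R by (auto simp: divide_simps)
        have "ennreal (cmod (f (of_real (e i / R) * 1))) \<le>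
          (\<integral>\<^sup>+\<mu>. ennreal (poisson (e i / R) \<mu>) * ennreal (cmod (f (1 * \<mu>))) \<partial>circle_measure)"
          by (rule poisson_dominates[OF hol eR(3,1,2)]) auto
        also have "\<dots> = pavg (e i / R) g x"
          by (simp add: pavg_def g_def f_def scaleR_eq_vector_scalar_mult vector_smult_assoc mult.commute)
        also have "f (of_real (e i / R) * 1) = h (e i *\<^sub>R x)"
          using R by (simp add: f_def scaleR_eq_vector_scalar_mult vector_smult_assoc)
        finally have "(ennreal (cmod (h (e i *\<^sub>R x))))\<^sup>2 \<le> (pavg (e i / R) g x)\<^sup>2"
          by (rule power_mono) simp
        then have "ennreal ((cmod (h (e i *\<^sub>R x)))\<^sup>2) \<le> (pavg (e i / R) g x)\<^sup>2"
          by (simp add: ennreal_power)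
        also have "\<dots> \<le> (SUP r\<in>I. (pavg r g x)\<^sup>2)"
          using i by (intro SUP_upper) (auto simp: I_def)
        finally show "ennreal ((cmod (h (e i *\<^sub>R x)))\<^sup>2) \<le> (SUP r\<in>I. (pavg r g x)\<^sup>2)" .
      qed
    qed
    also have "\<dots> \<le> 256 * (\<integral>\<^sup>+x. (g x)\<^sup>2 \<partial>unif_sphere)"
      by (rule poisson_maximal[OF I]) measurable
    also have "(\<integral>\<^sup>+x. (g x)\<^sup>2 \<partial>unif_sphere) = S2 h R"
      by (simp add: S2_def g_def ennreal_power)
    also have "256 * S2 h R \<le> 256 * N2 h"
      using R h by (intro mult_left_mono S2_le_N2) auto
    finally show ?thesis .
  qed
  have "(\<integral>\<^sup>+x. radial_max h x \<partial>unif_sphere) = (SUP n. \<integral>\<^sup>+x. F n x \<partial>unif_sphere)"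
    unfolding rm using F_inc
  proof (rule nn_integral_monotone_convergence_SUP)
    show "F n \<in> borel_measurable unif_sphere" for n
      unfolding F_def[abs_def] by (intro borel_measurable_SUP) (auto simp: countable_finite)
  qed
  also have "\<dots> \<le> 256 * N2 h" by (rule SUP_least) (rule F_bound)
  finally show ?thesis .
qed

lemma radial_max_measurable:
  assumes h: "h \<in> hol0"
  shows "radial_max h \<in> borel_measurable borel"
proof -
  have [measurable]: "h \<in> borel_measurable borel" using h by (rule hol0_measurable)
  show ?thesis
    unfolding radial_max_def[abs_def]
    by (intro borel_measurable_SUP countable_Int1 countable_rat) measurable
qed

lemma radial_max_upper:
  assumes h: "h \<in> hol0" and x: "norm x \<le> 1" and r: "0 \<le> r" "r < 1"
  shows "ennreal ((cmod (h (r *\<^sub>R x)))\<^sup>2) \<le> radial_max h x"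
proof (rule ccontr)
  assume "\<not> ?thesis"
  then have less: "radial_max h x < ennreal ((cmod (h (r *\<^sub>R x)))\<^sup>2)" by simp
  then obtain c where c: "radial_max h x = ennreal c" "0 \<le> c"
    by (cases "radial_max h x") auto
  have le: "(cmod (h (q *\<^sub>R x)))\<^sup>2 \<le> c" if "q \<in> \<rat>" "0 \<le> q" "q < 1" for q
  proof -
    have "ennreal ((cmod (h (q *\<^sub>R x)))\<^sup>2) \<le> radial_max h x"
      unfolding radial_max_def using that by (intro SUP_upper) auto
    then show ?thesis using c by simp
  qed
  have lt: "c < (cmod (h (r *\<^sub>R x)))\<^sup>2" using less c by (simp add: ennreal_less_iff)
  have cont: "continuous_on {0..<1} (\<lambda>q. (cmod (h (q *\<^sub>R x)))\<^sup>2)"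
  proof (intro continuous_intros continuous_on_compose2[OF hol0_continuous_on[OF h]])
    show "(\<lambda>q. q *\<^sub>R x) ` {0..<1} \<subseteq> ball 0 1"
    proof clarsimp
      fix q :: real assume "0 \<le> q" "q < 1"
      then show "q * norm x < 1" using x mult_left_le[of "norm x" q] by linarith
    qed
  qed
  have "((\<lambda>q. (cmod (h (q *\<^sub>R x)))\<^sup>2) \<longlongrightarrow> (cmod (h (r *\<^sub>R x)))\<^sup>2) (at r within {0..<1})"
    using cont r by (auto simp: continuous_on_def)
  then have "((\<lambda>q. (cmod (h (q *\<^sub>R x)))\<^sup>2) \<longlongrightarrow> (cmod (h (r *\<^sub>R x)))\<^sup>2) (at r within {r..(r + 1) / 2})"
    by (rule tendsto_within_subset) (use r in auto)
  then have "((\<lambda>q. (cmod (h (q *\<^sub>R x)))\<^sup>2) \<longlongrightarrow> (cmod (h (r *\<^sub>R x)))\<^sup>2) (at_right r)"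
    using r by (simp add: at_within_Icc_at_right)
  then have "\<forall>\<^sub>F q in at_right r. c < (cmod (h (q *\<^sub>R x)))\<^sup>2"
    using lt by (rule order_tendstoD)
  then obtain b where b: "b > r" "\<And>q. r < q \<Longrightarrow> q < b \<Longrightarrow> c < (cmod (h (q *\<^sub>R x)))\<^sup>2"
    unfolding eventually_at_right_field by blast
  obtain q where "q \<in> \<rat>" "r < q" "q < min b 1"
    using Rats_dense_in_real[of r "min b 1"] b r by auto
  then show False using b(2)[of q] le[of q] r by auto
qed

section \<open>Radial limits\<close>

lemma hardy_space_iff: "h \<in> hardy_space \<longleftrightarrow> h \<in> hol0 \<and> N2 h < \<infinity>"
proof -
  have "bdd_above ((\<lambda>r. \<integral>\<zeta>. (cmod (h (r *\<^sub>R \<zeta>)))\<^sup>2 \<partial>surface_measure) ` {0<..<1}) \<longleftrightarrow> N2 h < \<infinity>"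
    if h: "h \<in> hol0"
  proof
    assume "bdd_above ((\<lambda>r. \<integral>\<zeta>. (cmod (h (r *\<^sub>R \<zeta>)))\<^sup>2 \<partial>surface_measure) ` {0<..<1})"
    then obtain B where B: "\<And>r. r \<in> {0<..<1} \<Longrightarrow> (\<integral>\<zeta>. (cmod (h (r *\<^sub>R \<zeta>)))\<^sup>2 \<partial>surface_measure) \<le> B"
      unfolding bdd_above_def by blast
    have "S2 h r \<le> ennreal B" if "r \<in> {0<..<1}" for r
      using S2_finite(2)[OF h, of r] B[OF that] that by (auto simp: ennreal_leI simp flip: S2_finite(2)[OF h])
    then have "N2 h \<le> ennreal B" unfolding N2_def by (rule SUP_least)
    then show "N2 h < \<infinity>" by (rule le_less_trans) simp
  next
    assume "N2 h < \<infinity>"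
    then obtain c where c: "N2 h = ennreal c" "0 \<le> c" by (cases "N2 h") auto
    have "(\<integral>\<zeta>. (cmod (h (r *\<^sub>R \<zeta>)))\<^sup>2 \<partial>surface_measure) \<le> c" if r: "r \<in> {0<..<1}" for r
    proof -
      have "ennreal (\<integral>\<zeta>. (cmod (h (r *\<^sub>R \<zeta>)))\<^sup>2 \<partial>surface_measure) \<le> ennreal c"
        using S2_finite(2)[OF h, of r] S2_le_N2[OF h, of r] r c by simp
      then show ?thesis using c by simp
    qed
    then show "bdd_above ((\<lambda>r. \<integral>\<zeta>. (cmod (h (r *\<^sub>R \<zeta>)))\<^sup>2 \<partial>surface_measure) ` {0<..<1})"
      unfolding bdd_above_def by blast
  qed
  then show ?thesis by (auto simp: hardy_space_def hol0_def)
qed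

lemma hardy_norm_eq:
  assumes "h \<in> hardy_space"
  shows "0 \<le> hardy_norm h" and "ennreal ((hardy_norm h)\<^sup>2) = N2 h"
proof -
  let ?I = "\<lambda>r. \<integral>\<zeta>. (cmod (h (r *\<^sub>R \<zeta>)))\<^sup>2 \<partial>surface_measure"
  have h: "h \<in> hol0" "N2 h < \<infinity>" using assms by (auto simp: hardy_space_iff)
  have bdd: "bdd_above (?I ` {0<..<1})" using assms by (simp add: hardy_space_def)
  have eq: "(SUP r\<in>{0<..<1}. ennreal (?I r)) = N2 h"
    unfolding N2_def using S2_finite(2)[OF h(1)] by (intro SUP_cong) auto
  have "0 \<le> ?I (1 / 2)" by simp
  also have "\<dots> \<le> (SUP r\<in>{0<..<1}. ?I r)" using bdd by (intro cSUP_upper) auto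
  finally have pos: "0 \<le> (SUP r\<in>{0<..<1}. ?I r)" .
  then show "0 \<le> hardy_norm h" by (simp add: hardy_norm_def)
  have "ennreal (SUP r\<in>{0<..<1}. ?I r) = (SUP r\<in>{0<..<1}. ennreal (?I r))"
    using h(2) eq by (intro ennreal_SUP) (auto simp: less_top[symmetric])
  then show "ennreal ((hardy_norm h)\<^sup>2) = N2 h"
    using pos eq by (simp add: hardy_norm_def)
qed

text \<open>A convergence criterion free of the limit value: it can be tested on countably many
  radii, which makes the set of convergence measurable, and it survives approximation by
  dilates.\<close>

lemma at_left_cauchy:
  fixes g :: "real \<Rightarrow> complex"
  shows "(\<exists>l. (g \<longlongrightarrow> l) (at_left 1)) \<longleftrightarrow>
    (\<forall>e>0. \<exists>d<1. \<forall>r\<in>{d<..<1}. \<forall>s\<in>{d<..<1}. cmod (g r - g s) \<le> e)"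
proof (intro iffI allI impI)
  fix e :: real assume "e > 0" and "\<exists>l. (g \<longlongrightarrow> l) (at_left 1)"
  then obtain l where "(g \<longlongrightarrow> l) (at_left 1)" by blast
  then have "\<forall>\<^sub>F r in at_left 1. dist (g r) l < e / 2"
    using \<open>e > 0\<close> by (intro tendstoD) auto
  then obtain d where d: "d < 1" "\<And>r. d < r \<Longrightarrow> r < 1 \<Longrightarrow> dist (g r) l < e / 2"
    unfolding eventually_at_left_field by blast
  have "cmod (g r - g s) \<le> e" if "r \<in> {d<..<1}" "s \<in> {d<..<1}" for r s
    using d(2)[of r] d(2)[of s] that dist_triangle_half_l[of "g r" l e "g s"]
    by (auto simp: dist_norm norm_minus_commute)
  then show "\<exists>d<1. \<forall>r\<in>{d<..<1}. \<forall>s\<in>{d<..<1}. cmod (g r - g s) \<le> e" using d(1) by blast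
next
  assume C: "\<forall>e>0. \<exists>d<1. \<forall>r\<in>{d<..<1}. \<forall>s\<in>{d<..<1}. cmod (g r - g s) \<le> e"
  define a where "a n = 1 - inverse (real (Suc n))" for n
  have a1: "a n < 1" for n by (simp add: a_def)
  have "(\<lambda>n. 1 - inverse (real (Suc n))) \<longlonglongrightarrow> 1 - 0"
    by (intro tendsto_intros LIMSEQ_inverse_real_of_nat)
  then have a: "a \<longlonglongrightarrow> 1" by (simp add: a_def[abs_def])
  have "Cauchy (\<lambda>n. g (a n))"
  proof (rule metric_CauchyI)
    fix e :: real assume "e > 0"
    then obtain d where d: "d < 1" "\<And>r s. r \<in> {d<..<1} \<Longrightarrow> s \<in> {d<..<1} \<Longrightarrow> cmod (g r - g s) \<le> e / 2"
      using C[rule_format, of "e / 2"] by auto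
    obtain N where "\<And>n. n \<ge> N \<Longrightarrow> d < a n"
      using order_tendstoD(1)[OF a d(1)] by (auto simp: eventually_sequentially)
    then have "dist (g (a m)) (g (a n)) < e" if "m \<ge> N" "n \<ge> N" for m n
      using d(2)[of "a m" "a n"] that a1 \<open>e > 0\<close> by (force simp: dist_norm)
    then show "\<exists>M. \<forall>m\<ge>M. \<forall>n\<ge>M. dist (g (a m)) (g (a n)) < e" by blast
  qed
  then obtain l where l: "(\<lambda>n. g (a n)) \<longlonglongrightarrow> l" using Cauchy_convergent convergent_def by blast
  have "(g \<longlongrightarrow> l) (at_left 1)"
  proof (rule tendstoI)
    fix e :: real assume "e > 0"
    then obtain d where d: "d < 1" "\<And>r s. r \<in> {d<..<1} \<Longrightarrow> s \<in> {d<..<1} \<Longrightarrow> cmod (g r - g s) \<le> e / 2"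
      using C[rule_format, of "e / 2"] by auto
    have "dist (g r) l \<le> e / 2" if r: "d < r" "r < 1" for r
    proof (rule tendsto_upperbound)
      show "(\<lambda>n. dist (g r) (g (a n))) \<longlonglongrightarrow> dist (g r) l"
        by (intro tendsto_intros l)
      show "\<forall>\<^sub>F n in sequentially. dist (g r) (g (a n)) \<le> e / 2"
        using order_tendstoD(1)[OF a d(1)]
        by eventually_elim (use d(2)[of r] r a1 in \<open>auto simp: dist_norm\<close>)
    qed simp
    then have "\<forall>r>d. r < 1 \<longrightarrow> dist (g r) l < e" using \<open>e > 0\<close> by fastforce
    then show "\<forall>\<^sub>F r in at_left 1. dist (g r) l < e"
      unfolding eventually_at_left_field using d(1) by blast
  qed
  then show "\<exists>l. (g \<longlongrightarrow> l) (at_left 1)" by blast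
qed

lemma hol0_radius_continuous:
  assumes "h \<in> hol0" "norm x \<le> 1"
  shows "continuous_on {-1<..<1} (\<lambda>r. h (r *\<^sub>R x))"
proof (rule continuous_on_compose2[OF hol0_continuous_on[OF assms(1)]])
  show "(\<lambda>r. r *\<^sub>R x) ` {-1<..<1} \<subseteq> ball 0 1"
  proof clarsimp
    fix q :: real assume q: "-1 < q" "q < 1"
    have "\<bar>q\<bar> * norm x \<le> \<bar>q\<bar> * 1" using assms(2) by (rule mult_left_mono) simp
    then show "\<bar>q\<bar> * norm x < 1" using q by linarith
  qed
qed (intro continuous_intros)

text \<open>Dilates converge along every radius. The maximal function of \<open>h\<close> minus a
  dilate has arbitrarily small integral, so almost everywhere its infimum over a sequence of dilates
  is 0, and the Cauchy criterion passes to \<open>h\<close> by splitting the error into three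
  parts.\<close>

lemma AE_radial_convergent:
  assumes h: "h \<in> hardy_space"
  shows "AE x in unif_sphere. \<exists>l. ((\<lambda>r. h (r *\<^sub>R x)) \<longlongrightarrow> l) (at_left 1)"
proof -
  have h0: "h \<in> hol0" and fin: "N2 h < \<infinity>" using h by (auto simp: hardy_space_iff)
  have ex: "\<exists>R. 0 < R \<and> R < 1 \<and> N2 (\<lambda>z. h z - dilate R h z) \<le> ennreal (inverse (real (Suc i)))" for i
  proof -
    let ?e = "ennreal (inverse (real (Suc i)))"
    have "\<exists>R\<in>{0<..<1}. N2 h < S2 h R + ?e"
    proof (rule ccontr)
      assume "\<not> ?thesis"
      then have "(SUP R\<in>{0<..<1}. S2 h R + ?e) \<le> N2 h" by (intro SUP_least) (auto simp: not_less)
      then have "N2 h + ?e \<le> N2 h" unfolding N2_def by (subst (asm) ennreal_SUP_add_left) auto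
      then have "N2 h + ?e \<le> N2 h + 0" by simp
      then show False using fin by (simp only: ennreal_add_left_cancel_le) (auto simp: less_top[symmetric])
    qed
    then obtain R where R: "0 < R" "R < 1" "N2 h < S2 h R + ?e" by auto
    have "S2 h R + N2 (\<lambda>z. h z - dilate R h z) \<le> S2 h R + ?e"
      using order_trans[OF N2_dilate_diff[OF h0 fin R(1,2)] less_imp_le[OF R(3)]]
      by (simp only: add.commute)
    moreover have "S2 h R < \<infinity>" using S2_le_N2[OF h0, of R] R fin by (auto intro: le_less_trans)
    ultimately have "N2 (\<lambda>z. h z - dilate R h z) \<le> ?e"
      by (simp only: ennreal_add_left_cancel_le) auto
    then show ?thesis using R by blast
  qed
  then obtain R where R: "\<And>i. 0 < R i" "\<And>i. R i < 1"
    and NR: "\<And>i. N2 (\<lambda>z. h z - dilate (R i) h z) \<le> ennreal (inverse (real (Suc i)))"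
    by metis
  define k where "k i = (\<lambda>z. h z - dilate (R i) h z)" for i
  have k: "k i \<in> hol0" for i
    unfolding k_def using R less_imp_le by (intro hol0_diff h0 hol0_dilate) auto
  have [measurable]: "radial_max (k i) \<in> borel_measurable borel" for i
    by (rule radial_max_measurable[OF k])
  have "(\<integral>\<^sup>+x. (INF i. radial_max (k i) x) \<partial>unif_sphere) \<le> ennreal (256 * inverse (real (Suc i)))" for i
  proof -
    have "(\<integral>\<^sup>+x. (INF i. radial_max (k i) x) \<partial>unif_sphere) \<le> (\<integral>\<^sup>+x. radial_max (k i) x \<partial>unif_sphere)"
      by (intro nn_integral_mono INF_lower) auto
    also have "\<dots> \<le> 256 * N2 (k i)" by (rule radial_maximal[OF k])
    also have "\<dots> \<le> 256 * ennreal (inverse (real (Suc i)))"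
      using NR[of i] by (intro mult_left_mono) (auto simp: k_def)
    also have "\<dots> = ennreal (256 * inverse (real (Suc i)))" by (subst ennreal_mult) auto
    finally show ?thesis .
  qed
  then have "(\<integral>\<^sup>+x. (INF i. radial_max (k i) x) \<partial>unif_sphere) \<le> ennreal 0"
  proof (intro LIMSEQ_le_const[where X = "\<lambda>i. ennreal (256 * inverse (real (Suc i)))"])
    have "(\<lambda>i. 256 * inverse (real (Suc i))) \<longlonglongrightarrow> 256 * 0"
      by (intro tendsto_intros LIMSEQ_inverse_real_of_nat)
    then show "(\<lambda>i. ennreal (256 * inverse (real (Suc i)))) \<longlonglongrightarrow> ennreal 0"
      by (intro tendsto_ennrealI) simp
  qed auto
  then have "AE x in unif_sphere. (INF i. radial_max (k i) x) = 0"
    by (subst (asm) ennreal_0) (simp add: nn_integral_0_iff_AE)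
  then show ?thesis
    using AE_unif_sphere
  proof eventually_elim
    fix x :: "complex ^ 'a" assume inf: "(INF i. radial_max (k i) x) = 0" and x: "norm x = 1"
    show "\<exists>l. ((\<lambda>r. h (r *\<^sub>R x)) \<longlongrightarrow> l) (at_left 1)"
      unfolding at_left_cauchy
    proof (intro allI impI)
      fix e :: real assume e: "e > 0"
      have "(INF i. radial_max (k i) x) < ennreal ((e / 3)\<^sup>2)"
        using e inf by simp
      then obtain i where i: "radial_max (k i) x < ennreal ((e / 3)\<^sup>2)"
        by (auto simp: INF_less_iff)
      have near: "cmod (h (r *\<^sub>R x) - h (R i *\<^sub>R r *\<^sub>R x)) \<le> e / 3" if r: "0 \<le> r" "r < 1" for r
      proof -
        have "ennreal ((cmod (k i (r *\<^sub>R x)))\<^sup>2) < ennreal ((e / 3)\<^sup>2)"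
          using radial_max_upper[OF k, of x r i] x r i by (auto intro: le_less_trans)
        then have "(cmod (k i (r *\<^sub>R x)))\<^sup>2 \<le> (e / 3)\<^sup>2" by (simp add: ennreal_less_iff)
        then have "cmod (k i (r *\<^sub>R x)) \<le> e / 3" by (rule power2_le_imp_le) (use e in auto)
        then show ?thesis using x r by (simp add: k_def dilate_def)
      qed
      have "isCont (\<lambda>r. h (r *\<^sub>R (R i *\<^sub>R x))) 1"
      proof -
        have "continuous_on {- (1 / R i)<..<1 / R i} (\<lambda>r. h (r *\<^sub>R (R i *\<^sub>R x)))"
        proof (rule continuous_on_compose2[OF hol0_continuous_on[OF h0]])
          show "(\<lambda>r. r *\<^sub>R (R i *\<^sub>R x)) ` {- (1 / R i)<..<1 / R i} \<subseteq> ball 0 1"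
            using x R[of i] by (auto simp: field_simps abs_if)
        qed (intro continuous_intros)
        moreover have "1 \<in> {- (1 / R i)<..<1 / R i}" using R[of i] by (auto simp: field_simps)
        ultimately show ?thesis by (subst (asm) continuous_on_eq_continuous_at) auto
      qed
      then have "((\<lambda>r. h (r *\<^sub>R (R i *\<^sub>R x))) \<longlongrightarrow> h (1 *\<^sub>R (R i *\<^sub>R x))) (at_left 1)"
        unfolding isCont_def by (rule tendsto_within_subset) auto
      then obtain d where d: "d < 1" "\<And>r s. r \<in> {d<..<1} \<Longrightarrow> s \<in> {d<..<1} \<Longrightarrow>
          cmod (h (r *\<^sub>R (R i *\<^sub>R x)) - h (s *\<^sub>R (R i *\<^sub>R x))) \<le> e / 3"
        using at_left_cauchy[of "\<lambda>r. h (r *\<^sub>R (R i *\<^sub>R x))"] e by (meson divide_pos_pos zero_less_numeral)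
      have "cmod (h (r *\<^sub>R x) - h (s *\<^sub>R x)) \<le> e" if rs: "r \<in> {max d 0<..<1}" "s \<in> {max d 0<..<1}" for r s
      proof -
        let ?H = "\<lambda>r. h (r *\<^sub>R (R i *\<^sub>R x))"
        have eq: "h (r *\<^sub>R x) - h (s *\<^sub>R x) = (h (r *\<^sub>R x) - ?H r) + (?H r - ?H s) + (?H s - h (s *\<^sub>R x))"
          by simp
        have "cmod (h (r *\<^sub>R x) - ?H r) \<le> e / 3" "cmod (?H s - h (s *\<^sub>R x)) \<le> e / 3"
          using near[of r] near[of s] rs by (auto simp: mult.commute norm_minus_commute)
        moreover have "cmod (?H r - ?H s) \<le> e / 3" using d(2)[of r s] rs by auto
        ultimately show ?thesis
          unfolding eq by (intro order_trans[OF norm_triangle_ineq] order_trans[OF add_mono[OF norm_triangle_ineq order_refl]]) linarith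
      qed
      then show "\<exists>d<1. \<forall>r\<in>{d<..<1}. \<forall>s\<in>{d<..<1}. cmod (h (r *\<^sub>R x) - h (s *\<^sub>R x)) \<le> e"
        using d(1) by (intro exI[of _ "max d 0"]) auto
    qed
  qed
qed

lemma AE_radial_limit:
  assumes h: "h \<in> hardy_space"
  shows "AE x in surface_measure. ((\<lambda>r. h (r *\<^sub>R x)) \<longlongrightarrow> radial_limit h x) (at_left 1)"
  unfolding AE_surface_measure_iff
  using AE_radial_convergent[OF h]
proof eventually_elim
  fix x assume "\<exists>l. ((\<lambda>r. h (r *\<^sub>R x)) \<longlongrightarrow> l) (at_left 1)"
  then obtain l where "((\<lambda>r. h (r *\<^sub>R x)) \<longlongrightarrow> l) (at_left 1)" by blast
  moreover from this have "radial_limit h x = l"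
    unfolding radial_limit_def by (intro tendsto_Lim) auto
  ultimately show "norm x = 1 \<longrightarrow> ((\<lambda>r. h (r *\<^sub>R x)) \<longlongrightarrow> radial_limit h x) (at_left 1)" by simp
qed

lemma rational_norm_bound:
  fixes g :: "real \<Rightarrow> complex"
  assumes g: "continuous_on {a<..<b} g" and r: "r \<in> {a<..<b}"
    and q: "\<And>q. q \<in> \<rat> \<Longrightarrow> q \<in> {a<..<b} \<Longrightarrow> cmod (g q) \<le> e"
  shows "cmod (g r) \<le> e"
proof (rule ccontr)
  assume "\<not> cmod (g r) \<le> e"
  have "open ({a<..<b} \<inter> (\<lambda>r. cmod (g r)) -` {e<..})"
    by (rule continuous_open_preimage) (auto intro!: continuous_intros g)
  moreover have "r \<in> {a<..<b} \<inter> (\<lambda>r. cmod (g r)) -` {e<..}"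
    using r \<open>\<not> cmod (g r) \<le> e\<close> by auto
  ultimately obtain d where d: "d > 0" "\<And>y. dist y r < d \<Longrightarrow> y \<in> {a<..<b} \<inter> (\<lambda>r. cmod (g r)) -` {e<..}"
    unfolding open_dist by blast
  obtain p where "p \<in> \<rat>" "r < p" "p < r + d" using Rats_dense_in_real[of r "r + d"] d by auto
  then show False using d(2)[of p] q[of p] by (auto simp: dist_real_def)
qed

text \<open>By continuity along radii the Cauchy criterion needs rational radii only, so the set of
  convergence is Borel; on it the radial limit is a limit along one fixed sequence.\<close>

lemma radial_limit_measurable [measurable_dest]:
  assumes h: "h \<in> hol0"
  shows "radial_limit h \<in> borel_measurable surface_measure"
proof -
  have [measurable]: "h \<in> borel_measurable borel" using h by (rule hol0_measurable)
  define D where "D j = \<rat> \<inter> {1 - inverse (real (Suc j))<..<1}" for j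
  have [simp]: "countable (D j)" for j
    unfolding D_def by (intro countable_Int1 countable_rat)
  define C where "C = {x. \<forall>k. \<exists>j. \<forall>r\<in>D j. \<forall>s\<in>D j. cmod (h (r *\<^sub>R x) - h (s *\<^sub>R x)) \<le> inverse (real (Suc k))}"
  define L where "L x = lim (\<lambda>n. h ((1 - inverse (real (Suc n))) *\<^sub>R x))" for x
  \<comment> \<open>\<open>Lim\<close> is a definite description. Where no limit exists its
    predicate is constantly false, so the value is the same at all such points.\<close>
  define c0 where "c0 = (THE l::complex. False)"
  have C_sets [measurable]: "C \<in> sets borel"
  proof -
    have 1: "{x. cmod (h (r *\<^sub>R x) - h (s *\<^sub>R x)) \<le> inverse (real (Suc k))} \<in> sets borel" for r s k
      by measurable
    have "C = (\<Inter>k. \<Union>j. \<Inter>r\<in>D j. \<Inter>s\<in>D j. {x. cmod (h (r *\<^sub>R x) - h (s *\<^sub>R x)) \<le> inverse (real (Suc k))})"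
      by (auto simp: C_def)
    also have "\<dots> \<in> sets borel"
      by (intro sets.countable_INT'' sets.countable_UN'' 1) auto
    finally show ?thesis .
  qed
  have [measurable]: "L \<in> borel_measurable borel"
    unfolding L_def[abs_def] by (intro borel_measurable_lim_metric) measurable
  have conv: "x \<in> C \<longleftrightarrow> (\<exists>l. ((\<lambda>r. h (r *\<^sub>R x)) \<longlongrightarrow> l) (at_left 1))" if x: "norm x = 1" for x
    unfolding at_left_cauchy
  proof (intro iffI allI impI)
    fix e :: real assume "x \<in> C" "e > 0"
    then obtain k where k: "inverse (real (Suc k)) < e" using reals_Archimedean by blast
    obtain j where j: "\<And>r s. r \<in> D j \<Longrightarrow> s \<in> D j \<Longrightarrow> cmod (h (r *\<^sub>R x) - h (s *\<^sub>R x)) \<le> inverse (real (Suc k))"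
      using \<open>x \<in> C\<close> unfolding C_def by blast
    define d where "d = 1 - inverse (real (Suc j))"
    have d: "d < 1" "-1 < d" by (auto simp: d_def field_simps)
    have c: "continuous_on {d<..<1} (\<lambda>r. h (r *\<^sub>R x))"
      using d x by (intro continuous_on_subset[OF hol0_radius_continuous[OF h]]) auto
    have "cmod (h (r *\<^sub>R x) - h (s *\<^sub>R x)) \<le> e" if "r \<in> {d<..<1}" "s \<in> {d<..<1}" for r s
    proof (rule rational_norm_bound[OF _ that(1), where g = "\<lambda>r. h (r *\<^sub>R x) - h (s *\<^sub>R x)"])
      fix q assume q: "q \<in> \<rat>" "q \<in> {d<..<1}"
      show "cmod (h (q *\<^sub>R x) - h (s *\<^sub>R x)) \<le> e"
      proof (rule rational_norm_bound[OF _ that(2), where g = "\<lambda>s. h (q *\<^sub>R x) - h (s *\<^sub>R x)"])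
        fix p assume "p \<in> \<rat>" "p \<in> {d<..<1}"
        then show "cmod (h (q *\<^sub>R x) - h (p *\<^sub>R x)) \<le> e"
          using q j[of q p] k by (auto simp: D_def d_def)
      qed (intro continuous_intros c)
    qed (intro continuous_intros c)
    then show "\<exists>d<1. \<forall>r\<in>{d<..<1}. \<forall>s\<in>{d<..<1}. cmod (h (r *\<^sub>R x) - h (s *\<^sub>R x)) \<le> e"
      using d by blast
  next
    assume A: "\<forall>e>0. \<exists>d<1. \<forall>r\<in>{d<..<1}. \<forall>s\<in>{d<..<1}. cmod (h (r *\<^sub>R x) - h (s *\<^sub>R x)) \<le> e"
    show "x \<in> C"
      unfolding C_def
    proof clarify
      fix k
      obtain d where d: "d < 1" "\<And>r s. r \<in> {d<..<1} \<Longrightarrow> s \<in> {d<..<1} \<Longrightarrow>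
          cmod (h (r *\<^sub>R x) - h (s *\<^sub>R x)) \<le> inverse (real (Suc k))"
        using A[rule_format, of "inverse (real (Suc k))"] by auto
      obtain j where "inverse (real (Suc j)) < 1 - d" using reals_Archimedean[of "1 - d"] d by auto
      then have "D j \<subseteq> {d<..<1}" by (auto simp: D_def)
      then show "\<exists>j. \<forall>r\<in>D j. \<forall>s\<in>D j. cmod (h (r *\<^sub>R x) - h (s *\<^sub>R x)) \<le> inverse (real (Suc k))"
        using d(2) by blast
    qed
  qed
  have "radial_limit h x = (if x \<in> C then L x else c0)" if x: "norm x = 1" for x
  proof (cases "x \<in> C")
    case True
    then obtain l where l: "((\<lambda>r. h (r *\<^sub>R x)) \<longlongrightarrow> l) (at_left 1)" using conv[OF x] by blast
    have "(\<lambda>n. 1 - inverse (real (Suc n))) \<longlonglongrightarrow> 1 - 0"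
      by (intro tendsto_intros LIMSEQ_inverse_real_of_nat)
    then have "filterlim (\<lambda>n. 1 - inverse (real (Suc n))) (at_left 1) sequentially"
      unfolding filterlim_at by (simp add: always_eventually)
    then have "(\<lambda>n. h ((1 - inverse (real (Suc n))) *\<^sub>R x)) \<longlonglongrightarrow> l"
      by (rule filterlim_compose[OF l])
    then have "L x = l" unfolding L_def by (rule limI)
    moreover have "radial_limit h x = l"
      unfolding radial_limit_def using l by (intro tendsto_Lim) auto
    ultimately show ?thesis using True by simp
  next
    case False
    then have "(\<lambda>l. ((\<lambda>r. h (r *\<^sub>R x)) \<longlongrightarrow> l) (at_left 1)) = (\<lambda>l. False)" using conv[OF x] by blast
    then show ?thesis using False by (simp add: radial_limit_def t2_space_class.Lim_def c0_def)
  qed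
  then show ?thesis
    by (subst measurable_cong[where g = "\<lambda>x. if x \<in> C then L x else c0"]) auto
qed

text \<open>The maximal function is an integrable majorant, so along radii tending to 1 the square
  means converge to the boundary integral, while by monotonicity they converge to
  \<open>N2 h\<close>.\<close>

lemma N2_radial_limit:
  assumes h: "h \<in> hardy_space"
  shows "(\<integral>\<^sup>+x. ennreal ((cmod (radial_limit h x))\<^sup>2) \<partial>surface_measure) = N2 h"
proof -
  have h0: "h \<in> hol0" and fin: "N2 h < \<infinity>" using h by (auto simp: hardy_space_iff)
  have [measurable]: "h \<in> borel_measurable borel" using h0 by (rule hol0_measurable)
  have [measurable]: "radial_limit h \<in> borel_measurable surface_measure"
    using h0 by (rule radial_limit_measurable)
  have [measurable]: "radial_max h \<in> borel_measurable borel" using h0 by (rule radial_max_measurable)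
  define a where "a n = 1 - inverse (real (Suc (Suc n)))" for n
  have a1: "0 < a n" "a n < 1" for n by (auto simp: a_def field_simps)
  have "(\<lambda>n. 1 - inverse (real (Suc (Suc n)))) \<longlonglongrightarrow> 1 - 0"
    by (intro tendsto_intros LIMSEQ_Suc[OF LIMSEQ_inverse_real_of_nat])
  then have a: "a \<longlonglongrightarrow> 1" by (simp add: a_def[abs_def])
  have fa: "filterlim a (at_left 1) sequentially"
    unfolding filterlim_at using a a1 by (auto intro!: always_eventually simp: less_imp_neq)
  have "(\<lambda>n. \<integral>\<^sup>+x. ennreal ((cmod (h (a n *\<^sub>R x)))\<^sup>2) \<partial>surface_measure) \<longlonglongrightarrow>
      (\<integral>\<^sup>+x. ennreal ((cmod (radial_limit h x))\<^sup>2) \<partial>surface_measure)"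
  proof (rule nn_integral_dominated_convergence[where w = "radial_max h"])
    show "AE x in surface_measure. ennreal ((cmod (h (a n *\<^sub>R x)))\<^sup>2) \<le> radial_max h x" for n
      unfolding AE_surface_measure_iff
      using radial_max_upper[OF h0] a1[of n] by (intro AE_I2) (auto simp: less_imp_le)
    have "(\<integral>\<^sup>+x. radial_max h x \<partial>surface_measure) \<le> 256 * N2 h"
      using radial_maximal[OF h0] by (simp add: nn_integral_surface_measure)
    also have "\<dots> < \<infinity>" using fin by (simp add: ennreal_mult_less_top)
    finally show "(\<integral>\<^sup>+x. radial_max h x \<partial>surface_measure) < \<infinity>" .
    show "AE x in surface_measure. (\<lambda>n. ennreal ((cmod (h (a n *\<^sub>R x)))\<^sup>2)) \<longlonglongrightarrow>
        ennreal ((cmod (radial_limit h x))\<^sup>2)"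
      using AE_radial_limit[OF h]
      by eventually_elim (intro tendsto_ennrealI tendsto_intros filterlim_compose[OF _ fa])
  qed measurable
  moreover have "(\<lambda>n. \<integral>\<^sup>+x. ennreal ((cmod (h (a n *\<^sub>R x)))\<^sup>2) \<partial>surface_measure) \<longlonglongrightarrow> N2 h"
  proof -
    have mono: "incseq (\<lambda>n. S2 h (a n))"
      by (intro incseq_SucI S2_mono[OF h0]) (use a1 in \<open>auto simp: a_def field_simps less_imp_le\<close>)
    have "N2 h = (SUP n. S2 h (a n))"
    proof (rule antisym)
      show "N2 h \<le> (SUP n. S2 h (a n))"
        unfolding N2_def
      proof (rule SUP_least)
        fix r :: real assume r: "r \<in> {0<..<1}"
        then obtain n where "r < a n"
          using order_tendstoD(1)[OF a, of r] by (auto simp: eventually_sequentially)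
        then have "S2 h r \<le> S2 h (a n)" using r a1 by (intro S2_mono[OF h0]) auto
        then show "S2 h r \<le> (SUP n. S2 h (a n))" by (rule order_trans) (auto intro: SUP_upper)
      qed
      show "(SUP n. S2 h (a n)) \<le> N2 h"
        using a1 by (intro SUP_least S2_le_N2[OF h0]) (auto simp: less_imp_le)
    qed
    then show ?thesis
      using LIMSEQ_SUP[OF mono] by (simp add: S2_def nn_integral_surface_measure)
  qed
  ultimately show ?thesis by (rule LIMSEQ_unique)
qed

lemma AE_radial_limit_lincomb:
  assumes h: "h \<in> hardy_space" and k: "k \<in> hardy_space"
  shows "AE x in surface_measure.
    radial_limit (\<lambda>z. a * h z + b * k z) x = a * radial_limit h x + b * radial_limit k x"
  using AE_radial_limit[OF h] AE_radial_limit[OF k]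
proof eventually_elim
  fix x assume lim: "((\<lambda>r. h (r *\<^sub>R x)) \<longlongrightarrow> radial_limit h x) (at_left 1)"
    "((\<lambda>r. k (r *\<^sub>R x)) \<longlongrightarrow> radial_limit k x) (at_left 1)"
  show "radial_limit (\<lambda>z. a * h z + b * k z) x = a * radial_limit h x + b * radial_limit k x"
    unfolding radial_limit_def[of "\<lambda>z. a * h z + b * k z"]
    by (rule tendsto_Lim) (auto intro!: tendsto_intros lim)
qed

lemma AE_radial_limit_mult:
  assumes h: "h \<in> hardy_space" and k: "continuous_on (cball 0 1) k"
  shows "AE x in surface_measure. radial_limit (\<lambda>z. k z * h z) x = k x * radial_limit h x"
  using AE_radial_limit[OF h] AE_space[of surface_measure]
proof eventually_elim
  fix x assume lim: "((\<lambda>r. h (r *\<^sub>R x)) \<longlongrightarrow> radial_limit h x) (at_left 1)"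
    and "x \<in> space surface_measure"
  then have x: "norm x = 1" by simp
  have "continuous_on {0..1} (\<lambda>r. k (r *\<^sub>R x))"
    by (rule continuous_on_compose2[OF k]) (use x in \<open>auto intro!: continuous_intros\<close>)
  then have "((\<lambda>r. k (r *\<^sub>R x)) \<longlongrightarrow> k (1 *\<^sub>R x)) (at 1 within {0..1})"
    unfolding continuous_on_def by (rule bspec) simp
  then have "((\<lambda>r. k (r *\<^sub>R x)) \<longlongrightarrow> k x) (at_left 1)"
    by (simp add: at_within_Icc_at_left)
  then show "radial_limit (\<lambda>z. k z * h z) x = k x * radial_limit h x"
    unfolding radial_limit_def[of "\<lambda>z. k z * h z"]
    by (intro tendsto_Lim tendsto_mult lim) auto
qed

section \<open>The Hardy space as a Hilbert space\<close>

definition L2S :: "(complex ^ 'n::finite \<Rightarrow> complex) \<Rightarrow> bool" where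
  "L2S g \<longleftrightarrow> g \<in> borel_measurable surface_measure \<and> integrable surface_measure (\<lambda>x. (cmod (g x))\<^sup>2)"

lemma L2S_prod:
  assumes "L2S f" "L2S g"
  shows "integrable surface_measure (\<lambda>x. f x * cnj (g x))"
proof (rule Bochner_Integration.integrable_bound)
  have [measurable]: "f \<in> borel_measurable surface_measure" "g \<in> borel_measurable surface_measure"
    using assms by (auto simp: L2S_def)
  show "integrable surface_measure (\<lambda>x. (cmod (f x))\<^sup>2 + (cmod (g x))\<^sup>2)"
    using assms by (auto simp: L2S_def)
  show "(\<lambda>x. f x * cnj (g x)) \<in> borel_measurable surface_measure" by measurable
  have "a * b \<le> a\<^sup>2 + b\<^sup>2" if "0 \<le> a" "0 \<le> b" for a b :: real
    using sum_squares_bound[of a b] that mult_nonneg_nonneg[of a b] by linarith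
  then show "AE x in surface_measure. norm (f x * cnj (g x)) \<le> norm ((cmod (f x))\<^sup>2 + (cmod (g x))\<^sup>2)"
    by (intro AE_I2) (simp add: norm_mult)
qed

lemma L2S_cauchy_schwarz:
  assumes "L2S f" "L2S g"
  shows "(cmod (\<integral>x. f x * cnj (g x) \<partial>surface_measure))\<^sup>2 \<le>
    (\<integral>x. (cmod (f x))\<^sup>2 \<partial>surface_measure) * (\<integral>x. (cmod (g x))\<^sup>2 \<partial>surface_measure)"
proof -
  have [measurable]: "f \<in> borel_measurable surface_measure" "g \<in> borel_measurable surface_measure"
    using assms by (auto simp: L2S_def)
  have sq: "(\<integral>\<^sup>+x. (ennreal (cmod (f x)))\<^sup>2 \<partial>surface_measure) = ennreal (\<integral>x. (cmod (f x))\<^sup>2 \<partial>surface_measure)"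
    if "L2S f" for f :: "complex ^ 'a \<Rightarrow> complex"
    using that by (simp add: L2S_def ennreal_power nn_integral_eq_integral)
  have "ennreal (cmod (\<integral>x. f x * cnj (g x) \<partial>surface_measure)) \<le>
      (\<integral>\<^sup>+x. ennreal (cmod (f x)) * ennreal (cmod (g x)) \<partial>surface_measure)"
    using integral_norm_bound_ennreal[OF L2S_prod[OF assms]] by (simp add: norm_mult ennreal_mult)
  then have "(ennreal (cmod (\<integral>x. f x * cnj (g x) \<partial>surface_measure)))\<^sup>2 \<le>
      (\<integral>\<^sup>+x. ennreal (cmod (f x)) * ennreal (cmod (g x)) \<partial>surface_measure)\<^sup>2"
    by (rule power_mono) simp
  also have "\<dots> \<le> (\<integral>\<^sup>+x. (ennreal (cmod (f x)))\<^sup>2 \<partial>surface_measure) *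
      (\<integral>\<^sup>+x. (ennreal (cmod (g x)))\<^sup>2 \<partial>surface_measure)"
    by (rule Cauchy_Schwarz_nn_integral) measurable
  finally have "ennreal ((cmod (\<integral>x. f x * cnj (g x) \<partial>surface_measure))\<^sup>2) \<le>
      ennreal (\<integral>x. (cmod (f x))\<^sup>2 \<partial>surface_measure) * ennreal (\<integral>x. (cmod (g x))\<^sup>2 \<partial>surface_measure)"
    unfolding sq[OF assms(1)] sq[OF assms(2)] by (simp add: ennreal_power)
  then show ?thesis by (simp flip: ennreal_mult)
qed

lemma L2S_mult_bounded:
  assumes f: "L2S f" and [measurable]: "m \<in> borel_measurable surface_measure"
    and B: "\<And>x. norm x = 1 \<Longrightarrow> cmod (m x) \<le> B"
  shows "L2S (\<lambda>x. m x * f x)"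
proof -
  have [measurable]: "f \<in> borel_measurable surface_measure" using f by (auto simp: L2S_def)
  have "integrable surface_measure (\<lambda>x. (cmod (m x * f x))\<^sup>2)"
  proof (rule Bochner_Integration.integrable_bound)
    show "integrable surface_measure (\<lambda>x. B\<^sup>2 * (cmod (f x))\<^sup>2)"
      using f by (auto simp: L2S_def)
    show "AE x in surface_measure. norm ((cmod (m x * f x))\<^sup>2) \<le> norm (B\<^sup>2 * (cmod (f x))\<^sup>2)"
      using B by (intro AE_I2) (auto simp: norm_mult power_mult_distrib intro!: mult_right_mono power_mono)
  qed measurable
  then show ?thesis by (simp add: L2S_def)
qed

lemma hardy_hol0: "h \<in> hardy_space \<Longrightarrow> h \<in> hol0"
  by (simp add: hardy_space_iff)

lemma L2S_radial_limit:
  assumes h: "h \<in> hardy_space"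
  shows "L2S (radial_limit h)"
    and "(\<integral>x. (cmod (radial_limit h x))\<^sup>2 \<partial>surface_measure) = (hardy_norm h)\<^sup>2"
proof -
  have [measurable]: "radial_limit h \<in> borel_measurable surface_measure"
    using hardy_hol0[OF h] by (rule radial_limit_measurable)
  have eq: "(\<integral>\<^sup>+x. ennreal ((cmod (radial_limit h x))\<^sup>2) \<partial>surface_measure) = ennreal ((hardy_norm h)\<^sup>2)"
    by (simp add: N2_radial_limit[OF h] hardy_norm_eq[OF h])
  show "L2S (radial_limit h)"
    unfolding L2S_def using eq by (auto intro!: integrableI_nonneg)
  show "(\<integral>x. (cmod (radial_limit h x))\<^sup>2 \<partial>surface_measure) = (hardy_norm h)\<^sup>2"
    using eq by (intro integral_eq_nn_integral[THEN trans]) auto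
qed

lemma hardy_space_lincomb:
  assumes h: "h \<in> hardy_space" and k: "k \<in> hardy_space"
  shows "(\<lambda>z. a * h z + b * k z) \<in> hardy_space"
proof -
  have h0: "h \<in> hol0" "k \<in> hol0" using h k by (auto simp: hardy_space_iff)
  have [measurable]: "h \<in> borel_measurable borel" "k \<in> borel_measurable borel"
    using h0 by (auto intro: hol0_measurable)
  let ?c = "ennreal (2 * (cmod a)\<^sup>2)" and ?d = "ennreal (2 * (cmod b)\<^sup>2)"
  have "S2 (\<lambda>z. a * h z + b * k z) r \<le> ?c * N2 h + ?d * N2 k" if r: "r \<in> {0<..<1}" for r
  proof -
    have le: "(cmod (u + v))\<^sup>2 \<le> 2 * (cmod u)\<^sup>2 + 2 * (cmod v)\<^sup>2" for u v
    proof -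
      have "(cmod (u + v))\<^sup>2 \<le> (cmod u + cmod v)\<^sup>2" by (intro power_mono norm_triangle_ineq) auto
      then show ?thesis using sum_squares_bound[of "cmod u" "cmod v"] by (simp add: power2_sum)
    qed
    have "S2 (\<lambda>z. a * h z + b * k z) r \<le> (\<integral>\<^sup>+x. ?c * ennreal ((cmod (h (r *\<^sub>R x)))\<^sup>2) +
        ?d * ennreal ((cmod (k (r *\<^sub>R x)))\<^sup>2) \<partial>unif_sphere)"
      unfolding S2_def
      by (rule nn_integral_mono)
         (use le[of "a * h _" "b * k _"] in \<open>auto simp: norm_mult power_mult_distrib mult.assoc
           simp flip: ennreal_plus ennreal_mult intro!: ennreal_leI\<close>)
    also have "\<dots> = ?c * S2 h r + ?d * S2 k r"
      by (subst nn_integral_add) (auto simp: nn_integral_cmult S2_def)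
    also have "\<dots> \<le> ?c * N2 h + ?d * N2 k"
      using r h0 by (intro add_mono mult_left_mono S2_le_N2) auto
    finally show ?thesis .
  qed
  then have "N2 (\<lambda>z. a * h z + b * k z) \<le> ?c * N2 h + ?d * N2 k"
    unfolding N2_def[of "\<lambda>z. a * h z + b * k z"] by (rule SUP_least)
  also have "\<dots> < \<infinity>" using h k by (auto simp: hardy_space_iff ennreal_mult_less_top)
  finally show ?thesis using hol0_lincomb[OF h0] by (simp add: hardy_space_iff)
qed

lemma hardy_space_add: "h \<in> hardy_space \<Longrightarrow> k \<in> hardy_space \<Longrightarrow> (\<lambda>z. h z + k z) \<in> hardy_space"
  and hardy_space_diff: "h \<in> hardy_space \<Longrightarrow> k \<in> hardy_space \<Longrightarrow> (\<lambda>z. h z - k z) \<in> hardy_space"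
  and hardy_space_cmult: "h \<in> hardy_space \<Longrightarrow> (\<lambda>z. a * h z) \<in> hardy_space"
  using hardy_space_lincomb[of h k 1 1] hardy_space_lincomb[of h k 1 "-1"] hardy_space_lincomb[of h h a 0]
  by simp_all

lemma hardy_space_zero: "(\<lambda>z. 0) \<in> hardy_space"
proof -
  have "Vector_Spaces.linear (*s) (*) (\<lambda>x :: complex ^ 'a. 0 :: complex)" by unfold_locales auto
  then have "(\<lambda>z. 0) \<in> (hol0 :: (complex ^ 'a \<Rightarrow> complex) set)"
    by (auto simp: hol0_def holomorphic_Cn_def intro!: exI[of _ "\<lambda>x. 0"])
  then show ?thesis by (simp add: hardy_space_iff N2_def S2_def)
qed

lemma hardy_space_sum: "(\<And>i. i \<in> I \<Longrightarrow> h i \<in> hardy_space) \<Longrightarrow> (\<lambda>z. \<Sum>i\<in>I. h i z) \<in> hardy_space"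
  by (induction I rule: infinite_finite_induct) (auto simp: hardy_space_zero hardy_space_add)

text \<open>The mean of \<open>|h|\<^sup>2\<close> over a small ball dominates \<open>|h|\<^sup>2\<close> at its centre; the small ball
  is swallowed by a concentric one, on which spherical means are at most \<open>N2 h\<close>.\<close>

lemma hardy_pointwise_bound:
  fixes h :: "complex ^ 'n::finite \<Rightarrow> complex"
  assumes h: "h \<in> hol0" and \<rho>: "0 < \<rho>" "2 * \<rho> < 1" and z: "norm z \<le> 1 - 2 * \<rho>"
  shows "ennreal ((cmod (h z))\<^sup>2) \<le> ennreal (inverse \<rho> ^ DIM(complex ^ 'n)) * N2 h"
proof -
  let ?N = "DIM(complex ^ 'n)"
  let ?B = "ball (0 :: complex ^ 'n) 1"
  have [measurable]: "h \<in> borel_measurable borel" using h by (rule hol0_measurable)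
  interpret C: prob_space "circle_measure" by (rule prob_space_unif_sphere)
  interpret U: prob_space "unif_ball :: (complex ^ 'n) measure" by (rule prob_space_unif_ball)
  define H where "H y = ennreal ((cmod (h y))\<^sup>2)" for y
  have [measurable]: "H \<in> borel_measurable borel" unfolding H_def[abs_def] by measurable
  have [measurable]: "(indicator (ball a s) :: complex ^ 'n \<Rightarrow> ennreal) \<in> borel_measurable borel" for a s
    by (intro borel_measurable_indicator) simp
  \<comment> \<open>The centred ball of this radius contains the ball of radius
    \<open>\<rho>\<close> around \<open>z\<close>, since
    \<open>norm z \<le> 1 - 2 * \<rho>\<close>.\<close>
  define r where "r = 1 - \<rho>"
  have r: "0 \<le> r" "r < 1" using \<rho> by (auto simp: r_def)
  have "(\<integral>\<^sup>+y. indicator (ball 0 r) y * H y \<partial>unif_ball) =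
      (\<integral>\<^sup>+y. \<integral>\<^sup>+\<mu>. indicator (ball 0 r) (\<mu> *s y) * H (\<mu> *s y) \<partial>circle_measure \<partial>unif_ball)"
    by (rule nn_integral_slices(2)[symmetric]) measurable
  \<comment> \<open>On each slice the circle mean of \<open>H\<close> grows with the radius, so
    every circle inside the ball is bounded by the outermost one.\<close>
  also have "\<dots> \<le> (\<integral>\<^sup>+y. \<integral>\<^sup>+\<mu>. H ((of_real r * \<mu>) *s sgn y) \<partial>circle_measure \<partial>unif_ball)"
  proof (rule nn_integral_mono)
    fix y :: "complex ^ 'n"
    show "(\<integral>\<^sup>+\<mu>. indicator (ball 0 r) (\<mu> *s y) * H (\<mu> *s y) \<partial>circle_measure) \<le>
        (\<integral>\<^sup>+\<mu>. H ((of_real r * \<mu>) *s sgn y) \<partial>circle_measure)"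
    proof (cases "norm y < r")
      case True
      have sg: "norm (sgn y) \<le> 1" by (simp add: norm_sgn)
      have y: "(of_real (norm y) * \<mu>) *s sgn y = \<mu> *s y" for \<mu>
      proof -
        have "(of_real (norm y) * \<mu>) *s sgn y = \<mu> *s (norm y *\<^sub>R sgn y)"
          by (simp add: scaleR_eq_vector_scalar_mult vector_smult_assoc mult.commute)
        also have "norm y *\<^sub>R sgn y = y" by (cases "y = 0") (simp_all add: sgn_div_norm)
        finally show ?thesis .
      qed
      have "(\<integral>\<^sup>+\<mu>. indicator (ball 0 r) (\<mu> *s y) * H (\<mu> *s y) \<partial>circle_measure) \<le>
          (\<integral>\<^sup>+\<mu>. H ((of_real (norm y) * \<mu>) *s sgn y) \<partial>circle_measure)"
        unfolding y by (intro nn_integral_mono) (auto simp: indicator_def)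
      also have "\<dots> \<le> (\<integral>\<^sup>+\<mu>. H ((of_real r * \<mu>) *s sgn y) \<partial>circle_measure)"
        unfolding H_def
        using circle_square_mono_nn[OF hol0_slice(1)[OF h sg] _ _ r(2) hol0_slice(2)[OF h sg], of "norm y"] True
        by simp
      finally show ?thesis .
    next
      case False
      have "(\<integral>\<^sup>+\<mu>. indicator (ball 0 r) (\<mu> *s y) * H (\<mu> *s y) \<partial>circle_measure) = (\<integral>\<^sup>+\<mu>. 0 \<partial>circle_measure)"
        by (rule nn_integral_cong_AE, rule eventually_mono[OF AE_circle])
           (use False in \<open>auto simp: norm_vector_scalar_mult indicator_def\<close>)
      then show ?thesis by simp
    qed
  qed
  also have "\<dots> = S2 h r"
    unfolding S2_slices[OF hol0_measurable[OF h]] H_def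
    by (rule nn_integral_unif_sphere[symmetric]) measurable
  also have "\<dots> \<le> N2 h" using h r by (rule S2_le_N2)
  finally have 1: "(\<integral>\<^sup>+y. indicator (ball 0 r) y * H y \<partial>unif_ball) \<le> N2 h" .
  have "H z = (\<integral>\<^sup>+u. H z \<partial>(unif_ball :: (complex ^ 'n) measure))"
    using U.emeasure_space_1 by simp
  also have "\<dots> \<le> (\<integral>\<^sup>+u. \<integral>\<^sup>+\<mu>. H (z + \<rho> *\<^sub>R (\<mu> *s u)) \<partial>circle_measure \<partial>unif_ball)"
  proof (rule nn_integral_mono_AE, rule eventually_mono[OF AE_unif_ball])
    fix u :: "complex ^ 'n" assume u: "u \<noteq> 0 \<and> norm u < 1"
    define f where "f t = h (z + t *s (\<rho> *\<^sub>R u))" for t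
    \<comment> \<open>The mean inequality on the unit circle needs holomorphy on a larger disc;
      \<open>3 / 2 * \<rho>\<close> is still less than the distance \<open>2 * \<rho>\<close> that
      at least remains to the sphere.\<close>
    have "ball 0 (3 / 2) \<subseteq> {t. z + t *s (\<rho> *\<^sub>R u) \<in> ball 0 1}"
    proof clarsimp
      fix t :: complex assume t: "cmod t * 2 < 3"
      have "norm (z + t *s (\<rho> *\<^sub>R u)) \<le> norm z + cmod t * (\<rho> * norm u)"
        using norm_triangle_ineq[of z "t *s (\<rho> *\<^sub>R u)"] \<rho> by (simp add: norm_vector_scalar_mult)
      also have "\<dots> \<le> (1 - 2 * \<rho>) + (3 / 2) * (\<rho> * 1)"
        using z t u \<rho> by (intro add_mono mult_mono) auto
      also have "\<dots> < 1" using \<rho> by simp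
      finally show "norm (z + t *s (\<rho> *\<^sub>R u)) < 1" .
    qed
    then have hol: "f holomorphic_on ball 0 (3 / 2)"
      unfolding f_def using h by (intro holomorphic_on_subset[OF holomorphic_Cn_line]) (auto simp: hol0_def)
    have mf [measurable]: "f \<in> borel_measurable borel" unfolding f_def[abs_def] by measurable
    have "compact (f ` sphere 0 1)"
      by (intro compact_continuous_image holomorphic_on_imp_continuous_on holomorphic_on_subset[OF hol])
        (auto simp: subset_iff)
    then obtain K where K: "\<And>t. cmod t = 1 \<Longrightarrow> cmod (f t) \<le> K"
      by (force dest!: compact_imp_bounded simp: bounded_iff)
    have int: "integrable circle_measure (\<lambda>\<mu>. (cmod (f \<mu>))\<^sup>2)"
      by (rule circle_integrable_bounded[where B = "K\<^sup>2"]) (use K in \<open>auto intro!: power_mono\<close>)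
    have "(cmod (f 0))\<^sup>2 \<le> (\<integral>\<mu>. (cmod (f \<mu>))\<^sup>2 \<partial>circle_measure)"
      using circle_square_mono[OF hol, of 0 1] mf by simp
    then have "ennreal ((cmod (f 0))\<^sup>2) \<le> (\<integral>\<^sup>+\<mu>. ennreal ((cmod (f \<mu>))\<^sup>2) \<partial>circle_measure)"
      using nn_integral_eq_integral[OF int] by (simp add: ennreal_leI)
    then show "H z \<le> (\<integral>\<^sup>+\<mu>. H (z + \<rho> *\<^sub>R (\<mu> *s u)) \<partial>circle_measure)"
      by (simp add: H_def f_def scaleR_eq_vector_scalar_mult vector_smult_assoc mult.commute)
  qed
  also have "\<dots> = (\<integral>\<^sup>+u. H (z + \<rho> *\<^sub>R u) \<partial>unif_ball)"
    by (rule nn_integral_slices(2)) measurable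
  finally have 2: "H z \<le> (\<integral>\<^sup>+u. H (z + \<rho> *\<^sub>R u) \<partial>unif_ball)" .
  define F where "F y = indicator (ball z \<rho>) y * H y" for y
  have [measurable]: "F \<in> borel_measurable borel" unfolding F_def[abs_def] by measurable
  have ub: "(\<integral>\<^sup>+u. g u \<partial>unif_ball) = (\<integral>\<^sup>+u. g u * indicator ?B u \<partial>lborel) / emeasure lborel ?B"
    if [measurable]: "g \<in> borel_measurable borel" for g
    unfolding unif_ball_def by (rule nn_integral_uniform_measure) auto
  have "ennreal (\<rho> ^ ?N) * (\<integral>\<^sup>+u. H (z + \<rho> *\<^sub>R u) * indicator ?B u \<partial>lborel) =
      (\<integral>\<^sup>+u. ennreal (\<rho> ^ ?N) * F (z + \<rho> *\<^sub>R u) \<partial>lborel)"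
  proof -
    have "H (z + \<rho> *\<^sub>R u) * indicator ?B u = F (z + \<rho> *\<^sub>R u)" for u
      using \<rho> by (auto simp: F_def indicator_def dist_norm)
    then show ?thesis by (simp add: nn_integral_cmult)
  qed
  also have "\<dots> = (\<integral>\<^sup>+y. F y \<partial>lborel)"
    by (subst (2) lborel_affine[of \<rho> z]) (use \<rho> in \<open>auto simp: nn_integral_density nn_integral_distr\<close>)
  also have "\<dots> \<le> (\<integral>\<^sup>+y. (indicator (ball 0 r) y * H y) * indicator ?B y \<partial>lborel)"
  proof (rule nn_integral_mono)
    fix y
    have "y \<in> ball z \<rho> \<Longrightarrow> norm y < r"
      using z norm_triangle_ineq2[of y z] by (auto simp: r_def dist_norm norm_minus_commute)
    then show "F y \<le> (indicator (ball 0 r) y * H y) * indicator ?B y"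
      using r by (auto simp: F_def indicator_def)
  qed
  finally have "ennreal (\<rho> ^ ?N) * (\<integral>\<^sup>+u. H (z + \<rho> *\<^sub>R u) * indicator ?B u \<partial>lborel) / emeasure lborel ?B \<le>
      (\<integral>\<^sup>+y. (indicator (ball 0 r) y * H y) * indicator ?B y \<partial>lborel) / emeasure lborel ?B"
    by (rule divide_right_mono_ennreal)
  then have 3: "ennreal (\<rho> ^ ?N) * (\<integral>\<^sup>+u. H (z + \<rho> *\<^sub>R u) \<partial>unif_ball) \<le>
      (\<integral>\<^sup>+y. indicator (ball 0 r) y * H y \<partial>unif_ball)"
    by (subst ub, measurable, subst ub, measurable) (simp add: ennreal_times_divide)
  have "ennreal (\<rho> ^ ?N) * H z \<le> N2 h"
    using mult_left_mono[OF 2, of "ennreal (\<rho> ^ ?N)"] 3 1 by (meson order_trans zero_le)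
  then have "ennreal (inverse \<rho> ^ ?N) * (ennreal (\<rho> ^ ?N) * H z) \<le> ennreal (inverse \<rho> ^ ?N) * N2 h"
    by (rule mult_left_mono) simp
  moreover have "ennreal (inverse \<rho> ^ ?N) * ennreal (\<rho> ^ ?N) = 1"
    using \<rho> by (simp add: power_inverse flip: ennreal_mult)
  ultimately show ?thesis by (simp add: H_def flip: mult.assoc)
qed

lemma hardy_norm_pointwise:
  fixes h :: "complex ^ 'n::finite \<Rightarrow> complex"
  assumes h: "h \<in> hardy_space" and \<rho>: "0 < \<rho>" "2 * \<rho> < 1" and z: "norm z \<le> 1 - 2 * \<rho>"
  shows "cmod (h z) \<le> sqrt (inverse \<rho> ^ DIM(complex ^ 'n)) * hardy_norm h"
proof -
  have "ennreal ((cmod (h z))\<^sup>2) \<le> ennreal (inverse \<rho> ^ DIM(complex ^ 'n)) * ennreal ((hardy_norm h)\<^sup>2)"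
    using hardy_pointwise_bound[OF hardy_hol0[OF h] \<rho> z] by (simp add: hardy_norm_eq[OF h])
  then have "(cmod (h z))\<^sup>2 \<le> inverse \<rho> ^ DIM(complex ^ 'n) * (hardy_norm h)\<^sup>2"
    using \<rho> by (simp flip: ennreal_mult)
  then have "sqrt ((cmod (h z))\<^sup>2) \<le> sqrt (inverse \<rho> ^ DIM(complex ^ 'n) * (hardy_norm h)\<^sup>2)"
    by (rule real_sqrt_le_mono)
  then show ?thesis using hardy_norm_eq(1)[OF h] by (simp add: real_sqrt_mult)
qed

section \<open>Locally uniform limits and completeness\<close>

lemma holomorphic_Cn_line_has_field_derivative:
  fixes h :: "complex ^ 'n::finite \<Rightarrow> complex"
  assumes "(h has_derivative D) (at (a + t *s v))" "Vector_Spaces.linear (*s) (*) D"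
  shows "((\<lambda>t. h (a + t *s v)) has_field_derivative D v) (at t)"
proof -
  have "holomorphic_Cn h {a + t *s v}" using assms by (auto simp: holomorphic_Cn_def)
  then obtain E where "(h has_derivative E) (at (a + t *s v))"
    "((\<lambda>t. h (a + t *s v)) has_field_derivative E v) (at t)"
    using holomorphic_Cn_line_deriv[of h "{a + t *s v}" a t v] by auto
  moreover from this(1) have "E = D" using assms(1) by (rule has_derivative_unique)
  ultimately show ?thesis by simp
qed

text \<open>Cauchy's inequality on the complex line through \<open>x\<close> in the direction of
  \<open>v\<close>, combined with complex homogeneity of \<open>D\<close>.\<close>

lemma holomorphic_Cn_cauchy_estimate:
  assumes h: "(h has_derivative D) (at x)" "Vector_Spaces.linear (*s) (*) D"
    and hol: "holomorphic_Cn h (ball 0 1)" and \<rho>: "0 < \<rho>" "norm x + \<rho> < 1"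
    and bound: "\<And>y. norm y \<le> norm x + \<rho> \<Longrightarrow> cmod (h y) \<le> e"
  shows "cmod (D v) \<le> e / \<rho> * norm v"
proof (cases "v = 0")
  case True
  interpret D: Vector_Spaces.linear "(*s)" "(*)" D by fact
  show ?thesis using True by (simp add: D.zero)
next
  case False
  interpret D: Vector_Spaces.linear "(*s)" "(*)" D by fact
  define u where "u = sgn v"
  have u: "norm u = 1" using False by (simp add: u_def norm_sgn)
  have le: "norm (x + t *s u) \<le> norm x + \<rho>" if "cmod t \<le> \<rho>" for t
    using norm_triangle_ineq[of x "t *s u"] that u by (simp add: norm_vector_scalar_mult)
  have sub: "cball 0 \<rho> \<subseteq> {t. x + t *s u \<in> ball 0 1}"
    using le_less_trans[OF le \<rho>(2)] by auto
  have hol': "(\<lambda>t. h (x + t *s u)) holomorphic_on cball 0 \<rho>"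
    using holomorphic_on_subset[OF holomorphic_Cn_line[OF hol] sub] .
  have "cmod ((deriv ^^ 1) (\<lambda>t. h (x + t *s u)) 0) \<le> fact 1 * e / \<rho> ^ 1"
    by (rule Cauchy_inequality)
      (use hol' \<rho> le bound in \<open>auto intro: holomorphic_on_subset holomorphic_on_imp_continuous_on\<close>)
  moreover have "deriv (\<lambda>t. h (x + t *s u)) 0 = D u"
    by (intro DERIV_imp_deriv holomorphic_Cn_line_has_field_derivative h(2)) (use h(1) in simp)
  ultimately have "cmod (D u) \<le> e / \<rho>" by simp
  moreover have "D v = of_real (norm v) * D u"
  proof -
    have "v = of_real (norm v) *s u"
      using False by (simp add: u_def sgn_div_norm flip: scaleR_eq_vector_scalar_mult)
    then show ?thesis by (metis D.scale)
  qed
  ultimately show ?thesis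
    using mult_right_mono[of "cmod (D u)" "e / \<rho>" "norm v"] by (simp add: norm_mult mult.commute)
qed

text \<open>Cauchy estimates turn uniform closeness of the functions into uniform closeness of the
  derivatives on smaller balls. The real theorem on differentiating a sequence then applies, and
  complex linearity survives pointwise limits.\<close>

lemma holomorphic_Cn_limit:
  fixes h :: "nat \<Rightarrow> complex ^ 'n::finite \<Rightarrow> complex"
  assumes hol: "\<And>i. holomorphic_Cn (h i) (ball 0 1)"
    and unif: "\<And>s e. s < 1 \<Longrightarrow> 0 < e \<Longrightarrow>
      \<exists>N. \<forall>i\<ge>N. \<forall>j\<ge>N. \<forall>z. norm z \<le> s \<longrightarrow> cmod (h i z - h j z) \<le> e"
  shows "holomorphic_Cn (\<lambda>z. lim (\<lambda>i. h i z)) (ball 0 1)"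
    and "\<And>z. z \<in> ball 0 1 \<Longrightarrow> (\<lambda>i. h i z) \<longlonglongrightarrow> lim (\<lambda>i. h i z)"
proof -
  have "\<forall>i. \<forall>x\<in>ball 0 1. \<exists>D. (h i has_derivative D) (at x) \<and> Vector_Spaces.linear (*s) (*) D"
    using hol by (auto simp: holomorphic_Cn_def)
  then obtain D where D: "\<And>i x. x \<in> ball 0 1 \<Longrightarrow> (h i has_derivative D i x) (at x)"
    "\<And>i x. x \<in> ball 0 1 \<Longrightarrow> Vector_Spaces.linear (*s) (*) (D i x)"
    by metis
  show conv: "(\<lambda>i. h i z) \<longlonglongrightarrow> lim (\<lambda>i. h i z)" if z: "z \<in> ball 0 1" for z
  proof -
    have "Cauchy (\<lambda>i. h i z)"
    proof (rule metric_CauchyI)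
      fix e :: real assume "e > 0"
      then obtain N where "\<forall>i\<ge>N. \<forall>j\<ge>N. \<forall>y. norm y \<le> norm z \<longrightarrow> cmod (h i y - h j y) \<le> e / 2"
        using unif[of "norm z" "e / 2"] z half_gt_zero[of e] unfolding mem_ball dist_0_norm by blast
      then show "\<exists>N. \<forall>i\<ge>N. \<forall>j\<ge>N. dist (h i z) (h j z) < e"
        using \<open>e > 0\<close> by (intro exI[of _ N]) (force simp: dist_norm)
    qed
    then show ?thesis by (simp add: Cauchy_convergent_iff convergent_LIMSEQ_iff)
  qed
  have near: "\<exists>N. \<forall>i\<ge>N. \<forall>j\<ge>N. \<forall>x\<in>ball z ((1 - norm z) / 4). \<forall>v. cmod (D i x v - D j x v) \<le> e * norm v"
    if z: "z \<in> ball 0 1" and e: "0 < e" for z e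
  proof -
    \<comment> \<open>Points within \<open>\<rho>\<close> of \<open>z\<close>, together with discs
      of radius \<open>\<rho>\<close> around them, stay in the ball of radius
      \<open>norm z + 2 * \<rho> < 1\<close>.\<close>
    define \<rho> where "\<rho> = (1 - norm z) / 4"
    have \<rho>: "0 < \<rho>" using z by (simp add: \<rho>_def)
    obtain N where N: "\<And>i j y. i \<ge> N \<Longrightarrow> j \<ge> N \<Longrightarrow> norm y \<le> norm z + 2 * \<rho> \<Longrightarrow> cmod (h i y - h j y) \<le> e * \<rho>"
      using unif[of "norm z + 2 * \<rho>" "e * \<rho>"] e \<rho> z by (auto simp: \<rho>_def field_simps)
    have "cmod (D i x v - D j x v) \<le> e * norm v"
      if ij: "i \<ge> N" "j \<ge> N" and x: "x \<in> ball z \<rho>" for i j x v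
    proof -
      have nx: "norm x < norm z + \<rho>"
        using x norm_triangle_ineq2[of x z] by (auto simp: dist_norm norm_minus_commute)
      then have x1: "x \<in> ball 0 1" using \<rho> by (simp add: \<rho>_def field_simps)
      have "cmod ((\<lambda>v. 1 * D i x v + (-1) * D j x v) v) \<le> (e * \<rho>) / \<rho> * norm v"
      proof (rule holomorphic_Cn_cauchy_estimate)
        show "((\<lambda>y. h i y - h j y) has_derivative (\<lambda>v. 1 * D i x v + (-1) * D j x v)) (at x)"
          using has_derivative_diff[OF D(1)[OF x1, of i] D(1)[OF x1, of j]] by simp
        show "Vector_Spaces.linear (*s) (*) (\<lambda>v. 1 * D i x v + (-1) * D j x v)"
          by (intro linear_Cn_lincomb D x1)
        show "holomorphic_Cn (\<lambda>y. h i y - h j y) (ball 0 1)"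
          unfolding holomorphic_Cn_def
        proof
          fix y :: "complex ^ 'n" assume y: "y \<in> ball 0 1"
          have "((\<lambda>y. h i y - h j y) has_derivative (\<lambda>v. 1 * D i y v + (-1) * D j y v)) (at y)"
            using has_derivative_diff[OF D(1)[OF y, of i] D(1)[OF y, of j]] by simp
          then show "\<exists>E. ((\<lambda>y. h i y - h j y) has_derivative E) (at y) \<and> Vector_Spaces.linear (*s) (*) E"
            using linear_Cn_lincomb[OF D(2)[OF y, of i] D(2)[OF y, of j], of 1 "-1"] by blast
        qed
        show "0 < \<rho>" by fact
        show "norm x + \<rho> < 1" using nx z by (simp add: \<rho>_def field_simps)
        show "cmod (h i y - h j y) \<le> e * \<rho>" if "norm y \<le> norm x + \<rho>" for y
          using N[OF ij, of y] that nx by linarith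
      qed
      then show ?thesis using \<rho> by simp
    qed
    then show ?thesis unfolding \<rho>_def by blast
  qed
  define E where "E x v = lim (\<lambda>i. D i x v)" for x v
  have convD: "(\<lambda>i. D i x v) \<longlonglongrightarrow> E x v" if x: "x \<in> ball 0 1" for x v
  proof -
    have "Cauchy (\<lambda>i. D i x v)"
    proof (rule metric_CauchyI)
      fix e :: real assume "e > 0"
      define X where "X = 1 + norm v"
      have X: "0 < X" "norm v \<le> X" by (auto simp: X_def add_pos_nonneg)
      define e' where "e' = e / (2 * X)"
      have e': "0 < e'" "e' * norm v < e"
      proof -
        show "0 < e'" using \<open>e > 0\<close> X by (simp add: e'_def)
        have "e' * norm v \<le> e' * X" using \<open>0 < e'\<close> X by (intro mult_left_mono) auto
        also have "\<dots> = e / 2" using X by (simp add: e'_def)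
        finally show "e' * norm v < e" using \<open>e > 0\<close> by simp
      qed
      obtain N where "\<forall>i\<ge>N. \<forall>j\<ge>N. \<forall>y\<in>ball x ((1 - norm x) / 4). \<forall>v. cmod (D i y v - D j y v) \<le> e' * norm v"
        using near[OF x e'(1)] by blast
      moreover have "x \<in> ball x ((1 - norm x) / 4)" using x by simp
      ultimately show "\<exists>N. \<forall>i\<ge>N. \<forall>j\<ge>N. dist (D i x v) (D j x v) < e"
        using e'(2) unfolding dist_norm by (meson le_less_trans)
    qed
    then show ?thesis by (simp add: E_def Cauchy_convergent_iff convergent_LIMSEQ_iff)
  qed
  show "holomorphic_Cn (\<lambda>z. lim (\<lambda>i. h i z)) (ball 0 1)"
    unfolding holomorphic_Cn_def
  proof
    fix z :: "complex ^ 'n" assume z: "z \<in> ball 0 1"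
    let ?S = "ball z ((1 - norm z) / 4)"
    have S1: "x \<in> ball 0 1" if "x \<in> ?S" for x
      using that z norm_triangle_ineq2[of x z] by (auto simp: dist_norm norm_minus_commute)
    have zS: "z \<in> ?S" using z by simp
    have "\<exists>g. \<forall>x\<in>?S. (\<lambda>i. h i x) \<longlonglongrightarrow> g x \<and> (g has_derivative E x) (at x within ?S)"
    proof (rule has_derivative_sequence[where f' = D])
      show "(h n has_derivative D n x) (at x within ?S)" if "x \<in> ?S" for n x
        using D(1)[OF S1[OF that]] by (rule has_derivative_at_withinI)
      fix e :: real assume e: "0 < e"
      obtain N where N: "\<forall>i\<ge>N. \<forall>j\<ge>N. \<forall>x\<in>?S. \<forall>v. cmod (D i x v - D j x v) \<le> e * norm v"
        using near[OF z e] by blast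
      have "cmod (D n x v - E x v) \<le> e * norm v" if n: "n \<ge> N" and x: "x \<in> ?S" for n x v
      proof (rule tendsto_upperbound)
        show "(\<lambda>j. cmod (D n x v - D j x v)) \<longlonglongrightarrow> cmod (D n x v - E x v)"
          by (intro tendsto_intros convD S1 x)
        show "\<forall>\<^sub>F j in sequentially. cmod (D n x v - D j x v) \<le> e * norm v"
          unfolding eventually_sequentially using N n x by blast
      qed simp
      then show "\<forall>\<^sub>F n in sequentially. \<forall>x\<in>?S. \<forall>v. cmod (D n x v - E x v) \<le> e * norm v"
        unfolding eventually_sequentially by blast
    qed (use zS conv[OF z] in auto)
    then obtain g where g: "\<And>x. x \<in> ?S \<Longrightarrow> (\<lambda>i. h i x) \<longlonglongrightarrow> g x"
      "(g has_derivative E z) (at z within ?S)" using zS by blast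
    have "(g has_derivative E z) (at z)" using g(2) by (simp only: at_within_open[OF zS open_ball])
    then have "((\<lambda>z. lim (\<lambda>i. h i z)) has_derivative E z) (at z)"
      by (rule has_derivative_transform_within_open[OF _ open_ball zS])
         (rule limI[OF g(1), symmetric])
    moreover have "Vector_Spaces.linear (*s) (*) (E z)"
    proof -
      have "E z (u + v) = E z u + E z v" for u v
      proof (rule LIMSEQ_unique[OF convD[OF z]])
        interpret D: Vector_Spaces.linear "(*s)" "(*)" "D i z" for i by (rule D(2)[OF z])
        show "(\<lambda>i. D i z (u + v)) \<longlonglongrightarrow> E z u + E z v"
          unfolding D.add by (intro tendsto_intros convD z)
      qed
      moreover have "E z (c *s v) = c * E z v" for c v
      proof (rule LIMSEQ_unique[OF convD[OF z]])
        interpret D: Vector_Spaces.linear "(*s)" "(*)" "D i z" for i by (rule D(2)[OF z])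
        show "(\<lambda>i. D i z (c *s v)) \<longlonglongrightarrow> c * E z v"
          unfolding D.scale by (intro tendsto_intros convD z)
      qed
      ultimately show ?thesis by unfold_locales (auto simp: algebra_simps)
    qed
    ultimately show "\<exists>D. ((\<lambda>z. lim (\<lambda>i. h i z)) has_derivative D) (at z) \<and> Vector_Spaces.linear (*s) (*) D"
      by blast
  qed
qed

text \<open>The pointwise bound makes the sequence uniformly Cauchy on smaller balls, which provides
  a holomorphic limit; Fatou's lemma transfers the norm estimate to it.\<close>

lemma hardy_space_complete:
  fixes h :: "nat \<Rightarrow> complex ^ 'n::finite \<Rightarrow> complex"
  assumes h: "\<And>i. h i \<in> hardy_space"
    and cauchy: "\<And>e. 0 < e \<Longrightarrow> \<exists>N. \<forall>i\<ge>N. \<forall>j\<ge>N. hardy_norm (\<lambda>z. h i z - h j z) \<le> e"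
  shows "\<exists>g\<in>hardy_space. (\<lambda>i. hardy_norm (\<lambda>z. h i z - g z)) \<longlonglongrightarrow> 0"
proof -
  have h0: "h i \<in> hol0" for i using h by (rule hardy_hol0)
  have [measurable]: "h i \<in> borel_measurable borel" for i using h0 by (rule hol0_measurable)
  have unif: "\<exists>N. \<forall>i\<ge>N. \<forall>j\<ge>N. \<forall>z. norm z \<le> s \<longrightarrow> cmod (h i z - h j z) \<le> e"
    if s: "s < 1" and e: "0 < e" for s e
  proof -
    define \<rho> where "\<rho> = min (1 / 4) ((1 - s) / 2)"
    have \<rho>: "0 < \<rho>" "2 * \<rho> < 1" "s \<le> 1 - 2 * \<rho>" using s by (auto simp: \<rho>_def min_def field_simps)
    define K where "K = sqrt (inverse \<rho> ^ DIM(complex ^ 'n))"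
    have K: "0 < K" using \<rho> by (simp add: K_def)
    obtain N where N: "\<And>i j. i \<ge> N \<Longrightarrow> j \<ge> N \<Longrightarrow> hardy_norm (\<lambda>z. h i z - h j z) \<le> e / K"
      using cauchy[of "e / K"] e K by auto
    have "cmod (h i z - h j z) \<le> e" if "i \<ge> N" "j \<ge> N" "norm z \<le> s" for i j z
    proof -
      have "cmod (h i z - h j z) \<le> K * hardy_norm (\<lambda>z. h i z - h j z)"
        unfolding K_def using hardy_norm_pointwise[OF hardy_space_diff[OF h h] \<rho>(1,2)] \<rho>(3) that(3) by auto
      also have "\<dots> \<le> K * (e / K)" using N that K by (intro mult_left_mono) auto
      finally show ?thesis using K by simp
    qed
    then show ?thesis by blast
  qed
  define g where "g z = lim (\<lambda>i. h i z)" for z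
  have hol: "holomorphic_Cn (h i) (ball 0 1)" for i using h0 by (simp add: hol0_def)
  have conv: "(\<lambda>i. h i z) \<longlonglongrightarrow> g z" for z
  proof (cases "z \<in> ball 0 1")
    case True
    then show ?thesis unfolding g_def using holomorphic_Cn_limit(2)[OF hol unif] by blast
  next
    case False
    then have "h i z = 0" for i using h0[of i] by (auto simp: hol0_def)
    then show ?thesis by (simp add: g_def)
  qed
  have g0: "g \<in> hol0"
  proof -
    have "holomorphic_Cn g (ball 0 1)"
      unfolding g_def[abs_def] using holomorphic_Cn_limit(1)[OF hol unif] by blast
    moreover have "g z = 0" if "z \<notin> ball 0 1" for z
      using conv[of z] h0 that by (auto simp: hol0_def LIMSEQ_const_iff)
    ultimately show ?thesis by (simp add: hol0_def)
  qed
  have [measurable]: "g \<in> borel_measurable borel" using g0 by (rule hol0_measurable)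
  have close: "\<exists>N. \<forall>i\<ge>N. N2 (\<lambda>z. h i z - g z) \<le> ennreal (e\<^sup>2)" if e: "0 < e" for e
  proof -
    obtain N where N: "\<And>i j. i \<ge> N \<Longrightarrow> j \<ge> N \<Longrightarrow> hardy_norm (\<lambda>z. h i z - h j z) \<le> e"
      using cauchy[OF e] by auto
    have "S2 (\<lambda>z. h i z - g z) r \<le> ennreal (e\<^sup>2)" if i: "i \<ge> N" and r: "r \<in> {0<..<1}" for i r
    proof -
      have "S2 (\<lambda>z. h i z - g z) r =
          (\<integral>\<^sup>+x. liminf (\<lambda>j. ennreal ((cmod (h i (r *\<^sub>R x) - h j (r *\<^sub>R x)))\<^sup>2)) \<partial>unif_sphere)"
        unfolding S2_def
      proof (rule nn_integral_cong)
        fix x :: "complex ^ 'n"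
        have "(\<lambda>j. ennreal ((cmod (h i (r *\<^sub>R x) - h j (r *\<^sub>R x)))\<^sup>2)) \<longlonglongrightarrow>
            ennreal ((cmod (h i (r *\<^sub>R x) - g (r *\<^sub>R x)))\<^sup>2)"
          by (intro tendsto_ennrealI tendsto_intros conv)
        then show "ennreal ((cmod (h i (r *\<^sub>R x) - g (r *\<^sub>R x)))\<^sup>2) =
            liminf (\<lambda>j. ennreal ((cmod (h i (r *\<^sub>R x) - h j (r *\<^sub>R x)))\<^sup>2))"
          by (intro lim_imp_Liminf[symmetric]) auto
      qed
      also have "\<dots> \<le> liminf (\<lambda>j. S2 (\<lambda>z. h i z - h j z) r)"
        unfolding S2_def by (rule nn_integral_liminf) measurable
      also have "\<dots> \<le> limsup (\<lambda>j. S2 (\<lambda>z. h i z - h j z) r)" by (rule Liminf_le_Limsup) simp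
      also have "\<dots> \<le> ennreal (e\<^sup>2)"
      proof (rule Limsup_bounded)
        have "S2 (\<lambda>z. h i z - h j z) r \<le> ennreal (e\<^sup>2)" if j: "j \<ge> N" for j
        proof -
          have d: "(\<lambda>z. h i z - h j z) \<in> hardy_space" by (intro hardy_space_diff h)
          have "S2 (\<lambda>z. h i z - h j z) r \<le> N2 (\<lambda>z. h i z - h j z)"
            using r by (intro S2_le_N2 hardy_hol0[OF d]) auto
          also have "\<dots> = ennreal ((hardy_norm (\<lambda>z. h i z - h j z))\<^sup>2)" by (simp add: hardy_norm_eq[OF d])
          also have "\<dots> \<le> ennreal (e\<^sup>2)"
            using N[OF i j] hardy_norm_eq(1)[OF d] by (intro ennreal_leI power_mono)
          finally show ?thesis .
        qed
        then show "\<forall>\<^sub>F j in sequentially. S2 (\<lambda>z. h i z - h j z) r \<le> ennreal (e\<^sup>2)"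
          by (auto simp: eventually_sequentially)
      qed
      finally show ?thesis .
    qed
    then have "N2 (\<lambda>z. h i z - g z) \<le> ennreal (e\<^sup>2)" if "i \<ge> N" for i
      unfolding N2_def using that by (intro SUP_least) auto
    then show ?thesis by blast
  qed
  have diff: "(\<lambda>z. h i z - g z) \<in> hardy_space" if "N2 (\<lambda>z. h i z - g z) \<le> ennreal (e\<^sup>2)" for i e
    using hol0_diff[OF h0 g0] that by (auto simp: hardy_space_iff intro: le_less_trans)
  have g: "g \<in> hardy_space"
  proof -
    obtain N where "N2 (\<lambda>z. h N z - g z) \<le> ennreal (1\<^sup>2)" using close[of 1] by auto
    from hardy_space_diff[OF h[of N] diff[OF this]] show ?thesis by simp
  qed
  have "(\<lambda>i. hardy_norm (\<lambda>z. h i z - g z)) \<longlonglongrightarrow> 0"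
  proof (rule LIMSEQ_I)
    fix e :: real assume e: "0 < e"
    then obtain N where N: "\<And>i. i \<ge> N \<Longrightarrow> N2 (\<lambda>z. h i z - g z) \<le> ennreal ((e / 2)\<^sup>2)"
      using close[of "e / 2"] by auto
    have "norm (hardy_norm (\<lambda>z. h i z - g z) - 0) < e" if "i \<ge> N" for i
    proof -
      have d: "(\<lambda>z. h i z - g z) \<in> hardy_space" using N[OF that] by (rule diff)
      have "ennreal ((hardy_norm (\<lambda>z. h i z - g z))\<^sup>2) \<le> ennreal ((e / 2)\<^sup>2)"
        using N[OF that] by (simp only: hardy_norm_eq(2)[OF d])
      then have "(hardy_norm (\<lambda>z. h i z - g z))\<^sup>2 \<le> (e / 2)\<^sup>2" by (subst (asm) ennreal_le_iff) auto
      then have "hardy_norm (\<lambda>z. h i z - g z) \<le> e / 2" by (rule power2_le_imp_le) (use e in simp)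
      then show ?thesis using e hardy_norm_eq(1)[OF d] by simp
    qed
    then show "\<exists>N. \<forall>i\<ge>N. norm (hardy_norm (\<lambda>z. h i z - g z) - 0) < e" by blast
  qed
  then show ?thesis using g by blast
qed

section \<open>Inner product and representation of functionals\<close>

lemma hardy_inner_lincomb_left:
  assumes h: "h \<in> hardy_space" and k: "k \<in> hardy_space" and g: "L2S g"
  shows "(\<integral>x. radial_limit (\<lambda>z. a * h z + b * k z) x * cnj (g x) \<partial>surface_measure) =
    a * (\<integral>x. radial_limit h x * cnj (g x) \<partial>surface_measure) +
    b * (\<integral>x. radial_limit k x * cnj (g x) \<partial>surface_measure)"
proof -
  note ih = L2S_prod[OF L2S_radial_limit(1)[OF h] g] and ik = L2S_prod[OF L2S_radial_limit(1)[OF k] g]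
  have [measurable]: "radial_limit h \<in> borel_measurable surface_measure"
    "radial_limit k \<in> borel_measurable surface_measure" "g \<in> borel_measurable surface_measure"
    "radial_limit (\<lambda>z. a * h z + b * k z) \<in> borel_measurable surface_measure"
    using L2S_radial_limit(1)[OF h] L2S_radial_limit(1)[OF k] g
      L2S_radial_limit(1)[OF hardy_space_lincomb[OF h k]] by (auto simp: L2S_def)
  have "(\<integral>x. radial_limit (\<lambda>z. a * h z + b * k z) x * cnj (g x) \<partial>surface_measure) =
     (\<integral>x. a * (radial_limit h x * cnj (g x)) + b * (radial_limit k x * cnj (g x)) \<partial>surface_measure)"
    by (rule integral_cong_AE)
       (measurable, use AE_radial_limit_lincomb[OF h k, of a b] in
        \<open>auto simp: algebra_simps elim!: eventually_mono\<close>)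
  also have "\<dots> = a * (\<integral>x. radial_limit h x * cnj (g x) \<partial>surface_measure) +
    b * (\<integral>x. radial_limit k x * cnj (g x) \<partial>surface_measure)"
    using ih ik by simp
  finally show ?thesis .
qed

lemma hardy_inner_lincomb:
  assumes "h \<in> hardy_space" "k \<in> hardy_space" "g \<in> hardy_space"
  shows "hardy_inner (\<lambda>z. a * h z + b * k z) g = a * hardy_inner h g + b * hardy_inner k g"
  unfolding hardy_inner_def by (intro hardy_inner_lincomb_left L2S_radial_limit assms)

lemma hardy_inner_cnj: "hardy_inner k h = cnj (hardy_inner h k)"
proof -
  have "hardy_inner k h = (\<integral>x. cnj (radial_limit h x * cnj (radial_limit k x)) \<partial>surface_measure)"
    by (simp add: hardy_inner_def mult.commute)
  also have "\<dots> = cnj (hardy_inner h k)"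
    unfolding hardy_inner_def by (rule Bochner_Integration.integral_cnj)
  finally show ?thesis .
qed

lemma hardy_inner_lincomb_right:
  assumes "h \<in> hardy_space" "k \<in> hardy_space" "g \<in> hardy_space"
  shows "hardy_inner g (\<lambda>z. a * h z + b * k z) = cnj a * hardy_inner g h + cnj b * hardy_inner g k"
  using hardy_inner_lincomb[OF assms, of a b]
  by (simp add: hardy_inner_cnj[of g])

lemma hardy_inner_self:
  assumes "h \<in> hardy_space"
  shows "hardy_inner h h = of_real ((hardy_norm h)\<^sup>2)"
  unfolding hardy_inner_def L2S_radial_limit(2)[OF assms, symmetric]
  by (simp only: complex_norm_square[symmetric] integral_complex_of_real[symmetric])

lemma hardy_norm_lincomb:
  assumes h: "h \<in> hardy_space" and k: "k \<in> hardy_space"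
  shows "(hardy_norm (\<lambda>z. a * h z + b * k z))\<^sup>2 =
    (cmod a)\<^sup>2 * (hardy_norm h)\<^sup>2 + (cmod b)\<^sup>2 * (hardy_norm k)\<^sup>2 + 2 * Re (a * cnj b * hardy_inner h k)"
proof -
  have "of_real ((hardy_norm (\<lambda>z. a * h z + b * k z))\<^sup>2) =
      a * cnj a * hardy_inner h h + b * cnj b * hardy_inner k k +
      (a * cnj b * hardy_inner h k + cnj (a * cnj b * hardy_inner h k))"
    unfolding hardy_inner_self[OF hardy_space_lincomb[OF h k], symmetric]
      hardy_inner_lincomb[OF h k hardy_space_lincomb[OF h k]]
      hardy_inner_lincomb_right[OF h k h] hardy_inner_lincomb_right[OF h k k] hardy_inner_cnj[of k h]
    by (simp add: algebra_simps)
  also have "\<dots> = of_real ((cmod a)\<^sup>2 * (hardy_norm h)\<^sup>2 + (cmod b)\<^sup>2 * (hardy_norm k)\<^sup>2 +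
      2 * Re (a * cnj b * hardy_inner h k))"
    unfolding hardy_inner_self[OF h] hardy_inner_self[OF k] complex_add_cnj
    by (simp only: complex_norm_square[symmetric] of_real_add of_real_mult of_real_power)
  finally show ?thesis by (simp only: of_real_eq_iff)
qed

lemma hardy_inner_bound:
  assumes h: "h \<in> hardy_space" and k: "k \<in> hardy_space"
  shows "cmod (hardy_inner h k) \<le> hardy_norm h * hardy_norm k"
proof (rule power2_le_imp_le)
  show "(cmod (hardy_inner h k))\<^sup>2 \<le> (hardy_norm h * hardy_norm k)\<^sup>2"
    using L2S_cauchy_schwarz[OF L2S_radial_limit(1)[OF h] L2S_radial_limit(1)[OF k]]
    by (simp add: hardy_inner_def L2S_radial_limit(2)[OF h] L2S_radial_limit(2)[OF k] power_mult_distrib)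
qed (use hardy_norm_eq(1)[OF h] hardy_norm_eq(1)[OF k] in simp)

lemma hardy_norm_eq_0:
  fixes h :: "complex ^ 'n::finite \<Rightarrow> complex"
  assumes h: "h \<in> hardy_space" and 0: "hardy_norm h = 0"
  shows "h = (\<lambda>z. 0)"
proof
  fix z
  show "h z = 0"
  proof (cases "z \<in> ball 0 1")
    case True
    define \<rho> where "\<rho> = min (1 / 4) ((1 - norm z) / 2)"
    have "0 < \<rho>" "2 * \<rho> < 1" "norm z \<le> 1 - 2 * \<rho>" using True by (auto simp: \<rho>_def min_def field_simps)
    from hardy_norm_pointwise[OF h this] show ?thesis using 0 by simp
  next
    case False
    then show ?thesis using hardy_hol0[OF h] by (simp add: hol0_def)
  qed
qed

lemma hardy_eqI:
  assumes h: "h \<in> hardy_space" and k: "k \<in> hardy_space"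
    and eq: "\<And>g. g \<in> hardy_space \<Longrightarrow> hardy_inner h g = hardy_inner k g"
  shows "h = k"
proof -
  have d: "(\<lambda>z. h z - k z) \<in> hardy_space" using h k by (rule hardy_space_diff)
  have "hardy_inner (\<lambda>z. h z - k z) (\<lambda>z. h z - k z) = 0"
    using hardy_inner_lincomb[OF h k d, of 1 "-1"] eq[OF d] by simp
  then have "hardy_norm (\<lambda>z. h z - k z) = 0" by (simp add: hardy_inner_self[OF d])
  from hardy_norm_eq_0[OF d this] show ?thesis by (simp add: fun_eq_iff)
qed

lemma parallelogram_arith:
  fixes x a b c m p q :: real
  assumes "x = 2 * a + 2 * b - 4 * c" "a < m + p" "b < m + q" "m \<le> c"
  shows "x \<le> 2 * (p + q)"
  using assms by argo

text \<open>The representing vector minimises \<open>\<parallel>k\<parallel>\<^sup>2 - 2 Re (L k)\<close>; minimising sequences are Cauchy by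
  the parallelogram law.\<close>

lemma hardy_riesz:
  assumes lin: "\<And>a b h k. h \<in> hardy_space \<Longrightarrow> k \<in> hardy_space \<Longrightarrow>
      L (\<lambda>z. a * h z + b * k z) = a * L h + b * L k"
    and bdd: "\<And>k. k \<in> hardy_space \<Longrightarrow> cmod (L k) \<le> C * hardy_norm k"
  shows "\<exists>g\<in>hardy_space. \<forall>k\<in>hardy_space. L k = hardy_inner k g"
proof -
  define Q where "Q k = (hardy_norm k)\<^sup>2 - 2 * Re (L k)" for k
  have Q_ge: "- (C\<^sup>2) \<le> Q k" if k: "k \<in> hardy_space" for k
  proof -
    have "Re (L k) \<le> C * hardy_norm k" using complex_Re_le_cmod[of "L k"] bdd[OF k] by linarith
    moreover have "0 \<le> (hardy_norm k - C)\<^sup>2" by simp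
    moreover have "(hardy_norm k - C)\<^sup>2 = (hardy_norm k)\<^sup>2 - 2 * (C * hardy_norm k) + C\<^sup>2"
      by (simp add: power2_diff)
    ultimately show ?thesis unfolding Q_def by linarith
  qed
  define m where "m = Inf (Q ` hardy_space)"
  have bddQ: "bdd_below (Q ` hardy_space)" using Q_ge by (auto simp: bdd_below_def)
  have neQ: "Q ` hardy_space \<noteq> {}" using hardy_space_zero by auto
  have m_le: "m \<le> Q k" if "k \<in> hardy_space" for k
    unfolding m_def using that bddQ by (intro cInf_lower) auto
  have "\<exists>k\<in>hardy_space. Q k < m + inverse (real (Suc i))" for i
    using cInf_lessD[OF neQ, of "m + inverse (real (Suc i))"] by (auto simp: m_def)
  then obtain h where h: "\<And>i. h i \<in> hardy_space" and hQ: "\<And>i. Q (h i) < m + inverse (real (Suc i))"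
    by metis
  \<comment> \<open>The midpoint \<open>q\<close> has functional value at least \<open>m\<close>, so
    two nearly minimal vectors cannot lie far apart.\<close>
  have par: "(hardy_norm (\<lambda>z. h i z - h j z))\<^sup>2 \<le> 2 * (inverse (real (Suc i)) + inverse (real (Suc j)))" for i j
  proof -
    define q where "q = (\<lambda>z. (1/2) * h i z + (1/2) * h j z)"
    have q: "q \<in> hardy_space" unfolding q_def by (intro hardy_space_lincomb h)
    have "(hardy_norm (\<lambda>z. 1 * h i z + (-1) * h j z))\<^sup>2 + 4 * (hardy_norm q)\<^sup>2 =
        2 * (hardy_norm (h i))\<^sup>2 + 2 * (hardy_norm (h j))\<^sup>2"
      unfolding q_def hardy_norm_lincomb[OF h h] by (simp add: power2_eq_square)
    moreover have "L q = (1/2) * L (h i) + (1/2) * L (h j)"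
      unfolding q_def by (rule lin[OF h h])
    then have "2 * Re (L q) = Re (L (h i)) + Re (L (h j))" by simp
    ultimately have "(hardy_norm (\<lambda>z. h i z - h j z))\<^sup>2 = 2 * Q (h i) + 2 * Q (h j) - 4 * Q q"
      by (simp add: Q_def algebra_simps)
    then show ?thesis using parallelogram_arith hQ m_le[OF q] by blast
  qed
  have "\<exists>N. \<forall>i\<ge>N. \<forall>j\<ge>N. hardy_norm (\<lambda>z. h i z - h j z) \<le> e" if e: "0 < e" for e
  proof -
    have "0 < e\<^sup>2 / 4" using e by simp
    then obtain N where N: "inverse (real (Suc N)) < e\<^sup>2 / 4" using reals_Archimedean by blast
    have "hardy_norm (\<lambda>z. h i z - h j z) \<le> e" if "i \<ge> N" "j \<ge> N" for i j
    proof (rule power2_le_imp_le)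
      have "inverse (real (Suc i)) \<le> inverse (real (Suc N))" "inverse (real (Suc j)) \<le> inverse (real (Suc N))"
        using that by auto
      then show "(hardy_norm (\<lambda>z. h i z - h j z))\<^sup>2 \<le> e\<^sup>2" using par[of i j] N by argo
    qed (use e in simp)
    then show ?thesis by blast
  qed
  from hardy_space_complete[OF h this] obtain g where g: "g \<in> hardy_space"
    and lim: "(\<lambda>i. hardy_norm (\<lambda>z. h i z - g z)) \<longlonglongrightarrow> 0" by blast
  \<comment> \<open>The limit attains the infimum: \<open>Q g\<close> exceeds \<open>Q (h i)\<close>
    by at most terms linear in the distance \<open>d i\<close>.\<close>
  have Qg: "Q g \<le> m"
  proof (rule LIMSEQ_le_const)
    define d where "d i = hardy_norm (\<lambda>z. h i z - g z)" for i
    define G where "G = hardy_norm g"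
    have d0: "0 \<le> d i" for i unfolding d_def by (intro hardy_norm_eq(1) hardy_space_diff h g)
    have up: "Q g \<le> m + inverse (real (Suc i)) + 2 * C * d i + 2 * d i * G" for i
    proof -
      have dh: "(\<lambda>z. h i z - g z) \<in> hardy_space" by (intro hardy_space_diff h g)
      have "L (\<lambda>z. 1 * h i z + (-1) * g z) = 1 * L (h i) + (-1) * L g" by (rule lin[OF h g])
      then have l: "L (h i) - L g = L (\<lambda>z. h i z - g z)" by simp
      have 1: "Re (L (h i)) - Re (L g) \<le> C * d i"
        using bdd[OF dh] complex_Re_le_cmod[of "L (\<lambda>z. h i z - g z)"] by (simp add: d_def flip: l)
      have "(hardy_norm (\<lambda>z. 1 * g z + 1 * (h i z - g z)))\<^sup>2 = G\<^sup>2 + (d i)\<^sup>2 +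
          2 * Re (hardy_inner g (\<lambda>z. h i z - g z))"
        unfolding hardy_norm_lincomb[OF g dh] by (simp add: G_def d_def)
      then have "(hardy_norm (h i))\<^sup>2 = G\<^sup>2 + (d i)\<^sup>2 + 2 * Re (hardy_inner g (\<lambda>z. h i z - g z))" by simp
      moreover have "- (G * d i) \<le> Re (hardy_inner g (\<lambda>z. h i z - g z))"
        using hardy_inner_bound[OF g dh] abs_Re_le_cmod[of "hardy_inner g (\<lambda>z. h i z - g z)"]
        by (simp add: G_def d_def)
      moreover have "0 \<le> (d i)\<^sup>2" by simp
      ultimately have 2: "G\<^sup>2 \<le> (hardy_norm (h i))\<^sup>2 + 2 * (G * d i)" by linarith
      have "Q g \<le> Q (h i) + 2 * (C * d i) + 2 * (G * d i)"
        unfolding Q_def using 1 2 by (simp add: G_def)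
      then show ?thesis using hQ[of i] by (simp add: mult.assoc mult.commute[of "d i"] mult.left_commute[of 2])
    qed
    then show "\<exists>N. \<forall>i\<ge>N. Q g \<le> m + inverse (real (Suc i)) + 2 * C * d i + 2 * d i * G" by blast
    have "(\<lambda>i. m + inverse (real (Suc i)) + 2 * C * d i + 2 * d i * G) \<longlonglongrightarrow> m + 0 + 2 * C * 0 + 2 * 0 * G"
      unfolding d_def by (intro tendsto_intros lim LIMSEQ_inverse_real_of_nat)
    then show "(\<lambda>i. m + inverse (real (Suc i)) + 2 * C * d i + 2 * d i * G) \<longlonglongrightarrow> m" by simp
  qed
  have "L k = hardy_inner k g" if k: "k \<in> hardy_space" for k
  proof -
    define D where "D = hardy_inner k g - L k"
    \<comment> \<open>Minimality of \<open>g\<close> is compared with \<open>g + t * k\<close>,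
      where \<open>t = - (s * cnj D)\<close> points in the direction of descent; a small
      \<open>s\<close> then forces the defect \<open>D\<close> to vanish.\<close>
    have "(cmod D)\<^sup>2 * 2 \<le> (cmod D)\<^sup>2 * (s * (hardy_norm k)\<^sup>2)" if s: "0 < s" for s :: real
    proof -
      define t where "t = - (of_real s * cnj D)"
      have "(\<lambda>z. t * k z + 1 * g z) \<in> hardy_space" by (intro hardy_space_lincomb k g)
      from order_trans[OF Qg m_le[OF this]]
      have "0 \<le> (cmod t)\<^sup>2 * (hardy_norm k)\<^sup>2 + 2 * Re (t * hardy_inner k g) - 2 * Re (t * L k)"
        unfolding Q_def hardy_norm_lincomb[OF k g] lin[OF k g] by simp
      also have "\<dots> = (cmod t)\<^sup>2 * (hardy_norm k)\<^sup>2 + 2 * Re (t * D)"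
        by (simp add: D_def algebra_simps)
      also have "t * D = - of_real (s * (cmod D)\<^sup>2)"
        unfolding t_def of_real_mult complex_norm_square by (simp add: mult_ac)
      also have "(cmod t)\<^sup>2 = s\<^sup>2 * (cmod D)\<^sup>2"
        using s by (simp add: t_def norm_mult power_mult_distrib)
      finally have "s * ((cmod D)\<^sup>2 * 2) \<le> s * ((cmod D)\<^sup>2 * (s * (hardy_norm k)\<^sup>2))"
        by (simp add: power2_eq_square algebra_simps)
      then show ?thesis using s by simp
    qed
    \<comment> \<open>This step size makes the factor on the right less than 1, against the 2 on the
      left.\<close>
    from this[of "1 / (1 + (hardy_norm k)\<^sup>2)"]
    have "(cmod D)\<^sup>2 * 2 \<le> (cmod D)\<^sup>2 * ((hardy_norm k)\<^sup>2 / (1 + (hardy_norm k)\<^sup>2))"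
      by (simp add: add_pos_nonneg)
    also have "\<dots> \<le> (cmod D)\<^sup>2 * 1"
      by (intro mult_left_mono) (auto simp: divide_le_eq add_pos_nonneg)
    finally have "D = 0" by simp
    then show ?thesis by (simp add: D_def)
  qed
  then show ?thesis using g by blast
qed

section \<open>Iterates of the Toeplitz map\<close>

text \<open>The representing vector of the pairing with \<open>g\<close> is the projection. This
  makes the definite description in \<open>hardy_proj\<close> meaningful for square-integrable
  \<open>g\<close>.\<close>

lemma hardy_proj_ex1:
  fixes g :: "complex ^ 'n::finite \<Rightarrow> complex"
  assumes g: "L2S g"
  shows "\<exists>!h. h \<in> hardy_space \<and>
    (\<forall>k\<in>hardy_space. (\<integral>\<zeta>. (g \<zeta> - radial_limit h \<zeta>) * cnj (radial_limit k \<zeta>) \<partial>surface_measure) = 0)"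
proof -
  let ?L = "\<lambda>k. \<integral>x. radial_limit k x * cnj (g x) \<partial>surface_measure"
  have split: "(\<integral>\<zeta>. (g \<zeta> - radial_limit h \<zeta>) * cnj (radial_limit k \<zeta>) \<partial>surface_measure) =
      cnj (?L k) - hardy_inner h k" if h: "h \<in> hardy_space" and k: "k \<in> hardy_space" for h k
  proof -
    have "(\<integral>\<zeta>. (g \<zeta> - radial_limit h \<zeta>) * cnj (radial_limit k \<zeta>) \<partial>surface_measure) =
        (\<integral>\<zeta>. g \<zeta> * cnj (radial_limit k \<zeta>) \<partial>surface_measure) - hardy_inner h k"
      unfolding hardy_inner_def left_diff_distrib
      by (intro Bochner_Integration.integral_diff L2S_prod g L2S_radial_limit h k)
    also have "(\<integral>\<zeta>. g \<zeta> * cnj (radial_limit k \<zeta>) \<partial>surface_measure) =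
        (\<integral>\<zeta>. cnj (radial_limit k \<zeta> * cnj (g \<zeta>)) \<partial>surface_measure)"
      by (simp add: mult.commute)
    also have "\<dots> = cnj (?L k)" by (rule Bochner_Integration.integral_cnj)
    finally show ?thesis .
  qed
  have "\<exists>p\<in>hardy_space. \<forall>k\<in>hardy_space. ?L k = hardy_inner k p"
  proof (rule hardy_riesz)
    show "?L (\<lambda>z. a * h z + b * k z) = a * ?L h + b * ?L k"
      if "h \<in> hardy_space" "k \<in> hardy_space" for a b h k
      using that g by (rule hardy_inner_lincomb_left)
    show "cmod (?L k) \<le> sqrt (\<integral>x. (cmod (g x))\<^sup>2 \<partial>surface_measure) * hardy_norm k" if k: "k \<in> hardy_space" for k
    proof (rule power2_le_imp_le)
      show "(cmod (?L k))\<^sup>2 \<le> (sqrt (\<integral>x. (cmod (g x))\<^sup>2 \<partial>surface_measure) * hardy_norm k)\<^sup>2"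
        using L2S_cauchy_schwarz[OF L2S_radial_limit(1)[OF k] g]
        by (simp add: power_mult_distrib L2S_radial_limit(2)[OF k] mult.commute)
    qed (simp add: hardy_norm_eq(1)[OF k])
  qed
  then obtain p where p: "p \<in> hardy_space" "\<And>k. k \<in> hardy_space \<Longrightarrow> ?L k = hardy_inner k p" by blast
  show ?thesis
  proof (rule ex1I[of _ p])
    show "p \<in> hardy_space \<and>
      (\<forall>k\<in>hardy_space. (\<integral>\<zeta>. (g \<zeta> - radial_limit p \<zeta>) * cnj (radial_limit k \<zeta>) \<partial>surface_measure) = 0)"
      using p by (auto simp: split hardy_inner_cnj[of p])
    fix h assume h: "h \<in> hardy_space \<and>
      (\<forall>k\<in>hardy_space. (\<integral>\<zeta>. (g \<zeta> - radial_limit h \<zeta>) * cnj (radial_limit k \<zeta>) \<partial>surface_measure) = 0)"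
    show "h = p"
    proof (rule hardy_eqI)
      fix k :: "complex ^ 'n \<Rightarrow> complex" assume k: "k \<in> hardy_space"
      have "(\<integral>\<zeta>. (g \<zeta> - radial_limit h \<zeta>) * cnj (radial_limit k \<zeta>) \<partial>surface_measure) = 0"
        using h k by blast
      then show "hardy_inner h k = hardy_inner p k"
        using h k p by (simp add: split hardy_inner_cnj[of p])
    qed (use h p in auto)
  qed
qed

lemma hardy_proj_spec:
  assumes "L2S g"
  shows "hardy_proj g \<in> hardy_space \<and> (\<forall>k\<in>hardy_space.
    (\<integral>\<zeta>. (g \<zeta> - radial_limit (hardy_proj g) \<zeta>) * cnj (radial_limit k \<zeta>) \<partial>surface_measure) = 0)"
  unfolding hardy_proj_def by (rule theI'[OF hardy_proj_ex1[OF assms]])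

lemma hardy_proj_mem: "L2S g \<Longrightarrow> hardy_proj g \<in> hardy_space"
  using hardy_proj_spec by blast

lemma hardy_proj_inner:
  assumes g: "L2S g" and k: "k \<in> hardy_space"
  shows "hardy_inner (hardy_proj g) k = (\<integral>\<zeta>. g \<zeta> * cnj (radial_limit k \<zeta>) \<partial>surface_measure)"
proof -
  have p: "hardy_proj g \<in> hardy_space" using g by (rule hardy_proj_mem)
  have "0 = (\<integral>\<zeta>. (g \<zeta> - radial_limit (hardy_proj g) \<zeta>) * cnj (radial_limit k \<zeta>) \<partial>surface_measure)"
    using conjunct2[OF hardy_proj_spec[OF g]] k by simp
  also have "\<dots> = (\<integral>\<zeta>. g \<zeta> * cnj (radial_limit k \<zeta>) \<partial>surface_measure) - hardy_inner (hardy_proj g) k"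
    unfolding hardy_inner_def left_diff_distrib
    by (intro Bochner_Integration.integral_diff L2S_prod g L2S_radial_limit p k)
  finally show ?thesis by simp
qed

lemma hardy_proj_eqI:
  fixes g :: "complex ^ 'n::finite \<Rightarrow> complex"
  assumes g: "L2S g" and h: "h \<in> hardy_space"
    and eq: "\<And>k. k \<in> hardy_space \<Longrightarrow>
      hardy_inner h k = (\<integral>\<zeta>. g \<zeta> * cnj (radial_limit k \<zeta>) \<partial>surface_measure)"
  shows "hardy_proj g = h"
  using hardy_proj_inner[OF g] eq by (intro hardy_eqI hardy_proj_mem g h) simp

section \<open>Coordinate multiplications and the Toeplitz map\<close>

lemma hardy_space_mult:
  assumes h: "h \<in> hardy_space" and k: "holomorphic_Cn k (ball 0 1)"
    and B: "\<And>z. z \<in> ball 0 1 \<Longrightarrow> cmod (k z) \<le> B"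
  shows "(\<lambda>z. k z * h z) \<in> hardy_space"
proof -
  have h0: "h \<in> hol0" and fin: "N2 h < \<infinity>" using h by (auto simp: hardy_space_iff)
  have m [measurable]: "h \<in> borel_measurable borel" using h0 by (rule hol0_measurable)
  have "S2 (\<lambda>z. k z * h z) r \<le> ennreal (B\<^sup>2) * N2 h" if r: "r \<in> {0<..<1}" for r
  proof -
    have "S2 (\<lambda>z. k z * h z) r \<le> (\<integral>\<^sup>+x. ennreal (B\<^sup>2) * ennreal ((cmod (h (r *\<^sub>R x)))\<^sup>2) \<partial>unif_sphere)"
      unfolding S2_def
    proof (rule nn_integral_mono_AE, rule eventually_mono[OF AE_unif_sphere])
      fix x :: "complex ^ 'a" assume "norm x = 1"
      then have "r *\<^sub>R x \<in> ball 0 1" using r by simp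
      then have "(cmod (k (r *\<^sub>R x) * h (r *\<^sub>R x)))\<^sup>2 \<le> B\<^sup>2 * (cmod (h (r *\<^sub>R x)))\<^sup>2"
        using B[of "r *\<^sub>R x"] unfolding norm_mult power_mult_distrib
        by (intro mult_right_mono power_mono) auto
      then show "ennreal ((cmod (k (r *\<^sub>R x) * h (r *\<^sub>R x)))\<^sup>2) \<le> ennreal (B\<^sup>2) * ennreal ((cmod (h (r *\<^sub>R x)))\<^sup>2)"
        by (simp flip: ennreal_mult)
    qed
    also have "\<dots> = ennreal (B\<^sup>2) * S2 h r" unfolding S2_def by (rule nn_integral_cmult) measurable
    also have "\<dots> \<le> ennreal (B\<^sup>2) * N2 h" using r by (intro mult_left_mono S2_le_N2 h0) auto
    finally show ?thesis .
  qed
  then have "N2 (\<lambda>z. k z * h z) \<le> ennreal (B\<^sup>2) * N2 h"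
    unfolding N2_def[of "\<lambda>z. k z * h z"] by (rule SUP_least)
  also have "\<dots> < \<infinity>" using fin by (simp add: ennreal_mult_less_top)
  finally show ?thesis using hol0_mult[OF h0 k] by (simp add: hardy_space_iff)
qed

lemma holomorphic_Cn_linear:
  fixes L :: "complex ^ 'n::finite \<Rightarrow> complex"
  assumes "Vector_Spaces.linear (*s) (*) L"
  shows "holomorphic_Cn (\<lambda>z. L z + c) S"
proof -
  interpret L: Vector_Spaces.linear "(*s)" "(*)" L by fact
  have "bounded_linear L"
    by (intro linear_conv_bounded_linear[THEN iffD1] linearI)
      (auto simp: L.add L.scale scaleR_eq_vector_scalar_mult scaleR_conv_of_real)
  then have "((\<lambda>z. L z + c) has_derivative L) (at z)" for z
    by (auto intro!: derivative_eq_intros bounded_linear_imp_has_derivative)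
  then show ?thesis using assms by (auto simp: holomorphic_Cn_def)
qed

lemma linear_component: "Vector_Spaces.linear (*s) (*) (\<lambda>z :: complex ^ 'n. z $ j)"
  by unfold_locales auto

lemma hardy_space_coord:
  assumes "h \<in> hardy_space"
  shows "(\<lambda>z. z $ j * h z) \<in> hardy_space"
proof (rule hardy_space_mult[OF assms])
  show "holomorphic_Cn (\<lambda>z. z $ j) (ball 0 1)"
    using holomorphic_Cn_linear[OF linear_component[of j], of 0] by simp
  show "cmod (z $ j) \<le> 1" if "z \<in> ball 0 1" for z :: "complex ^ 'a"
    using Finite_Cartesian_Product.norm_nth_le[of z j] that by simp
qed

lemma component_measurable [measurable]:
  "(\<lambda>z :: complex ^ 'n::finite. z $ j) \<in> borel_measurable borel"
  by (intro borel_measurable_continuous_onI continuous_intros)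

lemma AE_radial_limit_coord:
  assumes "h \<in> hardy_space"
  shows "AE x in surface_measure. radial_limit (\<lambda>z. z $ j * h z) x = x $ j * radial_limit h x"
  by (rule AE_radial_limit_mult[OF assms]) (intro continuous_intros)

lemma L2S_coord:
  assumes "h \<in> hardy_space"
  shows "L2S (\<lambda>x. x $ j * radial_limit h x)" and "L2S (\<lambda>x. cnj (x $ j) * radial_limit h x)"
proof -
  have "cmod (x $ j) \<le> 1" if "norm x = 1" for x :: "complex ^ 'a"
    using Finite_Cartesian_Product.norm_nth_le[of x j] that by simp
  then show "L2S (\<lambda>x. x $ j * radial_limit h x)" "L2S (\<lambda>x. cnj (x $ j) * radial_limit h x)"
    using assms by (auto intro!: L2S_mult_bounded[where B = 1] L2S_radial_limit)
qed

text \<open>The product with a coordinate function already lies in the Hardy space, so the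
  projection leaves it unchanged.\<close>

lemma toeplitz_coord:
  fixes h :: "complex ^ 'n::finite \<Rightarrow> complex"
  assumes h: "h \<in> hardy_space"
  shows "toeplitz (\<lambda>\<zeta>. \<zeta> $ j) h = (\<lambda>z. z $ j * h z)"
  unfolding toeplitz_def
proof (rule hardy_proj_eqI[OF L2S_coord(1)[OF h] hardy_space_coord[OF h]])
  fix k :: "complex ^ 'n \<Rightarrow> complex" assume k: "k \<in> hardy_space"
  have [measurable]: "radial_limit h \<in> borel_measurable surface_measure"
    "radial_limit k \<in> borel_measurable surface_measure"
    "radial_limit (\<lambda>z. z $ j * h z) \<in> borel_measurable surface_measure"
    using L2S_radial_limit(1)[OF h] L2S_radial_limit(1)[OF k]
      L2S_radial_limit(1)[OF hardy_space_coord[OF h]] by (auto simp: L2S_def)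
  show "hardy_inner (\<lambda>z. z $ j * h z) k =
      (\<integral>\<zeta>. \<zeta> $ j * radial_limit h \<zeta> * cnj (radial_limit k \<zeta>) \<partial>surface_measure)"
    unfolding hardy_inner_def
    by (rule integral_cong_AE)
       (measurable, use AE_radial_limit_coord[OF h, of j] in \<open>auto elim!: eventually_mono\<close>)
qed

text \<open>The orthogonality that defines the projection removes it from the pairing, and the
  conjugated coordinate moves to the other argument.\<close>

lemma toeplitz_cnj_coord:
  fixes h k :: "complex ^ 'n::finite \<Rightarrow> complex"
  assumes h: "h \<in> hardy_space"
  shows "toeplitz (\<lambda>\<zeta>. cnj (\<zeta> $ j)) h \<in> hardy_space"
    and "k \<in> hardy_space \<Longrightarrow> hardy_inner (toeplitz (\<lambda>\<zeta>. cnj (\<zeta> $ j)) h) k = hardy_inner h (\<lambda>z. z $ j * k z)"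
proof -
  show "toeplitz (\<lambda>\<zeta>. cnj (\<zeta> $ j)) h \<in> hardy_space"
    unfolding toeplitz_def by (rule hardy_proj_mem[OF L2S_coord(2)[OF h]])
  assume k: "k \<in> hardy_space"
  have [measurable]: "radial_limit h \<in> borel_measurable surface_measure"
    "radial_limit k \<in> borel_measurable surface_measure"
    "radial_limit (\<lambda>z. z $ j * k z) \<in> borel_measurable surface_measure"
    using L2S_radial_limit(1)[OF h] L2S_radial_limit(1)[OF k]
      L2S_radial_limit(1)[OF hardy_space_coord[OF k]] by (auto simp: L2S_def)
  have "hardy_inner (toeplitz (\<lambda>\<zeta>. cnj (\<zeta> $ j)) h) k =
      (\<integral>\<zeta>. cnj (\<zeta> $ j) * radial_limit h \<zeta> * cnj (radial_limit k \<zeta>) \<partial>surface_measure)"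
    unfolding toeplitz_def by (rule hardy_proj_inner[OF L2S_coord(2)[OF h] k])
  also have "\<dots> = hardy_inner h (\<lambda>z. z $ j * k z)"
    unfolding hardy_inner_def
    by (rule integral_cong_AE)
       (measurable, use AE_radial_limit_coord[OF k, of j] in \<open>auto elim!: eventually_mono\<close>)
  finally show "hardy_inner (toeplitz (\<lambda>\<zeta>. cnj (\<zeta> $ j)) h) k = hardy_inner h (\<lambda>z. z $ j * k z)" .
qed

lemma hardy_inner_sum_left:
  assumes "finite I" "\<And>i. i \<in> I \<Longrightarrow> h i \<in> hardy_space" "k \<in> hardy_space"
  shows "hardy_inner (\<lambda>z. \<Sum>i\<in>I. h i z) k = (\<Sum>i\<in>I. hardy_inner (h i) k)"
  using assms(1,2)
proof (induction I)
  case empty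
  show ?case using hardy_inner_lincomb[OF assms(3) assms(3) assms(3), of 0 0] by simp
next
  case (insert i I)
  have "hardy_inner (\<lambda>z. 1 * h i z + 1 * (\<Sum>i\<in>I. h i z)) k =
      1 * hardy_inner (h i) k + 1 * hardy_inner (\<lambda>z. \<Sum>i\<in>I. h i z) k"
    using insert by (intro hardy_inner_lincomb hardy_space_sum assms(3)) auto
  then show ?case using insert by simp
qed

lemma toeplitz_map_mem:
  assumes B: "\<And>h. h \<in> hardy_space \<Longrightarrow> B h \<in> hardy_space" and h: "h \<in> hardy_space"
  shows "toeplitz_map B h \<in> hardy_space"
  unfolding toeplitz_map_def
  by (intro hardy_space_sum toeplitz_cnj_coord(1) B) (simp add: toeplitz_coord[OF h] hardy_space_coord h)

text \<open>In the weak form the outer Toeplitz factors become coordinate multiplications of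
  \<open>k\<close>. This is the formula that is iterated, so the projections inside the iterates
  never have to be computed.\<close>

lemma toeplitz_map_inner:
  assumes B: "\<And>h. h \<in> hardy_space \<Longrightarrow> B h \<in> hardy_space"
    and h: "h \<in> hardy_space" and k: "k \<in> hardy_space"
  shows "hardy_inner (toeplitz_map B h) k = (\<Sum>j\<in>UNIV. hardy_inner (B (\<lambda>z. z $ j * h z)) (\<lambda>z. z $ j * k z))"
  unfolding toeplitz_map_def toeplitz_coord[OF h]
  by (subst hardy_inner_sum_left)
     (auto intro!: toeplitz_cnj_coord B hardy_space_coord h k simp: toeplitz_cnj_coord(2)[OF B[OF hardy_space_coord[OF h]] k])

lemma toeplitz_map_power_mem:
  assumes B: "\<And>h. h \<in> hardy_space \<Longrightarrow> B h \<in> hardy_space" and h: "h \<in> hardy_space"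
  shows "(toeplitz_map ^^ m) B h \<in> hardy_space"
  using h
proof (induction m arbitrary: h)
  case (Suc m)
  then show ?case by (simp add: toeplitz_map_mem)
qed (simp add: B)

text \<open>Taking adjoints commutes with the Toeplitz map. The adjoint is given only by its
  pairings and not by a boundary formula, so its iterates are reached through those of the
  operator.\<close>

lemma toeplitz_map_power_duality:
  assumes B: "\<And>h. h \<in> hardy_space \<Longrightarrow> B h \<in> hardy_space"
    and B': "\<And>h. h \<in> hardy_space \<Longrightarrow> B' h \<in> hardy_space"
    and dual: "\<And>g h. g \<in> hardy_space \<Longrightarrow> h \<in> hardy_space \<Longrightarrow> hardy_inner (B g) h = hardy_inner g (B' h)"
    and g: "g \<in> hardy_space" and h: "h \<in> hardy_space"
  shows "hardy_inner ((toeplitz_map ^^ m) B g) h = hardy_inner g ((toeplitz_map ^^ m) B' h)"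
  using g h
proof (induction m arbitrary: g h)
  case (Suc m)
  note M = toeplitz_map_power_mem[of B, OF B, of _ m] toeplitz_map_power_mem[of B', OF B', of _ m]
  have "hardy_inner ((toeplitz_map ^^ Suc m) B g) h =
      (\<Sum>j\<in>UNIV. hardy_inner ((toeplitz_map ^^ m) B (\<lambda>z. z $ j * g z)) (\<lambda>z. z $ j * h z))"
    using toeplitz_map_inner[of "(toeplitz_map ^^ m) B", OF M(1) Suc.prems] by simp
  also have "\<dots> = (\<Sum>j\<in>UNIV. cnj (hardy_inner ((toeplitz_map ^^ m) B' (\<lambda>z. z $ j * h z)) (\<lambda>z. z $ j * g z)))"
    using Suc by (simp add: hardy_space_coord hardy_inner_cnj[of "\<lambda>z. z $ _ * g z"])
  also have "\<dots> = cnj (hardy_inner ((toeplitz_map ^^ Suc m) B' h) g)"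
    using toeplitz_map_inner[of "(toeplitz_map ^^ m) B'", OF M(2) Suc.prems(2,1)] by simp
  finally show ?case by (simp add: hardy_inner_cnj[of g])
qed (simp add: dual)

section \<open>Bounded operators and their adjoints\<close>

lemma hardy_boundedD:
  assumes "hardy_bounded B"
  shows "h \<in> hardy_space \<Longrightarrow> B h \<in> hardy_space"
    and "h \<in> hardy_space \<Longrightarrow> k \<in> hardy_space \<Longrightarrow> B (\<lambda>z. h z + k z) = (\<lambda>z. B h z + B k z)"
    and "h \<in> hardy_space \<Longrightarrow> B (\<lambda>z. c * h z) = (\<lambda>z. c * B h z)"
    and "\<exists>C. \<forall>h\<in>hardy_space. hardy_norm (B h) \<le> C * hardy_norm h"
  using assms by (simp_all add: hardy_bounded_def)

lemma hardy_bounded_lincomb: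
  assumes "hardy_bounded B" "h \<in> hardy_space" "k \<in> hardy_space"
  shows "B (\<lambda>z. a * h z + b * k z) = (\<lambda>z. a * B h z + b * B k z)"
  using hardy_boundedD(2)[OF assms(1) hardy_space_cmult[OF assms(2), of a] hardy_space_cmult[OF assms(3), of b]]
  by (simp add: hardy_boundedD(3)[OF assms(1,2)] hardy_boundedD(3)[OF assms(1,3)])

lemma hardy_adjoint_ex1:
  assumes B: "hardy_bounded B" and h: "h \<in> hardy_space"
  shows "\<exists>!k. k \<in> hardy_space \<and> (\<forall>g\<in>hardy_space. hardy_inner (B g) h = hardy_inner g k)"
proof -
  obtain C where C: "\<And>h. h \<in> hardy_space \<Longrightarrow> hardy_norm (B h) \<le> C * hardy_norm h"
    using hardy_boundedD(4)[OF B] by blast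
  have mem: "B g \<in> hardy_space" if "g \<in> hardy_space" for g using B that by (simp add: hardy_bounded_def)
  note lin = hardy_bounded_lincomb[OF B]
  have "\<exists>k\<in>hardy_space. \<forall>g\<in>hardy_space. hardy_inner (B g) h = hardy_inner g k"
  proof (rule hardy_riesz)
    show "hardy_inner (B (\<lambda>z. a * g z + b * k z)) h = a * hardy_inner (B g) h + b * hardy_inner (B k) h"
      if "g \<in> hardy_space" "k \<in> hardy_space" for a b g k
      unfolding lin[OF that] using that by (intro hardy_inner_lincomb mem h)
    show "cmod (hardy_inner (B k) h) \<le> (C * hardy_norm h) * hardy_norm k" if "k \<in> hardy_space" for k
    proof -
      have "cmod (hardy_inner (B k) h) \<le> hardy_norm (B k) * hardy_norm h"
        by (intro hardy_inner_bound mem that h)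
      also have "\<dots> \<le> (C * hardy_norm k) * hardy_norm h"
        using C[OF that] hardy_norm_eq(1)[OF h] by (rule mult_right_mono)
      finally show ?thesis by (simp add: mult_ac)
    qed
  qed
  moreover have "k = k'" if "k \<in> hardy_space" "k' \<in> hardy_space"
    "\<forall>g\<in>hardy_space. hardy_inner (B g) h = hardy_inner g k"
    "\<forall>g\<in>hardy_space. hardy_inner (B g) h = hardy_inner g k'" for k k'
    using that by (intro hardy_eqI) (auto simp: hardy_inner_cnj[of k] hardy_inner_cnj[of k'])
  ultimately show ?thesis by blast
qed

lemma hardy_adjoint_mem:
  assumes "hardy_bounded B" "h \<in> hardy_space"
  shows "hardy_adjoint B h \<in> hardy_space"
  unfolding hardy_adjoint_def using theI'[OF hardy_adjoint_ex1[OF assms]] by blast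

lemma hardy_adjoint_inner:
  assumes "hardy_bounded B" "h \<in> hardy_space" "g \<in> hardy_space"
  shows "hardy_inner (B g) h = hardy_inner g (hardy_adjoint B h)"
  unfolding hardy_adjoint_def using theI'[OF hardy_adjoint_ex1[OF assms(1,2)]] assms(3) by blast

lemma hardy_bounded_adjoint:
  assumes B: "hardy_bounded B"
  shows "hardy_bounded (hardy_adjoint B)"
proof -
  let ?A = "hardy_adjoint B"
  have mem: "B g \<in> hardy_space" if "g \<in> hardy_space" for g using B that by (simp add: hardy_bounded_def)
  note A = hardy_adjoint_mem[OF B] and adj = hardy_adjoint_inner[OF B]
  have adj': "hardy_inner (?A h) g = hardy_inner h (B g)" if "h \<in> hardy_space" "g \<in> hardy_space" for h g
    using adj[OF that] by (simp add: hardy_inner_cnj[of "?A h"] hardy_inner_cnj[of h])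
  have lin: "?A (\<lambda>z. a * h z + b * k z) = (\<lambda>z. a * ?A h z + b * ?A k z)"
    if h: "h \<in> hardy_space" and k: "k \<in> hardy_space" for a b h k
  proof (rule hardy_eqI)
    show "?A (\<lambda>z. a * h z + b * k z) \<in> hardy_space" "(\<lambda>z. a * ?A h z + b * ?A k z) \<in> hardy_space"
      by (intro A hardy_space_lincomb h k)+
    show "hardy_inner (?A (\<lambda>z. a * h z + b * k z)) g = hardy_inner (\<lambda>z. a * ?A h z + b * ?A k z) g"
      if g: "g \<in> hardy_space" for g
      using hardy_inner_lincomb[OF A[OF h] A[OF k] g] hardy_inner_lincomb[OF h k mem[OF g]]
      by (simp add: adj' g h k hardy_space_lincomb)
  qed
  obtain C where C: "\<And>h. h \<in> hardy_space \<Longrightarrow> hardy_norm (B h) \<le> C * hardy_norm h"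
    using hardy_boundedD(4)[OF B] by blast
  have bound: "hardy_norm (?A h) \<le> C * hardy_norm h" if h: "h \<in> hardy_space" for h
  proof (cases "hardy_norm (?A h) = 0")
    case False
    then have pos: "0 < hardy_norm (?A h)" using hardy_norm_eq(1)[OF A[OF h]] by simp
    have "(hardy_norm (?A h))\<^sup>2 = cmod (hardy_inner (?A h) (?A h))"
      by (simp add: hardy_inner_self[OF A[OF h]] norm_power)
    also have "hardy_inner (?A h) (?A h) = hardy_inner h (B (?A h))" by (rule adj'[OF h A[OF h]])
    also have "cmod \<dots> \<le> hardy_norm h * hardy_norm (B (?A h))"
      by (intro hardy_inner_bound h mem A)
    also have "\<dots> \<le> hardy_norm h * (C * hardy_norm (?A h))"
      by (intro mult_left_mono C A h hardy_norm_eq(1))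
    finally have "hardy_norm (?A h) * hardy_norm (?A h) \<le> (C * hardy_norm h) * hardy_norm (?A h)"
      by (simp add: power2_eq_square mult_ac)
    then show ?thesis using pos by (rule mult_right_le_imp_le)
  next
    case True
    have "0 \<le> hardy_norm (B h)" by (rule hardy_norm_eq(1)[OF mem[OF h]])
    then show ?thesis using C[OF h] True by linarith
  qed
  show ?thesis
    unfolding hardy_bounded_def
  proof (intro conjI ballI allI)
    fix h k :: "complex ^ 'a \<Rightarrow> complex" and c assume h: "h \<in> hardy_space" and k: "k \<in> hardy_space"
    show "?A (\<lambda>z. h z + k z) = (\<lambda>z. ?A h z + ?A k z)" using lin[OF h k, of 1 1] by simp
  next
    fix h :: "complex ^ 'a \<Rightarrow> complex" and c assume h: "h \<in> hardy_space"
    show "?A (\<lambda>z. c * h z) = (\<lambda>z. c * ?A h z)" using lin[OF h h, of c 0] by simp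
  next
    show "\<exists>C. \<forall>h\<in>hardy_space. hardy_norm (?A h) \<le> C * hardy_norm h" using bound by blast
  qed (rule A)
qed

text \<open>The powers of \<open>w\<close> tend to 0 almost everywhere, with
  \<open>(cmod (g x))\<^sup>2\<close> as integrable majorant.\<close>

lemma integral_power_weight_tendsto_0:
  fixes g w :: "complex ^ 'n::finite \<Rightarrow> complex"
  assumes g: "L2S g" and [measurable]: "w \<in> borel_measurable surface_measure"
    and w1: "\<And>x. norm x = 1 \<Longrightarrow> cmod (w x) \<le> 1" and w: "AE x in surface_measure. cmod (w x) < 1"
  shows "(\<lambda>m. \<integral>x. (cmod (w x ^ m * g x))\<^sup>2 \<partial>surface_measure) \<longlonglongrightarrow> 0"
proof -
  have [measurable]: "g \<in> borel_measurable surface_measure" using g by (simp add: L2S_def)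
  have "(\<lambda>m. \<integral>x. (cmod (w x ^ m * g x))\<^sup>2 \<partial>surface_measure) \<longlonglongrightarrow>
      (\<integral>x. (0::real) \<partial>(surface_measure :: (complex ^ 'n) measure))"
  proof (rule integral_dominated_convergence[where w = "\<lambda>x. (cmod (g x))\<^sup>2"])
    show "integrable surface_measure (\<lambda>x. (cmod (g x))\<^sup>2)" using g by (simp add: L2S_def)
    show "AE x in surface_measure. (\<lambda>m. (cmod (w x ^ m * g x))\<^sup>2) \<longlonglongrightarrow> 0"
      using w
    proof eventually_elim
      fix x assume "cmod (w x) < 1"
      then have "(\<lambda>m. (cmod (w x) ^ m * cmod (g x))\<^sup>2) \<longlonglongrightarrow> (0 * cmod (g x))\<^sup>2"
        by (intro tendsto_intros LIMSEQ_power_zero) simp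
      then show "(\<lambda>m. (cmod (w x ^ m * g x))\<^sup>2) \<longlonglongrightarrow> 0" by (simp add: norm_mult norm_power)
    qed
    have "(cmod (w x ^ m * g x))\<^sup>2 \<le> (cmod (g x))\<^sup>2" if "norm x = 1" for m x
    proof (rule power_mono)
      have "cmod (w x) ^ m * cmod (g x) \<le> 1 * cmod (g x)"
        using w1[OF that] by (intro mult_right_mono power_le_one) auto
      then show "cmod (w x ^ m * g x) \<le> cmod (g x)" by (simp add: norm_mult norm_power)
    qed simp
    then show "AE x in surface_measure. norm ((cmod (w x ^ m * g x))\<^sup>2) \<le> (cmod (g x))\<^sup>2" for m
      by (intro AE_I2) simp
  qed measurable
  then show ?thesis by simp
qed

lemma L2S_power_weight:
  assumes g: "L2S g" and [measurable]: "w \<in> borel_measurable surface_measure"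
    and w1: "\<And>x. norm x = 1 \<Longrightarrow> cmod (w x) \<le> 1"
  shows "L2S (\<lambda>x. w x ^ m * g x)"
  using w1 by (intro L2S_mult_bounded[OF g, where B = 1]) (auto simp: norm_power intro!: power_le_one)

text \<open>The pairing \<open>\<langle>\<Phi>\<^sup>m(C) h, k\<rangle> = \<integral> w\<^sup>m (C h) \<bar>k\<close> with the weight \<open>w(\<zeta>) = \<langle>\<psi>(\<zeta>), \<zeta>\<rangle>\<close>
  gives both limits by dominated convergence.\<close>

lemma toeplitz_map_power_inner:
  fixes C :: "'n::finite hardy_op" and \<psi> :: "complex ^ 'n \<Rightarrow> complex ^ 'n"
  assumes C: "\<And>h. h \<in> hardy_space \<Longrightarrow> C h \<in> hardy_space"
    and \<psi>: "\<And>h j. h \<in> hardy_space \<Longrightarrow> AE x in surface_measure.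
      radial_limit (C (\<lambda>z. z $ j * h z)) x = \<psi> x $ j * radial_limit (C h) x"
    and m\<psi>: "\<And>j. (\<lambda>x. \<psi> x $ j) \<in> borel_measurable surface_measure"
    and w: "\<And>x. w x = (\<Sum>j\<in>UNIV. \<psi> x $ j * cnj (x $ j))"
    and w1: "\<And>x. norm x = 1 \<Longrightarrow> cmod (w x) \<le> 1"
    and h: "h \<in> hardy_space" and k: "k \<in> hardy_space"
  shows "hardy_inner ((toeplitz_map ^^ m) C h) k =
    (\<integral>x. w x ^ m * radial_limit (C h) x * cnj (radial_limit k x) \<partial>surface_measure)"
  using h k
proof (induction m arbitrary: h k)
  case 0
  then show ?case by (simp add: hardy_inner_def)
next
  case (Suc m)
  note h = \<open>h \<in> hardy_space\<close> and k = \<open>k \<in> hardy_space\<close>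
  note [measurable] = m\<psi>
  have mw [measurable]: "w \<in> borel_measurable surface_measure"
    unfolding w[abs_def] by measurable
  have rl: "radial_limit g \<in> borel_measurable surface_measure" if "g \<in> hardy_space"
    for g :: "complex ^ 'n \<Rightarrow> complex"
    using L2S_radial_limit(1)[OF that] by (simp add: L2S_def)
  note [measurable] = rl[OF C[OF h]] rl[OF k] rl[OF hardy_space_coord[OF k]] rl[OF C[OF hardy_space_coord[OF h]]]
  let ?g = "\<lambda>j x. (w x ^ m * radial_limit (C (\<lambda>z. z $ j * h z)) x) * cnj (radial_limit (\<lambda>z. z $ j * k z) x)"
  have int: "integrable surface_measure (?g j)" for j
    by (intro L2S_prod L2S_power_weight L2S_radial_limit C hardy_space_coord h k mw w1)
  have "hardy_inner ((toeplitz_map ^^ Suc m) C h) k =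
      (\<Sum>j\<in>UNIV. hardy_inner ((toeplitz_map ^^ m) C (\<lambda>z. z $ j * h z)) (\<lambda>z. z $ j * k z))"
    using toeplitz_map_inner[of "(toeplitz_map ^^ m) C", OF toeplitz_map_power_mem[OF C] h k] by simp
  also have "\<dots> = (\<Sum>j\<in>UNIV. \<integral>x. ?g j x \<partial>surface_measure)"
    by (intro sum.cong refl Suc.IH hardy_space_coord h k)
  also have "\<dots> = (\<integral>x. (\<Sum>j\<in>UNIV. ?g j x) \<partial>surface_measure)"
    by (rule Bochner_Integration.integral_sum[symmetric]) (rule int)
  also have "\<dots> = (\<integral>x. w x ^ Suc m * radial_limit (C h) x * cnj (radial_limit k x) \<partial>surface_measure)"
  proof (rule integral_cong_AE)
    have "AE x in surface_measure. \<forall>j\<in>UNIV. radial_limit (C (\<lambda>z. z $ j * h z)) x = \<psi> x $ j * radial_limit (C h) x"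
      by (rule AE_finite_allI) (auto intro: \<psi> h)
    moreover have "AE x in surface_measure. \<forall>j\<in>UNIV. radial_limit (\<lambda>z. z $ j * k z) x = x $ j * radial_limit k x"
      by (rule AE_finite_allI) (auto intro: AE_radial_limit_coord k)
    ultimately show "AE x in surface_measure. (\<Sum>j\<in>UNIV. ?g j x) =
        w x ^ Suc m * radial_limit (C h) x * cnj (radial_limit k x)"
    proof eventually_elim
      fix x assume "\<forall>j\<in>UNIV. radial_limit (C (\<lambda>z. z $ j * h z)) x = \<psi> x $ j * radial_limit (C h) x"
        "\<forall>j\<in>UNIV. radial_limit (\<lambda>z. z $ j * k z) x = x $ j * radial_limit k x"
      \<comment> \<open>The coordinate of index \<open>j\<close> contributes
        \<open>\<psi> x $ j * cnj (x $ j)\<close>; the sum over \<open>j\<close> is one more factor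
        \<open>w x\<close>.\<close>
      then have "(\<Sum>j\<in>UNIV. ?g j x) =
          (\<Sum>j\<in>UNIV. (\<psi> x $ j * cnj (x $ j)) * (w x ^ m * radial_limit (C h) x * cnj (radial_limit k x)))"
        by (intro sum.cong) (auto simp: mult_ac)
      also have "\<dots> = w x * (w x ^ m * radial_limit (C h) x * cnj (radial_limit k x))"
        by (simp only: w[of x] sum_distrib_right)
      finally show "(\<Sum>j\<in>UNIV. ?g j x) = w x ^ Suc m * radial_limit (C h) x * cnj (radial_limit k x)"
        by (simp add: mult.assoc)
    qed
  qed measurable
  finally show ?case .
qed

lemma asymptotically_toeplitz_zero:
  fixes B :: "'n::finite hardy_op"
  assumes B: "hardy_bounded B"
    and lim: "\<And>h. h \<in> hardy_space \<Longrightarrow> (\<lambda>m. hardy_norm ((toeplitz_map ^^ m) B h)) \<longlonglongrightarrow> 0"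
  shows "strongly_asymptotically_toeplitz B"
    and "has_asymptotic_symbol B (\<lambda>\<zeta>. 0)"
    and "sot_tendsto (\<lambda>m. (toeplitz_map ^^ m) B) (\<lambda>h z. 0)"
proof -
  show s: "sot_tendsto (\<lambda>m. (toeplitz_map ^^ m) B) (\<lambda>h z. 0)"
    using lim by (simp add: sot_tendsto_def)
  have n0: "hardy_norm (\<lambda>z :: complex ^ 'n. 0) = 0" by (simp add: hardy_norm_def)
  have "hardy_bounded ((\<lambda>h z. 0) :: 'n hardy_op)"
    by (auto simp: hardy_bounded_def hardy_space_zero n0 intro!: exI[of _ 0])
  then show "strongly_asymptotically_toeplitz B"
    using B s unfolding strongly_asymptotically_toeplitz_def by blast
  \<comment> \<open>This holds for every \<open>h\<close>, not only for Hardy functions, so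
    \<open>toeplitz\<close> with symbol zero equals the zero operator as a HOL function.\<close>
  have "toeplitz (\<lambda>\<zeta>. 0) h = (\<lambda>z :: complex ^ 'n. 0)" for h
    unfolding toeplitz_def
  proof (rule hardy_proj_eqI)
    show "L2S (\<lambda>\<zeta> :: complex ^ 'n. 0 * radial_limit h \<zeta>)" by (simp add: L2S_def)
    show "hardy_inner (\<lambda>z. 0) k = (\<integral>\<zeta>. 0 * radial_limit h \<zeta> * cnj (radial_limit k \<zeta>) \<partial>surface_measure)"
      if "k \<in> hardy_space" for k
      using hardy_inner_lincomb[OF that that that, of 0 0] by simp
  qed (rule hardy_space_zero)
  then have "toeplitz (\<lambda>\<zeta>. 0) = (\<lambda>(h :: complex ^ 'n \<Rightarrow> complex) z. 0)" by (intro ext) simp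
  moreover have "(\<lambda>\<zeta> :: complex ^ 'n. 0) \<in> Linfty_sphere" by (auto simp: Linfty_sphere_def)
  ultimately show "has_asymptotic_symbol B (\<lambda>\<zeta>. 0)"
    using s by (simp add: has_asymptotic_symbol_def)
qed

text \<open>Let \<open>u\<close> be the iterate applied to \<open>h\<close>. Pairing
  \<open>u\<close> with itself gives its squared norm as an integral with weight
  \<open>w ^ m\<close>, and Cauchy-Schwarz leaves one factor \<open>hardy_norm u\<close> to cancel.
  For the adjoint the weight is put on the fixed function \<open>h\<close> instead, and
  \<open>C u\<close> is controlled by boundedness of \<open>C\<close>.\<close>

lemma weighted_operator_asymptotics:
  fixes C :: "'n::finite hardy_op" and \<psi> :: "complex ^ 'n \<Rightarrow> complex ^ 'n"
  assumes C: "hardy_bounded C"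
    and \<psi>: "\<And>h j. h \<in> hardy_space \<Longrightarrow> AE x in surface_measure.
      radial_limit (C (\<lambda>z. z $ j * h z)) x = \<psi> x $ j * radial_limit (C h) x"
    and m\<psi>: "\<And>j. (\<lambda>x. \<psi> x $ j) \<in> borel_measurable surface_measure"
    and w: "\<And>x. w x = (\<Sum>j\<in>UNIV. \<psi> x $ j * cnj (x $ j))"
    and w1: "\<And>x. norm x = 1 \<Longrightarrow> cmod (w x) \<le> 1"
    and w_less: "AE x in surface_measure. cmod (w x) < 1"
    and h: "h \<in> hardy_space"
  shows "(\<lambda>m. hardy_norm ((toeplitz_map ^^ m) C h)) \<longlonglongrightarrow> 0"
    and "(\<lambda>m. hardy_norm ((toeplitz_map ^^ m) (hardy_adjoint C) h)) \<longlonglongrightarrow> 0"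
proof -
  note [measurable] = m\<psi>
  have mw [measurable]: "w \<in> borel_measurable surface_measure"
    unfolding w[abs_def] by measurable
  have memC: "C g \<in> hardy_space" if "g \<in> hardy_space" for g using C that by (simp add: hardy_bounded_def)
  have inner: "hardy_inner ((toeplitz_map ^^ m) C h) k =
      (\<integral>x. w x ^ m * radial_limit (C h) x * cnj (radial_limit k x) \<partial>surface_measure)"
    if "h \<in> hardy_space" "k \<in> hardy_space" for h k m
    by (rule toeplitz_map_power_inner[where \<psi> = \<psi>]) (use memC \<psi> m\<psi> w w1 that in auto)
  define I where "I g m = (\<integral>x. (cmod (w x ^ m * radial_limit g x))\<^sup>2 \<partial>surface_measure)"
    for g :: "complex ^ 'n \<Rightarrow> complex" and m
  have I0: "0 \<le> I g m" for g m by (simp add: I_def)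
  have I_lim: "(\<lambda>m. sqrt (I g m)) \<longlonglongrightarrow> 0" if "g \<in> hardy_space" for g
  proof -
    have "(\<lambda>m. sqrt (I g m)) \<longlonglongrightarrow> sqrt 0"
      unfolding I_def
      by (intro tendsto_real_sqrt integral_power_weight_tendsto_0 L2S_radial_limit that mw w1 w_less)
    then show ?thesis by simp
  qed
  have cancel: "a \<le> b" if "a\<^sup>2 \<le> b * a" "0 \<le> a" "0 \<le> b" for a b :: real
    using that mult_right_le_imp_le[of a a b] by (cases "a = 0") (auto simp: power2_eq_square)
  show "(\<lambda>m. hardy_norm ((toeplitz_map ^^ m) C h)) \<longlonglongrightarrow> 0"
  proof (rule tendsto_sandwich[OF _ _ tendsto_const I_lim[OF memC[OF h]]])
    have mem: "(toeplitz_map ^^ m) C h \<in> hardy_space" for m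
      by (rule toeplitz_map_power_mem[OF memC h])
    then show "\<forall>\<^sub>F m in sequentially. 0 \<le> hardy_norm ((toeplitz_map ^^ m) C h)"
      by (intro always_eventually allI hardy_norm_eq(1))
    have "hardy_norm ((toeplitz_map ^^ m) C h) \<le> sqrt (I (C h) m)" for m
    proof (rule cancel)
      let ?u = "(toeplitz_map ^^ m) C h"
      have "(hardy_norm ?u)\<^sup>2 = cmod (hardy_inner ?u ?u)" by (simp add: hardy_inner_self[OF mem] norm_power)
      also have "\<dots> = cmod (\<integral>x. (w x ^ m * radial_limit (C h) x) * cnj (radial_limit ?u x) \<partial>surface_measure)"
        by (simp only: inner[OF h mem])
      also have "\<dots> \<le> sqrt (I (C h) m) * hardy_norm ?u"
      proof (rule power2_le_imp_le)
        show "(cmod (\<integral>x. (w x ^ m * radial_limit (C h) x) * cnj (radial_limit ?u x) \<partial>surface_measure))\<^sup>2 \<le>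
            (sqrt (I (C h) m) * hardy_norm ?u)\<^sup>2"
          using L2S_cauchy_schwarz[OF L2S_power_weight[OF L2S_radial_limit(1)[OF memC[OF h]] mw w1]
              L2S_radial_limit(1)[OF mem], of m m]
          by (simp add: power_mult_distrib L2S_radial_limit(2)[OF mem] I0 flip: I_def)
      qed (simp add: hardy_norm_eq(1)[OF mem] I0)
      finally show "(hardy_norm ?u)\<^sup>2 \<le> sqrt (I (C h) m) * hardy_norm ?u" .
    qed (auto simp: I0 hardy_norm_eq(1)[OF mem])
    then show "\<forall>\<^sub>F m in sequentially. hardy_norm ((toeplitz_map ^^ m) C h) \<le> sqrt (I (C h) m)"
      by (intro always_eventually allI)
  qed
  obtain K0 where K0: "\<And>h. h \<in> hardy_space \<Longrightarrow> hardy_norm (C h) \<le> K0 * hardy_norm h"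
    using hardy_boundedD(4)[OF C] by blast
  define K where "K = max K0 0"
  have K_nonneg: "0 \<le> K" by (simp add: K_def)
  have K: "hardy_norm (C h) \<le> K * hardy_norm h" if "h \<in> hardy_space" for h
    using K0[OF that] mult_right_mono[of K0 K "hardy_norm h"] hardy_norm_eq(1)[OF that] by (auto simp: K_def)
  show "(\<lambda>m. hardy_norm ((toeplitz_map ^^ m) (hardy_adjoint C) h)) \<longlonglongrightarrow> 0"
  proof (rule tendsto_sandwich[OF _ _ tendsto_const])
    have "(\<lambda>m. K * sqrt (I h m)) \<longlonglongrightarrow> K * 0" by (intro tendsto_intros I_lim h)
    then show "(\<lambda>m. K * sqrt (I h m)) \<longlonglongrightarrow> 0" by simp
    have mem: "(toeplitz_map ^^ m) (hardy_adjoint C) h \<in> hardy_space" for m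
      by (rule toeplitz_map_power_mem[OF hardy_adjoint_mem[OF C] h])
    then show "\<forall>\<^sub>F m in sequentially. 0 \<le> hardy_norm ((toeplitz_map ^^ m) (hardy_adjoint C) h)"
      by (intro always_eventually allI hardy_norm_eq(1))
    have "hardy_norm ((toeplitz_map ^^ m) (hardy_adjoint C) h) \<le> K * sqrt (I h m)" for m
    proof (rule cancel)
      let ?u = "(toeplitz_map ^^ m) (hardy_adjoint C) h"
      have "(hardy_norm ?u)\<^sup>2 = cmod (hardy_inner ?u ?u)" by (simp add: hardy_inner_self[OF mem] norm_power)
      also have "hardy_inner ?u ?u = hardy_inner ((toeplitz_map ^^ m) C ?u) h"
        by (rule toeplitz_map_power_duality[symmetric, OF memC hardy_adjoint_mem[OF C]
            hardy_adjoint_inner[OF C] mem h])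
      also have "\<dots> = (\<integral>x. radial_limit (C ?u) x * cnj (cnj (w x) ^ m * radial_limit h x) \<partial>surface_measure)"
        unfolding inner[OF mem h] by (intro Bochner_Integration.integral_cong) (simp_all add: mult_ac)
      also have "cmod \<dots> \<le> hardy_norm (C ?u) * sqrt (I h m)"
      proof (rule power2_le_imp_le)
        have "L2S (\<lambda>x. cnj (w x) ^ m * radial_limit h x)"
          by (rule L2S_power_weight[OF L2S_radial_limit(1)[OF h]]) (measurable, simp add: w1)
        from L2S_cauchy_schwarz[OF L2S_radial_limit(1)[OF memC[OF mem]] this]
        show "(cmod (\<integral>x. radial_limit (C ?u) x * cnj (cnj (w x) ^ m * radial_limit h x) \<partial>surface_measure))\<^sup>2 \<le>
            (hardy_norm (C ?u) * sqrt (I h m))\<^sup>2"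
          by (simp add: power_mult_distrib L2S_radial_limit(2)[OF memC[OF mem]] I_def norm_mult norm_power)
      qed (simp add: hardy_norm_eq(1)[OF memC[OF mem]] I0)
      also have "\<dots> \<le> (K * hardy_norm ?u) * sqrt (I h m)"
        by (intro mult_right_mono K mem) (simp add: I0)
      finally show "(hardy_norm ?u)\<^sup>2 \<le> K * sqrt (I h m) * hardy_norm ?u" by (simp add: mult_ac)
    qed (auto simp: I0 K_nonneg hardy_norm_eq(1)[OF mem])
    then show "\<forall>\<^sub>F m in sequentially. hardy_norm ((toeplitz_map ^^ m) (hardy_adjoint C) h) \<le> K * sqrt (I h m)"
      by (intro always_eventually allI)
  qed
qed

section \<open>Uniqueness from sets of positive measure\<close>

text \<open>Dilating about \<open>p\<close> by a factor between 1 and 2 changes volume by a bounded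
  factor. Averaging over these dilations and exchanging integrals leaves integrals along rays from
  \<open>p\<close>, each over a countable set.\<close>

lemma null_set_of_countable_rays:
  fixes Z :: "'a::euclidean_space set"
  assumes [measurable]: "Z \<in> sets borel"
    and count: "\<And>v. countable {t::real. 0 < t \<and> p + t *\<^sub>R v \<in> Z}"
  shows "emeasure lborel Z = 0"
proof -
  define F where "F y = (indicator Z (p + y) :: ennreal)" for y
  have [measurable]: "(indicator Z :: 'a \<Rightarrow> ennreal) \<in> borel_measurable borel"
    by (intro borel_measurable_indicator) simp
  have [measurable]: "F \<in> borel_measurable borel" unfolding F_def[abs_def] by measurable
  have P: "pair_sigma_finite (lborel :: real measure) (lborel :: 'a measure)"
    by (intro pair_sigma_finite.intro lborel.sigma_finite_measure_axioms)
  have F_int: "(\<integral>\<^sup>+y. F y \<partial>lborel) = emeasure lborel Z"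
    using nn_integral_lborel_shift[of "indicator Z" p] by (simp add: F_def add.commute)
  have scale: "(\<integral>\<^sup>+y. F (c *\<^sub>R y) \<partial>lborel) \<ge> ennreal ((1 / 2) ^ DIM('a)) * emeasure lborel Z"
    if c: "c \<in> {1..2}" for c :: real
  proof -
    have "emeasure lborel Z = (\<integral>\<^sup>+y. ennreal (c ^ DIM('a)) * F (c *\<^sub>R y) \<partial>lborel)"
      unfolding F_int[symmetric]
      by (subst lborel_affine[of c 0]) (use c in \<open>auto simp: nn_integral_density nn_integral_distr\<close>)
    also have "\<dots> = ennreal (c ^ DIM('a)) * (\<integral>\<^sup>+y. F (c *\<^sub>R y) \<partial>lborel)"
      by (rule nn_integral_cmult) measurable
    finally have "ennreal ((1 / 2) ^ DIM('a)) * emeasure lborel Z =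
        ennreal ((1 / 2) ^ DIM('a) * c ^ DIM('a)) * (\<integral>\<^sup>+y. F (c *\<^sub>R y) \<partial>lborel)"
      using c by (simp add: ennreal_mult mult.assoc)
    also have "\<dots> \<le> 1 * (\<integral>\<^sup>+y. F (c *\<^sub>R y) \<partial>lborel)"
    proof (rule mult_right_mono)
      have "(1 / 2) ^ DIM('a) * c ^ DIM('a) = (c / 2) ^ DIM('a)" by (simp add: power_divide)
      also have "\<dots> \<le> 1" using c by (intro power_le_one) auto
      finally show "ennreal ((1 / 2) ^ DIM('a) * c ^ DIM('a)) \<le> 1" by simp
    qed simp
    finally show ?thesis by simp
  qed
  have "ennreal ((1 / 2) ^ DIM('a)) * emeasure lborel Z =
      (\<integral>\<^sup>+c. indicator {1..2::real} c * (ennreal ((1 / 2) ^ DIM('a)) * emeasure lborel Z) \<partial>lborel)"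
    by (subst nn_integral_multc) auto
  also have "\<dots> \<le> (\<integral>\<^sup>+c. (\<integral>\<^sup>+y. indicator {1..2::real} c * F (c *\<^sub>R y) \<partial>lborel) \<partial>lborel)"
    by (rule nn_integral_mono) (use scale in \<open>auto simp: indicator_def nn_integral_cmult\<close>)
  also have "\<dots> = (\<integral>\<^sup>+y. (\<integral>\<^sup>+c. indicator {1..2::real} c * F (c *\<^sub>R y) \<partial>lborel) \<partial>lborel)"
    by (rule pair_sigma_finite.Fubini'[OF P, symmetric]) measurable
  also have "\<dots> = (\<integral>\<^sup>+y. 0 \<partial>(lborel :: 'a measure))"
  proof (rule nn_integral_cong)
    fix y :: 'a
    let ?T = "{t::real. 0 < t \<and> p + t *\<^sub>R y \<in> Z}"
    have "?T \<in> null_sets lborel" using count by (rule countable_imp_null_set_lborel)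
    then have "AE c in lborel. c \<notin> ?T" by (rule AE_not_in)
    then have "(\<integral>\<^sup>+c. indicator {1..2::real} c * F (c *\<^sub>R y) \<partial>lborel) = (\<integral>\<^sup>+c. 0 \<partial>(lborel :: real measure))"
      by (intro nn_integral_cong_AE) (auto simp: F_def indicator_def elim!: eventually_mono)
    then show "(\<integral>\<^sup>+c. indicator {1..2::real} c * F (c *\<^sub>R y) \<partial>lborel) = 0" by simp
  qed
  finally show ?thesis by simp
qed

lemma open_imp_fsigma:
  fixes S :: "'a::euclidean_space set"
  assumes "open S"
  shows "fsigma S"
proof -
  obtain C :: "nat \<Rightarrow> 'a set" where "\<And>n. compact (C n)" "\<Union> (range C) = S"
    using open_Union_compact_subsets[OF assms] by metis
  then show ?thesis unfolding fsigma_Union_compact by (intro exI[of _ C]) auto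
qed

text \<open>If \<open>G p\<close> were nonzero, \<open>H\<close> on any line through
  \<open>p\<close> would not vanish identically, so it would have countably many zeros and
  \<open>C\<close> would be null by rays. Agreement of \<open>H\<close> with \<open>G\<close> is
  asked only at real parameters, which admits expressions with conjugated coordinates.\<close>

lemma vanishing_on_positive_measure:
  fixes G :: "complex ^ 'n::finite \<Rightarrow> complex"
  assumes C [measurable]: "C \<in> sets borel" and sub: "C \<subseteq> ball 0 1" and pos: "emeasure lborel C \<noteq> 0"
    and zero: "\<And>z. z \<in> C \<Longrightarrow> G z = 0"
    and lines: "\<And>p v. p \<in> ball 0 1 \<Longrightarrow> \<exists>H. H holomorphic_on {t. p + t *s v \<in> ball 0 1} \<and>
      (\<forall>t::real. p + t *\<^sub>R v \<in> ball 0 1 \<longrightarrow> H (of_real t) = G (p + t *\<^sub>R v))"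
    and p: "p \<in> ball 0 1"
  shows "G p = 0"
proof (rule ccontr)
  assume Gp: "G p \<noteq> 0"
  have "countable {t::real. 0 < t \<and> p + t *\<^sub>R v \<in> C}" for v
  proof -
    let ?T = "{t. p + t *s v \<in> ball 0 1}"
    obtain H where H: "H holomorphic_on ?T"
      and HG: "\<And>t::real. p + t *\<^sub>R v \<in> ball 0 1 \<Longrightarrow> H (of_real t) = G (p + t *\<^sub>R v)"
      using lines[OF p, of v] by blast
    have "continuous_on UNIV (\<lambda>t. p + t *s v)" by (intro continuous_intros)
    then have opn: "open ?T" using open_vimage[of "ball 0 1" "\<lambda>t. p + t *s v"] by (simp add: vimage_def)
    have "convex ?T"
    proof (rule convexI)
      fix s t :: complex and a b :: real assume s: "s \<in> ?T" and t: "t \<in> ?T" and ab: "0 \<le> a" "0 \<le> b" "a + b = 1"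
      have "p = a *\<^sub>R p + b *\<^sub>R p" using ab(3) by (metis scaleR_left_distrib scaleR_one)
      then have "p + (a *\<^sub>R s + b *\<^sub>R t) *s v = a *\<^sub>R (p + s *s v) + b *\<^sub>R (p + t *s v)"
        by (simp add: scaleR_right_distrib vector_sadd_rdistrib scaleR_eq_vector_scalar_mult
            vector_smult_assoc scaleR_conv_of_real)
      also have "\<dots> \<in> ball 0 1" using s t ab by (intro convexD[OF convex_ball]) auto
      finally show "a *\<^sub>R s + b *\<^sub>R t \<in> ?T" by simp
    qed
    then have conn: "connected ?T" by (rule convex_connected)
    have 0: "0 \<in> ?T" and H0: "H 0 \<noteq> 0" using p HG[of 0] Gp by auto
    have "countable {t \<in> ?T. H t = 0}"
    proof (cases "H constant_on ?T")
      case True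
      then have "{t \<in> ?T. H t = 0} = {}" using 0 H0 unfolding constant_on_def by auto
      then show ?thesis by (simp only: countable_empty)
    next
      case False
      then show ?thesis
        by (intro holomorphic_countable_zeros[OF H opn conn open_imp_fsigma[OF opn]])
    qed
    then have "countable (complex_of_real ` (of_real -` {t \<in> ?T. H t = 0}))"
      by (rule countable_subset[rotated]) auto
    then have "countable (of_real -` {t \<in> ?T. H t = 0} :: real set)"
      by (rule countable_image_inj_on) (simp add: inj_on_def)
    moreover have "{t::real. 0 < t \<and> p + t *\<^sub>R v \<in> C} \<subseteq> of_real -` {t \<in> ?T. H t = 0}"
      using sub HG zero by (auto simp: scaleR_eq_vector_scalar_mult subset_iff)
    ultimately show ?thesis by (rule countable_subset[rotated])
  qed
  then have "emeasure lborel C = 0" by (intro null_set_of_countable_rays[OF C])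
  then show False using pos by contradiction
qed

section \<open>Boundary uniqueness for bounded holomorphic functions on the disc\<close>

lemma cis_near_root:
  assumes N: "0 < N" and z: "cmod z = 1"
  shows "\<exists>j::nat. cmod (cis (2 * pi / real N) ^ j - z) \<le> 2 * pi / real N"
proof -
  define \<theta> where "\<theta> = Arg2pi z"
  have \<theta>: "0 \<le> \<theta>" "z = cis \<theta>"
    using z complex_norm_eq_1_exp[of z] Arg2pi[of z] by (auto simp: \<theta>_def cis_conv_exp mult.commute)
  define x where "x = \<theta> / (2 * pi / real N)"
  define j where "j = nat \<lfloor>x\<rfloor>"
  have x0: "0 \<le> x" using \<theta> N by (simp add: x_def)
  then have j: "real j \<le> x" "x < real j + 1" unfolding j_def by linarith+
  define \<beta> where "\<beta> = real j * (2 * pi / real N)"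
  have \<theta>x: "\<theta> = x * (2 * pi / real N)" using N by (simp add: x_def)
  have "\<theta> - \<beta> = (x - real j) * (2 * pi / real N)" by (simp only: \<theta>x \<beta>_def left_diff_distrib)
  moreover have "0 \<le> 2 * pi / real N" by simp
  ultimately have d: "\<bar>\<theta> - \<beta>\<bar> \<le> 2 * pi / real N"
    using j mult_right_mono[of "x - real j" 1 "2 * pi / real N"] by (simp add: abs_of_nonneg mult_nonneg_nonneg)
  have "cis (2 * pi / real N) ^ j = cis \<beta>" by (simp add: \<beta>_def Complex.DeMoivre)
  moreover have "cmod (cis \<beta> - cis \<theta>) \<le> \<bar>\<theta> - \<beta>\<bar>"
  proof -
    have "cis \<theta> = cis \<beta> * cis (\<theta> - \<beta>)" by (simp add: cis_mult)
    then have "cis \<beta> - cis \<theta> = cis \<beta> * (1 - cis (\<theta> - \<beta>))" by (simp add: algebra_simps)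
    then have "cmod (cis \<beta> - cis \<theta>) = cmod (exp (\<i> * of_real (\<theta> - \<beta>)) - 1)"
      by (simp add: norm_mult norm_minus_commute cis_conv_exp)
    also have "\<dots> = 2 * \<bar>sin ((\<theta> - \<beta>) / 2)\<bar>" by (rule dist_exp_i_1)
    also have "\<dots> \<le> 2 * \<bar>(\<theta> - \<beta>) / 2\<bar>" by (intro mult_left_mono abs_sin_x_le_abs_x) auto
    finally show ?thesis by simp
  qed
  ultimately show ?thesis using d \<theta>(2) by (intro exI[of _ j]) simp
qed

text \<open>A form of Jensen's inequality without counting zeros: the maximum principle applied to
  \<open>\<Prod>\<^sub>k v (\<omega>\<^sup>k z)\<close> with \<open>\<omega>\<close> a primitive \<open>N\<close>-th root of unity compares the geometric means of \<open>|v|\<close> over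
  two circles.\<close>

lemma jensen_lower_bound:
  fixes v :: "complex \<Rightarrow> complex"
  assumes v: "v holomorphic_on ball 0 R" and R: "1 < R" and s: "0 \<le> s" "s < 1" and m: "0 < m"
    and low: "\<And>z. cmod z = s \<Longrightarrow> m \<le> cmod (v z)" and \<delta>: "0 < \<delta>"
    and [measurable]: "v \<in> borel_measurable borel"
  shows "ln m \<le> (\<integral>\<mu>. ln (max (cmod (v \<mu>)) \<delta>) \<partial>circle_measure)"
proof (rule field_le_epsilon)
  fix e :: real assume e: "0 < e"
  \<comment> \<open>The floor \<open>\<delta>\<close> keeps the logarithm continuous at zeros of
    \<open>v\<close>.\<close>
  define g where "g \<mu> = ln (max (cmod (v \<mu>)) \<delta>)" for \<mu>
  have contv: "continuous_on (cball 0 1) v"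
    using R by (intro holomorphic_on_imp_continuous_on holomorphic_on_subset[OF v]) auto
  have contg: "continuous_on (sphere 0 1) g"
    unfolding g_def using \<delta>
    by (intro continuous_intros continuous_on_subset[OF contv]) (auto simp: max_def)
  then have "uniformly_continuous_on (sphere 0 1) g"
    by (intro compact_uniformly_continuous) auto
  then obtain d where d: "0 < d" "\<And>\<mu> \<nu>. cmod \<mu> = 1 \<Longrightarrow> cmod \<nu> = 1 \<Longrightarrow> dist \<nu> \<mu> < d \<Longrightarrow> dist (g \<nu>) (g \<mu>) < e"
    using e unfolding uniformly_continuous_on_def by (metis dist_0_norm mem_sphere)
  obtain N where N: "2 * pi / d < real N" using reals_Archimedean2 by blast
  have "0 < 2 * pi / d" using d by simp
  then have N0: "0 < N" using N by (intro gr0I) auto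
  then have Nd: "2 * pi / real N < d" using N d by (simp add: field_simps)
  define \<omega> where "\<omega> = cis (2 * pi / real N)"
  have \<omega>: "cmod \<omega> = 1" "\<omega> ^ N = 1" using N0 by (auto simp: \<omega>_def Complex.DeMoivre)
  have \<omega>k: "cmod (\<omega> ^ k) = 1" for k using \<omega>(1) by (simp add: norm_power)
  \<comment> \<open>At the point \<open>s\<close> its modulus is at least \<open>m ^ N\<close>,
    since all rotated arguments lie on the circle of radius \<open>s\<close>; by the maximum
    principle some \<open>z0\<close> on the unit circle does at least as well.\<close>
  define p where "p z = (\<Prod>k<N. v (\<omega> ^ k * z))" for z
  have hol: "(\<lambda>z. v (\<omega> ^ k * z)) holomorphic_on ball 0 R" for k
    using holomorphic_on_compose_gen[of "\<lambda>z. \<omega> ^ k * z" "ball 0 R" v "ball 0 R"] v \<omega>k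
    by (auto simp: o_def norm_mult image_subset_iff intro!: holomorphic_intros)
  have p: "p holomorphic_on ball 0 R" unfolding p_def by (intro holomorphic_intros hol)
  have contp: "continuous_on (cball 0 1) p"
    using R by (intro holomorphic_on_imp_continuous_on holomorphic_on_subset[OF p]) auto
  have "\<exists>z\<in>sphere 0 1. \<forall>y\<in>sphere 0 1. cmod (p y) \<le> cmod (p z)"
  proof (rule continuous_attains_sup)
    have "(1 :: complex) \<in> sphere 0 1" by simp
    then show "sphere (0 :: complex) 1 \<noteq> {}" by blast
  qed (auto intro!: continuous_intros continuous_on_subset[OF contp])
  then obtain z0 where z0: "cmod z0 = 1" "\<And>y. cmod y = 1 \<Longrightarrow> cmod (p y) \<le> cmod (p z0)" by auto
  have "cmod (p s) \<le> cmod (p z0)"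
  proof (rule maximum_modulus_frontier[of p "cball 0 1"])
    show "p holomorphic_on interior (cball 0 1)"
      using R by (intro holomorphic_on_subset[OF p]) auto
    show "cmod (p z) \<le> cmod (p z0)" if "z \<in> frontier (cball 0 1)" for z
      using that z0(2) by (simp add: frontier_cball)
  qed (use contp s in auto)
  moreover have "m ^ N \<le> cmod (p s)"
  proof -
    have "m ^ N = (\<Prod>k<N. m)" by simp
    also have "\<dots> \<le> (\<Prod>k<N. cmod (v (\<omega> ^ k * s)))"
      using m s low \<omega>k by (intro prod_mono) (auto simp: norm_mult)
    finally show ?thesis by (simp add: p_def prod_norm)
  qed
  ultimately have mp: "m ^ N \<le> cmod (p z0)" by linarith
  define G where "G \<mu> = (\<Sum>k<N. g (\<omega> ^ k * \<mu>))" for \<mu>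
  have "real N * ln m = ln (m ^ N)" using m by (simp add: ln_realpow)
  also have "\<dots> \<le> ln (\<Prod>k<N. max (cmod (v (\<omega> ^ k * z0))) \<delta>)"
  proof (rule ln_mono)
    show "m ^ N \<le> (\<Prod>k<N. max (cmod (v (\<omega> ^ k * z0))) \<delta>)"
      using mp unfolding p_def prod_norm[symmetric] by (rule order_trans) (intro prod_mono, auto)
  qed (use m in auto)
  also have "\<dots> = G z0"
    unfolding G_def g_def using \<delta> by (intro ln_prod) auto
  finally have G0: "real N * ln m \<le> G z0" .
  have G_shift: "G (\<omega> * \<mu>) = G \<mu>" for \<mu>
  proof -
    have "G (\<omega> * \<mu>) = (\<Sum>k<N. g (\<omega> ^ Suc k * \<mu>))" by (simp add: G_def mult_ac)
    also have "\<dots> + g (\<omega> ^ 0 * \<mu>) = (\<Sum>k<Suc N. g (\<omega> ^ k * \<mu>))"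
      by (subst sum.lessThan_Suc_shift) simp
    also have "\<dots> = G \<mu> + g (\<omega> ^ N * \<mu>)" by (simp add: G_def)
    finally show ?thesis using \<omega>(2) by simp
  qed
  have G_shifts: "G (\<omega> ^ j * \<mu>) = G \<mu>" for j \<mu>
  proof (induction j)
    case (Suc j)
    then show ?case using G_shift[of "\<omega> ^ j * \<mu>"] by (simp add: mult.assoc)
  qed simp
  \<comment> \<open>\<open>G\<close> is invariant under multiplication by powers of
    \<open>\<omega>\<close>, and some power carries \<open>\<mu>\<close> to within \<open>d\<close>
    of \<open>z0\<close>. So the bound at the single point \<open>z0\<close> holds on the whole
    circle up to \<open>N * e\<close>.\<close>
  have G_ge: "G z0 - real N * e \<le> G \<mu>" if \<mu>: "cmod \<mu> = 1" for \<mu>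
  proof -
    obtain j where j: "cmod (\<omega> ^ j - z0 * cnj \<mu>) \<le> 2 * pi / real N"
      using cis_near_root[OF N0, of "z0 * cnj \<mu>"] \<mu> z0(1) by (auto simp: \<omega>_def norm_mult)
    have u: "cnj \<mu> * \<mu> = 1" using \<mu> by (simp add: mult.commute flip: complex_norm_square)
    have "\<omega> ^ j * \<mu> - z0 = (\<omega> ^ j - z0 * cnj \<mu>) * \<mu>" using u by (simp add: algebra_simps)
    then have near: "cmod (\<omega> ^ j * \<mu> - z0) < d" using j \<mu> Nd by (simp add: norm_mult)
    have "g (\<omega> ^ k * z0) - e \<le> g (\<omega> ^ k * (\<omega> ^ j * \<mu>))" for k
    proof -
      have "cmod (\<omega> ^ k * (\<omega> ^ j * \<mu>) - \<omega> ^ k * z0) < d"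
        using near by (simp add: \<omega>k norm_mult flip: right_diff_distrib)
      then have "dist (g (\<omega> ^ k * (\<omega> ^ j * \<mu>))) (g (\<omega> ^ k * z0)) < e"
        using \<mu> z0(1) \<omega>k by (intro d(2)) (auto simp: norm_mult dist_norm)
      then show ?thesis by (simp add: dist_real_def)
    qed
    then have "(\<Sum>k<N. g (\<omega> ^ k * z0) - e) \<le> G (\<omega> ^ j * \<mu>)"
      unfolding G_def by (intro sum_mono)
    then show ?thesis by (simp add: G_shifts) (simp add: G_def sum_subtractf)
  qed
  have mg [measurable]: "g \<in> borel_measurable borel" unfolding g_def[abs_def] by measurable
  have "compact (g ` sphere 0 1)" using contg by (intro compact_continuous_image) auto
  then obtain B where B: "\<And>\<mu>. cmod \<mu> = 1 \<Longrightarrow> norm (g \<mu>) \<le> B"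
    by (force dest!: compact_imp_bounded simp: bounded_iff)
  have int: "integrable circle_measure (\<lambda>\<mu>. g (\<omega> ^ k * \<mu>))" for k
    by (rule circle_integrable_bounded[where B = B]) (simp_all add: norm_mult \<omega>k B[unfolded real_norm_def])
  have "(\<integral>\<mu>. G \<mu> \<partial>circle_measure) = (\<Sum>k<N. \<integral>\<mu>. g (\<omega> ^ k * \<mu>) \<partial>circle_measure)"
    unfolding G_def by (rule Bochner_Integration.integral_sum) (rule int)
  also have "\<dots> = (\<Sum>k<N. \<integral>\<mu>. g \<mu> \<partial>circle_measure)"
    by (intro sum.cong refl integral_circle_rotate \<omega>k mg)
  finally have GI: "(\<integral>\<mu>. G \<mu> \<partial>circle_measure) = real N * (\<integral>\<mu>. g \<mu> \<partial>circle_measure)" by simp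
  have "G z0 - real N * e = (\<integral>\<mu>. G z0 - real N * e \<partial>circle_measure)" by simp
  also have "\<dots> \<le> (\<integral>\<mu>. G \<mu> \<partial>circle_measure)"
    by (rule integral_mono_AE) (auto simp: G_def intro!: int eventually_mono[OF AE_circle] G_ge[unfolded G_def])
  finally have "real N * ln m \<le> real N * ((\<integral>\<mu>. g \<mu> \<partial>circle_measure) + e)"
    using G0 GI by (simp add: algebra_simps)
  then show "ln m \<le> (\<integral>\<mu>. ln (max (cmod (v \<mu>)) \<delta>) \<partial>circle_measure) + e"
    using N0 by (simp add: g_def)
qed

text \<open>Applying \<open>jensen_lower_bound\<close> on circles of radius tending to 1 gives
  \<open>ln m \<le> c * ln \<delta> + ln K\<close>, with \<open>c\<close> the measure of
  \<open>A\<close>: where the boundary value is 0, the truncated logarithm falls to its floor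
  \<open>ln \<delta>\<close>. Small \<open>\<delta>\<close> contradicts this.\<close>

lemma bounded_holomorphic_uniqueness:
  fixes u :: "complex \<Rightarrow> complex"
  assumes u: "u holomorphic_on ball 0 1" and mu [measurable]: "u \<in> borel_measurable borel"
    and M: "\<And>z. z \<in> ball 0 1 \<Longrightarrow> cmod (u z) \<le> M"
    and A [measurable]: "A \<in> sets borel" and posA: "emeasure circle_measure A \<noteq> 0"
    and lim: "\<And>\<mu>. \<mu> \<in> A \<Longrightarrow> cmod \<mu> = 1 \<Longrightarrow> ((\<lambda>r. u (of_real r * \<mu>)) \<longlongrightarrow> 0) (at_left 1)"
    and z: "z \<in> ball 0 1"
  shows "u z = 0"
proof (rule ccontr)
  assume uz: "u z \<noteq> 0"
  \<comment> \<open>A circle around 0 that carries no zero of \<open>u\<close>, degenerate if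
    \<open>u 0\<close> is nonzero; it supplies the positive minimum \<open>m\<close>.\<close>
  obtain s where s: "0 \<le> s" "s < 1" and nz: "\<And>y. cmod y = s \<Longrightarrow> u y \<noteq> 0"
  proof (cases "u 0 = 0")
    case True
    obtain r where r: "0 < r" "ball 0 r \<subseteq> ball (0 :: complex) 1" "\<And>y. y \<in> ball 0 r - {0} \<Longrightarrow> u y \<noteq> 0"
      using isolated_zeros[OF u _ _ _ True z uz] by auto
    have q: "0 < min r 1 / 2" "min r 1 / 2 < 1" "min r 1 / 2 < r" using r(1) by (auto simp: min_def)
    have "u y \<noteq> 0" if "cmod y = min r 1 / 2" for y
      using that q by (intro r(3)) auto
    then show ?thesis using q by (intro that[of "min r 1 / 2"]) auto
  next
    case False
    then show ?thesis by (intro that[of 0]) auto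
  qed
  have cont: "continuous_on (ball 0 1) u" using u by (rule holomorphic_on_imp_continuous_on)
  have "\<exists>x\<in>sphere 0 s. \<forall>y\<in>sphere 0 s. cmod (u x) \<le> cmod (u y)"
  proof (rule continuous_attains_inf)
    have "complex_of_real s \<in> sphere 0 s" using s by simp
    then show "sphere (0 :: complex) s \<noteq> {}" by blast
    show "continuous_on (sphere 0 s) (\<lambda>x. cmod (u x))"
      using s by (intro continuous_intros continuous_on_subset[OF cont]) auto
  qed auto
  then obtain x where x: "cmod x = s" "\<And>y. cmod y = s \<Longrightarrow> cmod (u x) \<le> cmod (u y)" by auto
  define m where "m = cmod (u x)"
  have m: "0 < m" "\<And>y. cmod y = s \<Longrightarrow> m \<le> cmod (u y)" using nz x by (auto simp: m_def)
  define K where "K = max M 1"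
  have K: "1 \<le> K" "\<And>z. z \<in> ball 0 1 \<Longrightarrow> cmod (u z) \<le> K"
    using M by (auto simp: K_def max.coboundedI1)
  define c where "c = measure circle_measure A"
  have c: "0 < c" using posA by (simp add: c_def circle.emeasure_eq_measure zero_less_measure_iff)
  \<comment> \<open>Radii tending to 1 and all above \<open>s\<close>, so that the circle of radius
    \<open>s\<close> becomes one of radius \<open>s / a n < 1\<close> after rescaling.\<close>
  define a where "a n = 1 - (1 - s) * inverse (real (Suc (Suc n)))" for n
  have a: "s < a n" "a n < 1" for n
  proof -
    have i: "0 < inverse (real (Suc (Suc n)))" "inverse (real (Suc (Suc n))) < 1" by (auto simp: field_simps)
    have "(1 - s) * inverse (real (Suc (Suc n))) < (1 - s) * 1" using s i by (intro mult_strict_left_mono) auto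
    then show "s < a n" by (simp add: a_def)
    show "a n < 1" using s i by (simp add: a_def)
  qed
  have "(\<lambda>n. 1 - (1 - s) * inverse (real (Suc (Suc n)))) \<longlonglongrightarrow> 1 - (1 - s) * 0"
    by (intro tendsto_intros LIMSEQ_Suc[OF LIMSEQ_inverse_real_of_nat])
  then have "a \<longlonglongrightarrow> 1" by (simp add: a_def[abs_def])
  then have fa: "filterlim a (at_left 1) sequentially"
    unfolding filterlim_at using a by (auto intro!: always_eventually simp: less_imp_neq)
  have bound: "ln m \<le> c * ln \<delta> + ln K" if \<delta>: "0 < \<delta>" "\<delta> \<le> 1" for \<delta>
  proof -
    define g where "g n \<mu> = ln (max (cmod (u (of_real (a n) * \<mu>))) \<delta>)" for n \<mu>
    have [measurable]: "g n \<in> borel_measurable borel" for n unfolding g_def[abs_def] by measurable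
    have g_bounds: "ln \<delta> \<le> g n \<mu>" "g n \<mu> \<le> ln K" if "cmod \<mu> = 1" for n \<mu>
    proof -
      have "of_real (a n) * \<mu> \<in> ball 0 1" using that a[of n] s by (simp add: norm_mult)
      then have "cmod (u (of_real (a n) * \<mu>)) \<le> K" by (rule K)
      then show "g n \<mu> \<le> ln K" using \<delta> K(1) unfolding g_def by (intro ln_mono) auto
      show "ln \<delta> \<le> g n \<mu>" using \<delta> unfolding g_def by (intro ln_mono) auto
    qed
    have abs_g: "norm (g n \<mu>) \<le> \<bar>ln \<delta>\<bar> + ln K" if "cmod \<mu> = 1" for n \<mu>
    proof -
      have "0 \<le> ln K" using K(1) by simp
      then show ?thesis using g_bounds[OF that, of n] unfolding real_norm_def by linarith
    qed
    have int_g: "integrable circle_measure (g n)" for n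
      by (rule circle_integrable_bounded[OF _ abs_g]) auto
    have "ln m \<le> (\<integral>\<mu>. g n \<mu> \<partial>circle_measure)" for n
      unfolding g_def
    proof (rule jensen_lower_bound)
      have an: "0 < a n" using a[of n] s by linarith
      have "(\<lambda>z. of_real (a n) * z) holomorphic_on ball 0 (1 / a n)" by (intro holomorphic_intros)
      moreover have "(\<lambda>z. of_real (a n) * z) ` ball 0 (1 / a n) \<subseteq> ball (0 :: complex) 1"
        using an by (auto simp: norm_mult pos_less_divide_eq mult.commute)
      ultimately show "(\<lambda>z. u (of_real (a n) * z)) holomorphic_on ball 0 (1 / a n)"
        using holomorphic_on_compose_gen[OF _ u] by (simp add: o_def)
      show "1 < 1 / a n" using an a[of n] by simp
      show "0 \<le> s / a n" "s / a n < 1" using an a[of n] s by simp_all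
      show "m \<le> cmod (u (of_real (a n) * z))" if "cmod z = s / a n" for z
        using that an by (intro m) (simp add: norm_mult)
    qed (use m \<delta> in \<open>auto\<close>)
    also have "(\<integral>\<mu>. g n \<mu> \<partial>circle_measure) \<le> (\<integral>\<mu>. indicator A \<mu> * g n \<mu> + ln K \<partial>circle_measure)" for n
    proof (rule integral_mono_AE[OF int_g])
      show "integrable circle_measure (\<lambda>\<mu>. indicator A \<mu> * g n \<mu> + ln K)"
        using integrable_real_mult_indicator[OF _ int_g, of A n]
        by (intro Bochner_Integration.integrable_add circle.integrable_const) (simp_all add: mult.commute)
      show "AE \<mu> in circle_measure. g n \<mu> \<le> indicator A \<mu> * g n \<mu> + ln K"
        using g_bounds(2) K(1) by (intro eventually_mono[OF AE_circle]) (auto simp: indicator_def)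
    qed
    finally have le: "ln m \<le> (\<integral>\<mu>. indicator A \<mu> * g n \<mu> + ln K \<partial>circle_measure)" for n .
    have "(\<lambda>n. \<integral>\<mu>. indicator A \<mu> * g n \<mu> + ln K \<partial>circle_measure) \<longlonglongrightarrow>
        (\<integral>\<mu>. indicator A \<mu> * ln \<delta> + ln K \<partial>circle_measure)"
    proof (rule integral_dominated_convergence[where w = "\<lambda>_. \<bar>ln \<delta>\<bar> + ln K + ln K"])
      show "AE \<mu> in circle_measure. (\<lambda>n. indicator A \<mu> * g n \<mu> + ln K) \<longlonglongrightarrow> indicator A \<mu> * ln \<delta> + ln K"
      proof (rule eventually_mono[OF AE_circle])
        fix \<mu> :: complex assume \<mu>: "cmod \<mu> = 1"
        show "(\<lambda>n. indicator A \<mu> * g n \<mu> + ln K) \<longlonglongrightarrow> indicator A \<mu> * ln \<delta> + ln K"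
        proof (cases "\<mu> \<in> A")
          case True
          have "(\<lambda>n. u (of_real (a n) * \<mu>)) \<longlonglongrightarrow> 0"
            by (rule filterlim_compose[OF lim[OF True \<mu>] fa])
          then have "(\<lambda>n. g n \<mu>) \<longlonglongrightarrow> ln (max (cmod 0) \<delta>)"
            unfolding g_def using \<delta> by (intro tendsto_intros) auto
          then show ?thesis using True \<delta> by (auto intro!: tendsto_intros simp: max_def)
        qed simp
      qed
      show "AE \<mu> in circle_measure. norm (indicator A \<mu> * g n \<mu> + ln K) \<le> \<bar>ln \<delta>\<bar> + ln K + ln K" for n
      proof (rule eventually_mono[OF AE_circle])
        fix \<mu> :: complex assume \<mu>: "cmod \<mu> = 1"
        have "0 \<le> ln K" using K(1) by simp
        then show "norm (indicator A \<mu> * g n \<mu> + ln K) \<le> \<bar>ln \<delta>\<bar> + ln K + ln K"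
          using abs_g[OF \<mu>, of n] unfolding real_norm_def by (cases "\<mu> \<in> A") auto
      qed
    qed auto
    then have "ln m \<le> (\<integral>\<mu>. indicator A \<mu> * ln \<delta> + ln K \<partial>circle_measure)"
      by (rule LIMSEQ_le_const) (use le in blast)
    also have "\<dots> = c * ln \<delta> + ln K"
    proof -
      have "integrable circle_measure (indicat_real A)"
        by (rule circle_integrable_bounded[where B = 1]) (auto simp: indicator_def)
      then show ?thesis by (subst Bochner_Integration.integral_add) (auto simp: c_def)
    qed
    finally show ?thesis .
  qed
  \<comment> \<open>Chosen so that \<open>c * ln \<delta>\<close> lies below
    \<open>ln m - ln K\<close> by at least 1.\<close>
  define \<delta> where "\<delta> = exp (- ((\<bar>ln K - ln m\<bar> + 1) / c))"
  have "ln m \<le> c * ln \<delta> + ln K" using c by (intro bound) (auto simp: \<delta>_def)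
  moreover have "c * ln \<delta> = - (\<bar>ln K - ln m\<bar> + 1)" using c by (simp add: \<delta>_def)
  ultimately show False by linarith
qed

section \<open>Holomorphy of directional derivatives\<close>

lemma second_order_bound:
  assumes f: "f holomorphic_on ball 0 \<rho>" and d: "0 < d" "2 * d < \<rho>"
    and M: "\<And>s. cmod s \<le> 2 * d \<Longrightarrow> cmod (f s) \<le> M" and s: "cmod s < d"
  shows "cmod (f s - f 0 - deriv f 0 * s) \<le> (2 * M / d\<^sup>2) * (cmod s)\<^sup>2"
proof -
  have opn: "open (ball (0::complex) \<rho>)" by simp
  have "cmod ((\<lambda>i. (deriv ^^ i) f) 0 s - (\<Sum>i\<le>1. (\<lambda>i. (deriv ^^ i) f) i 0 * (s - 0) ^ i / fact i)) \<le>
      (2 * M / d\<^sup>2) * cmod (s - 0) ^ Suc 1 / fact 1"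
  proof (rule complex_Taylor[where S = "ball 0 d"])
    fix i x assume x: "x \<in> ball (0::complex) d"
    have "(deriv ^^ i) f holomorphic_on ball 0 \<rho>" using f opn by (rule holomorphic_higher_deriv)
    then have "((deriv ^^ i) f has_field_derivative deriv ((deriv ^^ i) f) x) (at x)"
      using x d by (intro holomorphic_derivI[OF _ opn]) auto
    then show "((deriv ^^ i) f has_field_derivative (deriv ^^ Suc i) f x) (at x within ball 0 d)"
      by (simp add: has_field_derivative_at_within)
    have sub: "cball x d \<subseteq> ball 0 \<rho>"
    proof
      fix y assume "y \<in> cball x d"
      then show "y \<in> ball 0 \<rho>" using x d norm_triangle_ineq2[of y x] by (auto simp: dist_norm norm_minus_commute)
    qed
    have "cmod ((deriv ^^ 2) f x) \<le> fact 2 * M / d ^ 2"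
    proof (rule Cauchy_inequality)
      show "f holomorphic_on ball x d"
        using sub ball_subset_cball by (intro holomorphic_on_subset[OF f]) auto
      show "continuous_on (cball x d) f"
        using sub by (intro holomorphic_on_imp_continuous_on holomorphic_on_subset[OF f])
      show "cmod (f y) \<le> M" if "cmod (x - y) = d" for y
        using that x norm_triangle_ineq2[of y x] by (intro M) (auto simp: norm_minus_commute)
    qed (use d in auto)
    then show "cmod ((deriv ^^ Suc 1) f x) \<le> 2 * M / d\<^sup>2" by (simp add: numeral_2_eq_2)
  qed (use s d in auto)
  then show ?thesis by (simp add: diff_diff_eq power2_eq_square)
qed

text \<open>Difference quotients in direction \<open>w\<close> are holomorphic in \<open>t\<close>.
  By \<open>second_order_bound\<close> they converge to the derivative locally uniformly, so the
  limit is holomorphic.\<close>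

lemma directional_derivative_holomorphic:
  fixes h :: "complex ^ 'n::finite \<Rightarrow> complex"
  assumes h: "holomorphic_Cn h S" and S: "open S"
    and D: "\<And>z. z \<in> S \<Longrightarrow> (h has_derivative D z) (at z)"
    and lin: "\<And>z. z \<in> S \<Longrightarrow> Vector_Spaces.linear (*s) (*) (D z)"
  shows "(\<lambda>t. D (a + t *s v) w) holomorphic_on {t. a + t *s v \<in> S}"
proof -
  let ?T = "{t. a + t *s v \<in> S}"
  have "(\<lambda>t. D (a + t *s v) w) field_differentiable at t0" if t0: "t0 \<in> ?T" for t0
  proof -
    have "continuous_on UNIV (\<lambda>x :: complex \<times> complex. a + fst x *s v + snd x *s w)"
      by (intro continuous_intros)
    then have "open ((\<lambda>x :: complex \<times> complex. a + fst x *s v + snd x *s w) -` S)"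
      using S by (intro open_vimage)
    then obtain d0 where d0: "0 < d0"
      "\<And>x :: complex \<times> complex. dist x (t0, 0) < d0 \<Longrightarrow> a + fst x *s v + snd x *s w \<in> S"
      using t0 unfolding open_dist by force
    \<comment> \<open>The two parameters may each vary by less than \<open>4 * d\<close>, which
      together stays below \<open>d0\<close>; the smaller closed discs used later leave a
      margin.\<close>
    define d where "d = d0 / 8"
    have d: "0 < d" using d0 by (simp add: d_def)
    have inS: "a + t *s v + s *s w \<in> S" if "cmod (t - t0) < 4 * d" "cmod s < 4 * d" for t s
    proof -
      have "dist (t, s) (t0, 0) \<le> dist t t0 + dist s 0"
        unfolding dist_Pair_Pair by (rule sqrt_sum_squares_le_sum) auto
      also have "\<dots> < d0" using that by (simp add: dist_norm d_def)
      finally show ?thesis using d0(2)[of "(t, s)"] by simp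
    qed
    define Q where "Q = (\<lambda>(t, s). h (a + t *s v + s *s w)) ` (cball t0 (3 * d) \<times> cball 0 (2 * d))"
    have "compact Q"
      unfolding Q_def case_prod_beta
    proof (intro compact_continuous_image compact_Times compact_cball)
      show "continuous_on (cball t0 (3 * d) \<times> cball 0 (2 * d)) (\<lambda>x. h (a + fst x *s v + snd x *s w))"
      proof (rule continuous_on_compose2[OF holomorphic_Cn_continuous_on[OF h]])
        show "(\<lambda>x. a + fst x *s v + snd x *s w) ` (cball t0 (3 * d) \<times> cball 0 (2 * d)) \<subseteq> S"
          using d inS by (auto simp: dist_norm norm_minus_commute)
      qed (intro continuous_intros)
    qed
    then obtain M where M0: "\<And>y. y \<in> Q \<Longrightarrow> cmod y \<le> M" by (force dest!: compact_imp_bounded simp: bounded_iff)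
    have M: "cmod (h (a + t *s v + s *s w)) \<le> M" if "cmod (t - t0) \<le> 3 * d" "cmod s \<le> 2 * d" for t s
      unfolding Q_def
      by (intro M0[unfolded Q_def] image_eqI[of _ _ "(t, s)"])
         (use that in \<open>auto simp: dist_norm norm_minus_commute\<close>)
    have M_nonneg: "0 \<le> M" using M[of t0 0] d by (auto intro: order_trans[OF norm_ge_zero])
    define \<epsilon> where "\<epsilon> n = d * inverse (real (Suc (Suc n)))" for n
    have \<epsilon>: "0 < \<epsilon> n" "\<epsilon> n < d" for n
      using d mult_strict_left_mono[of "inverse (real (Suc (Suc n)))" 1 d] by (auto simp: \<epsilon>_def field_simps)
    define q where "q n t = (h (a + t *s v + of_real (\<epsilon> n) *s w) - h (a + t *s v)) / of_real (\<epsilon> n)" for n t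
    have close: "cmod (q n t - D (a + t *s v) w) \<le> (2 * M / d\<^sup>2) * \<epsilon> n" if t: "cmod (t - t0) \<le> 3 * d" for n t
    proof -
      define f where "f s = h (a + t *s v + s *s w)" for s
      have sub: "ball 0 (4 * d) \<subseteq> {s. a + t *s v + s *s w \<in> S}" using inS[of t] t d by auto
      have f: "f holomorphic_on ball 0 (4 * d)"
        unfolding f_def by (rule holomorphic_on_subset[OF holomorphic_Cn_line[OF h] sub])
      have aS: "a + t *s v \<in> S" using inS[of t 0] t d by simp
      have f': "deriv f 0 = D (a + t *s v) w"
        unfolding f_def using D[OF aS] lin[OF aS]
        by (intro DERIV_imp_deriv holomorphic_Cn_line_has_field_derivative) auto
      have "cmod (f (\<epsilon> n) - f 0 - deriv f 0 * \<epsilon> n) \<le> (2 * M / d\<^sup>2) * (cmod (\<epsilon> n))\<^sup>2"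
        by (rule second_order_bound[OF f d]) (use d t M \<epsilon>[of n] in \<open>auto simp: f_def\<close>)
      moreover have "q n t - D (a + t *s v) w = (f (\<epsilon> n) - f 0 - deriv f 0 * \<epsilon> n) / of_real (\<epsilon> n)"
        using \<epsilon>[of n] by (simp add: q_def f' f_def[of "of_real (\<epsilon> n)"] f_def[of 0] field_simps)
      ultimately show ?thesis
        using \<epsilon>[of n] by (simp add: norm_divide divide_le_eq power2_eq_square mult_ac)
    qed
    have "(\<lambda>t. D (a + t *s v) w) holomorphic_on ball t0 (2 * d)"
    proof (rule holomorphic_uniform_sequence[OF open_ball])
      show "q n holomorphic_on ball t0 (2 * d)" for n
      proof -
        have "(\<lambda>t. h ((a + of_real (\<epsilon> n) *s w) + t *s v)) holomorphic_on ball t0 (2 * d)"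
          using inS[of _ "of_real (\<epsilon> n)"] \<epsilon>[of n] d
          by (intro holomorphic_on_subset[OF holomorphic_Cn_line[OF h]]) (auto simp: dist_norm norm_minus_commute algebra_simps)
        moreover have "(\<lambda>t. h (a + t *s v)) holomorphic_on ball t0 (2 * d)"
          using inS[of _ 0] d
          by (intro holomorphic_on_subset[OF holomorphic_Cn_line[OF h]]) (auto simp: dist_norm norm_minus_commute)
        ultimately show ?thesis
          unfolding q_def using \<epsilon>[of n] by (intro holomorphic_intros) (auto simp: algebra_simps)
      qed
      fix x assume x: "x \<in> ball t0 (2 * d)"
      obtain r where r: "0 < r" "cball x r \<subseteq> ball t0 (2 * d)"
        using x open_contains_cball[of "ball t0 (2 * d)"] open_ball by blast
      have "uniform_limit (cball x r) q (\<lambda>t. D (a + t *s v) w) sequentially"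
      proof (rule uniform_limitI)
        fix e :: real assume e: "0 < e"
        have "(\<lambda>n. (2 * M / d\<^sup>2) * (d * inverse (real (Suc (Suc n))))) \<longlonglongrightarrow> (2 * M / d\<^sup>2) * (d * 0)"
          by (intro tendsto_intros LIMSEQ_Suc[OF LIMSEQ_inverse_real_of_nat])
        then have "\<forall>\<^sub>F n in sequentially. (2 * M / d\<^sup>2) * \<epsilon> n < e"
          unfolding \<epsilon>_def using e by (intro order_tendstoD(2)) auto
        then show "\<forall>\<^sub>F n in sequentially. \<forall>t\<in>cball x r. dist (q n t) (D (a + t *s v) w) < e"
        proof eventually_elim
          case (elim n)
          show ?case
          proof
            fix t assume "t \<in> cball x r"
            then have "t \<in> ball t0 (2 * d)" using r(2) by blast
            then have "cmod (t - t0) \<le> 3 * d" using d by (simp add: dist_norm norm_minus_commute)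
            from close[OF this, of n] elim show "dist (q n t) (D (a + t *s v) w) < e" by (simp add: dist_norm)
          qed
        qed
      qed
      then show "\<exists>r>0. cball x r \<subseteq> ball t0 (2 * d) \<and> uniform_limit (cball x r) q (\<lambda>t. D (a + t *s v) w) sequentially"
        using r by blast
    qed
    then show ?thesis using d by (intro holomorphic_on_imp_differentiable_at) auto
  qed
  then show ?thesis
    by (auto simp: holomorphic_on_def intro: field_differentiable_at_within)
qed

section \<open>Tangential derivatives\<close>

definition cinner :: "complex ^ 'n::finite \<Rightarrow> complex ^ 'n \<Rightarrow> complex" where
  "cinner x y = (\<Sum>j\<in>UNIV. x $ j * cnj (y $ j))"

lemma inner_eq_Re_cinner: "x \<bullet> y = Re (cinner x y)"
  by (simp add: cinner_def inner_vec_def inner_complex_def)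

lemma cinner_scale_left: "cinner (c *s x) y = c * cinner x y"
  and cinner_scale_right: "cinner x (c *s y) = cnj c * cinner x y"
  and cinner_cnj: "cinner y x = cnj (cinner x y)"
  by (simp_all add: cinner_def sum_distrib_left mult_ac)

lemma norm_cinner_defect:
  assumes "norm y = 1"
  shows "(norm (x - cinner x y *s y))\<^sup>2 = (norm x)\<^sup>2 - (cmod (cinner x y))\<^sup>2"
proof -
  let ?c = "cinner x y"
  have 1: "x \<bullet> (?c *s y) = (cmod ?c)\<^sup>2"
    by (simp add: inner_eq_Re_cinner cinner_scale_right cmod_power2) (simp add: power2_eq_square)
  have 2: "(?c *s y) \<bullet> (?c *s y) = (cmod ?c)\<^sup>2"
    using assms by (simp add: norm_vector_scalar_mult flip: power2_norm_eq_inner)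
  show ?thesis
    unfolding power2_norm_eq_inner[of "x - ?c *s y"] power2_norm_eq_inner[of x] inner_diff_left inner_diff_right
    using 1 2 inner_commute[of x "?c *s y"] by linarith
qed

text \<open>The equality case of Cauchy-Schwarz, read off from the vanishing defect in
  \<open>norm_cinner_defect\<close>.\<close>

lemma cinner_eq_unit:
  assumes "norm y = 1" "norm x \<le> 1" "cmod (cinner x y) = 1"
  shows "x = cinner x y *s y"
proof -
  have "(norm x)\<^sup>2 \<le> 1" using assms(2) by (simp add: power_le_one)
  then have "(norm (x - cinner x y *s y))\<^sup>2 \<le> 0" using norm_cinner_defect[OF assms(1), of x] assms(3) by simp
  then show ?thesis by simp
qed

lemma cmod_cinner_le:
  assumes "norm y = 1" "norm x \<le> 1"
  shows "cmod (cinner x y) \<le> 1"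
proof -
  have "0 \<le> (norm (x - cinner x y *s y))\<^sup>2" by simp
  then have "(cmod (cinner x y))\<^sup>2 \<le> (norm x)\<^sup>2" by (simp add: norm_cinner_defect[OF assms(1)])
  also have "\<dots> \<le> 1" using assms(2) by (simp add: power_le_one)
  finally show ?thesis by (simp add: abs_square_le_1)
qed

lemma norm_orthogonal_sum:
  assumes "cinner w z = 0"
  shows "(norm (a *s z + s *s w))\<^sup>2 = (cmod a)\<^sup>2 * (norm z)\<^sup>2 + (cmod s)\<^sup>2 * (norm w)\<^sup>2"
proof -
  have "(a *s z) \<bullet> (s *s w) = 0"
    using assms by (simp add: inner_eq_Re_cinner cinner_scale_left cinner_scale_right cinner_cnj[of z])
  then show ?thesis
    by (simp add: norm_vector_scalar_mult power_mult_distrib norm_add_Pythagorean orthogonal_def)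
qed

text \<open>Orthogonality adds squares, and \<open>r'\<^sup>2 + (1 - r') < 1\<close>. This is why a
  tangential displacement may be of order \<open>sqrt (1 - r')\<close>, much larger than the
  depth.\<close>

lemma tangential_disc:
  assumes w: "cinner w z = 0" "norm w \<le> 1" and z: "norm z = 1"
    and r: "0 \<le> r" "r \<le> r'" "0 < r'" "r' < 1" and a: "cmod a = r" and s: "cmod s \<le> sqrt (1 - r')"
  shows "a *s z + s *s w \<in> ball 0 1"
proof -
  have "(cmod s)\<^sup>2 \<le> (sqrt (1 - r'))\<^sup>2" using s by (intro power_mono) auto
  then have s2: "(cmod s)\<^sup>2 \<le> 1 - r'" using r by simp
  have "(norm w)\<^sup>2 \<le> 1" using w(2) by (simp add: power_le_one)
  then have "(cmod s)\<^sup>2 * (norm w)\<^sup>2 \<le> (1 - r') * 1" using s2 r by (intro mult_mono) auto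
  moreover have "r\<^sup>2 \<le> r'\<^sup>2" using r by (intro power_mono) auto
  moreover have "r' * r' < r' * 1" using r by (intro mult_strict_left_mono) auto
  ultimately have "(norm (a *s z + s *s w))\<^sup>2 < 1"
    unfolding norm_orthogonal_sum[OF w(1)] using a z by (simp add: power2_eq_square)
  then show ?thesis by (simp add: abs_square_less_1)
qed

text \<open>Complex tangential discs at depth \<open>1 - r\<close> have radius \<open>sqrt (1 - r)\<close>, so a Lipschitz condition
  of order \<open>\<alpha> > 1/2\<close> makes the dyadic increments of a tangential derivative summable.\<close>

lemma tangential_derivative_bounded:
  fixes F :: "complex ^ 'n::finite \<Rightarrow> complex"
  assumes F: "holomorphic_Cn F (ball 0 1)"
    and D: "\<And>z. z \<in> ball 0 1 \<Longrightarrow> (F has_derivative D z) (at z)"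
    and lin: "\<And>z. z \<in> ball 0 1 \<Longrightarrow> Vector_Spaces.linear (*s) (*) (D z)"
    and L: "0 \<le> L" and Lip: "\<And>a b. a \<in> ball 0 1 \<Longrightarrow> b \<in> ball 0 1 \<Longrightarrow> cmod (F a - F b) \<le> L * norm (a - b) powr \<alpha>"
    and \<alpha>: "1 / 2 < \<alpha>" and z: "norm z = 1" and w: "cinner w z = 0" "norm w \<le> 1"
  shows "\<exists>M. \<forall>a\<in>ball 0 1. cmod (D (a *s z) w) \<le> M"
proof -
  \<comment> \<open>Cauchy's inequality for the difference of \<open>F\<close> on two parallel
    tangential discs of radius \<open>sqrt (1 - r')\<close>: corresponding points lie
    \<open>r' - r\<close> apart, so the Lipschitz bound is uniform.\<close>
  have step: "cmod (D ((r' * \<eta>) *s z) w - D ((r * \<eta>) *s z) w) \<le> L * (r' - r) powr \<alpha> / sqrt (1 - r')"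
    if r: "0 \<le> r" "r \<le> r'" "0 < r'" "r' < 1" and \<eta>: "cmod \<eta> = 1" for r r' :: real and \<eta> :: complex
  proof -
    define \<rho> where "\<rho> = sqrt (1 - r')"
    have \<rho>: "0 < \<rho>" using r by (simp add: \<rho>_def)
    have in1: "(r' * \<eta>) *s z + s *s w \<in> ball 0 1" if "cmod s \<le> \<rho>" for s
      by (rule tangential_disc[OF w z, where r = r' and r' = r']) (use r \<eta> that in \<open>auto simp: \<rho>_def norm_mult\<close>)
    have in2: "(r * \<eta>) *s z + s *s w \<in> ball 0 1" if "cmod s \<le> \<rho>" for s
      by (rule tangential_disc[OF w z, where r = r and r' = r']) (use r \<eta> that in \<open>auto simp: \<rho>_def norm_mult\<close>)
    have p1: "(r' * \<eta>) *s z \<in> ball 0 1" and p2: "(r * \<eta>) *s z \<in> ball 0 1"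
      using in1[of 0] in2[of 0] \<rho> by auto
    define f where "f s = F ((r' * \<eta>) *s z + s *s w) - F ((r * \<eta>) *s z + s *s w)" for s
    have "(\<lambda>s. F ((r' * \<eta>) *s z + s *s w)) holomorphic_on cball 0 \<rho>"
      "(\<lambda>s. F ((r * \<eta>) *s z + s *s w)) holomorphic_on cball 0 \<rho>"
      using in1 in2 by (auto intro!: holomorphic_on_subset[OF holomorphic_Cn_line[OF F]])
    then have f: "f holomorphic_on cball 0 \<rho>" unfolding f_def by (intro holomorphic_intros)
    have "cmod ((deriv ^^ 1) f 0) \<le> fact 1 * (L * (r' - r) powr \<alpha>) / \<rho> ^ 1"
    proof (rule Cauchy_inequality)
      fix s assume "cmod (0 - s) = \<rho>"
      then have "cmod (f s) \<le> L * norm (((r' * \<eta>) *s z + s *s w) - ((r * \<eta>) *s z + s *s w)) powr \<alpha>"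
        unfolding f_def by (intro Lip in1 in2) auto
      also have "((r' * \<eta>) *s z + s *s w) - ((r * \<eta>) *s z + s *s w) = (of_real (r' - r) * \<eta>) *s z"
        by (simp add: vec_eq_iff algebra_simps)
      also have "norm \<dots> = r' - r" using r \<eta> z by (simp add: norm_vector_scalar_mult norm_mult del: of_real_diff)
      finally show "cmod (f s) \<le> L * (r' - r) powr \<alpha>" .
    qed (use f \<rho> in \<open>auto intro: holomorphic_on_subset holomorphic_on_imp_continuous_on\<close>)
    moreover have "deriv f 0 = D ((r' * \<eta>) *s z) w - D ((r * \<eta>) *s z) w"
      unfolding f_def
      by (intro DERIV_imp_deriv DERIV_diff holomorphic_Cn_line_has_field_derivative lin p1 p2)
         (use D[OF p1] D[OF p2] in simp_all)
    ultimately show ?thesis by (simp add: \<rho>_def)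
  qed
  \<comment> \<open>Ratio of consecutive dyadic bounds: at depth \<open>x\<close> the increment is
    at most \<open>L * x powr (\<alpha> - 1 / 2)\<close>, and halving \<open>x\<close> multiplies
    this by \<open>q\<close>, which is below 1 because \<open>\<alpha> > 1 / 2\<close>.\<close>
  define q where "q = (1 / 2 :: real) powr (\<alpha> - 1 / 2)"
  have q: "0 < q" "q < 1" using \<alpha> by (auto simp: q_def powr_def ln_div)
  define b where "b k = 1 - (1 / 2 :: real) ^ k" for k
  have b: "0 \<le> b k" "b k \<le> b (Suc k)" "0 < b (Suc k)" "b k < 1" for k
  proof -
    have "(1 / 2 :: real) ^ k \<le> 1" "0 < (1 / 2 :: real) ^ k" by (auto intro: power_le_one)
    then show "0 \<le> b k" "b k \<le> b (Suc k)" "0 < b (Suc k)" "b k < 1"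
      unfolding b_def power_Suc by linarith+
  qed
  have dyadic: "cmod (D ((b (Suc k) * \<eta>) *s z) w - D ((r * \<eta>) *s z) w) \<le> L * q ^ Suc k"
    if r: "b k \<le> r" "r \<le> b (Suc k)" and \<eta>: "cmod \<eta> = 1" for r :: real and \<eta> :: complex and k
  proof -
    define x where "x = (1 / 2 :: real) ^ Suc k"
    have x: "0 < x" "1 - b (Suc k) = x" "b (Suc k) - r \<le> x" using r by (auto simp: x_def b_def)
    have "cmod (D ((b (Suc k) * \<eta>) *s z) w - D ((r * \<eta>) *s z) w) \<le>
        L * (b (Suc k) - r) powr \<alpha> / sqrt (1 - b (Suc k))"
      using b[of k] b[of "Suc k"] r \<eta> by (intro step) auto
    also have "\<dots> \<le> L * x powr \<alpha> / sqrt x"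
      unfolding x(2) using x L r \<alpha> by (intro divide_right_mono mult_left_mono powr_mono2) auto
    also have "\<dots> = L * x powr (\<alpha> - 1 / 2)"
      using x by (simp add: powr_diff powr_half_sqrt)
    also have "x powr (\<alpha> - 1 / 2) = q ^ Suc k"
    proof -
      have "x = (1 / 2) powr real (Suc k)" unfolding x_def by (rule powr_realpow[symmetric]) simp
      then have "x powr (\<alpha> - 1 / 2) = q powr real (Suc k)" by (simp add: q_def powr_powr mult.commute)
      then show ?thesis using powr_realpow[OF q(1), of "Suc k"] by simp
    qed
    finally show ?thesis .
  qed
  define S where "S = L * (1 / (1 - q))"
  have partial: "(\<Sum>i<k. L * q ^ i) \<le> S" for k
  proof -
    have "(\<Sum>i<k. q ^ i) \<le> (\<Sum>i. q ^ i)" using q by (intro sum_le_suminf summable_geometric) auto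
    also have "\<dots> = 1 / (1 - q)" using q by (intro suminf_geometric) auto
    finally show ?thesis unfolding S_def sum_distrib_left[symmetric] using L by (rule mult_left_mono)
  qed
  have at_b: "cmod (D ((b k * \<eta>) *s z) w) \<le> cmod (D 0 w) + S" if \<eta>: "cmod \<eta> = 1" for \<eta> :: complex and k
  proof -
    have "cmod (D ((b k * \<eta>) *s z) w) \<le> cmod (D 0 w) + (\<Sum>i<k. L * q ^ i)"
    proof (induction k)
      case 0
      show ?case by (simp add: b_def)
    next
      case (Suc k)
      have "cmod (D ((b (Suc k) * \<eta>) *s z) w) \<le> cmod (D ((b k * \<eta>) *s z) w) + L * q ^ Suc k"
        using dyadic[of k "b k" \<eta>] b[of k] \<eta>
          norm_triangle_ineq2[of "D ((b (Suc k) * \<eta>) *s z) w" "D ((b k * \<eta>) *s z) w"] by simp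
      moreover have "L * q ^ Suc k \<le> L * q ^ k" using L q by (intro mult_left_mono power_decreasing) auto
      ultimately show ?case using Suc by simp
    qed
    then show ?thesis using partial[of k] by linarith
  qed
  have main: "cmod (D ((r * \<eta>) *s z) w) \<le> cmod (D 0 w) + S + L" if r: "0 \<le> r" "r < 1" and \<eta>: "cmod \<eta> = 1" for r :: real and \<eta> :: complex
  proof -
    obtain n0 where n0: "(1 / 2 :: real) ^ n0 < 1 - r"
      using real_arch_pow_inv[of "1 - r" "1 / 2"] r by auto
    \<comment> \<open>The first dyadic radius beyond \<open>r\<close>. It is not
      \<open>b 0 = 0\<close>, so \<open>r\<close> lies in the dyadic interval that ends
      there.\<close>
    define n where "n = (LEAST n. r < b n)"
    have "r < b n0" using n0 by (simp add: b_def)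
    then have n: "r < b n" unfolding n_def by (rule LeastI)
    have "n \<noteq> 0"
    proof
      assume "n = 0"
      then show False using n r by (simp add: b_def)
    qed
    then obtain k where k: "n = Suc k" using not0_implies_Suc by blast
    have "\<not> r < b k" using k not_less_Least[of k "\<lambda>n. r < b n"] by (simp add: n_def)
    then have "cmod (D ((b (Suc k) * \<eta>) *s z) w - D ((r * \<eta>) *s z) w) \<le> L * q ^ Suc k"
      using n k \<eta> by (intro dyadic) auto
    also have "\<dots> \<le> L * 1" using L q by (intro mult_left_mono power_le_one) auto
    finally have "cmod (D ((r * \<eta>) *s z) w) \<le> cmod (D ((b (Suc k) * \<eta>) *s z) w) + L"
      using norm_triangle_ineq3[of "D ((b (Suc k) * \<eta>) *s z) w" "D ((r * \<eta>) *s z) w"] by linarith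
    then show ?thesis using at_b[OF \<eta>, of "Suc k"] by linarith
  qed
  have "cmod (D (a *s z) w) \<le> cmod (D 0 w) + S + L" if "a \<in> ball 0 1" for a
  proof (cases "a = 0")
    case True
    then show ?thesis using main[of 0 1] by simp
  next
    case False
    have "a = of_real (cmod a) * sgn a" using False by (simp add: sgn_div_norm scaleR_conv_of_real)
    then show ?thesis using main[of "cmod a" "sgn a"] that False by (simp add: norm_sgn)
  qed
  then show ?thesis by blast
qed

text \<open>The real part of \<open>1 - cnj c * F\<close> is nonnegative on a tangential disc of
  radius \<open>sqrt (1 - r)\<close> and at most \<open>L * (1 - r) powr \<alpha>\<close> at its
  centre. Dividing by the radius leaves the exponent \<open>\<alpha> - 1 / 2\<close>, which is
  positive.\<close>

lemma tangential_derivative_at_unimodular_point: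
  fixes F :: "complex ^ 'n::finite \<Rightarrow> complex" and \<mu> :: complex
  assumes F: "holomorphic_Cn F (ball 0 1)"
    and D: "\<And>z. z \<in> ball 0 1 \<Longrightarrow> (F has_derivative D z) (at z)"
    and lin: "\<And>z. z \<in> ball 0 1 \<Longrightarrow> Vector_Spaces.linear (*s) (*) (D z)"
    and F1: "\<And>z. z \<in> ball 0 1 \<Longrightarrow> cmod (F z) \<le> 1"
    and \<alpha>: "1 / 2 < \<alpha>" and z: "norm z = 1" and w: "cinner w z = 0" "norm w \<le> 1"
    and \<mu>: "cmod \<mu> = 1" and c: "cmod c = 1"
    and near: "\<And>r. 0 < r \<Longrightarrow> r < 1 \<Longrightarrow> cmod (c - F ((of_real r * \<mu>) *s z)) \<le> L * (1 - r) powr \<alpha>"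
  shows "((\<lambda>r. D ((of_real r * \<mu>) *s z) w) \<longlongrightarrow> 0) (at_left 1)"
proof (rule Lim_null_comparison)
  have cc: "cnj c * c = 1" using c by (simp add: mult.commute flip: complex_norm_square)
  have bound: "cmod (D ((of_real r * \<mu>) *s z) w) \<le> 2 * L * (1 - r) powr (\<alpha> - 1 / 2)" if r: "0 < r" "r < 1" for r :: real
  proof -
    define \<rho> where "\<rho> = sqrt (1 - r)"
    have \<rho>: "0 < \<rho>" using r by (simp add: \<rho>_def)
    have in1: "(of_real r * \<mu>) *s z + s *s w \<in> ball 0 1" if "cmod s \<le> \<rho>" for s :: complex
      by (rule tangential_disc[OF w z, where r = r and r' = r]) (use r \<mu> that in \<open>auto simp: \<rho>_def norm_mult\<close>)
    have p: "(of_real r * \<mu>) *s z \<in> ball 0 1" using in1[of 0] \<rho> by simp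
    define G where "G s = 1 - cnj c * F ((of_real r * \<mu>) *s z + s *s w)" for s :: complex
    have "(\<lambda>s. F ((of_real r * \<mu>) *s z + s *s w)) holomorphic_on ball 0 \<rho>"
      using in1 by (auto intro!: holomorphic_on_subset[OF holomorphic_Cn_line[OF F]])
    then have G: "G holomorphic_on ball 0 \<rho>" unfolding G_def by (intro holomorphic_intros)
    have "cmod (deriv G 0) * \<rho> \<le> 2 * Re (G 0)"
    proof (rule caratheodory_deriv_bound[OF G \<rho>])
      fix s :: complex assume "s \<in> ball 0 \<rho>"
      then have "cmod (cnj c * F ((of_real r * \<mu>) *s z + s *s w)) \<le> 1"
        using F1[OF in1, of s] c by (simp add: norm_mult)
      then show "0 \<le> Re (G s)"
        using complex_Re_le_cmod[of "cnj c * F ((of_real r * \<mu>) *s z + s *s w)"] unfolding G_def by simp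
    qed
    moreover have "deriv G 0 = - cnj c * D ((of_real r * \<mu>) *s z) w"
    proof (rule DERIV_imp_deriv)
      have "((\<lambda>s. F ((of_real r * \<mu>) *s z + s *s w)) has_field_derivative D ((of_real r * \<mu>) *s z) w) (at 0)"
        using D[OF p] by (intro holomorphic_Cn_line_has_field_derivative lin p) simp
      then show "(G has_field_derivative - cnj c * D ((of_real r * \<mu>) *s z) w) (at 0)"
        unfolding G_def by (auto intro!: derivative_eq_intros)
    qed
    moreover have "Re (G 0) \<le> L * (1 - r) powr \<alpha>"
    proof -
      have "G 0 = cnj c * (c - F ((of_real r * \<mu>) *s z))" using cc by (simp add: G_def algebra_simps)
      then have "cmod (G 0) = cmod (c - F ((of_real r * \<mu>) *s z))" using c by (simp add: norm_mult)
      then show ?thesis using near[OF r] complex_Re_le_cmod[of "G 0"] by simp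
    qed
    ultimately have "cmod (D ((of_real r * \<mu>) *s z) w) * \<rho> \<le> 2 * (L * (1 - r) powr \<alpha>)"
      using c by (simp add: norm_mult)
    then have "cmod (D ((of_real r * \<mu>) *s z) w) \<le> 2 * (L * (1 - r) powr \<alpha>) / \<rho>"
      using \<rho> by (simp add: pos_le_divide_eq)
    also have "\<dots> = 2 * L * ((1 - r) powr \<alpha> / (1 - r) powr (1 / 2))"
      using r by (simp add: \<rho>_def powr_half_sqrt)
    also have "\<dots> = 2 * L * (1 - r) powr (\<alpha> - 1 / 2)" by (simp add: powr_diff)
    finally show ?thesis by simp
  qed
  show "\<forall>\<^sub>F r in at_left 1. norm (D ((of_real r * \<mu>) *s z) w) \<le> 2 * L * (1 - r) powr (\<alpha> - 1 / 2)"
    unfolding eventually_at_left_field using bound by (intro exI[of _ 0]) auto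
  have "((\<lambda>r::real. (1 - r) powr (\<alpha> - 1 / 2)) \<longlongrightarrow> 0 powr (\<alpha> - 1 / 2)) (at_left 1)"
  proof (rule tendsto_powr2)
    show "((\<lambda>r::real. 1 - r) \<longlongrightarrow> 0) (at_left 1)" by (auto intro!: tendsto_eq_intros)
    show "\<forall>\<^sub>F r::real in at_left 1. 0 \<le> 1 - r"
      unfolding eventually_at_left_field by (intro exI[of _ 0]) auto
  qed (use \<alpha> in auto)
  then have "((\<lambda>r::real. 2 * L * (1 - r) powr (\<alpha> - 1 / 2)) \<longlongrightarrow> 2 * L * 0 powr (\<alpha> - 1 / 2)) (at_left 1)"
    by (intro tendsto_mult tendsto_const)
  then show "((\<lambda>r::real. 2 * L * (1 - r) powr (\<alpha> - 1 / 2)) \<longlongrightarrow> 0) (at_left 1)" by simp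
qed

text \<open>The points of the ball whose slice meets \<open>E\<close> in positive arc measure. It
  converts a boundary set into a solid one, as \<open>vanishing_on_positive_measure\<close>
  requires.\<close>

definition positive_cone :: "(complex ^ 'n::finite) set \<Rightarrow> (complex ^ 'n) set" where
  "positive_cone E = {z \<in> ball 0 1. z \<noteq> 0 \<and> emeasure circle_measure {\<mu>. \<mu> *s sgn z \<in> E} \<noteq> 0}"

lemma slice_set_measurable:
  fixes E :: "(complex ^ 'n::finite) set"
  assumes "E \<in> sets borel"
  shows "{\<mu>. \<mu> *s x \<in> E} \<in> sets borel"
proof -
  have "(\<lambda>\<mu>. \<mu> *s x) -` E \<inter> space borel \<in> sets borel"
    by (rule measurable_sets[OF _ assms]) measurable
  then show ?thesis by (simp add: vimage_def)
qed

text \<open>If the cone were null, almost every slice would meet \<open>E\<close> in a null set, and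
  integration over slices would make \<open>E\<close> null.\<close>

lemma positive_cone_positive:
  fixes E :: "(complex ^ 'n::finite) set"
  assumes E [measurable]: "E \<in> sets borel" and pos: "emeasure unif_sphere E \<noteq> 0"
  shows "positive_cone E \<in> sets borel" and "emeasure lborel (positive_cone E) \<noteq> 0"
proof -
  have mE [measurable]: "(indicator E :: complex ^ 'n \<Rightarrow> ennreal) \<in> borel_measurable borel"
    by (intro borel_measurable_indicator) simp
  define f where "f x = (\<integral>\<^sup>+\<mu>. indicator E (\<mu> *s x) \<partial>circle_measure)" for x :: "complex ^ 'n"
  have [measurable]: "f \<in> borel_measurable borel" unfolding f_def[abs_def] by measurable
  have f: "f x = emeasure circle_measure {\<mu>. \<mu> *s x \<in> E}" for x
  proof -
    have "f x = (\<integral>\<^sup>+\<mu>. indicator {\<mu>. \<mu> *s x \<in> E} \<mu> \<partial>circle_measure)"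
      unfolding f_def by (intro nn_integral_cong) (simp add: indicator_def)
    then show ?thesis using slice_set_measurable[OF E, of x] by simp
  qed
  have C_eq: "positive_cone E = ball 0 1 \<inter> - {0} \<inter> (\<lambda>z. f (sgn z)) -` (- {0})"
    by (auto simp: positive_cone_def f)
  have mf: "(\<lambda>z. f (sgn z)) \<in> borel_measurable borel" by measurable
  have "(\<lambda>z. f (sgn z)) -` (- {0}) \<inter> space borel \<in> sets borel"
    by (rule measurable_sets[OF mf]) auto
  then show C: "positive_cone E \<in> sets borel"
    unfolding C_eq by (intro sets.Int borel_comp) auto
  show "emeasure lborel (positive_cone E) \<noteq> 0"
  proof
    assume "emeasure lborel (positive_cone E) = 0"
    then have "AE z in lborel. z \<notin> positive_cone E"
      using C by (intro AE_not_in) (auto simp: null_sets_def)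
    then have "AE z in unif_ball. z \<notin> positive_cone E"
      unfolding unif_ball_def by (intro AE_uniform_measureI) auto
    then have "AE z in unif_ball. f (sgn z) = 0"
      using AE_unif_ball by eventually_elim (auto simp: C_eq)
    then have "(\<integral>\<^sup>+z. f (sgn z) \<partial>unif_ball) = (\<integral>\<^sup>+z. 0 \<partial>(unif_ball :: (complex ^ 'n) measure))"
      by (rule nn_integral_cong_AE)
    then have "(\<integral>\<^sup>+x. f x \<partial>unif_sphere) = 0"
      by (simp add: nn_integral_unif_sphere)
    moreover have "(\<integral>\<^sup>+x. f x \<partial>unif_sphere) = (\<integral>\<^sup>+x. indicator E x \<partial>unif_sphere)"
      unfolding f_def by (rule nn_integral_slices(1)[OF mE])
    ultimately show False using pos by simp
  qed
qed

lemma holomorphic_slice_restrict_measurable: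
  fixes g :: "complex \<Rightarrow> complex"
  assumes "g holomorphic_on ball 0 1"
  shows "(\<lambda>t. if t \<in> ball 0 1 then g t else 0) holomorphic_on ball 0 1"
    and "(\<lambda>t. if t \<in> ball 0 1 then g t else 0) \<in> borel_measurable borel"
proof -
  show "(\<lambda>t. if t \<in> ball 0 1 then g t else 0) holomorphic_on ball 0 1"
    using assms by (subst holomorphic_cong[OF refl, where g = g]) auto
  show "(\<lambda>t. if t \<in> ball 0 1 then g t else 0) \<in> borel_measurable borel"
    by (rule borel_measurable_continuous_on_if)
      (use holomorphic_on_imp_continuous_on[OF assms] in \<open>auto intro!: continuous_intros\<close>)
qed

text \<open>Extension by zero outside the disc supplies the Borel measurability that
  \<open>bounded_holomorphic_uniqueness\<close> requires, without affecting radial limits.\<close>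

lemma uniqueness_on_slice:
  assumes u: "u holomorphic_on ball 0 1" and M: "\<And>a. a \<in> ball 0 1 \<Longrightarrow> cmod (u a) \<le> M"
    and A: "A \<in> sets borel" "emeasure circle_measure A \<noteq> 0"
    and lim: "\<And>\<mu>. \<mu> \<in> A \<Longrightarrow> cmod \<mu> = 1 \<Longrightarrow> ((\<lambda>r. u (of_real r * \<mu>)) \<longlongrightarrow> 0) (at_left 1)"
    and a: "a \<in> ball 0 1"
  shows "u a = 0"
proof -
  let ?u = "\<lambda>t. if t \<in> ball 0 1 then u t else 0"
  have "?u a = 0"
  proof (rule bounded_holomorphic_uniqueness[OF holomorphic_slice_restrict_measurable[OF u] _ A])
    show "cmod (?u z) \<le> M" if "z \<in> ball 0 1" for z using M that by simp
    show "((\<lambda>r. ?u (of_real r * \<mu>)) \<longlongrightarrow> 0) (at_left 1)" if "\<mu> \<in> A" "cmod \<mu> = 1" for \<mu>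
    proof (rule Lim_transform_eventually[OF lim[OF that]])
      show "\<forall>\<^sub>F r in at_left 1. u (of_real r * \<mu>) = ?u (of_real r * \<mu>)"
        unfolding eventually_at_left_field using that by (intro exI[of _ 0]) (auto simp: norm_mult)
    qed
  qed (use a in simp)
  then show ?thesis using a by simp
qed

lemma boundary_Lipschitz:
  fixes F :: "complex ^ 'n::finite \<Rightarrow> complex"
  assumes cont: "continuous_on (cball 0 1) F" and \<alpha>: "0 < \<alpha>"
    and Lip: "\<And>a b. a \<in> ball 0 1 \<Longrightarrow> b \<in> ball 0 1 \<Longrightarrow> cmod (F a - F b) \<le> L * norm (a - b) powr \<alpha>"
    and x: "norm x = 1" and r: "0 < r" "r < 1"
  shows "cmod (F x - F (r *\<^sub>R x)) \<le> L * (1 - r) powr \<alpha>"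
proof (rule tendsto_le)
  have "continuous_on {0..1} (\<lambda>t. F (t *\<^sub>R x))"
    by (rule continuous_on_compose2[OF cont]) (use x in \<open>auto intro!: continuous_intros\<close>)
  then have "((\<lambda>t. F (t *\<^sub>R x)) \<longlongrightarrow> F (1 *\<^sub>R x)) (at 1 within {0..1})"
    unfolding continuous_on_def by (rule bspec) simp
  then have "((\<lambda>t. F (t *\<^sub>R x)) \<longlongrightarrow> F x) (at_left 1)" by (simp add: at_within_Icc_at_left)
  then show "((\<lambda>t. cmod (F (t *\<^sub>R x) - F (r *\<^sub>R x))) \<longlongrightarrow> cmod (F x - F (r *\<^sub>R x))) (at_left 1)"
    by (intro tendsto_intros)
  show "((\<lambda>t. L * \<bar>t - r\<bar> powr \<alpha>) \<longlongrightarrow> L * (1 - r) powr \<alpha>) (at_left 1)"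
    using r by (auto intro!: tendsto_eq_intros)
  show "\<forall>\<^sub>F t in at_left 1. cmod (F (t *\<^sub>R x) - F (r *\<^sub>R x)) \<le> L * \<bar>t - r\<bar> powr \<alpha>"
    unfolding eventually_at_left_field
  proof (intro exI[of _ 0] conjI allI impI)
    fix t :: real assume "0 < t" "t < 1"
    then have "cmod (F (t *\<^sub>R x) - F (r *\<^sub>R x)) \<le> L * norm (t *\<^sub>R x - r *\<^sub>R x) powr \<alpha>"
      using r x by (intro Lip) auto
    also have "norm (t *\<^sub>R x - r *\<^sub>R x) = \<bar>t - r\<bar>"
      using x by (simp flip: scaleR_left_diff_distrib)
    finally show "cmod (F (t *\<^sub>R x) - F (r *\<^sub>R x)) \<le> L * \<bar>t - r\<bar> powr \<alpha>" .
  qed simp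
qed simp

lemma linear_vec_axis:
  fixes D :: "complex ^ 'n::finite \<Rightarrow> complex"
  assumes "Vector_Spaces.linear (*s) (*) D"
  shows "D v = (\<Sum>j\<in>UNIV. v $ j * D (axis j 1))"
proof -
  interpret D: Vector_Spaces.linear "(*s)" "(*)" D by fact
  have "v = (\<Sum>j\<in>UNIV. v $ j *s axis j 1)"
    by (simp add: vec_eq_iff axis_def if_distrib[of "(*) _"] cong: if_cong)
  then have "D v = D (\<Sum>j\<in>UNIV. v $ j *s axis j 1)" by simp
  then show ?thesis by (simp add: D.sum D.scale)
qed

text \<open>A nonconstant \<open>F\<close> would have vanishing complex tangential derivatives on almost every slice
  meeting the set \<open>|F| = 1\<close>, hence \<open>\<bar>z\<^sub>i \<partial>\<^sub>j F = \<bar>z\<^sub>j \<partial>\<^sub>i F\<close> throughout the ball; differentiating in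
  \<open>\<bar>z\<^sub>i\<close> gives \<open>\<partial>\<^sub>j F = 0\<close>.\<close>

lemma constant_if_unimodular_on_positive_measure:
  fixes F :: "complex ^ 'n::finite \<Rightarrow> complex"
  assumes card: "CARD('n) \<ge> 2" and F: "holomorphic_Cn F (ball 0 1)"
    and cont: "continuous_on (cball 0 1) F"
    and F1: "\<And>z. z \<in> ball 0 1 \<Longrightarrow> cmod (F z) \<le> 1"
    and L: "0 \<le> L" and Lip: "\<And>a b. a \<in> ball 0 1 \<Longrightarrow> b \<in> ball 0 1 \<Longrightarrow> cmod (F a - F b) \<le> L * norm (a - b) powr \<alpha>"
    and \<alpha>: "1 / 2 < \<alpha>"
    and E: "E \<in> sets borel" "emeasure unif_sphere E \<noteq> 0" "\<And>x. x \<in> E \<Longrightarrow> norm x = 1 \<and> cmod (F x) = 1"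
    and z: "z \<in> ball 0 1"
  shows "F z = F 0"
proof -
  have "\<forall>z\<in>ball 0 1. \<exists>D. (F has_derivative D) (at z) \<and> Vector_Spaces.linear (*s) (*) D"
    using F by (simp add: holomorphic_Cn_def)
  then obtain D where D: "\<And>z. z \<in> ball 0 1 \<Longrightarrow> (F has_derivative D z) (at z)"
    and lin: "\<And>z. z \<in> ball 0 1 \<Longrightarrow> Vector_Spaces.linear (*s) (*) (D z)"
    by metis
  define e where "e j = (axis j 1 :: complex ^ 'n)" for j
  note dirhol = directional_derivative_holomorphic[OF F open_ball D lin]
  have tangential: "cnj (p $ i) * D p (e j) = cnj (p $ j) * D p (e i)" if p: "p \<in> ball 0 1" and ij: "i \<noteq> j" for p i j
  proof -
    define G where "G p = cnj (p $ i) * D p (e j) - cnj (p $ j) * D p (e i)" for p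
    have "G p = 0"
    proof (rule vanishing_on_positive_measure[where C = "positive_cone E" and G = G, OF positive_cone_positive(1)[OF E(1,2)]])
      show "positive_cone E \<subseteq> ball 0 1" by (auto simp: positive_cone_def)
      show "emeasure lborel (positive_cone E) \<noteq> 0" by (rule positive_cone_positive(2)[OF E(1,2)])
      show "p \<in> ball 0 1" by fact
      show "\<exists>H. H holomorphic_on {t. p + t *s v \<in> ball 0 1} \<and>
          (\<forall>t::real. p + t *\<^sub>R v \<in> ball 0 1 \<longrightarrow> H (of_real t) = G (p + t *\<^sub>R v))" for p v
      proof (intro exI conjI allI impI)
        \<comment> \<open>The conjugated coordinates of the moving point are continued from real
          \<open>t\<close> by leaving \<open>t\<close> itself unconjugated.\<close>
        show "(\<lambda>t. (cnj (p $ i) + t * cnj (v $ i)) * D (p + t *s v) (e j) -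
            (cnj (p $ j) + t * cnj (v $ j)) * D (p + t *s v) (e i)) holomorphic_on {t. p + t *s v \<in> ball 0 1}"
          by (intro holomorphic_intros dirhol)
      qed (simp add: G_def scaleR_eq_vector_scalar_mult)
      fix x assume x: "x \<in> positive_cone E"
      define \<zeta> where "\<zeta> = sgn x"
      have \<zeta>: "norm \<zeta> = 1" using x by (simp add: \<zeta>_def norm_sgn positive_cone_def)
      \<comment> \<open>The complex tangent vector at \<open>\<zeta>\<close> for which
        \<open>G x\<close> is a multiple of \<open>D x w\<close>; the halves keep its norm at most
        1.\<close>
      define w where "w = (cnj (\<zeta> $ i) / 2) *s e j - (cnj (\<zeta> $ j) / 2) *s e i"
      have wc: "cinner w \<zeta> = 0"
      proof -
        have "cinner (e k) \<zeta> = cnj (\<zeta> $ k)" for k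
          by (simp add: cinner_def e_def axis_def if_distrib[of "\<lambda>x. x * _"] cong: if_cong)
        moreover have "cinner (a - b) \<zeta> = cinner a \<zeta> - cinner b \<zeta>" for a b
          by (simp add: cinner_def left_diff_distrib sum_subtractf)
        ultimately show ?thesis by (simp add: w_def cinner_scale_left)
      qed
      have wn: "norm w \<le> 1"
      proof -
        have "norm (e k) = 1" for k by (simp add: e_def)
        then have "norm w \<le> cmod (\<zeta> $ i) / 2 + cmod (\<zeta> $ j) / 2"
          unfolding w_def by (intro order_trans[OF norm_triangle_ineq4]) (simp add: norm_vector_scalar_mult norm_divide)
        also have "\<dots> \<le> 1"
          using Finite_Cartesian_Product.norm_nth_le[of \<zeta> i] Finite_Cartesian_Product.norm_nth_le[of \<zeta> j] \<zeta> by simp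
        finally show ?thesis .
      qed
      have slice: "{t. 0 + t *s \<zeta> \<in> ball 0 1} = ball 0 1" using \<zeta> by (auto simp: norm_vector_scalar_mult)
      obtain M where M: "\<And>a. a \<in> ball 0 1 \<Longrightarrow> cmod (D (a *s \<zeta>) w) \<le> M"
        using tangential_derivative_bounded[OF F D lin L Lip \<alpha> \<zeta> wc wn] by blast
      have zero: "D (a *s \<zeta>) w = 0" if "a \<in> ball 0 1" for a
      proof (rule uniqueness_on_slice[OF _ M _ _ _ that])
        show "(\<lambda>a. D (a *s \<zeta>) w) holomorphic_on ball 0 1"
          using dirhol[of 0 \<zeta> w] unfolding slice by simp
        show "{\<mu>. \<mu> *s \<zeta> \<in> E} \<in> sets borel" by (rule slice_set_measurable[OF E(1)])
        show "emeasure circle_measure {\<mu>. \<mu> *s \<zeta> \<in> E} \<noteq> 0" using x by (simp add: positive_cone_def \<zeta>_def)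
        fix \<mu> assume \<mu>: "\<mu> \<in> {\<mu>. \<mu> *s \<zeta> \<in> E}" "cmod \<mu> = 1"
        have n1: "norm (\<mu> *s \<zeta>) = 1" using \<mu> \<zeta> by (simp add: norm_vector_scalar_mult)
        show "((\<lambda>r. D ((of_real r * \<mu>) *s \<zeta>) w) \<longlongrightarrow> 0) (at_left 1)"
        proof (rule tangential_derivative_at_unimodular_point[OF F D lin F1 \<alpha> \<zeta> wc wn \<mu>(2)])
          show "cmod (F (\<mu> *s \<zeta>)) = 1" using E(3) \<mu> by simp
          show "cmod (F (\<mu> *s \<zeta>) - F ((of_real r * \<mu>) *s \<zeta>)) \<le> L * (1 - r) powr \<alpha>" if "0 < r" "r < 1" for r
            using boundary_Lipschitz[OF cont _ Lip n1 that] \<alpha>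
            by (simp add: scaleR_eq_vector_scalar_mult vector_smult_assoc)
        qed
      qed
      have x_eq: "x = of_real (norm x) *s \<zeta>" and nx: "0 < norm x" "norm x < 1"
        using x by (auto simp: \<zeta>_def sgn_div_norm positive_cone_def simp flip: scaleR_eq_vector_scalar_mult)
      have "D x w = 0" using zero[of "of_real (norm x)"] nx x_eq by simp
      moreover have "x \<in> ball 0 1" using nx by simp
      then interpret Dx: Vector_Spaces.linear "(*s)" "(*)" "D x" by (rule lin)
      have "G x = 2 * of_real (norm x) * D x w"
        unfolding w_def Dx.diff Dx.scale G_def
        by (subst (1 2) x_eq) (simp add: algebra_simps)
      ultimately show "G x = 0" by simp
    qed
    then show ?thesis by (simp add: G_def)
  qed
  have partial0: "D p (e j) = 0" if p: "p \<in> ball 0 1" for p j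
  proof -
    obtain i where ij: "i \<noteq> j"
    proof -
      have "UNIV \<noteq> {j}"
      proof
        assume "UNIV = {j}"
        then have "CARD('n) = card {j}" by (rule arg_cong)
        then show False using card by simp
      qed
      then show ?thesis using that by blast
    qed
    let ?T = "{t. p + t *s e i \<in> ball 0 1}"
    define a where "a t = D (p + t *s e i) (e j)" for t
    \<comment> \<open>Moving \<open>p\<close> in direction \<open>e i\<close> changes only one of
      the two conjugated coordinates in \<open>tangential\<close>, whose identity becomes
      \<open>cnj t * a t = b t\<close> with \<open>a\<close> and \<open>b\<close>
      holomorphic.\<close>
    define b where "b t = cnj (p $ j) * D (p + t *s e i) (e i) - cnj (p $ i) * a t" for t
    have hola: "a holomorphic_on ?T" unfolding a_def by (rule dirhol)
    have holb: "b holomorphic_on ?T" unfolding b_def by (intro holomorphic_intros dirhol hola)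
    have "continuous_on UNIV (\<lambda>t. p + t *s e i)" by (intro continuous_intros)
    then have opn: "open ?T" using open_vimage[of "ball 0 1" "\<lambda>t. p + t *s e i"] by (simp add: vimage_def)
    have T0: "0 \<in> ?T" using p by simp
    have eq: "cnj t * a t = b t" if "t \<in> ?T" for t
      using tangential[of "p + t *s e i" i j] that ij
      by (simp add: a_def b_def e_def axis_def algebra_simps)
    have b0: "b 0 = 0" using eq[OF T0] by simp
    obtain d where d: "(b has_field_derivative d) (at 0)"
      using holb opn T0 by (meson holomorphic_derivI)
    then have lim: "((\<lambda>t. b t / t) \<longlongrightarrow> d) (at 0)"
      by (simp add: has_field_derivative_iff b0)
    have conta: "isCont a 0"
      using hola opn T0 by (meson holomorphic_on_imp_continuous_on continuous_on_eq_continuous_at)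
    define s where "s c n = c * of_real (inverse (real (Suc n)))" for c :: complex and n
    have s_lim: "s c \<longlonglongrightarrow> 0" for c
    proof -
      have "(\<lambda>n. c * of_real (inverse (real (Suc n)))) \<longlonglongrightarrow> c * of_real 0"
        by (intro tendsto_intros LIMSEQ_inverse_real_of_nat)
      then show ?thesis by (simp add: s_def[abs_def])
    qed
    have s_nz: "s c n \<noteq> 0" if "c \<noteq> 0" for c n
      unfolding s_def using that by (simp only: mult_eq_0_iff of_real_eq_0_iff inverse_nonzero_iff_nonzero of_nat_eq_0_iff) simp
    \<comment> \<open>Difference quotients of \<open>b\<close> at 0 along the ray through
      \<open>c\<close>. Their limit does not depend on \<open>c\<close>, yet
      \<open>cnj c / c\<close> is 1 for \<open>c = 1\<close> and -1 for \<open>c = \<i>\<close>;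
      hence \<open>a 0 = 0\<close>.\<close>
    have key: "d = (cnj c / c) * a 0" if c: "c \<noteq> 0" for c
    proof -
      have fl: "filterlim (s c) (at 0) sequentially"
        unfolding filterlim_at using s_lim s_nz[OF c] by auto
      have quot: "(\<lambda>n. b (s c n) / s c n) \<longlonglongrightarrow> d" by (rule filterlim_compose[OF lim fl])
      have lim_a: "(\<lambda>n. (cnj c / c) * a (s c n)) \<longlonglongrightarrow> (cnj c / c) * a 0"
        by (intro tendsto_intros isCont_tendsto_compose[OF conta] s_lim)
      have "\<forall>\<^sub>F n in sequentially. b (s c n) / s c n = (cnj c / c) * a (s c n)"
      proof -
        have "\<forall>\<^sub>F n in sequentially. s c n \<in> ?T"
          using s_lim[of c] opn T0 by (rule topological_tendstoD)
        then show ?thesis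
        proof eventually_elim
          case (elim n)
          have "cnj (s c n) / s c n = cnj c / c"
            unfolding s_def complex_cnj_mult complex_cnj_complex_of_real
            by (rule mult_divide_mult_cancel_right) (simp del: of_nat_Suc of_real_inverse)
          then show ?case using eq[OF elim] by (metis times_divide_eq_left)
        qed
      qed
      then have "(\<lambda>n. (cnj c / c) * a (s c n)) \<longlonglongrightarrow> d" by (rule Lim_transform_eventually[OF quot])
      then show ?thesis using lim_a by (rule LIMSEQ_unique)
    qed
    have "d = a 0" "d = - a 0" using key[of 1] key[of \<i>] by auto
    then have "a 0 = 0" by simp
    then show ?thesis by (simp add: a_def)
  qed
  have "(F has_derivative (\<lambda>v. 0)) (at x within ball 0 1)" if x: "x \<in> ball 0 1" for x
  proof -
    have "D x v = 0" for v
      using linear_vec_axis[OF lin[OF x], of v] partial0[OF x] by (simp add: e_def)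
    then have "D x = (\<lambda>v. 0)" by (intro ext)
    then show ?thesis using D[OF x] by (simp add: has_derivative_at_withinI)
  qed
  then obtain c where "\<And>x. x \<in> ball 0 1 \<Longrightarrow> F x = c"
    using has_derivative_zero_constant[OF convex_ball] by metis
  then show ?thesis using z by simp
qed

text \<open>The two-by-two minors of \<open>A x + b\<close> and \<open>x\<close> vanish on
  \<open>E\<close>. On a slice, after division by the parameter, they are affine in it, so
  uniqueness separates the parts coming from \<open>A\<close> and from \<open>b\<close>; each
  vanishes on the cone and then on the ball.\<close>

lemma parallel_affine_map:
  fixes A :: "complex ^ 'n::finite \<Rightarrow> complex ^ 'n"
  assumes card: "CARD('n) \<ge> 2" and A: "Vector_Spaces.linear (*s) (*s) A"
    and E: "E \<in> sets borel" "emeasure unif_sphere E \<noteq> 0"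
    and par: "\<And>x i j. x \<in> E \<Longrightarrow> (A x + b) $ i * x $ j = (A x + b) $ j * x $ i"
  shows "b = 0" and "\<exists>a. \<forall>z. A z = a *s z"
proof -
  interpret A: Vector_Spaces.linear "(*s)" "(*s)" A by fact
  have on_cone: "b $ i * x $ j - b $ j * x $ i = 0" "A x $ i * x $ j - A x $ j * x $ i = 0"
    if x: "x \<in> positive_cone E" for x i j
  proof -
    define \<zeta> where "\<zeta> = sgn x"
    define c1 where "c1 = A \<zeta> $ i * \<zeta> $ j - A \<zeta> $ j * \<zeta> $ i"
    define c2 where "c2 = b $ i * \<zeta> $ j - b $ j * \<zeta> $ i"
    have u: "a * c1 + c2 = 0" if "a \<in> ball 0 1" for a
    proof (rule uniqueness_on_slice[where u = "\<lambda>a. a * c1 + c2", OF _ _ _ _ _ that])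
      show "cmod (a * c1 + c2) \<le> cmod c1 + cmod c2" if "a \<in> ball 0 1" for a
        using that mult_right_mono[of "cmod a" 1 "cmod c1"]
        by (intro order_trans[OF norm_triangle_ineq]) (simp add: norm_mult)
      show "{\<mu>. \<mu> *s \<zeta> \<in> E} \<in> sets borel" by (rule slice_set_measurable[OF E(1)])
      show "emeasure circle_measure {\<mu>. \<mu> *s \<zeta> \<in> E} \<noteq> 0" using x by (simp add: positive_cone_def \<zeta>_def)
      fix \<mu> assume \<mu>: "\<mu> \<in> {\<mu>. \<mu> *s \<zeta> \<in> E}" "cmod \<mu> = 1"
      then have "(\<mu> * A \<zeta> $ i + b $ i) * (\<mu> * \<zeta> $ j) = (\<mu> * A \<zeta> $ j + b $ j) * (\<mu> * \<zeta> $ i)"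
        using par[of "\<mu> *s \<zeta>" i j] by (simp add: A.scale)
      then have "\<mu> * (\<mu> * c1 + c2) = 0" by (simp add: c1_def c2_def algebra_simps)
      then have "\<mu> * c1 + c2 = 0" using \<mu>(2) by auto
      then have "1 * \<mu> * c1 + c2 = 0" by simp
      moreover have "((\<lambda>r. of_real r * \<mu> * c1 + c2) \<longlongrightarrow> of_real 1 * \<mu> * c1 + c2) (at_left 1)"
        by (intro tendsto_intros)
      ultimately show "((\<lambda>r. of_real r * \<mu> * c1 + c2) \<longlongrightarrow> 0) (at_left 1)" by simp
    qed (intro holomorphic_intros)
    have c2: "c2 = 0" using u[of 0] by simp
    then have c1: "c1 = 0" using u[of "1 / 2"] by simp
    have x_eq: "x = of_real (norm x) *s \<zeta>"
      using x by (auto simp: \<zeta>_def sgn_div_norm positive_cone_def simp flip: scaleR_eq_vector_scalar_mult)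
    have "b $ i * x $ j - b $ j * x $ i = of_real (norm x) * c2"
      by (subst (1 2) x_eq) (simp add: c2_def algebra_simps)
    then show "b $ i * x $ j - b $ j * x $ i = 0" by (simp add: c2)
    have Ax: "A x = of_real (norm x) *s A \<zeta>" by (subst x_eq) (rule A.scale)
    have "A x $ i * x $ j - A x $ j * x $ i = (of_real (norm x))\<^sup>2 * c1"
      unfolding Ax by (subst (2 4) x_eq) (simp add: c1_def algebra_simps power2_eq_square)
    then show "A x $ i * x $ j - A x $ j * x $ i = 0" by (simp add: c1)
  qed
  note cone = positive_cone_positive[OF E]
  have sub: "positive_cone E \<subseteq> ball 0 1" by (auto simp: positive_cone_def)
  have ball_b: "b $ i * p $ j - b $ j * p $ i = 0" if "p \<in> ball 0 1" for p i j
  proof (rule vanishing_on_positive_measure[OF cone(1) sub cone(2), where G = "\<lambda>p. b $ i * p $ j - b $ j * p $ i"])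
    show "\<exists>H. H holomorphic_on {t. p + t *s v \<in> ball 0 1} \<and> (\<forall>t::real. p + t *\<^sub>R v \<in> ball 0 1 \<longrightarrow>
        H (of_real t) = b $ i * (p + t *\<^sub>R v) $ j - b $ j * (p + t *\<^sub>R v) $ i)" for p v
    proof (intro exI conjI allI impI)
      show "(\<lambda>t. b $ i * (p $ j + t * v $ j) - b $ j * (p $ i + t * v $ i)) holomorphic_on {t. p + t *s v \<in> ball 0 1}"
        by (intro holomorphic_intros)
    qed (simp add: scaleR_eq_vector_scalar_mult)
  qed (use that on_cone in auto)
  have ball_A: "A p $ i * p $ j - A p $ j * p $ i = 0" if "p \<in> ball 0 1" for p i j
  proof (rule vanishing_on_positive_measure[OF cone(1) sub cone(2), where G = "\<lambda>p. A p $ i * p $ j - A p $ j * p $ i"])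
    show "\<exists>H. H holomorphic_on {t. p + t *s v \<in> ball 0 1} \<and> (\<forall>t::real. p + t *\<^sub>R v \<in> ball 0 1 \<longrightarrow>
        H (of_real t) = A (p + t *\<^sub>R v) $ i * (p + t *\<^sub>R v) $ j - A (p + t *\<^sub>R v) $ j * (p + t *\<^sub>R v) $ i)" for p v
    proof (intro exI conjI allI impI)
      show "(\<lambda>t. (A p $ i + t * A v $ i) * (p $ j + t * v $ j) - (A p $ j + t * A v $ j) * (p $ i + t * v $ i))
          holomorphic_on {t. p + t *s v \<in> ball 0 1}"
        by (intro holomorphic_intros)
    qed (simp add: scaleR_eq_vector_scalar_mult A.add A.scale)
  qed (use that on_cone in auto)
  \<comment> \<open>Coordinate vectors scaled into the ball, where the minors are known to vanish.
    They isolate the entries of \<open>b\<close> and the off-diagonal entries of \<open>A\<close>;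
    sums of two of them compare diagonal entries.\<close>
  have half: "(1 / 2) *s axis j 1 \<in> ball (0 :: complex ^ 'n) 1" for j :: 'n
    by (simp add: norm_vector_scalar_mult)
  have other: "\<exists>j. j \<noteq> i" for i :: 'n
  proof -
    have "UNIV \<noteq> {i}"
      proof
        assume "UNIV = {i}"
        then have "CARD('n) = card {i}" by (rule arg_cong)
        then show False using card by simp
      qed
    then show ?thesis by blast
  qed
  show "b = 0"
  proof (simp add: vec_eq_iff, rule)
    fix i :: 'n
    obtain j where "j \<noteq> i" using other[of i] by blast
    then show "b $ i = 0" using ball_b[OF half[of j], of i j] by (simp add: axis_def)
  qed
  have Ax_off: "A (axis j 1) $ i = 0" if "i \<noteq> j" for i j
    using ball_A[OF half[of j], of i j] that by (simp add: A.scale axis_def)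
  have Ax_diag: "A (axis i 1) $ i = A (axis j 1) $ j" if "i \<noteq> j" for i j
  proof -
    let ?p = "(1 / 4) *s (axis i 1 + axis j 1 :: complex ^ 'n)"
    have "norm ?p \<le> (1 / 4) * (norm (axis i 1 :: complex ^ 'n) + norm (axis j 1 :: complex ^ 'n))"
      unfolding norm_vector_scalar_mult using norm_triangle_ineq[of "axis i 1 :: complex ^ 'n" "axis j 1"] by simp
    then have "?p \<in> ball 0 1" by simp
    from ball_A[OF this, of i j] show ?thesis
      using that Ax_off[of i j] Ax_off[of j i] by (simp add: A.scale A.add axis_def)
  qed
  obtain k :: 'n where True by blast
  define a where "a = A (axis k 1) $ k"
  have diag: "A (axis j 1) $ j = a" for j using Ax_diag[of j k] by (cases "j = k") (auto simp: a_def)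
  have "A z = a *s z" for z
  proof -
    have "z = (\<Sum>j\<in>UNIV. z $ j *s axis j 1)"
      by (simp add: vec_eq_iff axis_def if_distrib[of "(*) _"] cong: if_cong)
    then have "A z = A (\<Sum>j\<in>UNIV. z $ j *s axis j 1)" by simp
    also have "\<dots> = (\<Sum>j\<in>UNIV. z $ j *s A (axis j 1))" by (simp add: A.sum A.scale)
    finally have Az: "A z = (\<Sum>j\<in>UNIV. z $ j *s A (axis j 1))" .
    have "A z $ i = a * z $ i" for i
    proof -
      have "A z $ i = (\<Sum>j\<in>UNIV. z $ j * A (axis j 1) $ i)" by (simp add: Az)
      also have "\<dots> = (\<Sum>j\<in>UNIV. if j = i then z $ j * a else 0)"
        using Ax_off diag by (intro sum.cong) auto
      finally show ?thesis by simp
    qed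
    then show ?thesis by (simp add: vec_eq_iff)
  qed
  then show "\<exists>a. \<forall>z. A z = a *s z" by blast
qed

section \<open>Affine maps with a scalar multiplier\<close>

lemma Lip_bound:
  fixes f :: "complex ^ 'n \<Rightarrow> complex"
  assumes "f \<in> Lip \<alpha>"
  obtains K where "0 \<le> K"
    "\<And>p q. p \<in> ball 0 1 \<Longrightarrow> q \<in> ball 0 1 \<Longrightarrow> cmod (f p - f q) \<le> K * norm (p - q) powr \<alpha>"
proof -
  obtain K where K: "\<And>p q. p \<in> ball 0 1 \<Longrightarrow> q \<in> ball 0 1 \<Longrightarrow> p \<noteq> q \<Longrightarrow>
      cmod (f p - f q) / norm (p - q) powr \<alpha> \<le> K"
    using assms unfolding Lip_def bdd_above_def by blast
  show thesis
  proof (rule that[of "max 0 K"])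
    fix p q :: "complex ^ 'n" assume pq: "p \<in> ball 0 1" "q \<in> ball 0 1"
    show "cmod (f p - f q) \<le> max 0 K * norm (p - q) powr \<alpha>"
    proof (cases "p = q")
      case False
      then have pos: "0 < norm (p - q) powr \<alpha>" by simp
      then have "cmod (f p - f q) \<le> K * norm (p - q) powr \<alpha>"
        using K[OF pq False] by (simp only: pos_divide_le_eq)
      also have "\<dots> \<le> max 0 K * norm (p - q) powr \<alpha>" by (intro mult_right_mono) auto
      finally show ?thesis .
    qed simp
  qed simp
qed

lemma holomorphic_Cn_const_mult:
  fixes f :: "complex ^ 'n::finite \<Rightarrow> complex"
  assumes "holomorphic_Cn f S"
  shows "holomorphic_Cn (\<lambda>z. a * f z) S"
  unfolding holomorphic_Cn_def
proof
  fix z assume "z \<in> S"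
  then obtain D where D: "(f has_derivative D) (at z)" and lin: "Vector_Spaces.linear (*s) (*) D"
    using assms by (auto simp: holomorphic_Cn_def)
  interpret D: Vector_Spaces.linear "(*s)" "(*)" D by (rule lin)
  have "Vector_Spaces.linear (*s) (*) (\<lambda>v. a * D v)"
    by unfold_locales (simp_all add: D.add D.scale algebra_simps)
  then show "\<exists>D. ((\<lambda>z. a * f z) has_derivative D) (at z) \<and> Vector_Spaces.linear (*s) (*) D"
    using has_derivative_mult_right[OF D, of a] by blast
qed

text \<open>On the slice through a unit vector \<open>e\<close> the function
  \<open>t * F (t *s e)\<close> maps the disc into itself and fixes 0, so the Schwarz lemma applies;
  the value at the centre follows by continuity.\<close>

lemma multiplier_bounded_by_1:
  fixes F :: "complex ^ 'n::finite \<Rightarrow> complex"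
  assumes F: "holomorphic_Cn F (ball 0 1)"
    and self: "\<And>z. z \<in> ball 0 1 \<Longrightarrow> norm (F z *s z) < 1"
    and z: "z \<in> ball 0 1"
  shows "cmod (F z) \<le> 1"
proof -
  have nz: "cmod (F z) \<le> 1" if z: "z \<in> ball 0 1" and "z \<noteq> 0" for z
  proof -
    define e where "e = sgn z"
    have e: "norm e = 1" using \<open>z \<noteq> 0\<close> by (simp add: e_def norm_sgn)
    have e_ball: "t *s e \<in> ball 0 1" if "cmod t < 1" for t using that e by (simp add: norm_vector_scalar_mult)
    let ?g = "\<lambda>t. t * F (0 + t *s e)"
    have "(\<lambda>t. F (0 + t *s e)) holomorphic_on ball 0 1"
      by (rule holomorphic_on_subset[OF holomorphic_Cn_line[OF F]]) (use e_ball in auto)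
    then have "?g holomorphic_on ball 0 1" by (intro holomorphic_intros)
    moreover have "cmod (?g t) < 1" if "cmod t < 1" for t
      using self[OF e_ball[OF that]] e by (simp add: norm_vector_scalar_mult norm_mult mult_ac)
    moreover have "cmod (of_real (norm z)) < 1" using z by simp
    ultimately have "cmod (?g (of_real (norm z))) \<le> cmod (of_real (norm z))"
      by (intro Schwarz_Lemma(1)) auto
    moreover have "of_real (norm z) *s e = z"
      using \<open>z \<noteq> 0\<close> by (simp add: e_def sgn_div_norm flip: scaleR_eq_vector_scalar_mult)
    ultimately show ?thesis using \<open>z \<noteq> 0\<close> by (simp add: norm_mult)
  qed
  show ?thesis
  proof (cases "z = 0")
    case True
    have "continuous_on (ball 0 1) F" by (rule holomorphic_Cn_continuous_on[OF F])
    then have "(F \<longlongrightarrow> F 0) (at 0)" by (simp add: continuous_on_eq_continuous_at isCont_def)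
    moreover have "\<forall>\<^sub>F z in at 0. cmod (F z) \<le> 1"
      unfolding eventually_at using nz by (intro exI[of _ 1]) auto
    ultimately show ?thesis unfolding True by (intro Lim_norm_ubound) auto
  qed (rule nz[OF z])
qed

theorem theorem2p5:
  fixes A :: "complex ^ 'n \<Rightarrow> complex ^ 'n"
    and b :: "complex ^ 'n"
    and f :: "complex ^ 'n \<Rightarrow> complex"
    and \<alpha> :: real
    and \<phi> :: "complex ^ 'n \<Rightarrow> complex ^ 'n"
  assumes "CARD('n) \<ge> 2"
    and "Vector_Spaces.linear (*s) (*s) A"
    and "1 / 2 < \<alpha>" and "\<alpha> \<le> 1"
    and "f \<in> ball_algebra \<inter> Lip \<alpha>"
    and "\<And>z. z \<in> ball 0 1 \<Longrightarrow> \<phi> z = f z *s (A z + b)"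
    and "\<phi> ` ball 0 1 \<subseteq> ball 0 1"
    and "hardy_bounded (composition_op \<phi>)"
    and "\<not> (\<exists>c. cmod c = 1 \<and> (\<forall>z\<in>ball 0 1. \<phi> z = c *s z))"
  shows "strongly_asymptotically_toeplitz (composition_op \<phi>)
      \<and> has_asymptotic_symbol (composition_op \<phi>) (\<lambda>\<zeta>. 0)
      \<and> sot_tendsto (\<lambda>m. (toeplitz_map ^^ m) (composition_op \<phi>)) (\<lambda>h z. 0)
      \<and> strongly_asymptotically_toeplitz (hardy_adjoint (composition_op \<phi>))
      \<and> has_asymptotic_symbol (hardy_adjoint (composition_op \<phi>)) (\<lambda>\<zeta>. 0)
      \<and> sot_tendsto (\<lambda>m. (toeplitz_map ^^ m) (hardy_adjoint (composition_op \<phi>))) (\<lambda>h z. 0)"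
proof -
  note \<phi> = assms(6) and self = assms(7) and bounded = assms(8)
  interpret A: Vector_Spaces.linear "(*s)" "(*s)" A by (rule assms(2))
  have f: "holomorphic_Cn f (ball 0 1)" "continuous_on (cball 0 1) f" "f \<in> Lip \<alpha>"
    using assms(5) by (auto simp: ball_algebra_def)
  have "linear A" by (intro linearI) (simp_all add: A.add A.scale scaleR_eq_vector_scalar_mult)
  then have contA: "continuous_on S A" for S
    by (intro linear_continuous_on) (simp add: linear_conv_bounded_linear)
  \<comment> \<open>\<open>\<phi>\<close> is prescribed on the open ball only; \<open>\<psi>\<close>
    extends it continuously to the closed ball and supplies the boundary values.\<close>
  define \<psi> where "\<psi> z = f z *s (A z + b)" for z
  have cont\<psi>: "continuous_on (cball 0 1) \<psi>"
    unfolding \<psi>_def[abs_def] by (intro continuous_on_vector_scalar_mult continuous_intros f(2) contA)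
  have \<psi>_self: "norm (\<psi> z) < 1" if "z \<in> ball 0 1" for z
    using self that \<phi>[OF that] by (force simp: \<psi>_def)
  have \<psi>1: "norm (\<psi> z) \<le> 1" if "z \<in> cball 0 1" for z
    using \<psi>_self that cont\<psi> by (intro continuous_on_closure_norm_le[of "ball 0 1" \<psi>]) (auto simp: less_imp_le)
  have cont_coord: "continuous_on (cball 0 1) (\<lambda>z. \<psi> z $ j)" for j
    by (intro continuous_on_component cont\<psi>)
  define w where "w x = cinner (\<psi> x) x" for x
  have w1: "cmod (w x) \<le> 1" if "norm x = 1" for x
    unfolding w_def using that \<psi>1[of x] by (intro cmod_cinner_le) auto
  have radial: "AE x in surface_measure.
      radial_limit (composition_op \<phi> (\<lambda>z. z $ j * h z)) x = \<psi> x $ j * radial_limit (composition_op \<phi> h) x"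
    if "h \<in> hardy_space" for h j
  proof -
    have "composition_op \<phi> (\<lambda>z. z $ j * h z) = (\<lambda>z. \<psi> z $ j * composition_op \<phi> h z)"
      using \<phi> by (intro ext) (simp add: composition_op_def \<psi>_def)
    then show ?thesis
      using AE_radial_limit_mult[OF hardy_boundedD(1)[OF bounded that] cont_coord] by simp
  qed
  have meas: "(\<lambda>x. \<psi> x $ j) \<in> borel_measurable surface_measure" for j
  proof -
    have "(\<lambda>x. \<psi> x $ j) \<in> borel_measurable (restrict_space borel (sphere 0 1))"
      by (intro borel_measurable_continuous_on_restrict continuous_on_subset[OF cont_coord]) auto
    then show ?thesis
      unfolding surface_measure_eq
      by (subst measurable_cong_sets[OF sets_restrict_space_cong refl]) (auto simp: unif_sphere_def)
  qed
  \<comment> \<open>The exceptional set of the dominated convergence argument; it is closed and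
    hence Borel.\<close>
  define E where "E = {x. norm x = 1 \<and> cmod (w x) = 1}"
  have "E = sphere 0 1 \<inter> (\<lambda>x. cmod (w x)) -` {1}" by (auto simp: E_def)
  moreover have "continuous_on (sphere 0 1) (\<lambda>x. cmod (w x))"
    unfolding w_def cinner_def
    by (intro continuous_intros continuous_on_subset[OF cont_coord]) auto
  ultimately have "closed E" by (simp add: continuous_closed_preimage)
  then have mE: "E \<in> sets borel" by (rule borel_closed)
  have E0: "emeasure unif_sphere E = 0"
  proof (rule ccontr)
    assume pos: "emeasure unif_sphere E \<noteq> 0"
    \<comment> \<open>Equality in Cauchy-Schwarz: \<open>\<psi> x\<close> has norm at most 1, and
      its pairing with the unit vector \<open>x\<close> has modulus 1.\<close>
    have \<psi>E: "\<psi> x = w x *s x" if "x \<in> E" for x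
      unfolding w_def by (rule cinner_eq_unit) (use that \<psi>1[of x] in \<open>auto simp: E_def w_def\<close>)
    have par: "(A x + b) $ i * x $ j = (A x + b) $ j * x $ i" if x: "x \<in> E" for x i j
    proof -
      have comp: "f x * (A x + b) $ k = w x * x $ k" for k
        using \<psi>E[OF x] unfolding \<psi>_def by (metis vector_smult_component)
      \<comment> \<open>A nonzero \<open>\<psi> x\<close> allows \<open>f x\<close> to be cancelled,
        which leaves parallelism of \<open>A x + b\<close> and \<open>x\<close> without the
        multiplier.\<close>
      have "norm (\<psi> x) = 1" using x \<psi>E[OF x] by (simp add: E_def norm_vector_scalar_mult)
      then have "f x \<noteq> 0" by (auto simp: \<psi>_def)
      moreover have "f x * ((A x + b) $ i * x $ j) = f x * ((A x + b) $ j * x $ i)"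
        using comp[of i] comp[of j] by (metis mult.assoc mult.commute)
      ultimately show ?thesis by simp
    qed
    have b0: "b = 0" by (rule parallel_affine_map(1)[OF assms(1,2) mE pos par])
    obtain a where a: "\<And>z. A z = a *s z" using parallel_affine_map(2)[OF assms(1,2) mE pos par] by blast
    define F where "F z = a * f z" for z
    have \<psi>F: "\<psi> z = F z *s z" for z
      by (simp add: \<psi>_def F_def a b0 vector_smult_assoc mult.commute)
    have hol: "holomorphic_Cn F (ball 0 1)"
      unfolding F_def[abs_def] by (rule holomorphic_Cn_const_mult[OF f(1)])
    have cont: "continuous_on (cball 0 1) F" unfolding F_def[abs_def] by (intro continuous_intros f(2))
    have F1: "cmod (F z) \<le> 1" if "z \<in> ball 0 1" for z
      by (rule multiplier_bounded_by_1[OF hol _ that]) (use \<psi>_self in \<open>simp add: \<psi>F\<close>)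
    have FE: "norm x = 1 \<and> cmod (F x) = 1" if x: "x \<in> E" for x
    proof -
      have "norm (F x *s x) = norm (w x *s x)" using arg_cong[OF \<psi>E[OF x], of norm] unfolding \<psi>F .
      then show ?thesis using x by (auto simp: E_def norm_vector_scalar_mult)
    qed
    obtain K where K: "0 \<le> K"
      "\<And>p q. p \<in> ball 0 1 \<Longrightarrow> q \<in> ball 0 1 \<Longrightarrow> cmod (f p - f q) \<le> K * norm (p - q) powr \<alpha>"
      using Lip_bound[OF f(3)] by blast
    have FLip: "cmod (F p - F q) \<le> (cmod a * K) * norm (p - q) powr \<alpha>"
      if "p \<in> ball 0 1" "q \<in> ball 0 1" for p q
    proof -
      have "cmod (F p - F q) = cmod a * cmod (f p - f q)"
        by (simp add: F_def norm_mult flip: right_diff_distrib)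
      also have "\<dots> \<le> cmod a * (K * norm (p - q) powr \<alpha>)" by (intro mult_left_mono K(2) that) simp
      finally show ?thesis by (simp add: mult.assoc)
    qed
    have const: "F z = F 0" if "z \<in> ball 0 1" for z
      by (rule constant_if_unimodular_on_positive_measure[OF assms(1) hol cont F1 _ FLip assms(3) mE pos FE that])
        (use K(1) in auto)
    have "E \<noteq> {}" using pos by (metis emeasure_empty)
    then obtain x where x: "x \<in> E" by blast
    \<comment> \<open>\<open>F\<close> is constant on the open ball and continuous on the closed
      one, so the constant inherits modulus 1 from a point of \<open>E\<close>;
      \<open>\<phi>\<close> would then be the excluded unimodular multiple of the identity.\<close>
    have "F x = F 0"
    proof (rule continuous_constant_on_closure[where S = "ball 0 1" and f = F])
      show "continuous_on (closure (ball 0 1)) F" using cont by simp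
      show "F y = F 0" if "y \<in> ball 0 1" for y by (rule const[OF that])
      show "x \<in> closure (ball 0 1)" using FE[OF x] by simp
    qed
    then have "cmod (F 0) = 1" using FE[OF x] by simp
    moreover have "\<forall>z\<in>ball 0 1. \<phi> z = F 0 *s z"
    proof
      fix z :: "complex ^ 'n" assume z: "z \<in> ball 0 1"
      have "\<phi> z = \<psi> z" unfolding \<psi>_def by (rule \<phi>[OF z])
      then show "\<phi> z = F 0 *s z" unfolding \<psi>F const[OF z] .
    qed
    ultimately show False using assms(9) by blast
  qed
  then have "AE x in unif_sphere. x \<notin> E"
    using mE by (intro AE_not_in) (auto simp: null_sets_def unif_sphere_def)
  then have less: "AE x in surface_measure. cmod (w x) < 1"
    unfolding AE_surface_measure_iff by eventually_elim (use w1 in \<open>force simp: E_def\<close>)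
  note asym = weighted_operator_asymptotics[where \<psi> = \<psi> and w = w, OF bounded radial meas _ w1 less]
  show ?thesis
    by (intro conjI asymptotically_toeplitz_zero bounded hardy_bounded_adjoint asym) (simp_all add: w_def cinner_def)
qed

end
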